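(* Let $k$ be a field and let $\mathcal{T}$ be a symmetric compact closed category with finite direct sums such that (i) there is a finite set $\mathcal{C}$ of objects of $\mathcal{T}$ such that every object $X$ of $\mathcal{T}$ can be written as a direct sum $X\cong\bigoplus_{i=1}^n C_i$ with $C_i\in\mathcal{C}$; and (ii) each hom $\mathcal{T}(X,Y)$ is a finitely generated commutative monoid. Then the monoidal category $\mathbf{Mky}_{\mathit{fin}}$ of finite-dimensional Mackey functors on $\mathcal{T}$ is $*$-autonomous.
   Context: Having finite direct sums, $\mathcal{T}$ is canonically enriched in commutative monoids. Write $\otimes$, $I$ for its tensor product and unit. A Mackey functor on $\mathcal{T}$ is an additive functor $M:\mathcal{T}\to\mathbf{Vect}$ to $k$-vector spaces; it is finite dimensional when each $M(X)$ is finite dimensional. $\mathbf{Mky}$ is the category of Mackey functors and natural transformations, and $\mathbf{Mky}_{\mathit{fin}}$ is its full subcategory of finite-dimensional ones. $\mathbf{Mky}$ is monoidal under Day convolution $$(M*N)(Z)=\int^{X,Y}\mathcal{T}(X\otimes Y,Z)\otimes M(X)\otimes_k N(Y)$$ (a coend enriched in commutative monoids, where $V\otimes P$ for a commutative monoid $V$ and vector space $P$ is the vector space with $\mathrm{Hom}_k(V\otimes P,Q)\cong\mathrm{Hom}_{\mathrm{CMon}}(V,\mathrm{Hom}_k(P,Q))$ naturally in $Q$), with unit the Burnside functor $J$, where $J(U)$ is the free $k$-vector space on the commutative monoid $\mathcal{T}(I,U)$ (value of the left adjoint of the forgetful functor from vector spaces to commutative monoids). Under the stated assumptions $\mathbf{Mky}_{\mathit{fin}}$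 is a monoidal subcategory of $\mathbf{Mky}$. A promonoidal category $\mathcal{M}$ with promonoidal structure $P$ is called $*$-autonomous when it is equipped with an equivalence $S:\mathcal{M}^{\mathrm{op}}\to\mathcal{M}$ and a natural isomorphism $P(M,N;S(L))\cong P(N,L;S^{-1}(M))$. A monoidal category is $*$-autonomous when the associated promonoidal category, here $P(M,N;L)=\mathbf{Mky}_{\mathit{fin}}(M*N,L)$, is. *)

theory Defs
  imports "HOL-Algebra.AbelCoset" "Jordan_Normal_Form.Missing_VectorSpace"
begin

section \<open>Categories, functors, equivalences\<close>

record ('o, 'a) cat =
  Obj :: "'o set"
  Arr :: "'a set"
  Dom :: "'a \<Rightarrow> 'o"
  Cod :: "'a \<Rightarrow> 'o"
  Ident :: "'o \<Rightarrow> 'a"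
  Comp :: "'a \<Rightarrow> 'a \<Rightarrow> 'a"  (infixr "\<cdot>\<index>" 70)

definition homs :: "('o, 'a, 'z) cat_scheme \<Rightarrow> 'o \<Rightarrow> 'o \<Rightarrow> 'a set" where
  "homs C A B = {f \<in> Arr C. Dom C f = A \<and> Cod C f = B}"

locale category =
  fixes C :: "('o, 'a, 'z) cat_scheme" (structure)
  assumes Dom_closed: "f \<in> Arr C \<Longrightarrow> Dom C f \<in> Obj C"
    and Cod_closed: "f \<in> Arr C \<Longrightarrow> Cod C f \<in> Obj C"
    and Ident_closed: "A \<in> Obj C \<Longrightarrow> Ident C A \<in> homs C A A"
    and Comp_closed: "\<lbrakk>f \<in> homs C A B; g \<in> homs C B D\<rbrakk> \<Longrightarrow> g \<cdot> f \<in> homs C A D"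
    and Ident_left: "f \<in> homs C A B \<Longrightarrow> Ident C B \<cdot> f = f"
    and Ident_right: "f \<in> homs C A B \<Longrightarrow> f \<cdot> Ident C A = f"
    and Comp_assoc: "\<lbrakk>f \<in> homs C A B; g \<in> homs C B D; h \<in> homs C D E\<rbrakk>
      \<Longrightarrow> (h \<cdot> g) \<cdot> f = h \<cdot> (g \<cdot> f)"

definition inverse_arrows :: "('o, 'a, 'z) cat_scheme \<Rightarrow> 'a \<Rightarrow> 'a \<Rightarrow> bool" where
  "inverse_arrows C f g \<longleftrightarrow> f \<in> Arr C \<and> g \<in> homs C (Cod C f) (Dom C f) \<and>
     g \<cdot>\<^bsub>C\<^esub> f = Ident C (Dom C f) \<and> f \<cdot>\<^bsub>C\<^esub> g = Ident C (Cod C f)"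

definition iso_arrow :: "('o, 'a, 'z) cat_scheme \<Rightarrow> 'a \<Rightarrow> 'o \<Rightarrow> 'o \<Rightarrow> bool" where
  "iso_arrow C f A B \<longleftrightarrow> f \<in> homs C A B \<and> (\<exists>g. inverse_arrows C f g)"

definition isomorphic :: "('o, 'a, 'z) cat_scheme \<Rightarrow> 'o \<Rightarrow> 'o \<Rightarrow> bool" where
  "isomorphic C A B \<longleftrightarrow> (\<exists>f. iso_arrow C f A B)"

definition inv_arrow :: "('o, 'a, 'z) cat_scheme \<Rightarrow> 'a \<Rightarrow> 'a" where
  "inv_arrow C f = (THE g. inverse_arrows C f g)"

definition op_cat :: "('o, 'a, 'z) cat_scheme \<Rightarrow> ('o, 'a) cat" where
  "op_cat C = \<lparr>Obj = Obj C, Arr = Arr C, Dom = Cod C, Cod = Dom C, Ident = Ident C,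
     Comp = (\<lambda>g f. f \<cdot>\<^bsub>C\<^esub> g)\<rparr>"

definition is_functor ::
    "('o, 'a, 'y) cat_scheme \<Rightarrow> ('p, 'b, 'z) cat_scheme \<Rightarrow> ('o \<Rightarrow> 'p) \<Rightarrow> ('a \<Rightarrow> 'b) \<Rightarrow> bool" where
  "is_functor C D Fo Fa \<longleftrightarrow>
     (\<forall>A \<in> Obj C. Fo A \<in> Obj D \<and> Fa (Ident C A) = Ident D (Fo A)) \<and>
     (\<forall>A B f. f \<in> homs C A B \<longrightarrow> Fa f \<in> homs D (Fo A) (Fo B)) \<and>
     (\<forall>A B E f g. f \<in> homs C A B \<longrightarrow> g \<in> homs C B E \<longrightarrow> Fa (g \<cdot>\<^bsub>C\<^esub> f) = Fa g \<cdot>\<^bsub>D\<^esub> Fa f)"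

definition natural_iso ::
    "('o, 'a, 'y) cat_scheme \<Rightarrow> ('p, 'b, 'z) cat_scheme \<Rightarrow> ('o \<Rightarrow> 'p) \<Rightarrow> ('a \<Rightarrow> 'b) \<Rightarrow>
     ('o \<Rightarrow> 'p) \<Rightarrow> ('a \<Rightarrow> 'b) \<Rightarrow> ('o \<Rightarrow> 'b) \<Rightarrow> bool" where
  "natural_iso C D Fo Fa Go Ga \<theta> \<longleftrightarrow>
     (\<forall>A \<in> Obj C. iso_arrow D (\<theta> A) (Fo A) (Go A)) \<and>
     (\<forall>A B f. f \<in> homs C A B \<longrightarrow> \<theta> B \<cdot>\<^bsub>D\<^esub> Fa f = Ga f \<cdot>\<^bsub>D\<^esub> \<theta> A)"

definition equivalence_of_categories ::
    "('o, 'a, 'y) cat_scheme \<Rightarrow> ('p, 'b, 'z) cat_scheme \<Rightarrow> ('o \<Rightarrow> 'p) \<Rightarrow> ('a \<Rightarrow> 'b) \<Rightarrow>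
     ('p \<Rightarrow> 'o) \<Rightarrow> ('b \<Rightarrow> 'a) \<Rightarrow> bool" where
  "equivalence_of_categories C D So Sa Ro Ra \<longleftrightarrow>
     is_functor C D So Sa \<and> is_functor D C Ro Ra \<and>
     (\<exists>\<theta>. natural_iso C C (Ro \<circ> So) (Ra \<circ> Sa) id id \<theta>) \<and>
     (\<exists>\<theta>. natural_iso D D (So \<circ> Ro) (Sa \<circ> Ra) id id \<theta>)"


section \<open>Direct sums and the induced addition of arrows\<close>

definition zero_object :: "('o, 'a, 'z) cat_scheme \<Rightarrow> 'o \<Rightarrow> bool" where
  "zero_object C Z \<longleftrightarrow> Z \<in> Obj C \<and>
     (\<forall>A \<in> Obj C. (\<exists>!f. f \<in> homs C A Z) \<and> (\<exists>!f. f \<in> homs C Z A))"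

definition zero_arrow :: "('o, 'a, 'z) cat_scheme \<Rightarrow> 'o \<Rightarrow> 'o \<Rightarrow> 'a" where
  "zero_arrow C A B =
     (THE f. \<exists>Z g h. zero_object C Z \<and> g \<in> homs C A Z \<and> h \<in> homs C Z B \<and> f = h \<cdot>\<^bsub>C\<^esub> g)"

text \<open>\<open>S\<close> is simultaneously a product and a coproduct of \<open>A 0, \<dots>, A (n - 1)\<close>, with
  projections \<open>p j\<close> and injections \<open>i j\<close> such that \<open>p l \<cdot> i j\<close> is the Kronecker delta.
  For \<open>n = 0\<close> this says that \<open>S\<close> is a zero object.\<close>

definition is_direct_sum ::
    "('o, 'a, 'z) cat_scheme \<Rightarrow> nat \<Rightarrow> (nat \<Rightarrow> 'o) \<Rightarrow> 'o \<Rightarrow> (nat \<Rightarrow> 'a) \<Rightarrow> (nat \<Rightarrow> 'a) \<Rightarrow> bool" where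
  "is_direct_sum C n A S p i \<longleftrightarrow>
     S \<in> Obj C \<and>
     (\<forall>j<n. A j \<in> Obj C \<and> p j \<in> homs C S (A j) \<and> i j \<in> homs C (A j) S) \<and>
     (\<forall>X \<in> Obj C. \<forall>f. (\<forall>j<n. f j \<in> homs C X (A j)) \<longrightarrow>
        (\<exists>!u. u \<in> homs C X S \<and> (\<forall>j<n. p j \<cdot>\<^bsub>C\<^esub> u = f j))) \<and>
     (\<forall>X \<in> Obj C. \<forall>f. (\<forall>j<n. f j \<in> homs C (A j) X) \<longrightarrow>
        (\<exists>!u. u \<in> homs C S X \<and> (\<forall>j<n. u \<cdot>\<^bsub>C\<^esub> i j = f j))) \<and>
     (\<forall>j<n. \<forall>l<n. p l \<cdot>\<^bsub>C\<^esub> i j = (if j = l then Ident C (A j) else zero_arrow C (A j) (A l)))"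

definition has_finite_direct_sums :: "('o, 'a, 'z) cat_scheme \<Rightarrow> bool" where
  "has_finite_direct_sums C \<longleftrightarrow>
     (\<forall>n A. (\<forall>j<n. A j \<in> Obj C) \<longrightarrow> (\<exists>S p i. is_direct_sum C n A S p i))"

text \<open>For parallel \<open>f, g\<close> with codomain \<open>B\<close>, the sum \<open>f + g\<close> is the pairing of \<open>f\<close> and \<open>g\<close>
  into \<open>B \<oplus> B\<close> followed by the codiagonal.\<close>

definition add_arrow :: "('o, 'a, 'z) cat_scheme \<Rightarrow> 'a \<Rightarrow> 'a \<Rightarrow> 'a" where
  "add_arrow C f g =
     (THE h. \<exists>S p i u c. is_direct_sum C 2 (\<lambda>_. Cod C f) S p i \<and>
        u \<in> homs C (Dom C f) S \<and> p 0 \<cdot>\<^bsub>C\<^esub> u = f \<and> p 1 \<cdot>\<^bsub>C\<^esub> u = g \<and>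
        c \<in> homs C S (Cod C f) \<and>
        c \<cdot>\<^bsub>C\<^esub> i 0 = Ident C (Cod C f) \<and> c \<cdot>\<^bsub>C\<^esub> i 1 = Ident C (Cod C f) \<and>
        h = c \<cdot>\<^bsub>C\<^esub> u)"

definition hom_monoid :: "('o, 'a, 'z) cat_scheme \<Rightarrow> 'o \<Rightarrow> 'o \<Rightarrow> 'a monoid" where
  "hom_monoid C A B = \<lparr>carrier = homs C A B, mult = add_arrow C, one = zero_arrow C A B\<rparr>"

definition finitely_generated_monoid :: "('a, 'z) monoid_scheme \<Rightarrow> bool" where
  "finitely_generated_monoid G \<longleftrightarrow>
     (\<exists>F. finite F \<and> F \<subseteq> carrier G \<and> (\<forall>H. submonoid H G \<and> F \<subseteq> H \<longrightarrow> H = carrier G))"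


section \<open>Monoidal, symmetric monoidal and compact closed categories\<close>

record ('o, 'a) monoidal = "('o, 'a) cat" +
  tobj :: "'o \<Rightarrow> 'o \<Rightarrow> 'o"  (infixr "\<boxdot>\<index>" 75)
  tarr :: "'a \<Rightarrow> 'a \<Rightarrow> 'a"  (infixr "\<boxtimes>\<index>" 75)
  unt :: 'o
  asc :: "'o \<Rightarrow> 'o \<Rightarrow> 'o \<Rightarrow> 'a"
  lun :: "'o \<Rightarrow> 'a"
  run :: "'o \<Rightarrow> 'a"

record ('o, 'a) symmetric_monoidal = "('o, 'a) monoidal" +
  brd :: "'o \<Rightarrow> 'o \<Rightarrow> 'a"

locale monoidal_category = category C for C :: "('o, 'a, 'z) monoidal_scheme" (structure) +
  assumes tobj_closed: "\<lbrakk>A \<in> Obj C; B \<in> Obj C\<rbrakk> \<Longrightarrow> A \<boxdot> B \<in> Obj C"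
    and unt_closed: "unt C \<in> Obj C"
    and tarr_closed: "\<lbrakk>f \<in> homs C A A'; g \<in> homs C B B'\<rbrakk>
      \<Longrightarrow> f \<boxtimes> g \<in> homs C (A \<boxdot> B) (A' \<boxdot> B')"
    and tarr_Ident: "\<lbrakk>A \<in> Obj C; B \<in> Obj C\<rbrakk> \<Longrightarrow> Ident C A \<boxtimes> Ident C B = Ident C (A \<boxdot> B)"
    and tarr_Comp: "\<lbrakk>f \<in> homs C A A'; f' \<in> homs C A' A''; g \<in> homs C B B'; g' \<in> homs C B' B''\<rbrakk>
      \<Longrightarrow> (f' \<cdot> f) \<boxtimes> (g' \<cdot> g) = (f' \<boxtimes> g') \<cdot> (f \<boxtimes> g)"
    and asc_iso: "\<lbrakk>A \<in> Obj C; B \<in> Obj C; D \<in> Obj C\<rbrakk>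
      \<Longrightarrow> iso_arrow C (asc C A B D) ((A \<boxdot> B) \<boxdot> D) (A \<boxdot> (B \<boxdot> D))"
    and asc_natural: "\<lbrakk>f \<in> homs C A A'; g \<in> homs C B B'; h \<in> homs C D D'\<rbrakk>
      \<Longrightarrow> asc C A' B' D' \<cdot> ((f \<boxtimes> g) \<boxtimes> h) = (f \<boxtimes> (g \<boxtimes> h)) \<cdot> asc C A B D"
    and lun_iso: "A \<in> Obj C \<Longrightarrow> iso_arrow C (lun C A) (unt C \<boxdot> A) A"
    and lun_natural: "f \<in> homs C A B \<Longrightarrow> lun C B \<cdot> (Ident C (unt C) \<boxtimes> f) = f \<cdot> lun C A"
    and run_iso: "A \<in> Obj C \<Longrightarrow> iso_arrow C (run C A) (A \<boxdot> unt C) A"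
    and run_natural: "f \<in> homs C A B \<Longrightarrow> run C B \<cdot> (f \<boxtimes> Ident C (unt C)) = f \<cdot> run C A"
    and pentagon: "\<lbrakk>A \<in> Obj C; B \<in> Obj C; D \<in> Obj C; E \<in> Obj C\<rbrakk>
      \<Longrightarrow> asc C A B (D \<boxdot> E) \<cdot> asc C (A \<boxdot> B) D E
        = (Ident C A \<boxtimes> asc C B D E) \<cdot> asc C A (B \<boxdot> D) E \<cdot> (asc C A B D \<boxtimes> Ident C E)"
    and triangle: "\<lbrakk>A \<in> Obj C; B \<in> Obj C\<rbrakk>
      \<Longrightarrow> (Ident C A \<boxtimes> lun C B) \<cdot> asc C A (unt C) B = run C A \<boxtimes> Ident C B"

locale symmetric_monoidal_category =
  monoidal_category C for C :: "('o, 'a, 'z) symmetric_monoidal_scheme" (structure) +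
  assumes brd_closed: "\<lbrakk>A \<in> Obj C; B \<in> Obj C\<rbrakk> \<Longrightarrow> brd C A B \<in> homs C (A \<boxdot> B) (B \<boxdot> A)"
    and brd_natural: "\<lbrakk>f \<in> homs C A A'; g \<in> homs C B B'\<rbrakk>
      \<Longrightarrow> brd C A' B' \<cdot> (f \<boxtimes> g) = (g \<boxtimes> f) \<cdot> brd C A B"
    and brd_symmetric: "\<lbrakk>A \<in> Obj C; B \<in> Obj C\<rbrakk> \<Longrightarrow> brd C B A \<cdot> brd C A B = Ident C (A \<boxdot> B)"
    and hexagon: "\<lbrakk>A \<in> Obj C; B \<in> Obj C; D \<in> Obj C\<rbrakk>
      \<Longrightarrow> asc C B D A \<cdot> brd C A (B \<boxdot> D) \<cdot> asc C A B D
        = (Ident C B \<boxtimes> brd C A D) \<cdot> asc C B A D \<cdot> (brd C A B \<boxtimes> Ident C D)"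

locale symmetric_compact_closed_category =
  symmetric_monoidal_category C for C :: "('o, 'a, 'z) symmetric_monoidal_scheme" (structure) +
  assumes dual_exists: "A \<in> Obj C \<Longrightarrow>
    \<exists>A' \<in> Obj C. \<exists>\<eta> \<in> homs C (unt C) (A' \<boxdot> A). \<exists>\<epsilon> \<in> homs C (A \<boxdot> A') (unt C).
      lun C A \<cdot> (\<epsilon> \<boxtimes> Ident C A) \<cdot> inv_arrow C (asc C A A' A)
        \<cdot> (Ident C A \<boxtimes> \<eta>) \<cdot> inv_arrow C (run C A) = Ident C A \<and>
      run C A' \<cdot> (Ident C A' \<boxtimes> \<epsilon>) \<cdot> asc C A' A A'
        \<cdot> (\<eta> \<boxtimes> Ident C A') \<cdot> inv_arrow C (lun C A') = Ident C A'"


section \<open>Star-autonomy\<close>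

text \<open>A profunctor \<open>P(A, B; D)\<close>, contravariant in \<open>A\<close>, \<open>B\<close> and covariant in \<open>D\<close>, is given by its
  values \<open>Po A B D\<close> and its action \<open>Pa f g h\<close>.  \<open>(Ro, Ra)\<close> is the quasi-inverse of the
  equivalence \<open>(So, Sa)\<close>; as a functor into the opposite category it is contravariant too.\<close>

definition star_autonomous_promonoidal ::
    "('o, 'a, 'z) cat_scheme \<Rightarrow> ('o \<Rightarrow> 'o \<Rightarrow> 'o \<Rightarrow> 'p set) \<Rightarrow> ('a \<Rightarrow> 'a \<Rightarrow> 'a \<Rightarrow> 'p \<Rightarrow> 'p) \<Rightarrow> bool" where
  "star_autonomous_promonoidal C Po Pa \<longleftrightarrow>
     (\<exists>So Sa Ro Ra \<phi>.
        equivalence_of_categories (op_cat C) C So Sa Ro Ra \<and>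
        (\<forall>A \<in> Obj C. \<forall>B \<in> Obj C. \<forall>D \<in> Obj C.
           bij_betw (\<phi> A B D) (Po A B (So D)) (Po B D (Ro A))) \<and>
        (\<forall>A A' B B' D D' f g d x.
           f \<in> homs C A' A \<longrightarrow> g \<in> homs C B' B \<longrightarrow> d \<in> homs C D' D \<longrightarrow> x \<in> Po A B (So D) \<longrightarrow>
           \<phi> A' B' D' (Pa f g (Sa d) x) = Pa g d (Ra f) (\<phi> A B D x)))"

text \<open>The promonoidal structure of a monoidal category is \<open>P(A, B; D) = C(A \<boxdot> B, D)\<close>.  As in the
  definition for promonoidal categories, the unit and the coherence isomorphisms do not occur.\<close>

definition star_autonomous :: "('o, 'a, 'z) monoidal_scheme \<Rightarrow> bool" where
  "star_autonomous C \<longleftrightarrow>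
     star_autonomous_promonoidal C
       (\<lambda>A B D. homs C (A \<boxdot>\<^bsub>C\<^esub> B) D)
       (\<lambda>f g h x. h \<cdot>\<^bsub>C\<^esub> x \<cdot>\<^bsub>C\<^esub> (f \<boxtimes>\<^bsub>C\<^esub> g))"


section \<open>Vector spaces by generators and relations\<close>

definition free_module :: "('k, 'm) ring_scheme \<Rightarrow> 'g set \<Rightarrow> ('k, 'g \<Rightarrow> 'k) module" where
  "free_module K G =
     \<lparr>carrier = {f. (\<forall>x. f x \<in> carrier K) \<and> (\<forall>x. x \<notin> G \<longrightarrow> f x = \<zero>\<^bsub>K\<^esub>) \<and> finite {x. f x \<noteq> \<zero>\<^bsub>K\<^esub>}},
      mult = (\<lambda>f g. undefined), one = undefined,
      zero = (\<lambda>x. \<zero>\<^bsub>K\<^esub>),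
      add = (\<lambda>f g x. f x \<oplus>\<^bsub>K\<^esub> g x),
      smult = (\<lambda>c f x. c \<otimes>\<^bsub>K\<^esub> f x)\<rparr>"

definition unit_vector :: "('k, 'm) ring_scheme \<Rightarrow> 'g \<Rightarrow> 'g \<Rightarrow> 'k" where
  "unit_vector K g = (\<lambda>x. if x = g then \<one>\<^bsub>K\<^esub> else \<zero>\<^bsub>K\<^esub>)"

definition quotient_module :: "('k, 'v, 'z) module_scheme \<Rightarrow> 'v set \<Rightarrow> ('k, 'v set) module" where
  "quotient_module V W =
     \<lparr>carrier = a_rcosets\<^bsub>V\<^esub> W,
      mult = (\<lambda>A B. undefined), one = undefined,
      zero = W,
      add = (\<lambda>A B. A <+>\<^bsub>V\<^esub> B),
      smult = (\<lambda>c A. \<Union>a\<in>A. W +>\<^bsub>V\<^esub> (c \<odot>\<^bsub>V\<^esub> a))\<rparr>"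

definition presented_space ::
    "('k, 'm) ring_scheme \<Rightarrow> 'g set \<Rightarrow> ('g \<Rightarrow> 'k) set \<Rightarrow> ('k, ('g \<Rightarrow> 'k) set) module" where
  "presented_space K G R =
     quotient_module (free_module K G) (LinearCombinations.module.span K (free_module K G) R)"

definition presented_gen ::
    "('k, 'm) ring_scheme \<Rightarrow> 'g set \<Rightarrow> ('g \<Rightarrow> 'k) set \<Rightarrow> 'g \<Rightarrow> ('g \<Rightarrow> 'k) set" where
  "presented_gen K G R g =
     LinearCombinations.module.span K (free_module K G) R +>\<^bsub>free_module K G\<^esub> unit_vector K g"

text \<open>An isomorphic copy, with elements of type \<open>'v\<close>, of a space with elements of type \<open>'w\<close>.
  It is meaningful whenever the carrier injects into \<open>'v\<close>.\<close>

definition copy_map :: "('k, 'w, 'z) module_scheme \<Rightarrow> 'w \<Rightarrow> 'v" where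
  "copy_map V = (SOME j. inj_on j (carrier V))"

definition copy :: "('k, 'w, 'z) module_scheme \<Rightarrow> ('k, 'v) module" where
  "copy V =
     (let j = copy_map V; r = inv_into (carrier V) j in
      \<lparr>carrier = j ` carrier V,
       mult = (\<lambda>x y. undefined), one = undefined,
       zero = j \<zero>\<^bsub>V\<^esub>,
       add = (\<lambda>x y. j (r x \<oplus>\<^bsub>V\<^esub> r y)),
       smult = (\<lambda>c x. j (c \<odot>\<^bsub>V\<^esub> r x))\<rparr>)"

text \<open>Linear maps are taken to be undefined outside their domain, so that two of them are equal as
  soon as they agree on the domain.\<close>

definition linear_maps ::
    "('k, 'm) ring_scheme \<Rightarrow> ('k, 'v, 'y) module_scheme \<Rightarrow> ('k, 'w, 'z) module_scheme \<Rightarrow>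
     ('v \<Rightarrow> 'w) set" where
  "linear_maps K V W = module_hom K V W \<inter> extensional (carrier V)"


section \<open>Mackey functors\<close>

text \<open>The values of a Mackey functor have elements in a fixed type \<open>'v\<close>, which plays the role of the
  universe of vectors.  As soon as lists of scalars inject into \<open>'v\<close>, every finite-dimensional
  vector space over the field is isomorphic to one with elements in \<open>'v\<close>, and the tensor product and
  unit of finite-dimensional Mackey functors defined below are again realised in \<open>'v\<close>.\<close>

record ('o, 'a, 'k, 'v) mackey =
  mobj :: "'o \<Rightarrow> ('k, 'v) module"
  mmap :: "'a \<Rightarrow> 'v \<Rightarrow> 'v"

text \<open>A natural transformation together with its source and target.\<close>

type_synonym ('o, 'a, 'k, 'v) mackey_arrow =
  "('o, 'a, 'k, 'v) mackey \<times> ('o, 'a, 'k, 'v) mackey \<times> ('o \<Rightarrow> 'v \<Rightarrow> 'v)"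

context
  fixes K :: "('k, 'm) ring_scheme"
    and T :: "('o, 'a, 'z) monoidal_scheme" (structure)
begin

definition mackey_functor :: "('o, 'a, 'k, 'v) mackey \<Rightarrow> bool" where
  "mackey_functor M \<longleftrightarrow>
     (\<forall>X \<in> Obj T. vectorspace K (mobj M X)) \<and>
     (\<forall>X Y f. f \<in> homs T X Y \<longrightarrow> mmap M f \<in> module_hom K (mobj M X) (mobj M Y)) \<and>
     (\<forall>X \<in> Obj T. \<forall>x \<in> carrier (mobj M X). mmap M (Ident T X) x = x) \<and>
     (\<forall>X Y Z f g. f \<in> homs T X Y \<longrightarrow> g \<in> homs T Y Z \<longrightarrow>
        (\<forall>x \<in> carrier (mobj M X). mmap M (g \<cdot> f) x = mmap M g (mmap M f x))) \<and>
     (\<forall>X Y f g. f \<in> homs T X Y \<longrightarrow> g \<in> homs T X Y \<longrightarrow>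
        (\<forall>x \<in> carrier (mobj M X). mmap M (add_arrow T f g) x = mmap M f x \<oplus>\<^bsub>mobj M Y\<^esub> mmap M g x)) \<and>
     (\<forall>X \<in> Obj T. \<forall>Y \<in> Obj T. \<forall>x \<in> carrier (mobj M X).
        mmap M (zero_arrow T X Y) x = \<zero>\<^bsub>mobj M Y\<^esub>)"

definition fin_dim_mackey :: "('o, 'a, 'k, 'v) mackey \<Rightarrow> bool" where
  "fin_dim_mackey M \<longleftrightarrow> (\<forall>X \<in> Obj T. vectorspace.fin_dim K (mobj M X))"

definition natural_transformation ::
    "('o, 'a, 'k, 'v) mackey \<Rightarrow> ('o, 'a, 'k, 'v) mackey \<Rightarrow> ('o \<Rightarrow> 'v \<Rightarrow> 'v) \<Rightarrow> bool" where
  "natural_transformation M N \<tau> \<longleftrightarrow>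
     \<tau> \<in> extensional (Obj T) \<and>
     (\<forall>X \<in> Obj T. \<tau> X \<in> linear_maps K (mobj M X) (mobj N X)) \<and>
     (\<forall>X Y f. f \<in> homs T X Y \<longrightarrow>
        (\<forall>x \<in> carrier (mobj M X). \<tau> Y (mmap M f x) = mmap N f (\<tau> X x)))"


subsection \<open>Day convolution\<close>

text \<open>\<open>(M * N)(Z)\<close> is presented by generators \<open>h \<otimes> m \<otimes> n\<close> for \<open>h : X \<boxdot> Y \<rightarrow> Z\<close>, \<open>m \<in> M(X)\<close>,
  \<open>n \<in> N(Y)\<close>.  Additivity in \<open>h\<close> and linearity in \<open>m\<close> and \<open>n\<close> present
  \<open>T(X \<boxdot> Y, Z) \<otimes> M(X) \<otimes>\<^sub>k N(Y)\<close>: a linear map out of this space is a monoid morphism from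
  \<open>T(X \<boxdot> Y, Z)\<close> to the bilinear maps (such a morphism into a group preserves zero as soon as it is
  additive).  The last two families of relations are dinaturality in \<open>X\<close> and in \<open>Y\<close>.\<close>

definition day_generators ::
    "('o, 'a, 'k, 'v) mackey \<Rightarrow> ('o, 'a, 'k, 'v) mackey \<Rightarrow> 'o \<Rightarrow> ('o \<times> 'o \<times> 'a \<times> 'v \<times> 'v) set" where
  "day_generators M N Z =
     {(X, Y, h, m, n). X \<in> Obj T \<and> Y \<in> Obj T \<and> h \<in> homs T (X \<boxdot> Y) Z \<and>
        m \<in> carrier (mobj M X) \<and> n \<in> carrier (mobj N Y)}"

definition day_relations ::
    "('o, 'a, 'k, 'v) mackey \<Rightarrow> ('o, 'a, 'k, 'v) mackey \<Rightarrow> 'o \<Rightarrow>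
     (('o \<times> 'o \<times> 'a \<times> 'v \<times> 'v) \<Rightarrow> 'k) set" where
  "day_relations M N Z =
     (let G = day_generators M N Z; F = free_module K G;
          e = (\<lambda>X Y h m n. unit_vector K (X, Y, h, m, n))
      in
        {e X Y (add_arrow T h h') m n \<ominus>\<^bsub>F\<^esub> (e X Y h m n \<oplus>\<^bsub>F\<^esub> e X Y h' m n) | X Y h h' m n.
           (X, Y, h, m, n) \<in> G \<and> (X, Y, h', m, n) \<in> G} \<union>
        {e X Y h (m \<oplus>\<^bsub>mobj M X\<^esub> m') n \<ominus>\<^bsub>F\<^esub> (e X Y h m n \<oplus>\<^bsub>F\<^esub> e X Y h m' n) | X Y h m m' n.
           (X, Y, h, m, n) \<in> G \<and> (X, Y, h, m', n) \<in> G} \<union>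
        {e X Y h (c \<odot>\<^bsub>mobj M X\<^esub> m) n \<ominus>\<^bsub>F\<^esub> (c \<odot>\<^bsub>F\<^esub> e X Y h m n) | X Y h m n c.
           (X, Y, h, m, n) \<in> G \<and> c \<in> carrier K} \<union>
        {e X Y h m (n \<oplus>\<^bsub>mobj N Y\<^esub> n') \<ominus>\<^bsub>F\<^esub> (e X Y h m n \<oplus>\<^bsub>F\<^esub> e X Y h m n') | X Y h m n n'.
           (X, Y, h, m, n) \<in> G \<and> (X, Y, h, m, n') \<in> G} \<union>
        {e X Y h m (c \<odot>\<^bsub>mobj N Y\<^esub> n) \<ominus>\<^bsub>F\<^esub> (c \<odot>\<^bsub>F\<^esub> e X Y h m n) | X Y h m n c.
           (X, Y, h, m, n) \<in> G \<and> c \<in> carrier K} \<union>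
        {e X Y (h \<cdot> (f \<boxtimes> Ident T Y)) m n \<ominus>\<^bsub>F\<^esub> e X' Y h (mmap M f m) n | X X' Y f h m n.
           f \<in> homs T X X' \<and> Y \<in> Obj T \<and> h \<in> homs T (X' \<boxdot> Y) Z \<and>
           m \<in> carrier (mobj M X) \<and> n \<in> carrier (mobj N Y)} \<union>
        {e X Y (h \<cdot> (Ident T X \<boxtimes> g)) m n \<ominus>\<^bsub>F\<^esub> e X Y' h m (mmap N g n) | X Y Y' g h m n.
           X \<in> Obj T \<and> g \<in> homs T Y Y' \<and> h \<in> homs T (X \<boxdot> Y') Z \<and>
           m \<in> carrier (mobj M X) \<and> n \<in> carrier (mobj N Y)})"

definition day_space ::
    "('o, 'a, 'k, 'v) mackey \<Rightarrow> ('o, 'a, 'k, 'v) mackey \<Rightarrow> 'o \<Rightarrow>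
     ('k, (('o \<times> 'o \<times> 'a \<times> 'v \<times> 'v) \<Rightarrow> 'k) set) module" where
  "day_space M N Z = presented_space K (day_generators M N Z) (day_relations M N Z)"

text \<open>The class of \<open>h \<otimes> m \<otimes> n\<close> in the copy of \<open>(M * N)(Z)\<close> inside \<open>'v\<close>.\<close>

definition day_class ::
    "('o, 'a, 'k, 'v) mackey \<Rightarrow> ('o, 'a, 'k, 'v) mackey \<Rightarrow> 'o \<Rightarrow> 'o \<Rightarrow> 'o \<Rightarrow> 'a \<Rightarrow> 'v \<Rightarrow> 'v \<Rightarrow> 'v" where
  "day_class M N Z X Y h m n =
     copy_map (day_space M N Z)
       (presented_gen K (day_generators M N Z) (day_relations M N Z) (X, Y, h, m, n))"

definition day ::
    "('o, 'a, 'k, 'v) mackey \<Rightarrow> ('o, 'a, 'k, 'v) mackey \<Rightarrow> ('o, 'a, 'k, 'v) mackey" where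
  "day M N =
     \<lparr>mobj = (\<lambda>Z. copy (day_space M N Z)),
      mmap = (\<lambda>g.
        THE t. t \<in> linear_maps K (copy (day_space M N (Dom T g))) (copy (day_space M N (Cod T g))) \<and>
          (\<forall>X Y h m n. (X, Y, h, m, n) \<in> day_generators M N (Dom T g) \<longrightarrow>
             t (day_class M N (Dom T g) X Y h m n) = day_class M N (Cod T g) X Y (g \<cdot> h) m n))\<rparr>"

definition day_arrow ::
    "('o, 'a, 'k, 'v) mackey_arrow \<Rightarrow> ('o, 'a, 'k, 'v) mackey_arrow \<Rightarrow>
     ('o, 'a, 'k, 'v) mackey_arrow" where
  "day_arrow = (\<lambda>(M, M', \<sigma>) (N, N', \<tau>).
     (day M N, day M' N',
      \<lambda>Z \<in> Obj T.
        THE t. t \<in> linear_maps K (mobj (day M N) Z) (mobj (day M' N') Z) \<and>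
          (\<forall>X Y h m n. (X, Y, h, m, n) \<in> day_generators M N Z \<longrightarrow>
             t (day_class M N Z X Y h m n) = day_class M' N' Z X Y h (\<sigma> X m) (\<tau> Y n))))"


subsection \<open>The Burnside functor\<close>

text \<open>The free vector space on the commutative monoid \<open>T(I, U)\<close>: the free vector space on its
  elements, modulo additivity (which forces the zero of the monoid to become zero).\<close>

definition burnside_relations :: "'o \<Rightarrow> ('a \<Rightarrow> 'k) set" where
  "burnside_relations U =
     (let G = homs T (unt T) U; F = free_module K G in
      {unit_vector K (add_arrow T u v) \<ominus>\<^bsub>F\<^esub> (unit_vector K u \<oplus>\<^bsub>F\<^esub> unit_vector K v) | u v.
         u \<in> G \<and> v \<in> G})"

definition burnside_space :: "'o \<Rightarrow> ('k, ('a \<Rightarrow> 'k) set) module" where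
  "burnside_space U = presented_space K (homs T (unt T) U) (burnside_relations U)"

definition burnside_class :: "'o \<Rightarrow> 'a \<Rightarrow> 'v" where
  "burnside_class U u =
     copy_map (burnside_space U) (presented_gen K (homs T (unt T) U) (burnside_relations U) u)"

definition burnside :: "('o, 'a, 'k, 'v) mackey" where
  "burnside =
     \<lparr>mobj = (\<lambda>U. copy (burnside_space U)),
      mmap = (\<lambda>g.
        THE t. t \<in> linear_maps K (copy (burnside_space (Dom T g))) (copy (burnside_space (Cod T g))) \<and>
          (\<forall>u \<in> homs T (unt T) (Dom T g).
             t (burnside_class (Dom T g) u) = burnside_class (Cod T g) (g \<cdot> u)))\<rparr>"


subsection \<open>The monoidal category of Mackey functors\<close>

text \<open>The associativity and unit constraints are the unique maps with the stated values on
  generators; the elements listed span the domains because \<open>(M * N)(W)\<close> and \<open>J(X)\<close> are spanned by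
  the classes of their generators.\<close>

definition day_asc ::
    "('o, 'a, 'k, 'v) mackey \<Rightarrow> ('o, 'a, 'k, 'v) mackey \<Rightarrow> ('o, 'a, 'k, 'v) mackey \<Rightarrow>
     ('o, 'a, 'k, 'v) mackey_arrow" where
  "day_asc M N L =
     (day (day M N) L, day M (day N L),
      \<lambda>Z \<in> Obj T.
        THE t. t \<in> linear_maps K (mobj (day (day M N) L) Z) (mobj (day M (day N L)) Z) \<and>
          (\<forall>W V h X Y g m n l.
             V \<in> Obj T \<longrightarrow> h \<in> homs T (W \<boxdot> V) Z \<longrightarrow> (X, Y, g, m, n) \<in> day_generators M N W \<longrightarrow>
             l \<in> carrier (mobj L V) \<longrightarrow>
             t (day_class (day M N) L Z W V h (day_class M N W X Y g m n) l) =
               day_class M (day N L) Z X (Y \<boxdot> V)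
                 (h \<cdot> (g \<boxtimes> Ident T V) \<cdot> inv_arrow T (asc T X Y V)) m
                 (day_class N L (Y \<boxdot> V) Y V (Ident T (Y \<boxdot> V)) n l)))"

definition day_lun :: "('o, 'a, 'k, 'v) mackey \<Rightarrow> ('o, 'a, 'k, 'v) mackey_arrow" where
  "day_lun M =
     (day burnside M, M,
      \<lambda>Z \<in> Obj T.
        THE t. t \<in> linear_maps K (mobj (day burnside M) Z) (mobj M Z) \<and>
          (\<forall>X Y h u m. u \<in> homs T (unt T) X \<longrightarrow> Y \<in> Obj T \<longrightarrow> h \<in> homs T (X \<boxdot> Y) Z \<longrightarrow>
             m \<in> carrier (mobj M Y) \<longrightarrow>
             t (day_class burnside M Z X Y h (burnside_class X u) m) =
               mmap M (h \<cdot> (u \<boxtimes> Ident T Y) \<cdot> inv_arrow T (lun T Y)) m))"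

definition day_run :: "('o, 'a, 'k, 'v) mackey \<Rightarrow> ('o, 'a, 'k, 'v) mackey_arrow" where
  "day_run M =
     (day M burnside, M,
      \<lambda>Z \<in> Obj T.
        THE t. t \<in> linear_maps K (mobj (day M burnside) Z) (mobj M Z) \<and>
          (\<forall>X Y h m u. X \<in> Obj T \<longrightarrow> u \<in> homs T (unt T) Y \<longrightarrow> h \<in> homs T (X \<boxdot> Y) Z \<longrightarrow>
             m \<in> carrier (mobj M X) \<longrightarrow>
             t (day_class M burnside Z X Y h m (burnside_class Y u)) =
               mmap M (h \<cdot> (Ident T X \<boxtimes> u) \<cdot> inv_arrow T (run T X)) m))"

definition Mky :: "(('o, 'a, 'k, 'v) mackey, ('o, 'a, 'k, 'v) mackey_arrow) monoidal" where
  "Mky =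
     \<lparr>Obj = {M. mackey_functor M},
      Arr = {(M, N, \<tau>). mackey_functor M \<and> mackey_functor N \<and> natural_transformation M N \<tau>},
      Dom = (\<lambda>(M, N, \<tau>). M),
      Cod = (\<lambda>(M, N, \<tau>). N),
      Ident = (\<lambda>M. (M, M, \<lambda>X \<in> Obj T. \<lambda>x \<in> carrier (mobj M X). x)),
      Comp = (\<lambda>(N', L, \<sigma>) (M, N, \<tau>).
        (M, L, \<lambda>X \<in> Obj T. compose (carrier (mobj M X)) (\<sigma> X) (\<tau> X))),
      tobj = day,
      tarr = day_arrow,
      unt = burnside,
      asc = day_asc,
      lun = day_lun,
      run = day_run\<rparr>"

definition Mky_fin :: "(('o, 'a, 'k, 'v) mackey, ('o, 'a, 'k, 'v) mackey_arrow) monoidal" where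
  "Mky_fin = Mky
     \<lparr>Obj := {M \<in> Obj Mky. fin_dim_mackey M},
      Arr := {f \<in> Arr Mky. fin_dim_mackey (Dom Mky f) \<and> fin_dim_mackey (Cod Mky f)}\<rparr>"

end

end

theory Submission
  imports Defs
begin

text \<open>The dual \<open>S M\<close> of a Mackey functor \<open>M\<close> sends \<open>X\<close> to the space of families of maps
  \<open>T(Z \<boxdot> X, I) \<times> M(Z) \<rightarrow> k\<close>, additive in the first argument, linear in the second and dinatural in \<open>Z\<close>.
  If \<open>X'\<close> is a dual object of \<open>X\<close>, then \<open>T(Z \<boxdot> X, I) \<cong> T(Z, X')\<close>, and the Yoneda lemma identifies this
  space with the linear dual of \<open>M(X')\<close>; hence \<open>S\<close> preserves finite dimension and \<open>M \<cong> S (S M)\<close>.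
  Morphisms \<open>M * N \<rightarrow> S L\<close> are the same as families of maps
  \<open>T(Z \<boxdot> X \<boxdot> Y, I) \<times> L(Z) \<times> M(X) \<times> N(Y) \<rightarrow> k\<close>, additive in the first argument, trilinear in the others and
  dinatural in \<open>Z\<close>, \<open>X\<close> and \<open>Y\<close>.  The symmetry of \<open>T\<close> permutes the factors cyclically, which gives the isomorphism
  \<open>Hom(M * N, S L) \<cong> Hom(N * L, S M)\<close>; it is bijective because its third iterate is the identity.
  Since every object is a direct sum of objects from a finite set and the homs are finitely generated,
  finitely many of the generators already span \<open>(M * N)(Z)\<close>, so \<open>M * N\<close> is finite dimensional.\<close>

section \<open>Categories with finite direct sums\<close>

text \<open>Biadditivity of the tensor product of \<open>T\<close> is not among the assumptions, yet
  S M has to be an additive functor, so h \<cdot> (1 \<boxtimes> f) must be additive in f for every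
  arrow h into I. Compact closedness supplies this: arrows Z \<boxdot> A' -> I are the transposes of
  arrows Z -> A, and transposition respects addition because both sides agree on the two halves of a
  direct sum. All values of Mackey functors live in the one type \<open>'v\<close>, so a space that
  arises as a quotient or as a set of families has to be copied into \<open>'v\<close>. The copy is
  faithful only if an injection exists; for finite-dimensional spaces it is given by coordinate
  lists followed by \<open>e\<close>. Hence the finite dimension of each construction must be known
  before the construction can be used at all. Evaluating a morphism M * N -> S L only at generators
  whose arrow is the identity of X \<boxdot> Y puts the three functors on an equal footing, and this
  is what makes the cyclic symmetry visible.\<close>

lemma homsD: "f \<in> homs C A B \<Longrightarrow> f \<in> Arr C \<and> Dom C f = A \<and> Cod C f = B"
  by (simp add: homs_def)

lemma homsI: "\<lbrakk>f \<in> Arr C; Dom C f = A; Cod C f = B\<rbrakk> \<Longrightarrow> f \<in> homs C A B"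
  by (simp add: homs_def)

context category
begin

lemma homs_Obj: "f \<in> homs C A B \<Longrightarrow> A \<in> Obj C \<and> B \<in> Obj C"
  using Dom_closed Cod_closed by (auto simp: homs_def)

lemma arr_Ident: "A \<in> Obj C \<Longrightarrow> Ident C A \<in> Arr C"
  and Dom_Ident: "A \<in> Obj C \<Longrightarrow> Dom C (Ident C A) = A"
  and Cod_Ident: "A \<in> Obj C \<Longrightarrow> Cod C (Ident C A) = A"
  using Ident_closed by (auto simp: homs_def)

lemma arr_Comp: "\<lbrakk>f \<in> Arr C; g \<in> Arr C; Cod C f = Dom C g\<rbrakk> \<Longrightarrow> g \<cdot> f \<in> Arr C"
  and Dom_Comp: "\<lbrakk>f \<in> Arr C; g \<in> Arr C; Cod C f = Dom C g\<rbrakk> \<Longrightarrow> Dom C (g \<cdot> f) = Dom C f"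
  and Cod_Comp: "\<lbrakk>f \<in> Arr C; g \<in> Arr C; Cod C f = Dom C g\<rbrakk> \<Longrightarrow> Cod C (g \<cdot> f) = Cod C g"
  using Comp_closed[of f "Dom C f" "Cod C f" g "Cod C g"] by (auto simp: homs_def)

lemma Ident_Comp: "\<lbrakk>f \<in> Arr C; Cod C f = B\<rbrakk> \<Longrightarrow> Ident C B \<cdot> f = f"
  and Comp_Ident: "\<lbrakk>f \<in> Arr C; Dom C f = A\<rbrakk> \<Longrightarrow> f \<cdot> Ident C A = f"
  using Ident_left[of f] Ident_right[of f] by (auto simp: homs_def)

lemma assoc: "\<lbrakk>f \<in> Arr C; g \<in> Arr C; h \<in> Arr C; Cod C f = Dom C g; Cod C g = Dom C h\<rbrakk>
    \<Longrightarrow> (h \<cdot> g) \<cdot> f = h \<cdot> (g \<cdot> f)"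
  using Comp_assoc[of f _ _ g _ h] by (auto simp: homs_def)

lemmas arr_simps = Dom_closed Cod_closed arr_Ident Dom_Ident Cod_Ident arr_Comp Dom_Comp Cod_Comp
  Ident_Comp Comp_Ident assoc

lemma assoc_eq:
  assumes "g \<cdot> f = k" "f \<in> Arr C" "g \<in> Arr C" "Cod C f = Dom C g" "x \<in> Arr C" "Cod C x = Dom C f"
  shows "g \<cdot> (f \<cdot> x) = k \<cdot> x"
  using assms by (metis assoc)

lemma inverse_arrows_unique:
  assumes "inverse_arrows C f g" "inverse_arrows C f g'"
  shows "g = g'"
proof -
  have "f \<cdot> g' = Ident C (Dom C g)" "g \<in> Arr C"
    using assms by (auto simp: inverse_arrows_def homs_def)
  then have "g = g \<cdot> (f \<cdot> g')"
    by (simp add: Comp_Ident)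
  also have "\<dots> = (g \<cdot> f) \<cdot> g'"
    using assms by (subst assoc) (auto simp: inverse_arrows_def homs_def)
  also have "\<dots> = g'"
    using assms by (auto simp: inverse_arrows_def homs_def arr_simps)
  finally show ?thesis .
qed

lemma inv_arrow_eq: "inverse_arrows C f g \<Longrightarrow> inv_arrow C f = g"
  unfolding inv_arrow_def using inverse_arrows_unique by blast

lemma iso_arrow_inv:
  assumes "iso_arrow C f A B"
  shows "f \<in> homs C A B" "inv_arrow C f \<in> homs C B A"
    "inv_arrow C f \<cdot> f = Ident C A" "f \<cdot> inv_arrow C f = Ident C B"
proof -
  obtain g where "inverse_arrows C f g" and "f \<in> homs C A B"
    using assms by (auto simp: iso_arrow_def)
  then show "f \<in> homs C A B" "inv_arrow C f \<in> homs C B A"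
    "inv_arrow C f \<cdot> f = Ident C A" "f \<cdot> inv_arrow C f = Ident C B"
    using inv_arrow_eq by (auto simp: inverse_arrows_def homs_def)
qed

lemma inverse_arrowsI:
  "\<lbrakk>f \<in> homs C A B; g \<in> homs C B A; g \<cdot> f = Ident C A; f \<cdot> g = Ident C B\<rbrakk> \<Longrightarrow> inverse_arrows C f g"
  by (auto simp: inverse_arrows_def homs_def)

lemma iso_arrowI:
  "\<lbrakk>f \<in> homs C A B; g \<in> homs C B A; g \<cdot> f = Ident C A; f \<cdot> g = Ident C B\<rbrakk> \<Longrightarrow> iso_arrow C f A B"
  by (auto simp: iso_arrow_def intro: inverse_arrowsI)

lemma iso_arrow_inv_arrow:
  assumes "iso_arrow C f A B"
  shows "iso_arrow C (inv_arrow C f) B A" "inv_arrow C (inv_arrow C f) = f"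
proof -
  note i = iso_arrow_inv[OF assms]
  show "iso_arrow C (inv_arrow C f) B A"
    by (rule iso_arrowI[OF i(2,1,4,3)])
  show "inv_arrow C (inv_arrow C f) = f"
    by (rule inv_arrow_eq[OF inverse_arrowsI[OF i(2,1,4,3)]])
qed

lemma iso_comp_cancel:
  assumes "iso_arrow C k A B" "f \<in> homs C B D" "g \<in> homs C B D" "f \<cdot> k = g \<cdot> k"
  shows "f = g"
proof -
  note i = iso_arrow_inv[OF assms(1)]
  have "f = (f \<cdot> k) \<cdot> inv_arrow C k" "g = (g \<cdot> k) \<cdot> inv_arrow C k"
    using i assms(2,3) by (auto simp: homs_def arr_simps)
  then show ?thesis using assms(4) by simp
qed

lemma comp_iso_cancel:
  assumes "iso_arrow C k B D" "f \<in> homs C A B" "g \<in> homs C A B" "k \<cdot> f = k \<cdot> g"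
  shows "f = g"
proof -
  note i = iso_arrow_inv[OF assms(1)]
  have "f = inv_arrow C k \<cdot> (k \<cdot> f)" "g = inv_arrow C k \<cdot> (k \<cdot> g)"
    using i assms(2,3) by (auto simp: homs_def arr_simps assoc_eq[OF i(3)])
  then show ?thesis using assms(4) by simp
qed

text \<open>Both composites are compared through the unique arrow Z -> Z'. This makes the
  description in \<open>zero_arrow\<close> independent of the zero object through which an arrow
  factors.\<close>

lemma zero_object_comp:
  assumes "zero_object C Z" "zero_object C Z'" "g \<in> homs C A Z" "h \<in> homs C Z B"
    "g' \<in> homs C A Z'" "h' \<in> homs C Z' B"
  shows "h \<cdot> g = h' \<cdot> g'"
proof -
  obtain k where k: "k \<in> homs C Z Z'"
    using assms(1,2) by (auto simp: zero_object_def)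
  have "A \<in> Obj C" "B \<in> Obj C" using assms(3,4) homs_Obj by auto
  then have "k \<cdot> g = g'" "h' \<cdot> k = h"
    using assms Comp_closed[OF _ k] Comp_closed[OF k] by (auto simp: zero_object_def)
  then show ?thesis
    using Comp_assoc[OF assms(3) k assms(6)] by simp
qed

end

text \<open>The case n = 2 with equal summands is the one used by \<open>add_arrow\<close>; families
  indexed by natural numbers are turned into pairs once and for all.\<close>

lemma is_direct_sum_2D:
  assumes "is_direct_sum C 2 (\<lambda>_. B) S p i"
  shows "S \<in> Obj C" "B \<in> Obj C" "p 0 \<in> homs C S B" "p 1 \<in> homs C S B" "i 0 \<in> homs C B S" "i 1 \<in> homs C B S"
    and "\<And>X f g. \<lbrakk>X \<in> Obj C; f \<in> homs C X B; g \<in> homs C X B\<rbrakk>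
      \<Longrightarrow> \<exists>!u. u \<in> homs C X S \<and> p 0 \<cdot>\<^bsub>C\<^esub> u = f \<and> p 1 \<cdot>\<^bsub>C\<^esub> u = g"
    and "\<And>X f g. \<lbrakk>X \<in> Obj C; f \<in> homs C B X; g \<in> homs C B X\<rbrakk>
      \<Longrightarrow> \<exists>!u. u \<in> homs C S X \<and> u \<cdot>\<^bsub>C\<^esub> i 0 = f \<and> u \<cdot>\<^bsub>C\<^esub> i 1 = g"
    and "p 0 \<cdot>\<^bsub>C\<^esub> i 0 = Ident C B" "p 1 \<cdot>\<^bsub>C\<^esub> i 1 = Ident C B"
      "p 1 \<cdot>\<^bsub>C\<^esub> i 0 = zero_arrow C B B" "p 0 \<cdot>\<^bsub>C\<^esub> i 1 = zero_arrow C B B"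
proof -
  have all2: "(\<forall>j<2. P j) \<longleftrightarrow> P 0 \<and> P 1" for P :: "nat \<Rightarrow> bool"
    by (auto simp: less_2_cases_iff)
  note a = assms[unfolded is_direct_sum_def all2]
  show "S \<in> Obj C" "B \<in> Obj C" "p 0 \<in> homs C S B" "p 1 \<in> homs C S B" "i 0 \<in> homs C B S" "i 1 \<in> homs C B S"
    "p 0 \<cdot>\<^bsub>C\<^esub> i 0 = Ident C B" "p 1 \<cdot>\<^bsub>C\<^esub> i 1 = Ident C B"
    "p 1 \<cdot>\<^bsub>C\<^esub> i 0 = zero_arrow C B B" "p 0 \<cdot>\<^bsub>C\<^esub> i 1 = zero_arrow C B B"
    using a by simp_all
  show "\<exists>!u. u \<in> homs C X S \<and> p 0 \<cdot>\<^bsub>C\<^esub> u = f \<and> p 1 \<cdot>\<^bsub>C\<^esub> u = g"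
    if "X \<in> Obj C" "f \<in> homs C X B" "g \<in> homs C X B" for X f g
  proof -
    \<comment> \<open>The index 1 must stay a literal in order to match \<open>p 1\<close>, hence
      \<open>One_nat_def\<close> is removed from the simpset.\<close>
    have "\<forall>f :: nat \<Rightarrow> _. f 0 \<in> homs C X B \<and> f 1 \<in> homs C X B \<longrightarrow>
        (\<exists>!u. u \<in> homs C X S \<and> p 0 \<cdot>\<^bsub>C\<^esub> u = f 0 \<and> p 1 \<cdot>\<^bsub>C\<^esub> u = f 1)"
      using a that(1) by (simp del: One_nat_def)
    from this[rule_format, of "\<lambda>j. if j = 0 then f else g"] show ?thesis
      using that by simp
  qed
  show "\<exists>!u. u \<in> homs C S X \<and> u \<cdot>\<^bsub>C\<^esub> i 0 = f \<and> u \<cdot>\<^bsub>C\<^esub> i 1 = g"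
    if "X \<in> Obj C" "f \<in> homs C B X" "g \<in> homs C B X" for X f g
  proof -
    have "\<forall>f :: nat \<Rightarrow> _. f 0 \<in> homs C B X \<and> f 1 \<in> homs C B X \<longrightarrow>
        (\<exists>!u. u \<in> homs C S X \<and> u \<cdot>\<^bsub>C\<^esub> i 0 = f 0 \<and> u \<cdot>\<^bsub>C\<^esub> i 1 = f 1)"
      using a that(1) by (simp del: One_nat_def)
    from this[rule_format, of "\<lambda>j. if j = 0 then f else g"] show ?thesis
      using that by simp
  qed
qed

lemma is_direct_sum_2_eqI:
  assumes "is_direct_sum C 2 (\<lambda>_. B) S p i" "u \<in> homs C X S" "v \<in> homs C X S" "X \<in> Obj C"
    "p 0 \<cdot>\<^bsub>C\<^esub> u = p 0 \<cdot>\<^bsub>C\<^esub> v" "p 1 \<cdot>\<^bsub>C\<^esub> u = p 1 \<cdot>\<^bsub>C\<^esub> v"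
    "p 0 \<cdot>\<^bsub>C\<^esub> v \<in> homs C X B" "p 1 \<cdot>\<^bsub>C\<^esub> v \<in> homs C X B"
  shows "u = v"
  using is_direct_sum_2D(7)[OF assms(1,4,7,8)] assms by blast

lemma is_direct_sum_2_coeqI:
  assumes "is_direct_sum C 2 (\<lambda>_. B) S p i" "u \<in> homs C S X" "v \<in> homs C S X" "X \<in> Obj C"
    "u \<cdot>\<^bsub>C\<^esub> i 0 = v \<cdot>\<^bsub>C\<^esub> i 0" "u \<cdot>\<^bsub>C\<^esub> i 1 = v \<cdot>\<^bsub>C\<^esub> i 1"
    "v \<cdot>\<^bsub>C\<^esub> i 0 \<in> homs C B X" "v \<cdot>\<^bsub>C\<^esub> i 1 \<in> homs C B X"
  shows "u = v"
  using is_direct_sum_2D(8)[OF assms(1,4,7,8)] assms by blast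

section \<open>Zero arrows and the addition of arrows\<close>

locale semiadditive_category = category C for C :: "('o, 'a, 'z) cat_scheme" (structure) +
  assumes finite_direct_sums: "has_finite_direct_sums C"
begin

text \<open>The direct sum of the empty family is a zero object: both universal properties lose
  their conditions and become unique existence of an arrow.\<close>

lemma zero_object_exists: "\<exists>Z. zero_object C Z"
proof -
  obtain S p i where "is_direct_sum C 0 (\<lambda>_. undefined) S p i"
    using finite_direct_sums unfolding has_finite_direct_sums_def by (metis not_less0)
  then have "zero_object C S"
    by (auto simp: is_direct_sum_def zero_object_def)
  then show ?thesis ..
qed

lemma zero_arrow_eq:
  assumes "zero_object C Z" "g \<in> homs C A Z" "h \<in> homs C Z B"
  shows "zero_arrow C A B = h \<cdot> g"
  unfolding zero_arrow_def
proof (rule the_equality)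
  show "\<exists>Z g' h'. zero_object C Z \<and> g' \<in> homs C A Z \<and> h' \<in> homs C Z B \<and> h \<cdot> g = h' \<cdot> g'"
    using assms by blast
  show "f = h \<cdot> g" if "\<exists>Z g h. zero_object C Z \<and> g \<in> homs C A Z \<and> h \<in> homs C Z B \<and> f = h \<cdot> g" for f
    using that zero_object_comp[OF _ assms(1) _ _ assms(2,3)] by blast
qed

lemma zero_arrow_factor:
  assumes "A \<in> Obj C" "B \<in> Obj C"
  obtains Z g h where "zero_object C Z" "g \<in> homs C A Z" "h \<in> homs C Z B" "zero_arrow C A B = h \<cdot> g"
proof -
  obtain Z where Z: "zero_object C Z" using zero_object_exists by blast
  then obtain g h where "g \<in> homs C A Z" "h \<in> homs C Z B"
    using assms unfolding zero_object_def by meson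
  with Z zero_arrow_eq that show ?thesis by blast
qed

lemma zero_arrow_closed: "\<lbrakk>A \<in> Obj C; B \<in> Obj C\<rbrakk> \<Longrightarrow> zero_arrow C A B \<in> homs C A B"
  by (metis zero_arrow_factor Comp_closed)

lemma comp_zero_arrow:
  assumes "A \<in> Obj C" "k \<in> homs C B D"
  shows "k \<cdot> zero_arrow C A B = zero_arrow C A D"
proof -
  have "B \<in> Obj C" using assms homs_Obj by blast
  with assms(1) obtain Z g h where z: "zero_object C Z" "g \<in> homs C A Z" "h \<in> homs C Z B" "zero_arrow C A B = h \<cdot> g"
    by (rule zero_arrow_factor)
  then show ?thesis
    using zero_arrow_eq[OF z(1,2) Comp_closed[OF z(3) assms(2)]] Comp_assoc[OF z(2,3) assms(2)] by simp
qed

lemma zero_arrow_comp: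
  assumes "B \<in> Obj C" "k \<in> homs C D A"
  shows "zero_arrow C A B \<cdot> k = zero_arrow C D B"
proof -
  have "A \<in> Obj C" using assms homs_Obj by blast
  then obtain Z g h where z: "zero_object C Z" "g \<in> homs C A Z" "h \<in> homs C Z B" "zero_arrow C A B = h \<cdot> g"
    using assms(1) by (rule zero_arrow_factor)
  then show ?thesis
    using zero_arrow_eq[OF z(1) Comp_closed[OF assms(2) z(2)] z(3)] Comp_assoc[OF assms(2) z(2,3)] by simp
qed

lemma binary_sum_exists:
  assumes "B \<in> Obj C"
  obtains S p i where "is_direct_sum C 2 (\<lambda>_. B) S p i"
  using finite_direct_sums assms unfolding has_finite_direct_sums_def by metis

lemma codiagonal_exists:
  assumes "is_direct_sum C 2 (\<lambda>_. B) S p i"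
  obtains c where "c \<in> homs C S B" "c \<cdot> i 0 = Ident C B" "c \<cdot> i 1 = Ident C B"
  using is_direct_sum_2D(2)[OF assms] is_direct_sum_2D(8)[OF assms _ Ident_closed Ident_closed] by blast

text \<open>The description in \<open>add_arrow\<close> ranges over all direct sums, so two of them
  must give the same result. The arrow v : S -> S' that is compatible with the projections is also
  compatible with the injections, because the composites p l \<cdot> i j are the same Kronecker
  delta on both sides. Hence v carries pairing to pairing and codiagonal to codiagonal.\<close>

lemma add_arrow_eq:
  assumes S: "is_direct_sum C 2 (\<lambda>_. B) S p i" and u: "u \<in> homs C A S" "p 0 \<cdot> u = f" "p 1 \<cdot> u = g"
    and c: "c \<in> homs C S B" "c \<cdot> i 0 = Ident C B" "c \<cdot> i 1 = Ident C B"
  shows "add_arrow C f g = c \<cdot> u"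
proof -
  note S = S is_direct_sum_2D[OF S]
  have f: "Dom C f = A" "Cod C f = B" "f \<in> homs C A B" "g \<in> homs C A B" "A \<in> Obj C"
    using u S Comp_closed homs_Obj by (auto simp: homs_def)
  show ?thesis
    unfolding add_arrow_def f
  proof (rule the_equality)
    show "\<exists>S p i u' c'. is_direct_sum C 2 (\<lambda>_. B) S p i \<and> u' \<in> homs C A S \<and> p 0 \<cdot> u' = f \<and> p 1 \<cdot> u' = g \<and>
        c' \<in> homs C S B \<and> c' \<cdot> i 0 = Ident C B \<and> c' \<cdot> i 1 = Ident C B \<and> c \<cdot> u = c' \<cdot> u'"
      using S(1) u c by blast
  next
    fix h
    assume "\<exists>S p i u c. is_direct_sum C 2 (\<lambda>_. B) S p i \<and> u \<in> homs C A S \<and> p 0 \<cdot> u = f \<and> p 1 \<cdot> u = g \<and>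
        c \<in> homs C S B \<and> c \<cdot> i 0 = Ident C B \<and> c \<cdot> i 1 = Ident C B \<and> h = c \<cdot> u"
    then obtain S' p' i' u' c' where S': "is_direct_sum C 2 (\<lambda>_. B) S' p' i'"
      and u': "u' \<in> homs C A S'" "p' 0 \<cdot> u' = f" "p' 1 \<cdot> u' = g"
      and c': "c' \<in> homs C S' B" "c' \<cdot> i' 0 = Ident C B" "c' \<cdot> i' 1 = Ident C B" and h: "h = c' \<cdot> u'"
      by blast
    note S' = S' is_direct_sum_2D[OF S']
    obtain v where v: "v \<in> homs C S S'" "p' 0 \<cdot> v = p 0" "p' 1 \<cdot> v = p 1"
      using S'(8)[OF S(2) S(4,5)] by blast
    have vu: "v \<cdot> u = u'"
      by (rule is_direct_sum_2_eqI[OF S'(1) Comp_closed[OF u(1) v(1)] u'(1) f(5)])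
        (use Comp_assoc[OF u(1) v(1) S'(4)] Comp_assoc[OF u(1) v(1) S'(5)] v u u' f in auto)
    have e: "p' 0 \<cdot> (v \<cdot> i 0) = Ident C B" "p' 1 \<cdot> (v \<cdot> i 0) = zero_arrow C B B"
      "p' 0 \<cdot> (v \<cdot> i 1) = zero_arrow C B B" "p' 1 \<cdot> (v \<cdot> i 1) = Ident C B"
      using Comp_assoc[OF S(6) v(1) S'(4)] Comp_assoc[OF S(6) v(1) S'(5)]
        Comp_assoc[OF S(7) v(1) S'(4)] Comp_assoc[OF S(7) v(1) S'(5)] v S by simp_all
    note zc = zero_arrow_closed[OF S(3,3)] Ident_closed[OF S(3)]
    have vi: "v \<cdot> i 0 = i' 0"
      by (rule is_direct_sum_2_eqI[OF S'(1) Comp_closed[OF S(6) v(1)] S'(6) S(3)])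
        (simp_all only: e S' zc)
    have vi1: "v \<cdot> i 1 = i' 1"
      by (rule is_direct_sum_2_eqI[OF S'(1) Comp_closed[OF S(7) v(1)] S'(7) S(3)])
        (simp_all only: e S' zc)
    have "c' \<cdot> v = c"
      by (rule is_direct_sum_2_coeqI[OF S(1) Comp_closed[OF v(1) c'(1)] c(1) S(3)])
        (use Comp_assoc[OF S(6) v(1) c'(1)] Comp_assoc[OF S(7) v(1) c'(1)] vi vi1 c c' S Ident_closed in auto)
    then show "h = c \<cdot> u"
      using h vu Comp_assoc[OF u(1) v(1) c'(1)] by simp
  qed
qed

lemma add_arrow_decomp:
  assumes "f \<in> homs C A B" "g \<in> homs C A B" and S: "is_direct_sum C 2 (\<lambda>_. B) S p i"
  obtains u c where "u \<in> homs C A S" "p 0 \<cdot> u = f" "p 1 \<cdot> u = g"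
    "c \<in> homs C S B" "c \<cdot> i 0 = Ident C B" "c \<cdot> i 1 = Ident C B" "add_arrow C f g = c \<cdot> u"
proof -
  have "A \<in> Obj C" using assms homs_Obj by blast
  then obtain u where u: "u \<in> homs C A S" "p 0 \<cdot> u = f" "p 1 \<cdot> u = g"
    using is_direct_sum_2D(7)[OF S _ assms(1,2)] by blast
  obtain c where c: "c \<in> homs C S B" "c \<cdot> i 0 = Ident C B" "c \<cdot> i 1 = Ident C B"
    by (rule codiagonal_exists[OF S])
  show ?thesis
    using that[OF u c] add_arrow_eq[OF S u c] by blast
qed

lemma add_arrow_closed:
  assumes "f \<in> homs C A B" "g \<in> homs C A B"
  shows "add_arrow C f g \<in> homs C A B"
proof -
  obtain S p i where S: "is_direct_sum C 2 (\<lambda>_. B) S p i"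
    using assms homs_Obj binary_sum_exists by metis
  show ?thesis
    by (rule add_arrow_decomp[OF assms S]) (metis Comp_closed)
qed

lemma add_arrow_comp:
  assumes f: "f \<in> homs C A B" "g \<in> homs C A B" and k: "k \<in> homs C D A"
  shows "add_arrow C f g \<cdot> k = add_arrow C (f \<cdot> k) (g \<cdot> k)"
proof -
  obtain S p i where S: "is_direct_sum C 2 (\<lambda>_. B) S p i"
    using f homs_Obj binary_sum_exists by metis
  obtain u c where u: "u \<in> homs C A S" "p 0 \<cdot> u = f" "p 1 \<cdot> u = g"
    and c: "c \<in> homs C S B" "c \<cdot> i 0 = Ident C B" "c \<cdot> i 1 = Ident C B" and a: "add_arrow C f g = c \<cdot> u"
    by (rule add_arrow_decomp[OF f S])
  have "p 0 \<cdot> (u \<cdot> k) = f \<cdot> k" "p 1 \<cdot> (u \<cdot> k) = g \<cdot> k"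
    using Comp_assoc[OF k u(1)] is_direct_sum_2D[OF S] u by auto
  then show ?thesis
    using add_arrow_eq[OF S Comp_closed[OF k u(1)] _ _ c] a Comp_assoc[OF k u(1) c(1)] by simp
qed

text \<open>On this side k has to pass the codiagonal. The arrow w = k \<oplus> k between the two
  direct sums satisfies w \<cdot> i j = i' j \<cdot> k, by the Kronecker delta and the absorption
  laws of zero arrows, and therefore c' \<cdot> w = k \<cdot> c.\<close>

lemma comp_add_arrow:
  assumes f: "f \<in> homs C A B" "g \<in> homs C A B" and k: "k \<in> homs C B D"
  shows "k \<cdot> add_arrow C f g = add_arrow C (k \<cdot> f) (k \<cdot> g)"
proof -
  have obj: "B \<in> Obj C" "D \<in> Obj C" using k homs_Obj by auto
  obtain S p i where S: "is_direct_sum C 2 (\<lambda>_. B) S p i"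
    using obj binary_sum_exists by metis
  obtain S' p' i' where S': "is_direct_sum C 2 (\<lambda>_. D) S' p' i'"
    using obj binary_sum_exists by metis
  obtain u c where u: "u \<in> homs C A S" "p 0 \<cdot> u = f" "p 1 \<cdot> u = g"
    and c: "c \<in> homs C S B" "c \<cdot> i 0 = Ident C B" "c \<cdot> i 1 = Ident C B" and a: "add_arrow C f g = c \<cdot> u"
    by (rule add_arrow_decomp[OF f S])
  obtain c' where c': "c' \<in> homs C S' D" "c' \<cdot> i' 0 = Ident C D" "c' \<cdot> i' 1 = Ident C D"
    by (rule codiagonal_exists[OF S'])
  note S = S is_direct_sum_2D[OF S]
  note S' = S' is_direct_sum_2D[OF S']
  obtain w where w: "w \<in> homs C S S'" "p' 0 \<cdot> w = k \<cdot> p 0" "p' 1 \<cdot> w = k \<cdot> p 1"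
    using S'(8)[OF S(2) Comp_closed[OF S(4) k] Comp_closed[OF S(5) k]] by blast
  have z: "k \<cdot> zero_arrow C B B = zero_arrow C B D" "zero_arrow C D D \<cdot> k = zero_arrow C B D"
    using comp_zero_arrow[OF obj(1) k] zero_arrow_comp[OF obj(2) k] by auto
  note h = S S' w u c c' k f obj z
  have wi: "w \<cdot> i 0 = i' 0 \<cdot> k" "w \<cdot> i 1 = i' 1 \<cdot> k"
  proof -
    have e: "p' 0 \<cdot> (w \<cdot> i 0) = k" "p' 1 \<cdot> (w \<cdot> i 0) = zero_arrow C B D"
      "p' 0 \<cdot> (w \<cdot> i 1) = zero_arrow C B D" "p' 1 \<cdot> (w \<cdot> i 1) = k"
      using Comp_assoc[OF S(6) w(1) S'(4)] Comp_assoc[OF S(6) w(1) S'(5)]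
        Comp_assoc[OF S(7) w(1) S'(4)] Comp_assoc[OF S(7) w(1) S'(5)] w
        Comp_assoc[OF S(6) S(4) k] Comp_assoc[OF S(6) S(5) k] Comp_assoc[OF S(7) S(4) k]
        Comp_assoc[OF S(7) S(5) k] S z Ident_right[OF k] by simp_all
    have e': "p' 0 \<cdot> (i' 0 \<cdot> k) = k" "p' 1 \<cdot> (i' 0 \<cdot> k) = zero_arrow C B D"
      "p' 0 \<cdot> (i' 1 \<cdot> k) = zero_arrow C B D" "p' 1 \<cdot> (i' 1 \<cdot> k) = k"
      using Comp_assoc[OF k S'(6) S'(4)] Comp_assoc[OF k S'(6) S'(5)]
        Comp_assoc[OF k S'(7) S'(4)] Comp_assoc[OF k S'(7) S'(5)] S' z Ident_left[OF k] by simp_all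
    have zc: "zero_arrow C B D \<in> homs C B D" using zero_arrow_closed obj by blast
    show "w \<cdot> i 0 = i' 0 \<cdot> k"
      by (rule is_direct_sum_2_eqI[OF S'(1) Comp_closed[OF S(6) w(1)] Comp_closed[OF k S'(6)] obj(1)])
        (simp_all only: e e' k zc)
    show "w \<cdot> i 1 = i' 1 \<cdot> k"
      by (rule is_direct_sum_2_eqI[OF S'(1) Comp_closed[OF S(7) w(1)] Comp_closed[OF k S'(7)] obj(1)])
        (simp_all only: e e' k zc)
  qed
  have cw: "c' \<cdot> w = k \<cdot> c"
  proof -
    have e: "(c' \<cdot> w) \<cdot> i 0 = k" "(c' \<cdot> w) \<cdot> i 1 = k"
      using Comp_assoc[OF S(6) w(1) c'(1)] Comp_assoc[OF S(7) w(1) c'(1)] wi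
        Comp_assoc[OF k S'(6) c'(1)] Comp_assoc[OF k S'(7) c'(1)] c' Ident_left[OF k] by simp_all
    have e': "(k \<cdot> c) \<cdot> i 0 = k" "(k \<cdot> c) \<cdot> i 1 = k"
      using Comp_assoc[OF S(6) c(1) k] Comp_assoc[OF S(7) c(1) k] c Ident_right[OF k] by simp_all
    show ?thesis
      by (rule is_direct_sum_2_coeqI[OF S(1) Comp_closed[OF w(1) c'(1)] Comp_closed[OF c(1) k] obj(2)])
        (simp_all only: e e' k)
  qed
  have wu: "p' 0 \<cdot> (w \<cdot> u) = k \<cdot> f" "p' 1 \<cdot> (w \<cdot> u) = k \<cdot> g"
    using Comp_assoc[OF u(1) w(1) S'(4)] Comp_assoc[OF u(1) w(1) S'(5)] w u
      Comp_assoc[OF u(1) S(4) k] Comp_assoc[OF u(1) S(5) k] by simp_all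
  have "add_arrow C (k \<cdot> f) (k \<cdot> g) = c' \<cdot> (w \<cdot> u)"
    by (rule add_arrow_eq[OF S'(1) Comp_closed[OF u(1) w(1)] wu c'])
  also have "\<dots> = (k \<cdot> c) \<cdot> u"
    using Comp_assoc[OF u(1) w(1) c'(1)] cw by simp
  also have "\<dots> = k \<cdot> add_arrow C f g"
    using Comp_assoc[OF u(1) c(1) k] a by simp
  finally show ?thesis by simp
qed

text \<open>The pairing of f with zero is i 0 \<cdot> f, and the codiagonal cancels i 0;
  symmetrically with i 1.\<close>

lemma add_arrow_zero:
  assumes f: "f \<in> homs C A B"
  shows "add_arrow C f (zero_arrow C A B) = f" "add_arrow C (zero_arrow C A B) f = f"
proof -
  have obj: "A \<in> Obj C" "B \<in> Obj C" using f homs_Obj by auto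
  obtain S p i where S: "is_direct_sum C 2 (\<lambda>_. B) S p i"
    using obj binary_sum_exists by metis
  obtain c where c: "c \<in> homs C S B" "c \<cdot> i 0 = Ident C B" "c \<cdot> i 1 = Ident C B"
    by (rule codiagonal_exists[OF S])
  note S = S is_direct_sum_2D[OF S]
  note z = zero_arrow_comp[OF obj(2) f]
  note a = Comp_assoc[OF f S(6) S(4)] Comp_assoc[OF f S(6) S(5)] Comp_assoc[OF f S(7) S(4)]
    Comp_assoc[OF f S(7) S(5)]
  have "add_arrow C f (zero_arrow C A B) = c \<cdot> (i 0 \<cdot> f)"
    by (rule add_arrow_eq[OF S(1) Comp_closed[OF f S(6)] _ _ c])
      (use a S z Ident_left[OF f] in simp_all)
  then show "add_arrow C f (zero_arrow C A B) = f"
    using Comp_assoc[OF f S(6) c(1)] c Ident_left[OF f] by simp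
  have "add_arrow C (zero_arrow C A B) f = c \<cdot> (i 1 \<cdot> f)"
    by (rule add_arrow_eq[OF S(1) Comp_closed[OF f S(7)] _ _ c])
      (use a S z Ident_left[OF f] in simp_all)
  then show "add_arrow C (zero_arrow C A B) f = f"
    using Comp_assoc[OF f S(7) c(1)] c Ident_left[OF f] by simp
qed

primrec sum_arrows :: "'o \<Rightarrow> 'o \<Rightarrow> (nat \<Rightarrow> 'a) \<Rightarrow> nat \<Rightarrow> 'a" where
  "sum_arrows A B f 0 = zero_arrow C A B"
| "sum_arrows A B f (Suc n) = add_arrow C (sum_arrows A B f n) (f n)"

lemma sum_arrows_closed:
  "\<lbrakk>A \<in> Obj C; B \<in> Obj C; \<And>j. j < n \<Longrightarrow> f j \<in> homs C A B\<rbrakk> \<Longrightarrow> sum_arrows A B f n \<in> homs C A B"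
  by (induction n) (auto intro: zero_arrow_closed add_arrow_closed)

lemma sum_arrows_comp:
  assumes "A \<in> Obj C" "B \<in> Obj C" "\<And>j. j < n \<Longrightarrow> f j \<in> homs C A B" "k \<in> homs C D A"
  shows "sum_arrows A B f n \<cdot> k = sum_arrows D B (\<lambda>j. f j \<cdot> k) n"
  using assms(3)
proof (induction n)
  case 0
  then show ?case using zero_arrow_comp assms by simp
next
  case (Suc n)
  then show ?case
    using add_arrow_comp[OF sum_arrows_closed[OF assms(1,2)] _ assms(4), of n f] by simp
qed

text \<open>The conclusion distinguishes l < n because partial sums that end before l are still
  zero; this is the invariant of the induction.\<close>

lemma sum_arrows_delta:
  assumes "f \<in> homs C A B" "\<And>j. j < n \<Longrightarrow> g j = (if j = l then f else zero_arrow C A B)"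
  shows "sum_arrows A B g n = (if l < n then f else zero_arrow C A B)"
  using assms(2)
proof (induction n)
  case (Suc n)
  have "A \<in> Obj C" "B \<in> Obj C" using assms(1) homs_Obj by auto
  then show ?case
    using Suc add_arrow_zero[OF assms(1)] add_arrow_zero[OF zero_arrow_closed]
    by (auto simp: less_Suc_eq)
qed simp

text \<open>Both sides have the same composite with every injection, since the sum collapses to its
  l-th term after i l. Through this decomposition \<open>mackey_generated\<close> reduces elements
  at a direct sum to elements at the summands.\<close>

lemma direct_sum_Ident:
  assumes "is_direct_sum C n A S p i"
  shows "Ident C S = sum_arrows S S (\<lambda>j. i j \<cdot> p j) n"
proof -
  have S: "S \<in> Obj C" and pi: "\<And>j. j < n \<Longrightarrow> A j \<in> Obj C \<and> p j \<in> homs C S (A j) \<and> i j \<in> homs C (A j) S"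
    and coprod: "\<And>f X. \<lbrakk>X \<in> Obj C; \<And>j. j < n \<Longrightarrow> f j \<in> homs C (A j) X\<rbrakk>
      \<Longrightarrow> \<exists>!u. u \<in> homs C S X \<and> (\<forall>j<n. u \<cdot> i j = f j)"
    and delta: "\<And>j l. \<lbrakk>j < n; l < n\<rbrakk> \<Longrightarrow> p l \<cdot> i j = (if j = l then Ident C (A j) else zero_arrow C (A j) (A l))"
    using assms by (simp_all add: is_direct_sum_def)
  have cl: "\<And>j. j < n \<Longrightarrow> i j \<cdot> p j \<in> homs C S S"
    using pi Comp_closed by blast
  have "sum_arrows S S (\<lambda>j. i j \<cdot> p j) n \<cdot> i l = i l" if l: "l < n" for l
  proof -
    have "(i j \<cdot> p j) \<cdot> i l = (if j = l then i l else zero_arrow C (A l) S)" if "j < n" for j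
      using Comp_assoc[of "i l" "A l" S "p j" "A j" "i j" S] pi[OF that] pi[OF l] delta[OF l that]
        Ident_right comp_zero_arrow by auto
    then show ?thesis
      using sum_arrows_comp[where f = "\<lambda>j. i j \<cdot> p j" and n = n, OF S S cl] pi[OF l]
        sum_arrows_delta[of "i l" "A l" S n "\<lambda>j. (i j \<cdot> p j) \<cdot> i l" l] l by auto
  qed
  moreover have "Ident C S \<cdot> i l = i l" if "l < n" for l
    using pi[OF that] Ident_left by blast
  ultimately show ?thesis
    using coprod[OF S, of i] pi Ident_closed[OF S]
      sum_arrows_closed[where f = "\<lambda>j. i j \<cdot> p j" and n = n, OF S S cl] by blast
qed

end


section \<open>Duality in monoidal categories\<close>

lemma (in category) natural_inverse:
  assumes "iso_arrow C a A B" "iso_arrow C a' A' B'" "f \<in> homs C A A'" "g \<in> homs C B B'"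
    "a' \<cdot> f = g \<cdot> a"
  shows "inv_arrow C a' \<cdot> g = f \<cdot> inv_arrow C a"
proof -
  note a = iso_arrow_inv[OF assms(1)] and a' = iso_arrow_inv[OF assms(2)]
  have "inv_arrow C a' \<cdot> g = inv_arrow C a' \<cdot> (g \<cdot> a) \<cdot> inv_arrow C a"
    using a a' assms(3,4) by (auto simp: homs_def arr_simps)
  also have "\<dots> = f \<cdot> inv_arrow C a"
    unfolding assms(5)[symmetric]
    using a a' assms(3,4) by (auto simp: homs_def arr_simps assoc_eq[OF a'(3)])
  finally show ?thesis .
qed

text \<open>Variant of \<open>comp_iso_cancel\<close> with side conditions about \<open>Arr\<close>,
  \<open>Dom\<close> and \<open>Cod\<close>, which the simplifier can discharge for long
  composites.\<close>

lemma (in category) comp_iso_cancel_arr: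
  assumes "k \<cdot> f = k \<cdot> g" "iso_arrow C k B D" "f \<in> Arr C" "g \<in> Arr C" "Cod C f = B" "Cod C g = B"
    "Dom C f = Dom C g"
  shows "f = g"
  using assms by (intro comp_iso_cancel[OF assms(2), of f "Dom C f" g]) (auto intro: homsI)

section \<open>Coherence of the unit constraints\<close>

context monoidal_category
begin

abbreviation "I \<equiv> unt C"
abbreviation "iasc A B D \<equiv> inv_arrow C (asc C A B D)"
abbreviation "ilun A \<equiv> inv_arrow C (lun C A)"
abbreviation "irun A \<equiv> inv_arrow C (run C A)"

lemma arr_tarr: "\<lbrakk>f \<in> Arr C; g \<in> Arr C\<rbrakk> \<Longrightarrow> f \<boxtimes> g \<in> Arr C"
  and Dom_tarr: "\<lbrakk>f \<in> Arr C; g \<in> Arr C\<rbrakk> \<Longrightarrow> Dom C (f \<boxtimes> g) = Dom C f \<boxdot> Dom C g"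
  and Cod_tarr: "\<lbrakk>f \<in> Arr C; g \<in> Arr C\<rbrakk> \<Longrightarrow> Cod C (f \<boxtimes> g) = Cod C f \<boxdot> Cod C g"
  using tarr_closed[of f _ _ g] by (auto simp: homs_def)

lemma tarr_interchange: "\<lbrakk>f \<in> Arr C; f' \<in> Arr C; Cod C f = Dom C f'; g \<in> Arr C; g' \<in> Arr C; Cod C g = Dom C g'\<rbrakk>
   \<Longrightarrow> (f' \<boxtimes> g') \<cdot> (f \<boxtimes> g) = (f' \<cdot> f) \<boxtimes> (g' \<cdot> g)"
  using tarr_Comp[of f _ _ f' _ g _ _ g'] by (auto simp: homs_def)

lemma arr_asc: "\<lbrakk>A \<in> Obj C; B \<in> Obj C; D \<in> Obj C\<rbrakk> \<Longrightarrow> asc C A B D \<in> Arr C"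
  and Dom_asc: "\<lbrakk>A \<in> Obj C; B \<in> Obj C; D \<in> Obj C\<rbrakk> \<Longrightarrow> Dom C (asc C A B D) = (A \<boxdot> B) \<boxdot> D"
  and Cod_asc: "\<lbrakk>A \<in> Obj C; B \<in> Obj C; D \<in> Obj C\<rbrakk> \<Longrightarrow> Cod C (asc C A B D) = A \<boxdot> B \<boxdot> D"
  and arr_iasc: "\<lbrakk>A \<in> Obj C; B \<in> Obj C; D \<in> Obj C\<rbrakk> \<Longrightarrow> iasc A B D \<in> Arr C"
  and Dom_iasc: "\<lbrakk>A \<in> Obj C; B \<in> Obj C; D \<in> Obj C\<rbrakk> \<Longrightarrow> Dom C (iasc A B D) = A \<boxdot> B \<boxdot> D"
  and Cod_iasc: "\<lbrakk>A \<in> Obj C; B \<in> Obj C; D \<in> Obj C\<rbrakk> \<Longrightarrow> Cod C (iasc A B D) = (A \<boxdot> B) \<boxdot> D"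
  and asc_iasc: "\<lbrakk>A \<in> Obj C; B \<in> Obj C; D \<in> Obj C\<rbrakk> \<Longrightarrow> asc C A B D \<cdot> iasc A B D = Ident C (A \<boxdot> B \<boxdot> D)"
  and iasc_asc: "\<lbrakk>A \<in> Obj C; B \<in> Obj C; D \<in> Obj C\<rbrakk> \<Longrightarrow> iasc A B D \<cdot> asc C A B D = Ident C ((A \<boxdot> B) \<boxdot> D)"
  using iso_arrow_inv[OF asc_iso] by (auto simp: homs_def)

lemma arr_lun: "A \<in> Obj C \<Longrightarrow> lun C A \<in> Arr C"
  and Dom_lun: "A \<in> Obj C \<Longrightarrow> Dom C (lun C A) = I \<boxdot> A"
  and Cod_lun: "A \<in> Obj C \<Longrightarrow> Cod C (lun C A) = A"
  and arr_ilun: "A \<in> Obj C \<Longrightarrow> ilun A \<in> Arr C"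
  and Dom_ilun: "A \<in> Obj C \<Longrightarrow> Dom C (ilun A) = A"
  and Cod_ilun: "A \<in> Obj C \<Longrightarrow> Cod C (ilun A) = I \<boxdot> A"
  and lun_ilun: "A \<in> Obj C \<Longrightarrow> lun C A \<cdot> ilun A = Ident C A"
  using iso_arrow_inv[OF lun_iso] by (auto simp: homs_def)

lemma arr_run: "A \<in> Obj C \<Longrightarrow> run C A \<in> Arr C"
  and Dom_run: "A \<in> Obj C \<Longrightarrow> Dom C (run C A) = A \<boxdot> I"
  and Cod_run: "A \<in> Obj C \<Longrightarrow> Cod C (run C A) = A"
  and arr_irun: "A \<in> Obj C \<Longrightarrow> irun A \<in> Arr C"
  and Dom_irun: "A \<in> Obj C \<Longrightarrow> Dom C (irun A) = A"
  and Cod_irun: "A \<in> Obj C \<Longrightarrow> Cod C (irun A) = A \<boxdot> I"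
  and run_irun: "A \<in> Obj C \<Longrightarrow> run C A \<cdot> irun A = Ident C A"
  and irun_run: "A \<in> Obj C \<Longrightarrow> irun A \<cdot> run C A = Ident C (A \<boxdot> I)"
  using iso_arrow_inv[OF run_iso] by (auto simp: homs_def)

lemmas monoidal_simps = arr_simps tobj_closed unt_closed arr_tarr Dom_tarr Cod_tarr
  arr_asc Dom_asc Cod_asc arr_iasc Dom_iasc Cod_iasc arr_lun Dom_lun Cod_lun arr_ilun Dom_ilun Cod_ilun
  arr_run Dom_run Cod_run arr_irun Dom_irun Cod_irun

text \<open>Naturality of the unitor identifies I \<boxdot> - with the identity functor, so nothing
  is lost by tensoring with I. Coherence laws are proved below by comparing arrows after such a
  tensoring.\<close>

lemma unt_tensor_faithful:
  assumes "f \<in> homs C A B" "g \<in> homs C A B" "Ident C I \<boxtimes> f = Ident C I \<boxtimes> g"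
  shows "f = g"
  by (rule iso_comp_cancel[OF lun_iso assms(1,2)])
    (use assms homs_Obj[OF assms(1)] lun_natural[OF assms(1)] lun_natural[OF assms(2)] in auto)

lemma tensor_unt_faithful:
  assumes "f \<in> homs C A B" "g \<in> homs C A B" "f \<boxtimes> Ident C I = g \<boxtimes> Ident C I"
  shows "f = g"
  by (rule iso_comp_cancel[OF run_iso assms(1,2)])
    (use assms homs_Obj[OF assms(1)] run_natural[OF assms(1)] run_natural[OF assms(2)] in auto)

lemma iso_tarr:
  assumes "iso_arrow C f A B" "iso_arrow C g A' B'"
  shows "iso_arrow C (f \<boxtimes> g) (A \<boxdot> A') (B \<boxdot> B')" "inv_arrow C (f \<boxtimes> g) = inv_arrow C f \<boxtimes> inv_arrow C g"
proof -
  note f = iso_arrow_inv[OF assms(1)] and g = iso_arrow_inv[OF assms(2)]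
  have o: "A \<in> Obj C" "A' \<in> Obj C" "B \<in> Obj C" "B' \<in> Obj C"
    using homs_Obj f(1) g(1) by auto
  have 1: "(inv_arrow C f \<boxtimes> inv_arrow C g) \<cdot> (f \<boxtimes> g) = Ident C (A \<boxdot> A')"
    "(f \<boxtimes> g) \<cdot> (inv_arrow C f \<boxtimes> inv_arrow C g) = Ident C (B \<boxdot> B')"
    using tarr_Comp[OF f(1,2) g(1,2)] tarr_Comp[OF f(2,1) g(2,1)] f g o tarr_Ident by simp_all
  note i = tarr_closed[OF f(1) g(1)] tarr_closed[OF f(2) g(2)] 1
  show "iso_arrow C (f \<boxtimes> g) (A \<boxdot> A') (B \<boxdot> B')"
    by (rule iso_arrowI[OF i])
  show "inv_arrow C (f \<boxtimes> g) = inv_arrow C f \<boxtimes> inv_arrow C g"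
    by (rule inv_arrow_eq[OF inverse_arrowsI[OF i]])
qed

lemma iso_Ident: "A \<in> Obj C \<Longrightarrow> iso_arrow C (Ident C A) A A"
  and inv_arrow_Ident: "A \<in> Obj C \<Longrightarrow> inv_arrow C (Ident C A) = Ident C A"
  using Ident_closed[of A] iso_arrowI[of "Ident C A" A A "Ident C A"]
    inv_arrow_eq[OF inverse_arrowsI, of "Ident C A" A A "Ident C A"] Ident_left by auto

lemma iasc_natural:
  assumes "f \<in> homs C A A'" "g \<in> homs C B B'" "h \<in> homs C D D'"
  shows "iasc A' B' D' \<cdot> (f \<boxtimes> (g \<boxtimes> h)) = ((f \<boxtimes> g) \<boxtimes> h) \<cdot> iasc A B D"
  using assms homs_Obj[OF assms(1)] homs_Obj[OF assms(2)] homs_Obj[OF assms(3)]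
  by (intro natural_inverse[OF asc_iso asc_iso _ _ asc_natural[OF assms]])
    (simp_all add: tarr_closed)

lemma irun_natural:
  assumes "f \<in> homs C A B"
  shows "irun B \<cdot> f = (f \<boxtimes> Ident C I) \<cdot> irun A"
  using assms homs_Obj[OF assms]
  by (intro natural_inverse[OF run_iso run_iso _ _ run_natural[OF assms]])
    (simp_all add: tarr_closed Ident_closed unt_closed)

text \<open>Kelly's argument: it suffices to compare the two sides after tensoring with the unit, where
  the pentagon and the triangle identities apply.\<close>

lemma lun_tensor:
  assumes A: "A \<in> Obj C" and B: "B \<in> Obj C"
  shows "lun C (A \<boxdot> B) \<cdot> asc C I A B = lun C A \<boxtimes> Ident C B"
proof (rule unt_tensor_faithful)
  note o = A B unt_closed tobj_closed
  have 1: "lun C (A \<boxdot> B) \<cdot> asc C I A B \<in> homs C ((I \<boxdot> A) \<boxdot> B) (A \<boxdot> B)"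
    and 2: "lun C A \<boxtimes> Ident C B \<in> homs C ((I \<boxdot> A) \<boxdot> B) (A \<boxdot> B)"
    using o by (auto intro!: homsI simp: monoidal_simps)
  then show "lun C (A \<boxdot> B) \<cdot> asc C I A B \<in> homs C ((I \<boxdot> A) \<boxdot> B) (A \<boxdot> B)"
    and "lun C A \<boxtimes> Ident C B \<in> homs C ((I \<boxdot> A) \<boxdot> B) (A \<boxdot> B)" .
  \<comment> \<open>Precomposition with this invertible arrow makes the pentagon and the triangle
    applicable; both sides then turn into the same arrow.\<close>
  let ?k = "asc C I (I \<boxdot> A) B \<cdot> (asc C I I A \<boxtimes> Ident C B)"
  have "iso_arrow C (asc C I I A \<boxtimes> Ident C B) (((I \<boxdot> I) \<boxdot> A) \<boxdot> B) ((I \<boxdot> I \<boxdot> A) \<boxdot> B)"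
    using o by (intro iso_tarr asc_iso iso_Ident)
  note k2 = iso_arrow_inv[OF this] this
  have asc': "asc C I (I \<boxdot> A) B \<in> homs C ((I \<boxdot> I \<boxdot> A) \<boxdot> B) (I \<boxdot> (I \<boxdot> A) \<boxdot> B)"
    using o by (auto intro!: homsI simp: monoidal_simps)
  have l: "(Ident C I \<boxtimes> (lun C (A \<boxdot> B) \<cdot> asc C I A B)) \<cdot> ?k
      = asc C I A B \<cdot> ((run C I \<boxtimes> Ident C A) \<boxtimes> Ident C B)"
  proof -
    have "(Ident C I \<boxtimes> (lun C (A \<boxdot> B) \<cdot> asc C I A B)) \<cdot> ?k
      = (Ident C I \<boxtimes> lun C (A \<boxdot> B)) \<cdot> (Ident C I \<boxtimes> asc C I A B) \<cdot> ?k"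
      using o by (subst assoc[symmetric]) (auto simp: monoidal_simps tarr_interchange)
    also have "\<dots> = (Ident C I \<boxtimes> lun C (A \<boxdot> B)) \<cdot> asc C I I (A \<boxdot> B) \<cdot> asc C (I \<boxdot> I) A B"
      using o pentagon[of I I A B] by simp
    also have "\<dots> = (run C I \<boxtimes> (Ident C A \<boxtimes> Ident C B)) \<cdot> asc C (I \<boxdot> I) A B"
      using o triangle[of I "A \<boxdot> B"]
      by (subst assoc[symmetric]) (auto simp: monoidal_simps tarr_Ident)
    also have "\<dots> = asc C I A B \<cdot> ((run C I \<boxtimes> Ident C A) \<boxtimes> Ident C B)"
      using o by (subst asc_natural) (auto intro: homsI simp: monoidal_simps)
    finally show ?thesis .
  qed
  have r: "(Ident C I \<boxtimes> (lun C A \<boxtimes> Ident C B)) \<cdot> ?k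
      = asc C I A B \<cdot> ((run C I \<boxtimes> Ident C A) \<boxtimes> Ident C B)"
  proof -
    have "(Ident C I \<boxtimes> (lun C A \<boxtimes> Ident C B)) \<cdot> ?k
       = ((Ident C I \<boxtimes> (lun C A \<boxtimes> Ident C B)) \<cdot> asc C I (I \<boxdot> A) B) \<cdot> (asc C I I A \<boxtimes> Ident C B)"
      using o by (subst assoc) (auto simp: monoidal_simps)
    also have "\<dots> = (asc C I A B \<cdot> ((Ident C I \<boxtimes> lun C A) \<boxtimes> Ident C B)) \<cdot> (asc C I I A \<boxtimes> Ident C B)"
      using o by (subst asc_natural) (auto intro: homsI simp: monoidal_simps)
    also have "\<dots> = asc C I A B \<cdot> (((Ident C I \<boxtimes> lun C A) \<cdot> asc C I I A) \<boxtimes> Ident C B)"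
      using o by (subst assoc) (auto simp: monoidal_simps tarr_interchange)
    finally show ?thesis using triangle o by simp
  qed
  have eq: "((Ident C I \<boxtimes> (lun C (A \<boxdot> B) \<cdot> asc C I A B)) \<cdot> asc C I (I \<boxdot> A) B) \<cdot> (asc C I I A \<boxtimes> Ident C B)
      = ((Ident C I \<boxtimes> (lun C A \<boxtimes> Ident C B)) \<cdot> asc C I (I \<boxdot> A) B) \<cdot> (asc C I I A \<boxtimes> Ident C B)"
    using l r tarr_closed[OF Ident_closed[OF unt_closed] 1] tarr_closed[OF Ident_closed[OF unt_closed] 2]
      Comp_assoc[OF k2(1) asc'] by simp
  have "(Ident C I \<boxtimes> (lun C (A \<boxdot> B) \<cdot> asc C I A B)) \<cdot> asc C I (I \<boxdot> A) B
      = (Ident C I \<boxtimes> (lun C A \<boxtimes> Ident C B)) \<cdot> asc C I (I \<boxdot> A) B"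
    by (rule iso_comp_cancel[OF k2(5) _ _ eq])
      (rule Comp_closed[OF asc' tarr_closed[OF Ident_closed[OF unt_closed] 1]]
        Comp_closed[OF asc' tarr_closed[OF Ident_closed[OF unt_closed] 2]])+
  then show "Ident C I \<boxtimes> (lun C (A \<boxdot> B) \<cdot> asc C I A B) = Ident C I \<boxtimes> (lun C A \<boxtimes> Ident C B)"
    by (rule iso_comp_cancel[OF asc_iso, rotated -1])
      (use o tarr_closed[OF Ident_closed[OF unt_closed] 1] tarr_closed[OF Ident_closed[OF unt_closed] 2] in simp_all)
qed

text \<open>Naturality of \<open>lun\<close> at \<open>lun C I\<close>, with \<open>lun C I\<close>
  cancelled, gives lun (I \<boxdot> I) = 1 \<boxtimes> lun I. By \<open>lun_tensor\<close> and the
  triangle, the two arrows then agree after tensoring with I on the right.\<close>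

lemma lun_unt: "lun C I = run C I"
proof -
  have l: "lun C I \<in> homs C (I \<boxdot> I) I" and r: "run C I \<in> homs C (I \<boxdot> I) I"
    using iso_arrow_inv(1)[OF lun_iso] iso_arrow_inv(1)[OF run_iso] unt_closed by auto
  have 1: "lun C (I \<boxdot> I) \<in> homs C (I \<boxdot> I \<boxdot> I) (I \<boxdot> I)"
    using iso_arrow_inv(1)[OF lun_iso] unt_closed tobj_closed by auto
  have 2: "Ident C I \<boxtimes> lun C I \<in> homs C (I \<boxdot> I \<boxdot> I) (I \<boxdot> I)"
    by (rule tarr_closed[OF Ident_closed[OF unt_closed] l])
  have "lun C (I \<boxdot> I) = Ident C I \<boxtimes> lun C I"
    by (rule comp_iso_cancel[OF lun_iso[OF unt_closed] 1 2 lun_natural[OF l, symmetric]])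
  then have "lun C I \<boxtimes> Ident C I = run C I \<boxtimes> Ident C I"
    unfolding lun_tensor[OF unt_closed unt_closed, symmetric] triangle[OF unt_closed unt_closed, symmetric]
    by (rule arg_cong)
  then show ?thesis by (rule tensor_unt_faithful[OF l r])
qed

end

text \<open>The tensor product in the opposite order exchanges left and right, so the associator is
  replaced by its inverse. Mirrored laws then follow from the original ones instead of from a second
  computation.\<close>

definition reverse_monoidal :: "('o, 'a, 'z) monoidal_scheme \<Rightarrow> ('o, 'a) monoidal" where
  "reverse_monoidal C =
     \<lparr>Obj = Obj C, Arr = Arr C, Dom = Dom C, Cod = Cod C, Ident = Ident C, Comp = Comp C,
      tobj = (\<lambda>A B. tobj C B A), tarr = (\<lambda>f g. tarr C g f), unt = unt C,
      asc = (\<lambda>A B D. inv_arrow C (asc C D B A)), lun = run C, run = lun C\<rparr>"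

lemma reverse_monoidal_simps [simp]:
  "Obj (reverse_monoidal C) = Obj C" "Arr (reverse_monoidal C) = Arr C"
  "Dom (reverse_monoidal C) = Dom C" "Cod (reverse_monoidal C) = Cod C"
  "Ident (reverse_monoidal C) = Ident C" "Comp (reverse_monoidal C) = Comp C"
  "tobj (reverse_monoidal C) A B = tobj C B A" "tarr (reverse_monoidal C) f g = tarr C g f"
  "unt (reverse_monoidal C) = unt C" "asc (reverse_monoidal C) A B D = inv_arrow C (asc C D B A)"
  "lun (reverse_monoidal C) = run C" "run (reverse_monoidal C) = lun C"
  by (simp_all add: reverse_monoidal_def)

lemma reverse_monoidal_homs [simp]: "homs (reverse_monoidal C) = homs C"
  by (simp add: homs_def fun_eq_iff)

lemma reverse_monoidal_inv [simp]:
  "inverse_arrows (reverse_monoidal C) = inverse_arrows C"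
  "inv_arrow (reverse_monoidal C) = inv_arrow C"
  "iso_arrow (reverse_monoidal C) = iso_arrow C"
  by (simp_all add: inverse_arrows_def inv_arrow_def iso_arrow_def fun_eq_iff)

context monoidal_category
begin

text \<open>The pentagon of the reversed structure is the inverse of the original pentagon, and its
  triangle is the original triangle composed with an inverse associator. The remaining axioms are
  mirrored one by one.\<close>

lemma monoidal_category_reverse: "monoidal_category (reverse_monoidal C)"
proof unfold_locales
  fix A B D E
  assume "A \<in> Obj (reverse_monoidal C)" "B \<in> Obj (reverse_monoidal C)"
    "D \<in> Obj (reverse_monoidal C)" "E \<in> Obj (reverse_monoidal C)"
  then have o: "A \<in> Obj C" "B \<in> Obj C" "D \<in> Obj C" "E \<in> Obj C" by auto
  have i1: "iso_arrow C (asc C E (D \<boxdot> B) A) ((E \<boxdot> D \<boxdot> B) \<boxdot> A) (E \<boxdot> (D \<boxdot> B) \<boxdot> A)"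
    and i2: "iso_arrow C (asc C E D B \<boxtimes> Ident C A) (((E \<boxdot> D) \<boxdot> B) \<boxdot> A) ((E \<boxdot> D \<boxdot> B) \<boxdot> A)"
    and i3: "iso_arrow C (Ident C E \<boxtimes> asc C D B A) (E \<boxdot> (D \<boxdot> B) \<boxdot> A) (E \<boxdot> D \<boxdot> B \<boxdot> A)"
    and i4: "iso_arrow C (asc C (E \<boxdot> D) B A) (((E \<boxdot> D) \<boxdot> B) \<boxdot> A) ((E \<boxdot> D) \<boxdot> B \<boxdot> A)"
    and i5: "iso_arrow C (asc C E D (B \<boxdot> A)) ((E \<boxdot> D) \<boxdot> B \<boxdot> A) (E \<boxdot> D \<boxdot> B \<boxdot> A)"
    using o by (auto intro!: asc_iso iso_tarr iso_Ident tobj_closed)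
  \<comment> \<open>Inverting the pentagon reverses the order of the factors, which is exactly the
    order required after the reversal of the tensor product.\<close>
  have inv_comp: "inv_arrow C (g \<cdot> f) = inv_arrow C f \<cdot> inv_arrow C g \<and> iso_arrow C (g \<cdot> f) X Z"
    if "iso_arrow C f X Y" "iso_arrow C g Y Z" for f g X Y Z
  proof -
    note f = iso_arrow_inv[OF that(1)] and g = iso_arrow_inv[OF that(2)]
    have *: "(inv_arrow C f \<cdot> inv_arrow C g) \<cdot> (g \<cdot> f) = Ident C X"
      "(g \<cdot> f) \<cdot> (inv_arrow C f \<cdot> inv_arrow C g) = Ident C Z"
      using f g by (auto simp: homs_def monoidal_simps assoc_eq[OF f(4)] assoc_eq[OF g(3)])
    show ?thesis
      using inv_arrow_eq[OF inverse_arrowsI[OF Comp_closed[OF f(1) g(1)] Comp_closed[OF g(2) f(2)] *]]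
        iso_arrowI[OF Comp_closed[OF f(1) g(1)] Comp_closed[OF g(2) f(2)] *] by simp
  qed
  note v = inv_comp[OF i4 i5] inv_comp[OF i1 i3] inv_comp[OF i2 conjunct2[OF inv_comp[OF i1 i3]]]
  have "inv_arrow C (asc C (E \<boxdot> D) B A) \<cdot> inv_arrow C (asc C E D (B \<boxdot> A))
      = inv_arrow C (asc C E (D \<boxdot> B) A \<cdot> (asc C E D B \<boxtimes> Ident C A)) \<cdot> inv_arrow C (Ident C E \<boxtimes> asc C D B A)"
    using v pentagon[of E D B A] o inv_comp[OF i2 i1] inv_comp[OF conjunct2[OF inv_comp[OF i2 i1]] i3] by simp
  then have "iasc (E \<boxdot> D) B A \<cdot> iasc E D (B \<boxdot> A)
    = (iasc E D B \<boxtimes> Ident C A) \<cdot> iasc E (D \<boxdot> B) A \<cdot> (Ident C E \<boxtimes> iasc D B A)"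
    using v pentagon[of E D B A] o inv_comp[OF i2 i1]
    by (auto simp: iso_tarr(2)[OF asc_iso iso_Ident] iso_tarr(2)[OF iso_Ident asc_iso] inv_arrow_Ident monoidal_simps)
  then show "asc (reverse_monoidal C) A B (D \<boxdot>\<^bsub>reverse_monoidal C\<^esub> E) \<cdot>\<^bsub>reverse_monoidal C\<^esub>
      asc (reverse_monoidal C) (A \<boxdot>\<^bsub>reverse_monoidal C\<^esub> B) D E
    = (Ident (reverse_monoidal C) A \<boxtimes>\<^bsub>reverse_monoidal C\<^esub> asc (reverse_monoidal C) B D E) \<cdot>\<^bsub>reverse_monoidal C\<^esub>
      asc (reverse_monoidal C) A (B \<boxdot>\<^bsub>reverse_monoidal C\<^esub> D) E \<cdot>\<^bsub>reverse_monoidal C\<^esub>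
      (asc (reverse_monoidal C) A B D \<boxtimes>\<^bsub>reverse_monoidal C\<^esub> Ident (reverse_monoidal C) E)"
    by simp
next
  fix A B
  assume "A \<in> Obj (reverse_monoidal C)" "B \<in> Obj (reverse_monoidal C)"
  then have o: "A \<in> Obj C" "B \<in> Obj C" by auto
  have "(run C B \<boxtimes> Ident C A) \<cdot> iasc B I A = ((Ident C B \<boxtimes> lun C A) \<cdot> asc C B I A) \<cdot> iasc B I A"
    using triangle o by simp
  also have "\<dots> = Ident C B \<boxtimes> lun C A"
    using o by (simp add: monoidal_simps asc_iasc)
  finally show "(Ident (reverse_monoidal C) A \<boxtimes>\<^bsub>reverse_monoidal C\<^esub> lun (reverse_monoidal C) B) \<cdot>\<^bsub>reverse_monoidal C\<^esub>
      asc (reverse_monoidal C) A (unt (reverse_monoidal C)) B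
    = run (reverse_monoidal C) A \<boxtimes>\<^bsub>reverse_monoidal C\<^esub> Ident (reverse_monoidal C) B"
    by simp
qed (use Ident_closed Comp_closed Ident_left Ident_right Comp_assoc Dom_closed Cod_closed tobj_closed unt_closed
    tarr_closed tarr_Ident tarr_Comp iso_arrow_inv_arrow(1)[OF asc_iso] iasc_natural lun_iso run_iso
    lun_natural run_natural in simp_all)

lemma run_tensor:
  assumes "A \<in> Obj C" "B \<in> Obj C"
  shows "run C (A \<boxdot> B) \<cdot> iasc A B I = Ident C A \<boxtimes> run C B"
proof -
  interpret R: monoidal_category "reverse_monoidal C" by (rule monoidal_category_reverse)
  show ?thesis using R.lun_tensor[of B A] assms by simp
qed

section \<open>Dual objects and transposition\<close>

definition dual_pair :: "'o \<Rightarrow> 'o \<Rightarrow> 'a \<Rightarrow> 'a \<Rightarrow> bool" where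
  "dual_pair A A' \<eta> \<epsilon> \<longleftrightarrow> A \<in> Obj C \<and> A' \<in> Obj C \<and> \<eta> \<in> homs C I (A' \<boxdot> A) \<and> \<epsilon> \<in> homs C (A \<boxdot> A') I \<and>
     lun C A \<cdot> (\<epsilon> \<boxtimes> Ident C A) \<cdot> iasc A A' A \<cdot> (Ident C A \<boxtimes> \<eta>) \<cdot> irun A = Ident C A \<and>
     run C A' \<cdot> (Ident C A' \<boxtimes> \<epsilon>) \<cdot> asc C A' A A' \<cdot> (\<eta> \<boxtimes> Ident C A') \<cdot> ilun A' = Ident C A'"

text \<open>The inverse \<open>?t\<close> is the transpose built from \<eta>. One round trip needs
  naturality and the first triangle identity. The other needs the second triangle identity, which
  first has to be freed from the associators and unitors around it; \<open>lun_tensor\<close>,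
  \<open>run_tensor\<close> and \<open>lun_unt\<close> serve this purpose.\<close>

lemma dual_pair_transpose:
  assumes d: "dual_pair A A' \<eta> \<epsilon>" and Z: "Z \<in> Obj C"
  shows "bij_betw (\<lambda>g. \<epsilon> \<cdot> (g \<boxtimes> Ident C A')) (homs C Z A) (homs C (Z \<boxdot> A') I)"
proof (rule bij_betwI)
  let ?t = "\<lambda>h. lun C A \<cdot> (h \<boxtimes> Ident C A) \<cdot> iasc Z A' A \<cdot> (Ident C Z \<boxtimes> \<eta>) \<cdot> irun Z"
  have o: "A \<in> Obj C" "A' \<in> Obj C" "Z \<in> Obj C" "I \<in> Obj C" and \<eta>: "\<eta> \<in> homs C I (A' \<boxdot> A)" and \<epsilon>: "\<epsilon> \<in> homs C (A \<boxdot> A') I"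
    and T1: "lun C A \<cdot> (\<epsilon> \<boxtimes> Ident C A) \<cdot> iasc A A' A \<cdot> (Ident C A \<boxtimes> \<eta>) \<cdot> irun A = Ident C A"
    and T2: "run C A' \<cdot> (Ident C A' \<boxtimes> \<epsilon>) \<cdot> asc C A' A A' \<cdot> (\<eta> \<boxtimes> Ident C A') \<cdot> ilun A' = Ident C A'"
    using d Z unt_closed by (auto simp: dual_pair_def)
  have a: "\<eta> \<in> Arr C" "Dom C \<eta> = I" "Cod C \<eta> = A' \<boxdot> A" "\<epsilon> \<in> Arr C" "Dom C \<epsilon> = A \<boxdot> A'" "Cod C \<epsilon> = I"
    using \<eta> \<epsilon> by (auto simp: homs_def)
  note S = monoidal_simps o a
  show "(\<lambda>g. \<epsilon> \<cdot> (g \<boxtimes> Ident C A')) \<in> homs C Z A \<rightarrow> homs C (Z \<boxdot> A') I"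
    by (auto simp: homs_def S)
  show "?t \<in> homs C (Z \<boxdot> A') I \<rightarrow> homs C Z A"
    by (auto simp: homs_def S)
  show "?t (\<epsilon> \<cdot> (g \<boxtimes> Ident C A')) = g" if g: "g \<in> homs C Z A" for g
  proof -
    have ga: "g \<in> Arr C" "Dom C g = Z" "Cod C g = A" using g by (auto simp: homs_def)
    note S = S ga
    have 1: "(\<epsilon> \<cdot> (g \<boxtimes> Ident C A')) \<boxtimes> Ident C A = (\<epsilon> \<boxtimes> Ident C A) \<cdot> ((g \<boxtimes> Ident C A') \<boxtimes> Ident C A)"
      by (simp add: S tarr_interchange)
    have 2: "((g \<boxtimes> Ident C A') \<boxtimes> Ident C A) \<cdot> iasc Z A' A = iasc A A' A \<cdot> (g \<boxtimes> Ident C (A' \<boxdot> A))"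
      using iasc_natural[OF g Ident_closed Ident_closed, of A' A] o tarr_Ident by simp
    have 3: "(g \<boxtimes> Ident C (A' \<boxdot> A)) \<cdot> (Ident C Z \<boxtimes> \<eta>) = (Ident C A \<boxtimes> \<eta>) \<cdot> (g \<boxtimes> Ident C I)"
      by (simp add: S tarr_interchange)
    have 4: "(g \<boxtimes> Ident C I) \<cdot> irun Z = irun A \<cdot> g"
      using irun_natural[OF g] by simp
    have "?t (\<epsilon> \<cdot> (g \<boxtimes> Ident C A'))
      = lun C A \<cdot> (\<epsilon> \<boxtimes> Ident C A) \<cdot> (((g \<boxtimes> Ident C A') \<boxtimes> Ident C A) \<cdot> iasc Z A' A) \<cdot> (Ident C Z \<boxtimes> \<eta>) \<cdot> irun Z"
      unfolding 1 by (simp add: S)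
    also have "\<dots> = lun C A \<cdot> (\<epsilon> \<boxtimes> Ident C A) \<cdot> iasc A A' A \<cdot> ((g \<boxtimes> Ident C (A' \<boxdot> A)) \<cdot> (Ident C Z \<boxtimes> \<eta>)) \<cdot> irun Z"
      unfolding 2 by (simp add: S)
    also have "\<dots> = lun C A \<cdot> (\<epsilon> \<boxtimes> Ident C A) \<cdot> iasc A A' A \<cdot> (Ident C A \<boxtimes> \<eta>) \<cdot> ((g \<boxtimes> Ident C I) \<cdot> irun Z)"
      unfolding 3 by (simp add: S)
    also have "\<dots> = (lun C A \<cdot> (\<epsilon> \<boxtimes> Ident C A) \<cdot> iasc A A' A \<cdot> (Ident C A \<boxtimes> \<eta>) \<cdot> irun A) \<cdot> g"
      unfolding 4 by (simp add: S)
    also have "\<dots> = g" unfolding T1 by (simp add: S)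
    finally show ?thesis .
  qed
  show "\<epsilon> \<cdot> (?t h \<boxtimes> Ident C A') = h" if h: "h \<in> homs C (Z \<boxdot> A') I" for h
  proof -
    have ha: "h \<in> Arr C" "Dom C h = Z \<boxdot> A'" "Cod C h = I" using h by (auto simp: homs_def)
    note S = S ha
    let ?A = "Ident C A" and ?A' = "Ident C A'" and ?Z = "Ident C Z"
    \<comment> \<open>The triangle identity, solved for the inverse unitors.\<close>
    have 1: "irun Z \<boxtimes> ?A' = iasc Z I A' \<cdot> (?Z \<boxtimes> ilun A')"
    proof -
      have i: "iso_arrow C (asc C Z I A') ((Z \<boxdot> I) \<boxdot> A') (Z \<boxdot> I \<boxdot> A')"
        "iso_arrow C (?Z \<boxtimes> lun C A') (Z \<boxdot> I \<boxdot> A') (Z \<boxdot> A')"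
        using o by (auto intro!: asc_iso iso_tarr iso_Ident lun_iso)
      have "(run C Z \<boxtimes> ?A') \<cdot> (irun Z \<boxtimes> ?A') = (run C Z \<boxtimes> ?A') \<cdot> (iasc Z I A' \<cdot> (?Z \<boxtimes> ilun A'))"
      proof -
        have "(run C Z \<boxtimes> ?A') \<cdot> (iasc Z I A' \<cdot> (?Z \<boxtimes> ilun A'))
          = (?Z \<boxtimes> lun C A') \<cdot> (asc C Z I A' \<cdot> (iasc Z I A' \<cdot> (?Z \<boxtimes> ilun A')))"
          unfolding triangle[OF o(3,2), symmetric] by (simp add: S)
        also have "\<dots> = (?Z \<boxtimes> lun C A') \<cdot> (?Z \<boxtimes> ilun A')"
          by (simp add: S assoc_eq[OF asc_iasc])
        also have "\<dots> = (run C Z \<boxtimes> ?A') \<cdot> (irun Z \<boxtimes> ?A')"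
          by (simp add: S tarr_interchange lun_ilun run_irun)
        finally show ?thesis by simp
      qed
      then show ?thesis
        by (rule comp_iso_cancel_arr[OF _ iso_tarr(1)[OF run_iso iso_Ident]]) (simp_all add: S)
    qed
    have 2: "((?Z \<boxtimes> \<eta>) \<boxtimes> ?A') \<cdot> iasc Z I A' = iasc Z (A' \<boxdot> A) A' \<cdot> (?Z \<boxtimes> (\<eta> \<boxtimes> ?A'))"
      using iasc_natural[OF Ident_closed \<eta> Ident_closed, of Z A'] o by simp
    \<comment> \<open>The pentagon of the reversed category, with one associator moved to the other
      side.\<close>
    have 3: "(iasc Z A' A \<boxtimes> ?A') \<cdot> iasc Z (A' \<boxdot> A) A' = iasc (Z \<boxdot> A') A A' \<cdot> (iasc Z A' (A \<boxdot> A') \<cdot> (?Z \<boxtimes> asc C A' A A'))"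
    proof -
      interpret R: monoidal_category "reverse_monoidal C" by (rule monoidal_category_reverse)
      have p: "iasc (Z \<boxdot> A') A A' \<cdot> iasc Z A' (A \<boxdot> A')
        = (iasc Z A' A \<boxtimes> ?A') \<cdot> iasc Z (A' \<boxdot> A) A' \<cdot> (?Z \<boxtimes> iasc A' A A')"
        using R.pentagon[of A' A A' Z] o by simp
      have "iasc (Z \<boxdot> A') A A' \<cdot> (iasc Z A' (A \<boxdot> A') \<cdot> (?Z \<boxtimes> asc C A' A A'))
        = ((iasc Z A' A \<boxtimes> ?A') \<cdot> iasc Z (A' \<boxdot> A) A' \<cdot> (?Z \<boxtimes> iasc A' A A')) \<cdot> (?Z \<boxtimes> asc C A' A A')"
        unfolding p[symmetric] by (simp add: S)
      also have "\<dots> = (iasc Z A' A \<boxtimes> ?A') \<cdot> iasc Z (A' \<boxdot> A) A'"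
        by (simp add: S tarr_interchange iasc_asc tarr_Ident)
      finally show ?thesis by simp
    qed
    have 4: "((h \<boxtimes> ?A) \<boxtimes> ?A') \<cdot> iasc (Z \<boxdot> A') A A' = iasc I A A' \<cdot> (h \<boxtimes> Ident C (A \<boxdot> A'))"
      using iasc_natural[OF h Ident_closed Ident_closed, of A A'] o tarr_Ident by simp
    have 5: "(lun C A \<boxtimes> ?A') \<cdot> iasc I A A' = lun C (A \<boxdot> A')"
      unfolding lun_tensor[OF o(1,2), symmetric] by (simp add: S asc_iasc)
    have 6: "\<epsilon> \<cdot> lun C (A \<boxdot> A') = lun C I \<cdot> (Ident C I \<boxtimes> \<epsilon>)"
      using lun_natural[OF \<epsilon>] by simp
    have 7: "(Ident C I \<boxtimes> \<epsilon>) \<cdot> (h \<boxtimes> Ident C (A \<boxdot> A')) = (h \<boxtimes> Ident C I) \<cdot> (Ident C (Z \<boxdot> A') \<boxtimes> \<epsilon>)"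
      by (simp add: S tarr_interchange)
    have 8: "(Ident C (Z \<boxdot> A') \<boxtimes> \<epsilon>) \<cdot> iasc Z A' (A \<boxdot> A') = iasc Z A' I \<cdot> (?Z \<boxtimes> (?A' \<boxtimes> \<epsilon>))"
      using iasc_natural[OF Ident_closed Ident_closed \<epsilon>, of Z A'] o tarr_Ident by simp
    \<comment> \<open>The second triangle identity, solved for the inverse unitor of A' and tensored
      with Z.\<close>
    have 9: "(?Z \<boxtimes> (?A' \<boxtimes> \<epsilon>)) \<cdot> ((?Z \<boxtimes> asc C A' A A') \<cdot> ((?Z \<boxtimes> (\<eta> \<boxtimes> ?A')) \<cdot> (?Z \<boxtimes> ilun A'))) = ?Z \<boxtimes> irun A'"
    proof -
      have "irun A' = irun A' \<cdot> (run C A' \<cdot> (?A' \<boxtimes> \<epsilon>) \<cdot> asc C A' A A' \<cdot> (\<eta> \<boxtimes> ?A') \<cdot> ilun A')"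
        unfolding T2 by (simp add: S)
      also have "\<dots> = (?A' \<boxtimes> \<epsilon>) \<cdot> asc C A' A A' \<cdot> (\<eta> \<boxtimes> ?A') \<cdot> ilun A'"
        by (simp add: S assoc_eq[OF irun_run])
      finally show ?thesis by (simp add: S tarr_interchange)
    qed
    have 10: "iasc Z A' I \<cdot> (?Z \<boxtimes> irun A') = irun (Z \<boxdot> A')"
    proof -
      have "run C (Z \<boxdot> A') \<cdot> (iasc Z A' I \<cdot> (?Z \<boxtimes> irun A')) = (?Z \<boxtimes> run C A') \<cdot> (?Z \<boxtimes> irun A')"
        unfolding run_tensor[OF o(3,2), symmetric] by (simp add: S)
      also have "\<dots> = run C (Z \<boxdot> A') \<cdot> irun (Z \<boxdot> A')"
        by (simp add: S tarr_interchange run_irun tarr_Ident)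
      finally show ?thesis
        by (rule comp_iso_cancel_arr[OF _ run_iso]) (simp_all add: S)
    qed
    have "?t h \<boxtimes> ?A' = (lun C A \<boxtimes> ?A') \<cdot> ((h \<boxtimes> ?A) \<boxtimes> ?A') \<cdot> (iasc Z A' A \<boxtimes> ?A') \<cdot> ((?Z \<boxtimes> \<eta>) \<boxtimes> ?A') \<cdot> (irun Z \<boxtimes> ?A')"
      by (simp add: S tarr_interchange)
    also have "\<dots> = (lun C A \<boxtimes> ?A') \<cdot> ((h \<boxtimes> ?A) \<boxtimes> ?A') \<cdot> (iasc Z A' A \<boxtimes> ?A') \<cdot> (((?Z \<boxtimes> \<eta>) \<boxtimes> ?A') \<cdot> iasc Z I A') \<cdot> (?Z \<boxtimes> ilun A')"
      unfolding 1 by (simp add: S)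
    also have "\<dots> = (lun C A \<boxtimes> ?A') \<cdot> ((h \<boxtimes> ?A) \<boxtimes> ?A') \<cdot> ((iasc Z A' A \<boxtimes> ?A') \<cdot> iasc Z (A' \<boxdot> A) A') \<cdot> (?Z \<boxtimes> (\<eta> \<boxtimes> ?A')) \<cdot> (?Z \<boxtimes> ilun A')"
      unfolding 2 by (simp add: S)
    also have "\<dots> = (lun C A \<boxtimes> ?A') \<cdot> (((h \<boxtimes> ?A) \<boxtimes> ?A') \<cdot> iasc (Z \<boxdot> A') A A') \<cdot> iasc Z A' (A \<boxdot> A')
       \<cdot> (?Z \<boxtimes> asc C A' A A') \<cdot> (?Z \<boxtimes> (\<eta> \<boxtimes> ?A')) \<cdot> (?Z \<boxtimes> ilun A')"
      unfolding 3 by (simp add: S)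
    also have "\<dots> = ((lun C A \<boxtimes> ?A') \<cdot> iasc I A A') \<cdot> (h \<boxtimes> Ident C (A \<boxdot> A')) \<cdot> iasc Z A' (A \<boxdot> A')
       \<cdot> (?Z \<boxtimes> asc C A' A A') \<cdot> (?Z \<boxtimes> (\<eta> \<boxtimes> ?A')) \<cdot> (?Z \<boxtimes> ilun A')"
      unfolding 4 by (simp add: S)
    finally have "\<epsilon> \<cdot> (?t h \<boxtimes> ?A') = (\<epsilon> \<cdot> lun C (A \<boxdot> A')) \<cdot> (h \<boxtimes> Ident C (A \<boxdot> A')) \<cdot> iasc Z A' (A \<boxdot> A')
       \<cdot> (?Z \<boxtimes> asc C A' A A') \<cdot> (?Z \<boxtimes> (\<eta> \<boxtimes> ?A')) \<cdot> (?Z \<boxtimes> ilun A')"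
      unfolding 5 by (simp add: S)
    also have "\<dots> = lun C I \<cdot> ((Ident C I \<boxtimes> \<epsilon>) \<cdot> (h \<boxtimes> Ident C (A \<boxdot> A'))) \<cdot> iasc Z A' (A \<boxdot> A')
       \<cdot> (?Z \<boxtimes> asc C A' A A') \<cdot> (?Z \<boxtimes> (\<eta> \<boxtimes> ?A')) \<cdot> (?Z \<boxtimes> ilun A')"
      unfolding 6 by (simp add: S)
    also have "\<dots> = lun C I \<cdot> (h \<boxtimes> Ident C I) \<cdot> ((Ident C (Z \<boxdot> A') \<boxtimes> \<epsilon>) \<cdot> iasc Z A' (A \<boxdot> A'))
       \<cdot> (?Z \<boxtimes> asc C A' A A') \<cdot> (?Z \<boxtimes> (\<eta> \<boxtimes> ?A')) \<cdot> (?Z \<boxtimes> ilun A')"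
      unfolding 7 by (simp add: S)
    also have "\<dots> = lun C I \<cdot> (h \<boxtimes> Ident C I) \<cdot> iasc Z A' I \<cdot>
        ((?Z \<boxtimes> (?A' \<boxtimes> \<epsilon>)) \<cdot> ((?Z \<boxtimes> asc C A' A A') \<cdot> ((?Z \<boxtimes> (\<eta> \<boxtimes> ?A')) \<cdot> (?Z \<boxtimes> ilun A'))))"
      unfolding 8 by (simp add: S)
    also have "\<dots> = run C I \<cdot> (h \<boxtimes> Ident C I) \<cdot> irun (Z \<boxdot> A')"
      unfolding 9 10 lun_unt ..
    also have "\<dots> = (run C I \<cdot> (h \<boxtimes> Ident C I)) \<cdot> irun (Z \<boxdot> A')"
      by (simp add: S)
    also have "\<dots> = h"
      unfolding run_natural[OF h] by (simp add: S run_irun)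
    finally show ?thesis .
  qed
qed

text \<open>Reversing the tensor product exchanges the two triangle identities, and with them the
  roles of A and A', while \<eta> and \<epsilon> stay the same.\<close>

lemma dual_pair_reverse:
  assumes "dual_pair A A' \<eta> \<epsilon>"
  shows "monoidal_category.dual_pair (reverse_monoidal C) A' A \<eta> \<epsilon>"
proof -
  interpret R: monoidal_category "reverse_monoidal C" by (rule monoidal_category_reverse)
  show ?thesis
    using assms unfolding dual_pair_def R.dual_pair_def by (simp add: iso_arrow_inv_arrow(2)[OF asc_iso])
qed

lemma dual_pair_transpose':
  assumes "dual_pair A A' \<eta> \<epsilon>" "Z \<in> Obj C"
  shows "bij_betw (\<lambda>g. \<epsilon> \<cdot> (Ident C A \<boxtimes> g)) (homs C Z A') (homs C (A \<boxdot> Z) I)"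
proof -
  interpret R: monoidal_category "reverse_monoidal C" by (rule monoidal_category_reverse)
  show ?thesis
    using R.dual_pair_transpose[OF dual_pair_reverse[OF assms(1)], of Z] assms(2) by simp
qed

end


section \<open>Compact closed categories with finite direct sums\<close>

context symmetric_monoidal_category
begin

lemma arr_brd: "\<lbrakk>A \<in> Obj C; B \<in> Obj C\<rbrakk> \<Longrightarrow> brd C A B \<in> Arr C"
  and Dom_brd: "\<lbrakk>A \<in> Obj C; B \<in> Obj C\<rbrakk> \<Longrightarrow> Dom C (brd C A B) = A \<boxdot> B"
  and Cod_brd: "\<lbrakk>A \<in> Obj C; B \<in> Obj C\<rbrakk> \<Longrightarrow> Cod C (brd C A B) = B \<boxdot> A"
  using brd_closed[of A B] by (auto simp: homs_def)

lemmas symmetric_simps = monoidal_simps arr_brd Dom_brd Cod_brd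

text \<open>Cyclic permutation of three factors: A moves past B \<boxdot> D as a whole, then the
  brackets are shifted. Source and target are both bracketed to the right, so that rotations compose
  directly.\<close>

definition rot :: "'o \<Rightarrow> 'o \<Rightarrow> 'o \<Rightarrow> 'a" where
  "rot A B D = asc C B D A \<cdot> brd C A (B \<boxdot> D)"

lemma rot_closed: "\<lbrakk>A \<in> Obj C; B \<in> Obj C; D \<in> Obj C\<rbrakk> \<Longrightarrow> rot A B D \<in> homs C (A \<boxdot> B \<boxdot> D) (B \<boxdot> D \<boxdot> A)"
  unfolding rot_def by (rule homsI) (simp_all add: symmetric_simps)

lemma rot_natural:
  assumes "f \<in> homs C A A'" "g \<in> homs C B B'" "h \<in> homs C D D'"
  shows "rot A' B' D' \<cdot> (f \<boxtimes> (g \<boxtimes> h)) = (g \<boxtimes> (h \<boxtimes> f)) \<cdot> rot A B D"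
proof -
  have a: "f \<in> Arr C" "Dom C f = A" "Cod C f = A'" "g \<in> Arr C" "Dom C g = B" "Cod C g = B'"
    "h \<in> Arr C" "Dom C h = D" "Cod C h = D'"
    using assms by (auto simp: homs_def)
  have o: "A \<in> Obj C" "B \<in> Obj C" "D \<in> Obj C" "A' \<in> Obj C" "B' \<in> Obj C" "D' \<in> Obj C"
    using assms homs_Obj by blast+
  have "rot A' B' D' \<cdot> (f \<boxtimes> (g \<boxtimes> h)) = asc C B' D' A' \<cdot> (brd C A' (B' \<boxdot> D') \<cdot> (f \<boxtimes> (g \<boxtimes> h)))"
    by (simp add: rot_def symmetric_simps a o)
  also have "\<dots> = asc C B' D' A' \<cdot> (((g \<boxtimes> h) \<boxtimes> f) \<cdot> brd C A (B \<boxdot> D))"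
    using brd_natural[OF assms(1) tarr_closed[OF assms(2,3)]] by simp
  also have "\<dots> = (asc C B' D' A' \<cdot> ((g \<boxtimes> h) \<boxtimes> f)) \<cdot> brd C A (B \<boxdot> D)"
    by (simp add: symmetric_simps a o)
  also have "\<dots> = (g \<boxtimes> (h \<boxtimes> f)) \<cdot> rot A B D"
    unfolding asc_natural[OF assms(2,3,1)] by (simp add: rot_def symmetric_simps a o)
  finally show ?thesis .
qed

text \<open>The rotations are expanded by three hexagons, each of which replaces the crossing of one
  factor with a product of two by two simple crossings. Every simple crossing then occurs together
  with its opposite, and \<open>brd_symmetric\<close> cancels them in pairs.\<close>

lemma rot_rot_rot:
  assumes o: "A \<in> Obj C" "B \<in> Obj C" "D \<in> Obj C"
  shows "rot D A B \<cdot> (rot B D A \<cdot> rot A B D) = Ident C (A \<boxdot> B \<boxdot> D)"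
proof -
  note S = symmetric_simps o
  have n: "(brd C B D \<boxtimes> Ident C A) \<cdot> brd C A (B \<boxdot> D) = brd C A (D \<boxdot> B) \<cdot> (Ident C A \<boxtimes> brd C B D)"
    using brd_natural[OF Ident_closed brd_closed, of A B D] o by simp
  \<comment> \<open>The hexagon for A, D, B, solved for the composite that remains once the crossing
    of B and D has been moved to the right.\<close>
  have h3: "asc C D B A \<cdot> brd C A (D \<boxdot> B) = (Ident C D \<boxtimes> brd C A B) \<cdot> asc C D A B \<cdot> (brd C A D \<boxtimes> Ident C B) \<cdot> iasc A D B"
  proof -
    have "asc C D B A \<cdot> brd C A (D \<boxdot> B) = (asc C D B A \<cdot> brd C A (D \<boxdot> B) \<cdot> asc C A D B) \<cdot> iasc A D B"
      by (simp add: S asc_iasc)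
    then show ?thesis unfolding hexagon[OF o(1,3,2)] by (simp add: S)
  qed
  have "rot B D A \<cdot> rot A B D = (asc C D A B \<cdot> brd C B (D \<boxdot> A) \<cdot> asc C B D A) \<cdot> brd C A (B \<boxdot> D)"
    by (simp add: rot_def S)
  also have "\<dots> = (Ident C D \<boxtimes> brd C B A) \<cdot> asc C D B A \<cdot> ((brd C B D \<boxtimes> Ident C A) \<cdot> brd C A (B \<boxdot> D))"
    unfolding hexagon[OF o(2,3,1)] by (simp add: S)
  also have "\<dots> = (Ident C D \<boxtimes> brd C B A) \<cdot> (asc C D B A \<cdot> brd C A (D \<boxdot> B)) \<cdot> (Ident C A \<boxtimes> brd C B D)"
    unfolding n by (simp add: S)
  also have "\<dots> = ((Ident C D \<boxtimes> brd C B A) \<cdot> (Ident C D \<boxtimes> brd C A B)) \<cdot> asc C D A B \<cdot> (brd C A D \<boxtimes> Ident C B)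
      \<cdot> iasc A D B \<cdot> (Ident C A \<boxtimes> brd C B D)"
    unfolding h3 by (simp add: S)
  also have "\<dots> = asc C D A B \<cdot> (brd C A D \<boxtimes> Ident C B) \<cdot> iasc A D B \<cdot> (Ident C A \<boxtimes> brd C B D)"
    by (simp add: S tarr_interchange brd_symmetric tarr_Ident)
  finally have "rot D A B \<cdot> (rot B D A \<cdot> rot A B D)
     = (asc C A B D \<cdot> brd C D (A \<boxdot> B) \<cdot> asc C D A B) \<cdot> (brd C A D \<boxtimes> Ident C B) \<cdot> iasc A D B \<cdot> (Ident C A \<boxtimes> brd C B D)"
    by (simp add: rot_def S)
  also have "\<dots> = (Ident C A \<boxtimes> brd C D B) \<cdot> asc C A D B \<cdot> ((brd C D A \<boxtimes> Ident C B) \<cdot> (brd C A D \<boxtimes> Ident C B))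
      \<cdot> iasc A D B \<cdot> (Ident C A \<boxtimes> brd C B D)"
    unfolding hexagon[OF o(3,1,2)] by (simp add: S)
  also have "\<dots> = (Ident C A \<boxtimes> brd C D B) \<cdot> (asc C A D B \<cdot> iasc A D B) \<cdot> (Ident C A \<boxtimes> brd C B D)"
    by (simp add: S tarr_interchange brd_symmetric tarr_Ident)
  also have "\<dots> = Ident C (A \<boxdot> B \<boxdot> D)"
    unfolding asc_iasc[OF o(1,3,2)] by (simp add: S tarr_interchange brd_symmetric tarr_Ident)
  finally show ?thesis .
qed

lemma tarr_left_eq_brd:
  assumes "f \<in> homs C X B" "Y \<in> Obj C"
  shows "Ident C Y \<boxtimes> f = brd C B Y \<cdot> (f \<boxtimes> Ident C Y) \<cdot> brd C Y X"
proof -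
  have a: "f \<in> Arr C" "Dom C f = X" "Cod C f = B" and o: "X \<in> Obj C" "B \<in> Obj C"
    using assms(1) homs_Obj by (auto simp: homs_def)
  note S = symmetric_simps assms(2) a o
  have "brd C B Y \<cdot> (f \<boxtimes> Ident C Y) \<cdot> brd C Y X = (brd C B Y \<cdot> (f \<boxtimes> Ident C Y)) \<cdot> brd C Y X"
    by (simp add: S)
  also have "\<dots> = Ident C Y \<boxtimes> f"
    unfolding brd_natural[OF assms(1) Ident_closed[OF assms(2)]] by (simp add: S brd_symmetric)
  finally show ?thesis by simp
qed

text \<open>\<open>\<epsilon>\<close> exhibits \<open>A\<close> as the object representing \<open>Z \<mapsto> C(Z \<boxdot> A', I)\<close>.\<close>

definition perfect :: "'o \<Rightarrow> 'o \<Rightarrow> 'a \<Rightarrow> bool" where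
  "perfect A A' \<epsilon> \<longleftrightarrow> A \<in> Obj C \<and> A' \<in> Obj C \<and> \<epsilon> \<in> homs C (A \<boxdot> A') I \<and>
     (\<forall>Z \<in> Obj C. bij_betw (\<lambda>g. \<epsilon> \<cdot> (g \<boxtimes> Ident C A')) (homs C Z A) (homs C (Z \<boxdot> A') I))"

end

context symmetric_compact_closed_category
begin

text \<open>The second pairing is the first one read through the braiding, and its bijections are
  the transposes of the reversed dual pair. Both properties are stated for one \<epsilon>, since
  \<open>double_dual_bij\<close> has to pass from one to the other.\<close>

lemma perfect_exists:
  assumes A: "A \<in> Obj C"
  obtains A' \<epsilon> where "perfect A A' \<epsilon>" "perfect A' A (\<epsilon> \<cdot> brd C A' A)"
proof -
  obtain A' \<eta> \<epsilon> where d: "dual_pair A A' \<eta> \<epsilon>"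
    using dual_exists[OF A] A by (auto simp: dual_pair_def)
  then have o: "A' \<in> Obj C" and \<epsilon>: "\<epsilon> \<in> homs C (A \<boxdot> A') I" by (auto simp: dual_pair_def)
  then have \<epsilon>a: "\<epsilon> \<in> Arr C" "Dom C \<epsilon> = A \<boxdot> A'" "Cod C \<epsilon> = I" by (auto simp: homs_def)
  note S = symmetric_simps A o \<epsilon>a
  have "bij_betw (\<lambda>g. (\<epsilon> \<cdot> brd C A' A) \<cdot> (g \<boxtimes> Ident C A)) (homs C Z A') (homs C (Z \<boxdot> A) I)"
    if Z: "Z \<in> Obj C" for Z
  proof -
    have "bij_betw (\<lambda>k. k \<cdot> brd C Z A) (homs C (A \<boxdot> Z) I) (homs C (Z \<boxdot> A) I)"
      by (rule bij_betwI[where g = "\<lambda>k. k \<cdot> brd C A Z"])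
        (auto simp: homs_def S Z brd_symmetric)
    from bij_betw_trans[OF dual_pair_transpose'[OF d Z] this]
    have b: "bij_betw (\<lambda>g. (\<epsilon> \<cdot> (Ident C A \<boxtimes> g)) \<cdot> brd C Z A) (homs C Z A') (homs C (Z \<boxdot> A) I)"
      by (simp add: o_def)
    have "(\<epsilon> \<cdot> (Ident C A \<boxtimes> g)) \<cdot> brd C Z A = (\<epsilon> \<cdot> brd C A' A) \<cdot> (g \<boxtimes> Ident C A)" if g: "g \<in> homs C Z A'" for g
    proof -
      have "g \<in> Arr C" "Dom C g = Z" "Cod C g = A'" using g by (auto simp: homs_def)
      then show ?thesis using brd_natural[OF g Ident_closed[OF A]] by (simp add: S Z)
    qed
    then show ?thesis
      using b bij_betw_cong by (metis (no_types, lifting))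
  qed
  moreover have "\<epsilon> \<cdot> brd C A' A \<in> homs C (A' \<boxdot> A) I"
    by (rule homsI) (simp_all add: S)
  ultimately show ?thesis
    using that[of A' \<epsilon>] d dual_pair_transpose[OF d] by (auto simp: perfect_def dual_pair_def)
qed

end

section \<open>Addition of arrows and the tensor product\<close>

locale compact_closed_with_sums = symmetric_compact_closed_category C + semiadditive_category C
  for C :: "('o, 'a, 'z) symmetric_monoidal_scheme" (structure)
begin

text \<open>For a zero object N there is only one arrow N -> A, hence by transposition only one
  arrow N \<boxdot> A' -> I, the zero arrow. The general case factors through N.\<close>

lemma perfect_zero:
  assumes p: "perfect A A' \<epsilon>" and Z: "Z \<in> Obj C"
  shows "\<epsilon> \<cdot> (zero_arrow C Z A \<boxtimes> Ident C A') = zero_arrow C (Z \<boxdot> A') I"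
proof -
  have o: "A \<in> Obj C" "A' \<in> Obj C" and \<epsilon>: "\<epsilon> \<in> homs C (A \<boxdot> A') I"
    using p by (auto simp: perfect_def)
  obtain N g h where N: "zero_object C N" and g: "g \<in> homs C Z N" and h: "h \<in> homs C N A"
    and e: "zero_arrow C Z A = h \<cdot> g"
    by (rule zero_arrow_factor[OF Z o(1)])
  then have No: "N \<in> Obj C" by (simp add: zero_object_def)
  let ?F = "\<lambda>g. \<epsilon> \<cdot> (g \<boxtimes> Ident C A')"
  have b: "bij_betw ?F (homs C N A) (homs C (N \<boxdot> A') I)"
    using p No by (simp add: perfect_def)
  have "zero_arrow C (N \<boxdot> A') I \<in> ?F ` homs C N A"
    using b zero_arrow_closed[OF tobj_closed[OF No o(2)] unt_closed] by (simp add: bij_betw_def)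
  then obtain h' where "h' \<in> homs C N A" "zero_arrow C (N \<boxdot> A') I = ?F h'" by blast
  moreover have "h' = h" using N h calculation(1) o by (auto simp: zero_object_def)
  ultimately have z: "?F h = zero_arrow C (N \<boxdot> A') I" by simp
  have 1: "h \<boxtimes> Ident C A' \<in> homs C (N \<boxdot> A') (A \<boxdot> A')" and 2: "g \<boxtimes> Ident C A' \<in> homs C (Z \<boxdot> A') (N \<boxdot> A')"
    by (auto intro: tarr_closed h g Ident_closed o)
  have "zero_arrow C Z A \<boxtimes> Ident C A' = (h \<boxtimes> Ident C A') \<cdot> (g \<boxtimes> Ident C A')"
    unfolding e using tarr_Comp[OF g h Ident_closed Ident_closed, of A'] o Ident_left[OF Ident_closed] by simp
  then have "\<epsilon> \<cdot> (zero_arrow C Z A \<boxtimes> Ident C A') = ?F h \<cdot> (g \<boxtimes> Ident C A')"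
    using Comp_assoc[OF 2 1 \<epsilon>] by simp
  also have "\<dots> = zero_arrow C (Z \<boxdot> A') I"
    unfolding z by (rule zero_arrow_comp[OF unt_closed 2])
  finally show ?thesis .
qed

text \<open>Maps \<open>Z \<rightarrow> A\<close> correspond to maps \<open>Z \<boxdot> A' \<rightarrow> I\<close>.  Hence a map \<open>(Z \<oplus> Z) \<boxdot> A' \<rightarrow> I\<close> is determined by
  its restrictions along the two injections, which are compared here.\<close>

lemma perfect_add:
  assumes p: "perfect A A' \<epsilon>" and a: "a \<in> homs C Z A" and b: "b \<in> homs C Z A"
  shows "\<epsilon> \<cdot> (add_arrow C a b \<boxtimes> Ident C A') = add_arrow C (\<epsilon> \<cdot> (a \<boxtimes> Ident C A')) (\<epsilon> \<cdot> (b \<boxtimes> Ident C A'))"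
proof -
  have o: "A \<in> Obj C" "A' \<in> Obj C" "Z \<in> Obj C" and \<epsilon>: "\<epsilon> \<in> homs C (A \<boxdot> A') I"
    using p homs_Obj[OF a] by (auto simp: perfect_def)
  obtain S p' i where S: "is_direct_sum C 2 (\<lambda>_. Z) S p' i"
    using o binary_sum_exists by metis
  note S = S is_direct_sum_2D[OF S]
  let ?F = "\<lambda>g. \<epsilon> \<cdot> (g \<boxtimes> Ident C A')"
  have Fc: "?F g \<in> homs C (X \<boxdot> A') I" if "g \<in> homs C X A" for g X
    by (rule Comp_closed[OF tarr_closed[OF that Ident_closed[OF o(2)]] \<epsilon>])
  have t: "k \<boxtimes> Ident C A' \<in> homs C (Y \<boxdot> A') (X \<boxdot> A')" if "k \<in> homs C Y X" for k X Y
    using that o by (intro tarr_closed Ident_closed)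
  have Fcomp: "?F (g \<cdot> k) = ?F g \<cdot> (k \<boxtimes> Ident C A')" if "g \<in> homs C X A" "k \<in> homs C Y X" for g k X Y
    using tarr_Comp[OF that(2,1) Ident_closed[OF o(2)] Ident_closed[OF o(2)]] Ident_left[OF Ident_closed[OF o(2)]]
      Comp_assoc[OF t[OF that(2)] t[OF that(1)] \<epsilon>] by simp
  have inj: "g = g'" if "g \<in> homs C X A" "g' \<in> homs C X A" "?F g = ?F g'" for g g' X
  proof -
    have "inj_on ?F (homs C X A)"
      using p homs_Obj[OF that(1)] by (auto simp: perfect_def bij_betw_def)
    then show ?thesis using that by (auto dest: inj_onD)
  qed
  have surj: "\<exists>g \<in> homs C X A. k = ?F g" if "k \<in> homs C (X \<boxdot> A') I" "X \<in> Obj C" for k X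
  proof -
    have "?F ` homs C X A = homs C (X \<boxdot> A') I"
      using p that(2) by (auto simp: perfect_def bij_betw_def)
    then show ?thesis using that(1) by blast
  qed
  \<comment> \<open>The sum a + b is the restriction along the diagonal of the single arrow q = a
    \<cdot> p' 0 + b \<cdot> p' 1 on the direct sum of Z with itself, so it suffices to transpose
    q.\<close>
  obtain \<Delta> where \<Delta>: "\<Delta> \<in> homs C Z S" "p' 0 \<cdot> \<Delta> = Ident C Z" "p' 1 \<cdot> \<Delta> = Ident C Z"
    using S(8)[OF o(3) Ident_closed Ident_closed] o by blast
  let ?z = "zero_arrow C Z A"
  have az: "a \<cdot> zero_arrow C Z Z = ?z" "b \<cdot> zero_arrow C Z Z = ?z"
    by (rule comp_zero_arrow[OF o(3) a] comp_zero_arrow[OF o(3) b])+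
  have ap: "a \<cdot> p' 0 \<in> homs C S A" "b \<cdot> p' 1 \<in> homs C S A"
    by (rule Comp_closed[OF S(4) a] Comp_closed[OF S(5) b])+
  define q where "q = add_arrow C (a \<cdot> p' 0) (b \<cdot> p' 1)"
  have q: "q \<in> homs C S A" unfolding q_def using ap by (rule add_arrow_closed)
  have q\<Delta>: "q \<cdot> \<Delta> = add_arrow C a b"
    unfolding q_def add_arrow_comp[OF ap \<Delta>(1)] Comp_assoc[OF \<Delta>(1) S(4) a] Comp_assoc[OF \<Delta>(1) S(5) b]
      \<Delta>(2,3) Ident_right[OF a] Ident_right[OF b] ..
  have qi: "q \<cdot> i 0 = a" "q \<cdot> i 1 = b"
    unfolding q_def add_arrow_comp[OF ap S(6)] add_arrow_comp[OF ap S(7)]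
      Comp_assoc[OF S(6) S(4) a] Comp_assoc[OF S(6) S(5) b] Comp_assoc[OF S(7) S(4) a] Comp_assoc[OF S(7) S(5) b]
      S(10-13) az Ident_right[OF a] Ident_right[OF b] add_arrow_zero[OF a] add_arrow_zero[OF b] by simp_all
  define k where "k = add_arrow C (?F (a \<cdot> p' 0)) (?F (b \<cdot> p' 1))"
  have k: "k \<in> homs C (S \<boxdot> A') I"
    unfolding k_def by (rule add_arrow_closed[OF Fc[OF ap(1)] Fc[OF ap(2)]])
  have kcomp: "k \<cdot> (u \<boxtimes> Ident C A') = add_arrow C (?F ((a \<cdot> p' 0) \<cdot> u)) (?F ((b \<cdot> p' 1) \<cdot> u))" if "u \<in> homs C X S" for u X
    unfolding k_def using add_arrow_comp[OF Fc[OF ap(1)] Fc[OF ap(2)] t[OF that]]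
      Fcomp[OF ap(1) that] Fcomp[OF ap(2) that] by simp
  have pz: "?F ?z = zero_arrow C (Z \<boxdot> A') I" by (rule perfect_zero[OF p o(3)])
  have ki: "k \<cdot> (i 0 \<boxtimes> Ident C A') = ?F a" "k \<cdot> (i 1 \<boxtimes> Ident C A') = ?F b"
    unfolding kcomp[OF S(6)] kcomp[OF S(7)]
      Comp_assoc[OF S(6) S(4) a] Comp_assoc[OF S(6) S(5) b] Comp_assoc[OF S(7) S(4) a] Comp_assoc[OF S(7) S(5) b]
      S(10-13) az pz Ident_right[OF a] Ident_right[OF b] add_arrow_zero[OF Fc[OF a]] add_arrow_zero[OF Fc[OF b]] by simp_all
  \<comment> \<open>By surjectivity k is the transpose of some g; its restrictions along i 0 and i 1
    force g = q.\<close>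
  have "k = ?F q"
  proof -
    obtain g where g: "g \<in> homs C S A" "k = ?F g" using surj[OF k S(2)] by blast
    have "g \<cdot> i 0 = a"
      by (rule inj[OF Comp_closed[OF S(6) g(1)] a]) (use ki Fcomp[OF g(1) S(6)] g in simp)
    moreover have "g \<cdot> i 1 = b"
      by (rule inj[OF Comp_closed[OF S(7) g(1)] b]) (use ki Fcomp[OF g(1) S(7)] g in simp)
    ultimately have "g = q"
      using qi a b o by (intro is_direct_sum_2_coeqI[OF S(1) g(1) q]) simp_all
    then show ?thesis using g by simp
  qed
  then have "?F (q \<cdot> \<Delta>) = k \<cdot> (\<Delta> \<boxtimes> Ident C A')" using Fcomp[OF q \<Delta>(1)] by simp
  also have "\<dots> = add_arrow C (?F a) (?F b)"
    unfolding kcomp[OF \<Delta>(1)] Comp_assoc[OF \<Delta>(1) S(4) a] Comp_assoc[OF \<Delta>(1) S(5) b] \<Delta>(2,3)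
      Ident_right[OF a] Ident_right[OF b] ..
  finally show ?thesis unfolding q\<Delta> .
qed

text \<open>Transposing h to g : B -> Y' turns the composites into transposes of g \<cdot> f, where
  composition is additive and \<open>perfect_add\<close> applies. Additivity of \<boxtimes> under an
  arrow into I is thus a consequence of compact closedness.\<close>

lemma comp_add_tarr:
  assumes h: "h \<in> homs C (B \<boxdot> Y) I" and f: "f \<in> homs C X B" "f' \<in> homs C X B" and Y: "Y \<in> Obj C"
  shows "h \<cdot> (add_arrow C f f' \<boxtimes> Ident C Y) = add_arrow C (h \<cdot> (f \<boxtimes> Ident C Y)) (h \<cdot> (f' \<boxtimes> Ident C Y))"
proof -
  obtain Y' \<epsilon> where p: "perfect Y' Y \<epsilon>" using perfect_exists[OF Y] by metis
  have B: "B \<in> Obj C" using homs_Obj[OF f(1)] by simp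
  have \<epsilon>: "\<epsilon> \<in> homs C (Y' \<boxdot> Y) I" using p by (simp add: perfect_def)
  have "h \<in> (\<lambda>g. \<epsilon> \<cdot> (g \<boxtimes> Ident C Y)) ` homs C B Y'"
    using p B h by (auto simp: perfect_def bij_betw_def)
  then obtain g where g: "g \<in> homs C B Y'" "h = \<epsilon> \<cdot> (g \<boxtimes> Ident C Y)" by blast
  have t: "k \<boxtimes> Ident C Y \<in> homs C (X \<boxdot> Y) (Z \<boxdot> Y)" if "k \<in> homs C X Z" for k X Z
    using that Y by (intro tarr_closed Ident_closed)
  have c: "h \<cdot> (k \<boxtimes> Ident C Y) = \<epsilon> \<cdot> ((g \<cdot> k) \<boxtimes> Ident C Y)" if "k \<in> homs C X B" for k
    using tarr_Comp[OF that g(1) Ident_closed[OF Y] Ident_closed[OF Y]] Ident_left[OF Ident_closed[OF Y]]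
      Comp_assoc[OF t[OF that] t[OF g(1)] \<epsilon>] g(2) by simp
  show ?thesis
    unfolding c[OF f(1)] c[OF f(2)] c[OF add_arrow_closed[OF f]] comp_add_arrow[OF f g(1)]
    by (rule perfect_add[OF p Comp_closed[OF f(1) g(1)] Comp_closed[OF f(2) g(1)]])
qed

text \<open>The braiding reduces the right variable to the left one. This is the form needed for the
  additivity of S M and for rebuilding a morphism from a trilinear family.\<close>

lemma comp_add_tarr':
  assumes h: "h \<in> homs C (Y \<boxdot> B) I" and f: "f \<in> homs C X B" "f' \<in> homs C X B" and Y: "Y \<in> Obj C"
  shows "h \<cdot> (Ident C Y \<boxtimes> add_arrow C f f') = add_arrow C (h \<cdot> (Ident C Y \<boxtimes> f)) (h \<cdot> (Ident C Y \<boxtimes> f'))"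
proof -
  have o: "B \<in> Obj C" "X \<in> Obj C" using homs_Obj[OF f(1)] by simp_all
  have h': "h \<cdot> brd C B Y \<in> homs C (B \<boxdot> Y) I" and b: "brd C Y X \<in> homs C (Y \<boxdot> X) (X \<boxdot> Y)"
    using h o Y brd_closed Comp_closed by blast+
  have e: "h \<cdot> (Ident C Y \<boxtimes> k) = ((h \<cdot> brd C B Y) \<cdot> (k \<boxtimes> Ident C Y)) \<cdot> brd C Y X" if "k \<in> homs C X B" for k
    unfolding tarr_left_eq_brd[OF that Y] using that h o Y by (auto simp: homs_def symmetric_simps)
  have c: "(h \<cdot> brd C B Y) \<cdot> (k \<boxtimes> Ident C Y) \<in> homs C (X \<boxdot> Y) I" if "k \<in> homs C X B" for k
    by (rule Comp_closed[OF tarr_closed[OF that Ident_closed[OF Y]] h'])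
  show ?thesis
    unfolding e[OF f(1)] e[OF f(2)] e[OF add_arrow_closed[OF f]] comp_add_tarr[OF h' f Y]
    by (rule add_arrow_comp[OF c[OF f(1)] c[OF f(2)] b])
qed

end


section \<open>Linear algebra\<close>

text \<open>The axioms pass along a surjection that respects the operations. This serves both for
  quotients, where \<pi> is the coset map, and for copies, where \<pi> is a bijection onto the
  copy.\<close>

lemma image_vectorspace:
  assumes V: "vectorspace K V" and c: "carrier Q = \<pi> ` carrier V" and z: "\<zero>\<^bsub>Q\<^esub> = \<pi> \<zero>\<^bsub>V\<^esub>"
    and a: "\<And>x y. \<lbrakk>x \<in> carrier V; y \<in> carrier V\<rbrakk> \<Longrightarrow> \<pi> x \<oplus>\<^bsub>Q\<^esub> \<pi> y = \<pi> (x \<oplus>\<^bsub>V\<^esub> y)"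
    and s: "\<And>k x. \<lbrakk>k \<in> carrier K; x \<in> carrier V\<rbrakk> \<Longrightarrow> k \<odot>\<^bsub>Q\<^esub> \<pi> x = \<pi> (k \<odot>\<^bsub>V\<^esub> x)"
  shows "vectorspace K Q" "\<pi> \<in> module_hom K V Q"
proof -
  interpret vectorspace K V by (rule V)
  have neg: "\<exists>y \<in> carrier V. \<pi> (x \<oplus>\<^bsub>V\<^esub> y) = \<pi> \<zero>\<^bsub>V\<^esub>" if "x \<in> carrier V" for x
    using that by (intro bexI[of _ "\<ominus>\<^bsub>V\<^esub> x"]) (auto simp: M.r_neg)
  show "vectorspace K Q"
    by (rule vs_criteria[OF field.field_axioms])
      (auto simp: c z a s neg M.a_ac smult_assoc1 smult_l_distr smult_r_distr)
  show "\<pi> \<in> module_hom K V Q"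
    by (auto simp: module_hom_def c a s)
qed

lemma module_homI:
  assumes "\<And>x. x \<in> carrier V \<Longrightarrow> f x \<in> carrier W"
    and "\<And>x y. \<lbrakk>x \<in> carrier V; y \<in> carrier V\<rbrakk> \<Longrightarrow> f (x \<oplus>\<^bsub>V\<^esub> y) = f x \<oplus>\<^bsub>W\<^esub> f y"
    and "\<And>k x. \<lbrakk>k \<in> carrier K; x \<in> carrier V\<rbrakk> \<Longrightarrow> f (k \<odot>\<^bsub>V\<^esub> x) = k \<odot>\<^bsub>W\<^esub> f x"
  shows "f \<in> module_hom K V W"
  using assms by (auto simp: module_hom_def)

lemma module_hom_carrier: "\<lbrakk>f \<in> module_hom K V W; x \<in> carrier V\<rbrakk> \<Longrightarrow> f x \<in> carrier W"
  using module_hom_closed by blast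

lemma module_hom_zero:
  assumes "vectorspace K V" "vectorspace K W" "f \<in> module_hom K V W"
  shows "f \<zero>\<^bsub>V\<^esub> = \<zero>\<^bsub>W\<^esub>"
proof -
  interpret V: vectorspace K V by (rule assms)
  interpret W: vectorspace K W by (rule assms)
  interpret mod_hom K V W f by unfold_locales (rule assms)
  show ?thesis by simp
qed

section \<open>Spanning sets and finite dimension\<close>

definition linear_closed :: "('k, 'm) ring_scheme \<Rightarrow> ('k, 'v, 'z) module_scheme \<Rightarrow> 'v set \<Rightarrow> bool" where
  "linear_closed K V H \<longleftrightarrow> H \<subseteq> carrier V \<and> \<zero>\<^bsub>V\<^esub> \<in> H \<and> (\<forall>x\<in>H. \<forall>y\<in>H. x \<oplus>\<^bsub>V\<^esub> y \<in> H) \<and>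
     (\<forall>k\<in>carrier K. \<forall>x\<in>H. k \<odot>\<^bsub>V\<^esub> x \<in> H)"

text \<open>Spanning is phrased as an induction principle: a property that cuts out a linearly
  closed set and holds on A holds everywhere. Arguments on generators can then do without
  coefficients.\<close>

definition spans :: "('k, 'm) ring_scheme \<Rightarrow> ('k, 'v, 'z) module_scheme \<Rightarrow> 'v set \<Rightarrow> bool" where
  "spans K V A \<longleftrightarrow> A \<subseteq> carrier V \<and> (\<forall>H. linear_closed K V H \<longrightarrow> A \<subseteq> H \<longrightarrow> H = carrier V)"

lemma spansD: "\<lbrakk>spans K V A; linear_closed K V H; A \<subseteq> H\<rbrakk> \<Longrightarrow> H = carrier V"
  by (simp add: spans_def)

lemma linear_closed_span:
  assumes "vectorspace K V" "A \<subseteq> carrier V"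
  shows "linear_closed K V (LinearCombinations.module.span K V A)" "A \<subseteq> LinearCombinations.module.span K V A"
    "\<And>H. \<lbrakk>linear_closed K V H; A \<subseteq> H\<rbrakk> \<Longrightarrow> LinearCombinations.module.span K V A \<subseteq> H"
proof -
  interpret vectorspace K V by (rule assms)
  interpret s: LinearCombinations.submodule K "span A" V by (rule span_is_submodule[OF assms(2)])
  show "linear_closed K V (span A)"
    unfolding linear_closed_def using s.subset by auto
  show "A \<subseteq> span A" by (rule in_own_span[OF assms(2)])
  show "span A \<subseteq> H" if "linear_closed K V H" "A \<subseteq> H" for H
  proof (rule span_is_subset[OF that(2)])
    show "LinearCombinations.submodule K H V"
      using that(1) by unfold_locales (auto simp: linear_closed_def)
  qed
qed

lemma fin_dim_iff_spans:
  assumes "vectorspace K V"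
  shows "vectorspace.fin_dim K V \<longleftrightarrow> (\<exists>A. finite A \<and> spans K V A)"
proof -
  interpret vectorspace K V by (rule assms)
  have "span A = carrier V \<longleftrightarrow> spans K V A" if A: "A \<subseteq> carrier V" for A
  proof
    note s = linear_closed_span[OF assms A]
    show "spans K V A" if "span A = carrier V"
      using s(3) A that by (auto simp: spans_def linear_closed_def)
    show "span A = carrier V" if "spans K V A"
      by (rule spansD[OF that s(1,2)])
  qed
  then show ?thesis
    unfolding fin_dim_def by (auto simp: spans_def)
qed

text \<open>The preimage of a linearly closed set is linearly closed, so the induction principle is
  inherited by the image.\<close>

lemma spans_image:
  assumes "spans K V A" "f \<in> module_hom K V W" "carrier W = f ` carrier V" "vectorspace K V" "vectorspace K W"
  shows "spans K W (f ` A)"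
  unfolding spans_def
proof (intro conjI allI impI)
  have A: "A \<subseteq> carrier V" using assms(1) by (simp add: spans_def)
  then show "f ` A \<subseteq> carrier W" using assms(3) by blast
  fix H assume H: "linear_closed K W H" and sub: "f ` A \<subseteq> H"
  interpret V: vectorspace K V by (rule assms)
  have "linear_closed K V {x \<in> carrier V. f x \<in> H}"
    using H module_hom_zero[OF assms(4,5,2)]
    by (auto simp: linear_closed_def module_hom_add[OF assms(2)] module_hom_smult[OF assms(2)])
  then have "{x \<in> carrier V. f x \<in> H} = carrier V"
    by (rule spansD[OF assms(1)]) (use sub A in blast)
  then show "H = carrier W"
    using assms(3) H by (auto simp: linear_closed_def)
qed

lemma spans_module_hom_eq:
  assumes "spans K V A" "vectorspace K V" "vectorspace K W" "f \<in> module_hom K V W" "g \<in> module_hom K V W"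
    "\<And>x. x \<in> A \<Longrightarrow> f x = g x" "x \<in> carrier V"
  shows "f x = g x"
proof -
  interpret V: vectorspace K V by (rule assms)
  have "linear_closed K V {x \<in> carrier V. f x = g x}"
    using module_hom_zero[OF assms(2,3,4)] module_hom_zero[OF assms(2,3,5)]
    by (auto simp: linear_closed_def module_hom_add[OF assms(4)] module_hom_smult[OF assms(4)]
        module_hom_add[OF assms(5)] module_hom_smult[OF assms(5)])
  then have "{x \<in> carrier V. f x = g x} = carrier V"
    by (rule spansD[OF assms(1)]) (use assms(1,6) in \<open>auto simp: spans_def\<close>)
  then show ?thesis using assms(7) by blast
qed

subsection \<open>Spaces of functions, quotients and copies\<close>

text \<open>Common frame for free modules and for the spaces of families that make up the dual: both
  are sets of functions with pointwise operations, so one verification of the axioms serves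
  both.\<close>

definition pointwise_module :: "('k, 'm) ring_scheme \<Rightarrow> ('g \<Rightarrow> 'k) set \<Rightarrow> ('k, 'g \<Rightarrow> 'k) module" where
  "pointwise_module K H =
     \<lparr>carrier = H, mult = (\<lambda>f g. undefined), one = undefined, zero = (\<lambda>x. \<zero>\<^bsub>K\<^esub>),
      add = (\<lambda>f g x. f x \<oplus>\<^bsub>K\<^esub> g x), smult = (\<lambda>c f x. c \<otimes>\<^bsub>K\<^esub> f x)\<rparr>"

lemma pointwise_module_simps [simp]:
  "carrier (pointwise_module K H) = H" "\<zero>\<^bsub>pointwise_module K H\<^esub> = (\<lambda>x. \<zero>\<^bsub>K\<^esub>)"
  "f \<oplus>\<^bsub>pointwise_module K H\<^esub> g = (\<lambda>x. f x \<oplus>\<^bsub>K\<^esub> g x)"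
  "c \<odot>\<^bsub>pointwise_module K H\<^esub> f = (\<lambda>x. c \<otimes>\<^bsub>K\<^esub> f x)"
  by (simp_all add: pointwise_module_def)

lemma pointwise_vectorspace:
  assumes "field K" and H: "\<And>f x. f \<in> H \<Longrightarrow> f x \<in> carrier K" "(\<lambda>x. \<zero>\<^bsub>K\<^esub>) \<in> H"
    "\<And>f g. \<lbrakk>f \<in> H; g \<in> H\<rbrakk> \<Longrightarrow> (\<lambda>x. f x \<oplus>\<^bsub>K\<^esub> g x) \<in> H"
    "\<And>c f. \<lbrakk>c \<in> carrier K; f \<in> H\<rbrakk> \<Longrightarrow> (\<lambda>x. c \<otimes>\<^bsub>K\<^esub> f x) \<in> H"
  shows "vectorspace K (pointwise_module K H)"
proof -
  interpret field K by (rule assms)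
  \<comment> \<open>The negative of f is its multiple by -1, which lies in H by closure under
    scalars.\<close>
  have "\<exists>g\<in>H. (\<lambda>x. f x \<oplus>\<^bsub>K\<^esub> g x) = (\<lambda>x. \<zero>\<^bsub>K\<^esub>)" if "f \<in> H" for f
  proof (rule bexI)
    show "(\<lambda>x. (\<ominus>\<^bsub>K\<^esub> \<one>\<^bsub>K\<^esub>) \<otimes>\<^bsub>K\<^esub> f x) \<in> H" using H(4)[OF _ that, of "\<ominus>\<^bsub>K\<^esub> \<one>\<^bsub>K\<^esub>"] by simp
    show "(\<lambda>x. f x \<oplus>\<^bsub>K\<^esub> (\<ominus>\<^bsub>K\<^esub> \<one>\<^bsub>K\<^esub>) \<otimes>\<^bsub>K\<^esub> f x) = (\<lambda>x. \<zero>\<^bsub>K\<^esub>)"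
      using H(1)[OF that] by (auto simp: l_minus r_neg)
  qed
  then show ?thesis
    using H by (intro vs_criteria assms(1)) (auto simp: fun_eq_iff a_ac m_assoc l_distr r_distr)
qed

lemma free_module_eq:
  "free_module K G = pointwise_module K
     {f. (\<forall>x. f x \<in> carrier K) \<and> (\<forall>x. x \<notin> G \<longrightarrow> f x = \<zero>\<^bsub>K\<^esub>) \<and> finite {x. f x \<noteq> \<zero>\<^bsub>K\<^esub>}}"
  by (simp add: free_module_def pointwise_module_def)

lemma free_module_vectorspace:
  assumes "field K"
  shows "vectorspace K (free_module K G)"
proof -
  interpret field K by (rule assms)
  have add: "finite {x. f x \<oplus>\<^bsub>K\<^esub> g x \<noteq> \<zero>\<^bsub>K\<^esub>}"
    if "finite {x. f x \<noteq> \<zero>\<^bsub>K\<^esub>}" "finite {x. g x \<noteq> \<zero>\<^bsub>K\<^esub>}" for f g :: "_ \<Rightarrow> _"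
    by (rule finite_subset[OF _ finite_UnI[OF that]]) auto
  have smult: "finite {x. c \<otimes>\<^bsub>K\<^esub> f x \<noteq> \<zero>\<^bsub>K\<^esub>}"
    if "c \<in> carrier K" "finite {x. f x \<noteq> \<zero>\<^bsub>K\<^esub>}" for f :: "_ \<Rightarrow> _" and c
    by (rule finite_subset[OF _ that(2)]) (use that in auto)
  show ?thesis
    unfolding free_module_eq by (rule pointwise_vectorspace[OF assms]) (simp_all add: add smult)
qed

lemma unit_vector_closed:
  assumes "field K" and g: "g \<in> G"
  shows "unit_vector K g \<in> carrier (free_module K G)"
proof -
  interpret field K by (rule assms)
  have u: "unit_vector K g x = (if x = g then \<one>\<^bsub>K\<^esub> else \<zero>\<^bsub>K\<^esub>)" for x
    by (simp add: unit_vector_def)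
  have c: "unit_vector K g x \<in> carrier K" for x
    by (cases "x = g") (simp_all add: u)
  have z: "unit_vector K g x = \<zero>\<^bsub>K\<^esub>" if "x \<notin> G" for x
    using that g by (cases "x = g") (simp_all add: u)
  have f: "finite {x. unit_vector K g x \<noteq> \<zero>\<^bsub>K\<^esub>}"
    by (rule finite_subset[of _ "{g}"]) (auto simp: u)
  show ?thesis
    unfolding free_module_eq pointwise_module_simps by (intro CollectI conjI allI impI c z f)
qed

lemma free_moduleD:
  assumes "f \<in> carrier (free_module K G)"
  shows "f x \<in> carrier K" "x \<notin> G \<Longrightarrow> f x = \<zero>\<^bsub>K\<^esub>" "finite {x. f x \<noteq> \<zero>\<^bsub>K\<^esub>}"
  using assms unfolding free_module_eq pointwise_module_simps mem_Collect_eq by simp_all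

text \<open>Induction on a finite set that contains the support: the value at one point is split off
  as a multiple of a unit vector.\<close>

lemma free_module_spans:
  assumes K: "field K"
  shows "spans K (free_module K G) (unit_vector K ` G)"
  unfolding spans_def
proof (intro conjI allI impI)
  interpret field K by (rule K)
  show "unit_vector K ` G \<subseteq> carrier (free_module K G)"
    by (rule image_subsetI) (rule unit_vector_closed[OF K])
  fix H assume H: "linear_closed K (free_module K G) H" and sub: "unit_vector K ` G \<subseteq> H"
  have zero: "(\<lambda>x. \<zero>\<^bsub>K\<^esub>) \<in> H" and add: "\<And>f g. \<lbrakk>f \<in> H; g \<in> H\<rbrakk> \<Longrightarrow> (\<lambda>x. f x \<oplus>\<^bsub>K\<^esub> g x) \<in> H"
    and smult: "\<And>c f. \<lbrakk>c \<in> carrier K; f \<in> H\<rbrakk> \<Longrightarrow> (\<lambda>x. c \<otimes>\<^bsub>K\<^esub> f x) \<in> H"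
    and Hc: "H \<subseteq> carrier (free_module K G)"
    using H unfolding linear_closed_def free_module_eq pointwise_module_simps by simp_all
  have "f \<in> H" if "finite A" "f \<in> carrier (free_module K G)" "\<And>x. x \<notin> A \<Longrightarrow> f x = \<zero>\<^bsub>K\<^esub>" for A f
    using that
  proof (induction A arbitrary: f rule: finite_induct)
    case empty
    then have "f = (\<lambda>x. \<zero>\<^bsub>K\<^esub>)" by (intro ext) simp
    then show ?case using zero by simp
  next
    case (insert a A)
    note f = free_moduleD[OF insert.prems(1)]
    show ?case
    proof (cases "a \<in> G")
      case False
      have "f x = \<zero>\<^bsub>K\<^esub>" if "x \<notin> A" for x
        using f(2)[OF False] insert.prems(2)[of x] that by (cases "x = a") simp_all
      then show ?thesis using insert.IH[OF insert.prems(1)] by blast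
    next
      case True
      define g where "g x = (if x = a then \<zero>\<^bsub>K\<^esub> else f x)" for x
      have "{x. g x \<noteq> \<zero>\<^bsub>K\<^esub>} \<subseteq> {x. f x \<noteq> \<zero>\<^bsub>K\<^esub>}" by (auto simp: g_def)
      then have gf: "finite {x. g x \<noteq> \<zero>\<^bsub>K\<^esub>}" using f(3) by (rule finite_subset)
      have gc: "g x \<in> carrier K" for x using f(1) by (simp add: g_def)
      have gz: "g x = \<zero>\<^bsub>K\<^esub>" if "x \<notin> G" for x using f(2)[OF that] by (simp add: g_def)
      have "g \<in> carrier (free_module K G)"
        unfolding free_module_eq pointwise_module_simps by (intro CollectI conjI allI impI gc gz gf)
      then have g: "g \<in> H"
      proof (rule insert.IH)
        show "g x = \<zero>\<^bsub>K\<^esub>" if "x \<notin> A" for x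
          using insert.prems(2)[of x] that by (simp add: g_def)
      qed
      have "(\<lambda>x. g x \<oplus>\<^bsub>K\<^esub> f a \<otimes>\<^bsub>K\<^esub> unit_vector K a x) \<in> H"
        using sub True by (intro add[OF g] smult f(1)) blast
      moreover have "(\<lambda>x. g x \<oplus>\<^bsub>K\<^esub> f a \<otimes>\<^bsub>K\<^esub> unit_vector K a x) = f"
        using f(1) by (intro ext) (simp add: unit_vector_def g_def)
      ultimately show ?thesis by simp
    qed
  qed
  then have "f \<in> H" if "f \<in> carrier (free_module K G)" for f
    using free_moduleD(3)[OF that] that by blast
  then show "H = carrier (free_module K G)"
    using Hc by blast
qed

lemma free_module_lift:
  assumes K: "field K" and W: "vectorspace K W" and c: "\<And>g. g \<in> G \<Longrightarrow> c g \<in> carrier W"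
  obtains L where "L \<in> module_hom K (free_module K G) W" "\<And>g. g \<in> G \<Longrightarrow> L (unit_vector K g) = c g"
proof
  interpret vectorspace K W by (rule W)
  define L where "L f = (\<Oplus>\<^bsub>W\<^esub>x\<in>{x. f x \<noteq> \<zero>\<^bsub>K\<^esub>}. f x \<odot>\<^bsub>W\<^esub> c x)" for f
  let ?F = "free_module K G"
  have fin: "finite {x. f x \<noteq> \<zero>\<^bsub>K\<^esub>}" "{x. f x \<noteq> \<zero>\<^bsub>K\<^esub>} \<subseteq> G" "\<And>x. f x \<in> carrier K" if "f \<in> carrier ?F" for f
    using free_moduleD[OF that] by blast+
  \<comment> \<open>The sum may run over any finite subset of G that contains the support.
    Additivity needs a common set for f, g and their sum, whose support can be smaller.\<close>
  have L_eq: "L f = (\<Oplus>\<^bsub>W\<^esub>x\<in>A. f x \<odot>\<^bsub>W\<^esub> c x)"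
    if "f \<in> carrier ?F" "finite A" "A \<subseteq> G" "{x. f x \<noteq> \<zero>\<^bsub>K\<^esub>} \<subseteq> A" for f A
    unfolding L_def
    by (rule M.add.finprod_mono_neutral_cong_left[OF that(2,4)])
      (use that fin[OF that(1)] c in \<open>auto simp: Pi_def\<close>)
  show "L \<in> module_hom K ?F W"
  proof (rule module_homI)
    show "L f \<in> carrier W" if "f \<in> carrier ?F" for f
      unfolding L_def using fin[OF that] c by (intro M.finsum_closed) auto
    show "L (f \<oplus>\<^bsub>?F\<^esub> g) = L f \<oplus>\<^bsub>W\<^esub> L g" if "f \<in> carrier ?F" "g \<in> carrier ?F" for f g
    proof -
      interpret F: vectorspace K ?F by (rule free_module_vectorspace[OF K])
      let ?A = "{x. f x \<noteq> \<zero>\<^bsub>K\<^esub>} \<union> {x. g x \<noteq> \<zero>\<^bsub>K\<^esub>}"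
      have A: "finite ?A" "?A \<subseteq> G" using fin that by auto
      have fg: "(f \<oplus>\<^bsub>?F\<^esub> g) x = f x \<oplus>\<^bsub>K\<^esub> g x" for x by (simp add: free_module_def)
      have "L (f \<oplus>\<^bsub>?F\<^esub> g) = (\<Oplus>\<^bsub>W\<^esub>x\<in>?A. (f \<oplus>\<^bsub>?F\<^esub> g) x \<odot>\<^bsub>W\<^esub> c x)"
        using that A by (intro L_eq) (auto simp: fg)
      also have "\<dots> = (\<Oplus>\<^bsub>W\<^esub>x\<in>?A. f x \<odot>\<^bsub>W\<^esub> c x \<oplus>\<^bsub>W\<^esub> g x \<odot>\<^bsub>W\<^esub> c x)"
        using A c fin(3) that by (intro M.finsum_cong') (auto simp: fg smult_l_distr subset_iff)
      also have "\<dots> = (\<Oplus>\<^bsub>W\<^esub>x\<in>?A. f x \<odot>\<^bsub>W\<^esub> c x) \<oplus>\<^bsub>W\<^esub> (\<Oplus>\<^bsub>W\<^esub>x\<in>?A. g x \<odot>\<^bsub>W\<^esub> c x)"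
        using A c fin(3) that by (intro M.finsum_addf) (auto simp: subset_iff)
      also have "\<dots> = L f \<oplus>\<^bsub>W\<^esub> L g"
        using L_eq[OF that(1) A] L_eq[OF that(2) A] by auto
      finally show ?thesis .
    qed
    show "L (k \<odot>\<^bsub>?F\<^esub> f) = k \<odot>\<^bsub>W\<^esub> L f" if "k \<in> carrier K" "f \<in> carrier ?F" for k f
    proof -
      interpret F: vectorspace K ?F by (rule free_module_vectorspace[OF K])
      let ?A = "{x. f x \<noteq> \<zero>\<^bsub>K\<^esub>}"
      have kf: "(k \<odot>\<^bsub>?F\<^esub> f) x = k \<otimes>\<^bsub>K\<^esub> f x" for x by (simp add: free_module_def)
      have "L (k \<odot>\<^bsub>?F\<^esub> f) = (\<Oplus>\<^bsub>W\<^esub>x\<in>?A. (k \<odot>\<^bsub>?F\<^esub> f) x \<odot>\<^bsub>W\<^esub> c x)"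
        using that fin[OF that(2)] by (intro L_eq) (auto simp: kf)
      also have "\<dots> = (\<Oplus>\<^bsub>W\<^esub>x\<in>?A. k \<odot>\<^bsub>W\<^esub> (f x \<odot>\<^bsub>W\<^esub> c x))"
        using fin[OF that(2)] c that by (intro M.finsum_cong') (auto simp: kf smult_assoc1 subset_iff)
      also have "\<dots> = k \<odot>\<^bsub>W\<^esub> L f"
        unfolding L_def using fin[OF that(2)] c that
        by (intro finsum_smult_ldistr[symmetric]) (auto simp: subset_iff)
      finally show ?thesis .
    qed
  qed
  show "L (unit_vector K g) = c g" if "g \<in> G" for g
  proof -
    have "L (unit_vector K g) = (\<Oplus>\<^bsub>W\<^esub>x\<in>{g}. unit_vector K g x \<odot>\<^bsub>W\<^esub> c x)"
      using that by (intro L_eq[OF unit_vector_closed[OF K that]]) (auto simp: unit_vector_def)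
    also have "\<dots> = c g" using c[OF that] by (simp add: unit_vector_def)
    finally show ?thesis .
  qed
qed

text \<open>Scalar multiplication of cosets is defined as a union over representatives, which avoids
  a choice. All members of the union coincide because S is closed under scalars.\<close>

lemma quotient_module_vectorspace:
  assumes V: "vectorspace K V" and S: "linear_closed K V S"
  shows "vectorspace K (quotient_module V S)" "(+>\<^bsub>V\<^esub>) S \<in> module_hom K V (quotient_module V S)"
    "carrier (quotient_module V S) = (+>\<^bsub>V\<^esub>) S ` carrier V"
    "\<And>x y. \<lbrakk>x \<in> carrier V; y \<in> carrier V\<rbrakk> \<Longrightarrow> S +>\<^bsub>V\<^esub> x = S +>\<^bsub>V\<^esub> y \<longleftrightarrow> x \<ominus>\<^bsub>V\<^esub> y \<in> S"
    "\<And>x. x \<in> S \<Longrightarrow> S +>\<^bsub>V\<^esub> x = \<zero>\<^bsub>quotient_module V S\<^esub>"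
proof -
  interpret vectorspace K V by (rule V)
  have Sc: "S \<subseteq> carrier V" and S0: "\<zero>\<^bsub>V\<^esub> \<in> S" and Sadd: "\<And>x y. \<lbrakk>x \<in> S; y \<in> S\<rbrakk> \<Longrightarrow> x \<oplus>\<^bsub>V\<^esub> y \<in> S"
    and Ssmult: "\<And>k x. \<lbrakk>k \<in> carrier K; x \<in> S\<rbrakk> \<Longrightarrow> k \<odot>\<^bsub>V\<^esub> x \<in> S"
    using S unfolding linear_closed_def by simp_all
  have neg: "\<ominus>\<^bsub>V\<^esub> x \<in> S" if "x \<in> S" for x
  proof -
    have "(\<ominus>\<^bsub>K\<^esub> \<one>\<^bsub>K\<^esub>) \<odot>\<^bsub>V\<^esub> x \<in> S" and "x \<in> carrier V" using Ssmult that Sc by auto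
    then show ?thesis by (simp add: smult_minus_1)
  qed
  have "subgroup S (add_monoid V)"
    by (rule subgroup.intro) (use Sc S0 Sadd neg in \<open>simp_all add: a_inv_def\<close>)
  then have "additive_subgroup S V" by (rule additive_subgroup.intro)
  then interpret S: abelian_subgroup S V by (intro abelian_subgroupI3 M.abelian_group_axioms)
  show carr: "carrier (quotient_module V S) = (+>\<^bsub>V\<^esub>) S ` carrier V"
    by (auto simp: quotient_module_def A_RCOSETS_def' a_r_coset_def')
  show eq: "S +>\<^bsub>V\<^esub> x = S +>\<^bsub>V\<^esub> y \<longleftrightarrow> x \<ominus>\<^bsub>V\<^esub> y \<in> S" if "x \<in> carrier V" "y \<in> carrier V" for x y
  proof
    assume "S +>\<^bsub>V\<^esub> x = S +>\<^bsub>V\<^esub> y"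
    then have "x \<in> S +>\<^bsub>V\<^esub> y" using S.a_rcos_self[OF that(1)] by simp
    then obtain s where "s \<in> S" "x = s \<oplus>\<^bsub>V\<^esub> y" by (auto simp: a_r_coset_def')
    moreover have "s \<in> carrier V" using \<open>s \<in> S\<close> S.a_subset by blast
    ultimately show "x \<ominus>\<^bsub>V\<^esub> y \<in> S" using that by (simp add: a_minus_def M.a_assoc M.r_neg)
  next
    assume a: "x \<ominus>\<^bsub>V\<^esub> y \<in> S"
    have "x = (x \<ominus>\<^bsub>V\<^esub> y) \<oplus>\<^bsub>V\<^esub> y" using that by (simp add: a_minus_def M.a_assoc M.l_neg)
    then have "x \<in> S +>\<^bsub>V\<^esub> y" using a by (auto simp: a_r_coset_def')
    then show "S +>\<^bsub>V\<^esub> x = S +>\<^bsub>V\<^esub> y" using S.a_repr_independence' that by blast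
  qed
  show "S +>\<^bsub>V\<^esub> x = \<zero>\<^bsub>quotient_module V S\<^esub>" if "x \<in> S" for x
    using S.a_rcos_const[OF that] by (simp add: quotient_module_def)
  have smult: "(\<Union>a\<in>S +>\<^bsub>V\<^esub> x. S +>\<^bsub>V\<^esub> (k \<odot>\<^bsub>V\<^esub> a)) = S +>\<^bsub>V\<^esub> (k \<odot>\<^bsub>V\<^esub> x)"
    if "k \<in> carrier K" "x \<in> carrier V" for k x
  proof -
    have "S +>\<^bsub>V\<^esub> (k \<odot>\<^bsub>V\<^esub> a) = S +>\<^bsub>V\<^esub> (k \<odot>\<^bsub>V\<^esub> x)" if a: "a \<in> S +>\<^bsub>V\<^esub> x" for a
    proof -
      obtain s where s: "s \<in> S" "a = s \<oplus>\<^bsub>V\<^esub> x" using a by (auto simp: a_r_coset_def')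
      then have sc: "s \<in> carrier V" using S.a_subset by blast
      have "k \<odot>\<^bsub>V\<^esub> a \<ominus>\<^bsub>V\<^esub> k \<odot>\<^bsub>V\<^esub> x = k \<odot>\<^bsub>V\<^esub> s"
        using s sc \<open>k \<in> carrier K\<close> \<open>x \<in> carrier V\<close> by (simp add: smult_r_distr a_minus_def M.a_assoc M.r_neg)
      also have "\<dots> \<in> S" using Ssmult s \<open>k \<in> carrier K\<close> by blast
      finally show ?thesis
        using eq[of "k \<odot>\<^bsub>V\<^esub> a" "k \<odot>\<^bsub>V\<^esub> x"] s sc \<open>k \<in> carrier K\<close> \<open>x \<in> carrier V\<close> by simp
    qed
    then show ?thesis using S.a_rcos_self[OF that(2)] by (intro SUP_eq_const) blast+
  qed
  have "vectorspace K (quotient_module V S) \<and> (+>\<^bsub>V\<^esub>) S \<in> module_hom K V (quotient_module V S)"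
  proof (intro conjI image_vectorspace[OF V carr])
    show z: "\<zero>\<^bsub>quotient_module V S\<^esub> = S +>\<^bsub>V\<^esub> \<zero>\<^bsub>V\<^esub>"
      using M.a_coset_add_zero[OF S.a_subset] by (simp add: quotient_module_def)
    show a: "(S +>\<^bsub>V\<^esub> x) \<oplus>\<^bsub>quotient_module V S\<^esub> (S +>\<^bsub>V\<^esub> y) = S +>\<^bsub>V\<^esub> (x \<oplus>\<^bsub>V\<^esub> y)"
      if "x \<in> carrier V" "y \<in> carrier V" for x y
      using S.a_rcos_sum[OF that] by (simp add: quotient_module_def)
    show s: "k \<odot>\<^bsub>quotient_module V S\<^esub> (S +>\<^bsub>V\<^esub> x) = S +>\<^bsub>V\<^esub> (k \<odot>\<^bsub>V\<^esub> x)"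
      if "k \<in> carrier K" "x \<in> carrier V" for k x
      using smult[OF that] by (simp add: quotient_module_def)
    show "\<zero>\<^bsub>quotient_module V S\<^esub> = S +>\<^bsub>V\<^esub> \<zero>\<^bsub>V\<^esub>" by (rule z)
    show "(S +>\<^bsub>V\<^esub> x) \<oplus>\<^bsub>quotient_module V S\<^esub> (S +>\<^bsub>V\<^esub> y) = S +>\<^bsub>V\<^esub> (x \<oplus>\<^bsub>V\<^esub> y)"
      if "x \<in> carrier V" "y \<in> carrier V" for x y
      by (rule a[OF that])
    show "k \<odot>\<^bsub>quotient_module V S\<^esub> (S +>\<^bsub>V\<^esub> x) = S +>\<^bsub>V\<^esub> (k \<odot>\<^bsub>V\<^esub> x)"
      if "k \<in> carrier K" "x \<in> carrier V" for k x
      by (rule s[OF that])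
  qed
  then show "vectorspace K (quotient_module V S)" "(+>\<^bsub>V\<^esub>) S \<in> module_hom K V (quotient_module V S)"
    by auto
qed

text \<open>Universal property of generators and relations. A linear map that kills the relations
  kills their span, because its kernel is linearly closed, and so it is constant on cosets.\<close>

lemma presented_space:
  assumes K: "field K" and R: "R \<subseteq> carrier (free_module K G)"
  shows presented_vectorspace: "vectorspace K (presented_space K G R)"
    and presented_gen_closed: "\<And>g. g \<in> G \<Longrightarrow> presented_gen K G R g \<in> carrier (presented_space K G R)"
    and presented_spans: "spans K (presented_space K G R) (presented_gen K G R ` G)"
    and presented_relation: "\<And>\<pi>. \<pi> = (+>\<^bsub>free_module K G\<^esub>) (LinearCombinations.module.span K (free_module K G) R) \<Longrightarrow>
        \<pi> \<in> module_hom K (free_module K G) (presented_space K G R) \<and>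
        (\<forall>g. \<pi> (unit_vector K g) = presented_gen K G R g) \<and> (\<forall>r\<in>R. \<pi> r = \<zero>\<^bsub>presented_space K G R\<^esub>)"
    and presented_lift: "\<And>L W. \<lbrakk>vectorspace K W; L \<in> module_hom K (free_module K G) W; \<And>r. r \<in> R \<Longrightarrow> L r = \<zero>\<^bsub>W\<^esub>\<rbrakk>
      \<Longrightarrow> \<exists>t \<in> module_hom K (presented_space K G R) W. \<forall>g\<in>G. t (presented_gen K G R g) = L (unit_vector K g)"
proof -
  let ?F = "free_module K G" and ?P = "presented_space K G R"
  let ?S = "LinearCombinations.module.span K ?F R"
  let ?\<pi> = "(+>\<^bsub>?F\<^esub>) ?S"
  note F = free_module_vectorspace[OF K, of G]
  interpret F: vectorspace K ?F by (rule F)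
  note s = linear_closed_span[OF F R]
  note q = quotient_module_vectorspace[OF F s(1), folded presented_space_def]
  show v: "vectorspace K ?P" by (rule q(1))
  show "presented_gen K G R g \<in> carrier ?P" if "g \<in> G" for g
    using q(3) unit_vector_closed[OF K that] by (auto simp: presented_gen_def)
  have "spans K ?P (?\<pi> ` unit_vector K ` G)"
    by (rule spans_image[OF free_module_spans[OF K] q(2,3) F q(1)])
  then show "spans K ?P (presented_gen K G R ` G)"
    by (simp add: presented_gen_def[abs_def] image_image)
  have r0: "?\<pi> r = \<zero>\<^bsub>?P\<^esub>" if "r \<in> R" for r
    using q(5) s(2) that by blast
  show "\<pi> \<in> module_hom K ?F ?P \<and> (\<forall>g. \<pi> (unit_vector K g) = presented_gen K G R g) \<and> (\<forall>r\<in>R. \<pi> r = \<zero>\<^bsub>?P\<^esub>)"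
    if "\<pi> = ?\<pi>" for \<pi>
    using that q(2) r0 by (simp add: presented_gen_def)
  show "\<exists>t \<in> module_hom K ?P W. \<forall>g\<in>G. t (presented_gen K G R g) = L (unit_vector K g)"
    if W: "vectorspace K W" and L: "L \<in> module_hom K ?F W" and L0: "\<And>r. r \<in> R \<Longrightarrow> L r = \<zero>\<^bsub>W\<^esub>" for L W
  proof -
    interpret W: vectorspace K W by (rule W)
    have "linear_closed K ?F {x \<in> carrier ?F. L x = \<zero>\<^bsub>W\<^esub>}"
      using module_hom_zero[OF F W L]
      by (auto simp: linear_closed_def module_hom_add[OF L] module_hom_smult[OF L])
    then have ker: "L x = \<zero>\<^bsub>W\<^esub>" if "x \<in> ?S" for x
      using s(3)[of "{x \<in> carrier ?F. L x = \<zero>\<^bsub>W\<^esub>}"] L0 R that by auto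
    interpret L: mod_hom K ?F W L by unfold_locales (rule L)
    have L_eq: "L x = L y" if "x \<in> carrier ?F" "y \<in> carrier ?F" "?\<pi> x = ?\<pi> y" for x y
    proof -
      have "L x \<ominus>\<^bsub>W\<^esub> L y = \<zero>\<^bsub>W\<^esub>" using ker[of "x \<ominus>\<^bsub>?F\<^esub> y"] q(4)[OF that(1,2)] that by simp
      then show ?thesis using that L.f_im by simp
    qed
    \<comment> \<open>The value is computed on an arbitrary representative; \<open>L_eq\<close>
      makes the choice immaterial.\<close>
    define t where "t A = L (SOME x. x \<in> carrier ?F \<and> ?\<pi> x = A)" for A
    have t\<pi>: "t (?\<pi> x) = L x" if "x \<in> carrier ?F" for x
    proof -
      have "(SOME y. y \<in> carrier ?F \<and> ?\<pi> y = ?\<pi> x) \<in> carrier ?F \<and>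
          ?\<pi> (SOME y. y \<in> carrier ?F \<and> ?\<pi> y = ?\<pi> x) = ?\<pi> x"
        by (rule someI[of _ x]) (use that in simp)
      then show ?thesis unfolding t_def using L_eq that by blast
    qed
    have "t \<in> module_hom K ?P W"
    proof (rule module_homI)
      show "t A \<in> carrier W" if "A \<in> carrier ?P" for A
        using that t\<pi> L.f_im unfolding q(3) by auto
      show "t (A \<oplus>\<^bsub>?P\<^esub> B) = t A \<oplus>\<^bsub>W\<^esub> t B" if "A \<in> carrier ?P" "B \<in> carrier ?P" for A B
      proof -
        obtain x y where x: "x \<in> carrier ?F" "A = ?\<pi> x" "y \<in> carrier ?F" "B = ?\<pi> y"
          using \<open>A \<in> carrier ?P\<close> \<open>B \<in> carrier ?P\<close> unfolding q(3) by auto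
        then have "A \<oplus>\<^bsub>?P\<^esub> B = ?\<pi> (x \<oplus>\<^bsub>?F\<^esub> y)" using module_hom_add[OF q(2)] by simp
        then show ?thesis using x t\<pi> by simp
      qed
      show "t (k \<odot>\<^bsub>?P\<^esub> A) = k \<odot>\<^bsub>W\<^esub> t A" if "k \<in> carrier K" "A \<in> carrier ?P" for k A
      proof -
        obtain x where x: "x \<in> carrier ?F" "A = ?\<pi> x"
          using \<open>A \<in> carrier ?P\<close> unfolding q(3) by auto
        then have "k \<odot>\<^bsub>?P\<^esub> A = ?\<pi> (k \<odot>\<^bsub>?F\<^esub> x)" using module_hom_smult[OF q(2)] that(1) by simp
        then show ?thesis using x t\<pi> that(1) by simp
      qed
    qed
    moreover have "t (presented_gen K G R g) = L (unit_vector K g)" if "g \<in> G" for g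
      using t\<pi> unit_vector_closed[OF K that] by (simp add: presented_gen_def)
    ultimately show ?thesis by blast
  qed
qed

text \<open>\<open>copy_map\<close> is a choice that is injective as soon as some injection exists.
  The map i is only a witness for this and does not enter the copy.\<close>

lemma copy_vectorspace:
  fixes V :: "('k, 'w, 'z) module_scheme" and i :: "'w \<Rightarrow> 'v" and c :: "('k, 'v) module" and j :: "'w \<Rightarrow> 'v"
  assumes V: "vectorspace K V" and inj: "inj_on i (carrier V)"
  defines "j \<equiv> (copy_map V :: 'w \<Rightarrow> 'v)" and "c \<equiv> copy V"
  shows "vectorspace K c" "j \<in> module_hom K V c" "carrier c = j ` carrier V" "inj_on j (carrier V)"
    "inv_into (carrier V) j \<in> module_hom K c V"
proof -
  interpret vectorspace K V by (rule V)
  show inj': "inj_on j (carrier V)"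
    unfolding j_def copy_map_def by (rule someI[of _ i]) (rule inj)
  have r: "inv_into (carrier V) j (j x) = x" if "x \<in> carrier V" for x
    using inj' that by simp
  show carr: "carrier c = j ` carrier V" by (simp add: c_def copy_def Let_def j_def)
  have "vectorspace K c \<and> j \<in> module_hom K V c"
    by (intro conjI image_vectorspace[OF V carr])
      (simp_all add: c_def copy_def Let_def r[unfolded j_def] j_def)
  then show "vectorspace K c" "j \<in> module_hom K V c" by auto
  then show "inv_into (carrier V) j \<in> module_hom K c V"
    unfolding module_hom_def carr
    by (auto simp: r module_hom_add[OF \<open>j \<in> module_hom K V c\<close>, symmetric]
        module_hom_smult[OF \<open>j \<in> module_hom K V c\<close>, symmetric])
qed

text \<open>A vector is encoded by the list of its coefficients with respect to an enumerated finite
  spanning set, and this list by e. Coefficients are chosen once for each vector; since they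
  determine the vector, the encoding is injective.\<close>

lemma inj_on_of_fin_dim:
  fixes e :: "'k list \<Rightarrow> 'v"
  assumes V: "vectorspace K V" and fd: "vectorspace.fin_dim K V" and e: "inj_on e (lists (carrier K))"
  obtains i :: "_ \<Rightarrow> 'v" where "inj_on i (carrier V)"
proof -
  interpret vectorspace K V by (rule V)
  obtain A where A: "finite A" "A \<subseteq> carrier V" "span A = carrier V"
    using fd unfolding fin_dim_def by blast
  obtain as where as: "set as = A" using finite_list[OF A(1)] by blast
  have "\<exists>a. a \<in> A \<rightarrow> carrier K \<and> lincomb a A = v" if "v \<in> carrier V" for v
    using finite_in_span[OF A(1,2), of v] that A(3) by (metis (no_types, lifting))
  then obtain a where a: "\<And>v. v \<in> carrier V \<Longrightarrow> a v \<in> A \<rightarrow> carrier K \<and> lincomb (a v) A = v"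
    by metis
  have "inj_on (\<lambda>v. e (map (a v) as)) (carrier V)"
  proof (rule inj_onI)
    fix v w assume v: "v \<in> carrier V" and w: "w \<in> carrier V" and eq: "e (map (a v) as) = e (map (a w) as)"
    have "map (a v) as \<in> lists (carrier K)" "map (a w) as \<in> lists (carrier K)"
      using a[OF v] a[OF w] as by (auto simp: in_lists_conv_set)
    then have "map (a v) as = map (a w) as" using eq inj_onD[OF e] by blast
    then have "\<And>x. x \<in> A \<Longrightarrow> a v x = a w x" using as by auto
    then have "lincomb (a v) A = lincomb (a w) A"
      using A a[OF w] by (intro lincomb_cong) auto
    then show "v = w" using a[OF v] a[OF w] by simp
  qed
  then show ?thesis using that by blast
qed

subsection \<open>Linear forms\<close>

definition linear_form :: "('k, 'm) ring_scheme \<Rightarrow> ('k, 'v, 'z) module_scheme \<Rightarrow> ('v \<Rightarrow> 'k) \<Rightarrow> bool" where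
  "linear_form K V \<xi> \<longleftrightarrow> (\<forall>x\<in>carrier V. \<xi> x \<in> carrier K) \<and>
     (\<forall>x\<in>carrier V. \<forall>y\<in>carrier V. \<xi> (x \<oplus>\<^bsub>V\<^esub> y) = \<xi> x \<oplus>\<^bsub>K\<^esub> \<xi> y) \<and>
     (\<forall>k\<in>carrier K. \<forall>x\<in>carrier V. \<xi> (k \<odot>\<^bsub>V\<^esub> x) = k \<otimes>\<^bsub>K\<^esub> \<xi> x)"

lemma linear_formD:
  assumes "linear_form K V \<xi>"
  shows "x \<in> carrier V \<Longrightarrow> \<xi> x \<in> carrier K"
    "\<lbrakk>x \<in> carrier V; y \<in> carrier V\<rbrakk> \<Longrightarrow> \<xi> (x \<oplus>\<^bsub>V\<^esub> y) = \<xi> x \<oplus>\<^bsub>K\<^esub> \<xi> y"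
    "\<lbrakk>k \<in> carrier K; x \<in> carrier V\<rbrakk> \<Longrightarrow> \<xi> (k \<odot>\<^bsub>V\<^esub> x) = k \<otimes>\<^bsub>K\<^esub> \<xi> x"
  using assms by (auto simp: linear_form_def)

lemma linear_form_comp:
  "\<lbrakk>linear_form K W \<xi>; f \<in> module_hom K V W\<rbrakk> \<Longrightarrow> linear_form K V (\<lambda>x. \<xi> (f x))"
  by (auto simp: linear_form_def module_hom_add module_hom_smult module_hom_carrier)

lemma linear_form_lincomb:
  assumes "vectorspace K V" "linear_form K V \<xi>" "finite A" "a \<in> A \<rightarrow> carrier K" "f \<in> A \<rightarrow> carrier V"
  shows "\<xi> (\<Oplus>\<^bsub>V\<^esub>b\<in>A. a b \<odot>\<^bsub>V\<^esub> f b) = (\<Oplus>\<^bsub>K\<^esub>b\<in>A. a b \<otimes>\<^bsub>K\<^esub> \<xi> (f b))"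
proof -
  interpret vectorspace K V by (rule assms)
  note \<xi> = linear_formD[OF assms(2)]
  have z: "\<xi> \<zero>\<^bsub>V\<^esub> = \<zero>\<^bsub>K\<^esub>" using \<xi>(3)[of "\<zero>\<^bsub>K\<^esub>" "\<zero>\<^bsub>V\<^esub>"] \<xi>(1)[of "\<zero>\<^bsub>V\<^esub>"] by simp
  show ?thesis
    using assms(3-5)
  proof (induction A rule: finite_induct)
    case empty
    then show ?case by (simp add: z)
  next
    case (insert x A)
    have "a x \<in> carrier K" "f x \<in> carrier V" and a: "a \<in> A \<rightarrow> carrier K" "f \<in> A \<rightarrow> carrier V" using insert.prems by auto
    moreover have "(\<lambda>b. a b \<odot>\<^bsub>V\<^esub> f b) \<in> A \<rightarrow> carrier V" "(\<lambda>b. a b \<otimes>\<^bsub>K\<^esub> \<xi> (f b)) \<in> A \<rightarrow> carrier K"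
      using a \<xi> by auto
    ultimately show ?case
      using insert.hyps insert.IH \<xi> by (simp add: M.finsum_insert R.finsum_insert M.finsum_closed)
  qed
qed

text \<open>Coordinates with respect to a basis are linear because they are unique: sums and
  multiples of coordinate families are again coordinate families.\<close>

lemma dual_basis:
  assumes V: "vectorspace K V" and fd: "vectorspace.fin_dim K V"
  obtains B \<xi> where "finite B" "B \<subseteq> carrier V" "\<And>b. b \<in> B \<Longrightarrow> linear_form K V (\<xi> b)"
    "\<And>v. v \<in> carrier V \<Longrightarrow> v = (\<Oplus>\<^bsub>V\<^esub>b\<in>B. \<xi> b v \<odot>\<^bsub>V\<^esub> b)"
proof -
  interpret vectorspace K V by (rule V)
  obtain B where B: "finite B" "basis B" using finite_basis_exists[OF fd] by blast
  then have Bc: "B \<subseteq> carrier V" by (simp add: basis_def)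
  have ex: "\<exists>!a. a \<in> B \<rightarrow>\<^sub>E carrier K \<and> lincomb a B = v" if "v \<in> carrier V" for v
    using basis_criterion[OF B(1) Bc] B(2) that by blast
  define a where "a v = (THE a. a \<in> B \<rightarrow>\<^sub>E carrier K \<and> lincomb a B = v)" for v
  have a: "a v \<in> B \<rightarrow>\<^sub>E carrier K" "lincomb (a v) B = v" if "v \<in> carrier V" for v
    using theI'[OF ex[OF that]] by (auto simp: a_def)
  \<comment> \<open>Uniqueness holds among families that are \<open>undefined\<close> outside B, so
    a competing family is first restricted to B.\<close>
  have a_eq: "a v b = c b" if "v \<in> carrier V" "c \<in> B \<rightarrow> carrier K" "lincomb c B = v" "b \<in> B" for v c b
  proof -
    have "lincomb (restrict c B) B = v"
      using that(2,3) lincomb_cong[OF refl Bc, of "restrict c B" c] by auto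
    moreover have "restrict c B \<in> B \<rightarrow>\<^sub>E carrier K" using that(2) by auto
    ultimately have "a v = restrict c B" using a[OF that(1)] ex[OF that(1)] by blast
    then show ?thesis using that(4) by simp
  qed
  have "linear_form K V (\<lambda>v. a v b)" if b: "b \<in> B" for b
    unfolding linear_form_def
  proof (intro conjI ballI)
    show "a x b \<in> carrier K" if "x \<in> carrier V" for x using a(1)[OF that] b by auto
    show "a (x \<oplus>\<^bsub>V\<^esub> y) b = a x b \<oplus>\<^bsub>K\<^esub> a y b" if x: "x \<in> carrier V" and y: "y \<in> carrier V" for x y
    proof (rule a_eq[OF _ _ _ b])
      have ac: "a x \<in> B \<rightarrow> carrier K" "a y \<in> B \<rightarrow> carrier K" using a x y by auto
      show "x \<oplus>\<^bsub>V\<^esub> y \<in> carrier V" using x y by simp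
      show "(\<lambda>b. a x b \<oplus>\<^bsub>K\<^esub> a y b) \<in> B \<rightarrow> carrier K" using ac by auto
      show "lincomb (\<lambda>b. a x b \<oplus>\<^bsub>K\<^esub> a y b) B = x \<oplus>\<^bsub>V\<^esub> y"
        using lincomb_sum[OF B(1) Bc ac] a x y by simp
    qed
    show "a (k \<odot>\<^bsub>V\<^esub> x) b = k \<otimes>\<^bsub>K\<^esub> a x b" if k: "k \<in> carrier K" and x: "x \<in> carrier V" for k x
    proof (rule a_eq[OF _ _ _ b])
      have ac: "a x \<in> B \<rightarrow> carrier K" using a x by auto
      show "k \<odot>\<^bsub>V\<^esub> x \<in> carrier V" using k x by simp
      show "(\<lambda>b. k \<otimes>\<^bsub>K\<^esub> a x b) \<in> B \<rightarrow> carrier K" using ac k by auto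
      show "lincomb (\<lambda>b. k \<otimes>\<^bsub>K\<^esub> a x b) B = k \<odot>\<^bsub>V\<^esub> x"
        using lincomb_smult[OF Bc ac k] a x by simp
    qed
  qed
  then show ?thesis
    using that[of B "\<lambda>b v. a v b"] B(1) Bc a(2) by (simp add: lincomb_def)
qed

lemma linear_forms_separate:
  assumes V: "vectorspace K V" and fd: "vectorspace.fin_dim K V"
    and x: "x \<in> carrier V" "y \<in> carrier V" and eq: "\<And>\<xi>. linear_form K V \<xi> \<Longrightarrow> \<xi> x = \<xi> y"
  shows "x = y"
proof -
  interpret vectorspace K V by (rule V)
  obtain B \<xi> where B: "finite B" "B \<subseteq> carrier V" "\<And>b. b \<in> B \<Longrightarrow> linear_form K V (\<xi> b)"
    "\<And>v. v \<in> carrier V \<Longrightarrow> v = (\<Oplus>\<^bsub>V\<^esub>b\<in>B. \<xi> b v \<odot>\<^bsub>V\<^esub> b)"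
    using dual_basis[OF V fd] by blast
  have "(\<Oplus>\<^bsub>V\<^esub>b\<in>B. \<xi> b x \<odot>\<^bsub>V\<^esub> b) = (\<Oplus>\<^bsub>V\<^esub>b\<in>B. \<xi> b y \<odot>\<^bsub>V\<^esub> b)"
  proof (intro M.finsum_cong')
    show "\<xi> b x \<odot>\<^bsub>V\<^esub> b = \<xi> b y \<odot>\<^bsub>V\<^esub> b" if "b \<in> B" for b
      using eq[OF B(3)[OF that]] by simp
    show "(\<lambda>b. \<xi> b y \<odot>\<^bsub>V\<^esub> b) \<in> B \<rightarrow> carrier V"
      using linear_formD(1)[OF B(3) x(2)] B(2) by auto
  qed simp
  then show ?thesis using B(4) x by metis
qed

text \<open>The assumptions say that the pairing p identifies D with the linear dual of V. With
  \<delta> b representing the coordinate \<xi> b, every d is the combination of the \<delta> b with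
  coefficients p d b, so D is spanned by finitely many elements. A form \<Phi> on D is evaluation at
  the combination of the b with coefficients \<Phi> (\<delta> b); this second conclusion is
  reflexivity.\<close>

lemma dual_space:
  assumes V: "vectorspace K V" and fd: "vectorspace.fin_dim K V" and D: "vectorspace K D"
    and p1: "\<And>v. v \<in> carrier V \<Longrightarrow> linear_form K D (\<lambda>d. p d v)"
    and p2: "\<And>d. d \<in> carrier D \<Longrightarrow> linear_form K V (p d)"
    and inj: "\<And>d d'. \<lbrakk>d \<in> carrier D; d' \<in> carrier D; \<And>v. v \<in> carrier V \<Longrightarrow> p d v = p d' v\<rbrakk> \<Longrightarrow> d = d'"
    and surj: "\<And>\<xi>. linear_form K V \<xi> \<Longrightarrow> \<exists>d \<in> carrier D. \<forall>v \<in> carrier V. p d v = \<xi> v"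
  shows "vectorspace.fin_dim K D"
    and "\<And>\<Phi>. linear_form K D \<Phi> \<Longrightarrow> \<exists>v \<in> carrier V. \<forall>d \<in> carrier D. \<Phi> d = p d v"
proof -
  interpret V: vectorspace K V by (rule V)
  interpret D: vectorspace K D by (rule D)
  obtain B \<xi> where B: "finite B" "B \<subseteq> carrier V" "\<And>b. b \<in> B \<Longrightarrow> linear_form K V (\<xi> b)"
    "\<And>v. v \<in> carrier V \<Longrightarrow> v = (\<Oplus>\<^bsub>V\<^esub>b\<in>B. \<xi> b v \<odot>\<^bsub>V\<^esub> b)"
    using dual_basis[OF V fd] by blast
  have "\<exists>\<delta>. \<forall>b\<in>B. \<delta> b \<in> carrier D \<and> (\<forall>v \<in> carrier V. p (\<delta> b) v = \<xi> b v)"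
    using surj[OF B(3)] by (intro bchoice) blast
  then obtain \<delta> where \<delta>: "\<And>b. b \<in> B \<Longrightarrow> \<delta> b \<in> carrier D" "\<And>b v. \<lbrakk>b \<in> B; v \<in> carrier V\<rbrakk> \<Longrightarrow> p (\<delta> b) v = \<xi> b v"
    by blast
  have \<xi>c: "\<xi> b v \<in> carrier K" if "b \<in> B" "v \<in> carrier V" for b v
    using linear_formD(1)[OF B(3)[OF that(1)] that(2)] .
  have pc: "p d v \<in> carrier K" if "d \<in> carrier D" "v \<in> carrier V" for d v
    using linear_formD(1)[OF p2[OF that(1)] that(2)] .
  have d_eq: "d = (\<Oplus>\<^bsub>D\<^esub>b\<in>B. p d b \<odot>\<^bsub>D\<^esub> \<delta> b)" if d: "d \<in> carrier D" for d
  proof (rule inj[OF d])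
    have c: "(\<lambda>b. p d b) \<in> B \<rightarrow> carrier K" "\<delta> \<in> B \<rightarrow> carrier D" using pc[OF d] B(2) \<delta> by auto
    then show "(\<Oplus>\<^bsub>D\<^esub>b\<in>B. p d b \<odot>\<^bsub>D\<^esub> \<delta> b) \<in> carrier D" by (intro D.M.finsum_closed) auto
    fix v assume v: "v \<in> carrier V"
    have "p (\<Oplus>\<^bsub>D\<^esub>b\<in>B. p d b \<odot>\<^bsub>D\<^esub> \<delta> b) v = (\<Oplus>\<^bsub>K\<^esub>b\<in>B. p d b \<otimes>\<^bsub>K\<^esub> p (\<delta> b) v)"
      by (rule linear_form_lincomb[OF D p1[OF v] B(1) c])
    also have "\<dots> = (\<Oplus>\<^bsub>K\<^esub>b\<in>B. \<xi> b v \<otimes>\<^bsub>K\<^esub> p d b)"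
      using \<delta>(2) v c \<xi>c by (intro V.R.finsum_cong') (auto intro: V.R.m_comm)
    also have "\<dots> = p d (\<Oplus>\<^bsub>V\<^esub>b\<in>B. \<xi> b v \<odot>\<^bsub>V\<^esub> b)"
      by (rule linear_form_lincomb[OF V p2[OF d] B(1), symmetric]) (use \<xi>c v B(2) in auto)
    finally show "p d v = p (\<Oplus>\<^bsub>D\<^esub>b\<in>B. p d b \<odot>\<^bsub>D\<^esub> \<delta> b) v" using B(4)[OF v] by simp
  qed
  have "spans K D (\<delta> ` B)"
    unfolding spans_def
  proof (intro conjI allI impI)
    show "\<delta> ` B \<subseteq> carrier D" using \<delta> by blast
    fix H assume H: "linear_closed K D H" "\<delta> ` B \<subseteq> H"
    have H0: "\<zero>\<^bsub>D\<^esub> \<in> H" and Hadd: "\<And>x y. \<lbrakk>x \<in> H; y \<in> H\<rbrakk> \<Longrightarrow> x \<oplus>\<^bsub>D\<^esub> y \<in> H"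
      and Hsmult: "\<And>k x. \<lbrakk>k \<in> carrier K; x \<in> H\<rbrakk> \<Longrightarrow> k \<odot>\<^bsub>D\<^esub> x \<in> H" and Hc: "H \<subseteq> carrier D"
      using H(1) unfolding linear_closed_def by simp_all
    have comb: "(\<Oplus>\<^bsub>D\<^esub>b\<in>A. a b \<odot>\<^bsub>D\<^esub> \<delta> b) \<in> H" if "finite A" "A \<subseteq> B" "a \<in> B \<rightarrow> carrier K" for A a
      using that(1,2)
    proof (induction A rule: finite_induct)
      case empty
      then show ?case using H0 by simp
    next
      case (insert x A)
      have x: "a x \<odot>\<^bsub>D\<^esub> \<delta> x \<in> H"
        using insert.prems H(2) that(3) by (intro Hsmult) auto
      have c: "(\<lambda>b. a b \<odot>\<^bsub>D\<^esub> \<delta> b) \<in> A \<rightarrow> carrier D"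
        using insert.prems \<delta>(1) that(3) by (intro Pi_I D.smult_closed) auto
      have "(\<Oplus>\<^bsub>D\<^esub>b\<in>A. a b \<odot>\<^bsub>D\<^esub> \<delta> b) \<in> H" using insert by simp
      then have "a x \<odot>\<^bsub>D\<^esub> \<delta> x \<oplus>\<^bsub>D\<^esub> (\<Oplus>\<^bsub>D\<^esub>b\<in>A. a b \<odot>\<^bsub>D\<^esub> \<delta> b) \<in> H" by (rule Hadd[OF x])
      then show ?case
        using D.M.finsum_insert[OF insert.hyps c] x Hc by (simp add: subset_iff)
    qed
    have "d \<in> H" if "d \<in> carrier D" for d
    proof -
      have "p d \<in> B \<rightarrow> carrier K" using pc[OF that] B(2) by blast
      from comb[OF B(1) subset_refl this] show ?thesis using d_eq[OF that] by simp
    qed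
    then show "H = carrier D" using Hc by blast
  qed
  then show "vectorspace.fin_dim K D"
    using fin_dim_iff_spans[OF D] B(1) by blast
  show "\<exists>v \<in> carrier V. \<forall>d \<in> carrier D. \<Phi> d = p d v" if \<Phi>: "linear_form K D \<Phi>" for \<Phi>
  proof (intro bexI ballI)
    have c: "(\<lambda>b. \<Phi> (\<delta> b)) \<in> B \<rightarrow> carrier K" using linear_formD(1)[OF \<Phi>] \<delta> by auto
    show "(\<Oplus>\<^bsub>V\<^esub>b\<in>B. \<Phi> (\<delta> b) \<odot>\<^bsub>V\<^esub> b) \<in> carrier V" using c B(2) by (intro V.M.finsum_closed) auto
    fix d assume d: "d \<in> carrier D"
    have pdc: "p d \<in> B \<rightarrow> carrier K" using pc[OF d] B(2) by auto
    have "\<Phi> d = \<Phi> (\<Oplus>\<^bsub>D\<^esub>b\<in>B. p d b \<odot>\<^bsub>D\<^esub> \<delta> b)" using d_eq[OF d] by simp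
    also have "\<dots> = (\<Oplus>\<^bsub>K\<^esub>b\<in>B. p d b \<otimes>\<^bsub>K\<^esub> \<Phi> (\<delta> b))"
      by (rule linear_form_lincomb[OF D \<Phi> B(1) pdc]) (use \<delta> in auto)
    also have "\<dots> = (\<Oplus>\<^bsub>K\<^esub>b\<in>B. \<Phi> (\<delta> b) \<otimes>\<^bsub>K\<^esub> p d b)"
      using c pdc by (intro V.R.finsum_cong') (auto intro: V.R.m_comm)
    also have "\<dots> = p d (\<Oplus>\<^bsub>V\<^esub>b\<in>B. \<Phi> (\<delta> b) \<odot>\<^bsub>V\<^esub> b)"
      by (rule linear_form_lincomb[OF V p2[OF d] B(1) c, symmetric]) (use B(2) in auto)
    finally show "\<Phi> d = p d (\<Oplus>\<^bsub>V\<^esub>b\<in>B. \<Phi> (\<delta> b) \<odot>\<^bsub>V\<^esub> b)" .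
  qed
qed


section \<open>Mackey functors\<close>

lemma linear_closedD:
  assumes "linear_closed K V H"
  shows "x \<in> H \<Longrightarrow> x \<in> carrier V" "\<zero>\<^bsub>V\<^esub> \<in> H" "\<lbrakk>x \<in> H; y \<in> H\<rbrakk> \<Longrightarrow> x \<oplus>\<^bsub>V\<^esub> y \<in> H"
    "\<lbrakk>k \<in> carrier K; x \<in> H\<rbrakk> \<Longrightarrow> k \<odot>\<^bsub>V\<^esub> x \<in> H"
  using assms unfolding linear_closed_def by auto

lemma linear_closed_vimage:
  assumes V: "vectorspace K V" and W: "vectorspace K W" and f: "f \<in> module_hom K V W" and H: "linear_closed K W H"
  shows "linear_closed K V {x \<in> carrier V. f x \<in> H}"
proof -
  interpret V: vectorspace K V by (rule V)
  note H = linear_closedD[OF H]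
  show ?thesis
    unfolding linear_closed_def using module_hom_zero[OF V W f] H(2)
    by (auto simp: module_hom_add[OF f] module_hom_smult[OF f] intro: H(3,4))
qed

text \<open>Relations are stored as differences; this translates the vanishing of a difference into
  an equation.\<close>

lemma module_hom_diff_eq_zero:
  assumes V: "vectorspace K V" and W: "vectorspace K W" and f: "f \<in> module_hom K V W"
    and x: "x \<in> carrier V" "y \<in> carrier V"
  shows "f (x \<ominus>\<^bsub>V\<^esub> y) = \<zero>\<^bsub>W\<^esub> \<longleftrightarrow> f x = f y"
proof -
  interpret V: vectorspace K V by (rule V)
  interpret W: vectorspace K W by (rule W)
  interpret mod_hom K V W f by unfold_locales (rule f)
  show ?thesis using x f_im by simp
qed

lemma vectorspace_closed:
  assumes "vectorspace K V"
  shows "\<lbrakk>x \<in> carrier V; y \<in> carrier V\<rbrakk> \<Longrightarrow> x \<oplus>\<^bsub>V\<^esub> y \<in> carrier V"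
    "\<lbrakk>x \<in> carrier V; k \<in> carrier K\<rbrakk> \<Longrightarrow> k \<odot>\<^bsub>V\<^esub> x \<in> carrier V"
    "\<lbrakk>x \<in> carrier V; y \<in> carrier V\<rbrakk> \<Longrightarrow> x \<ominus>\<^bsub>V\<^esub> y \<in> carrier V"
    "\<zero>\<^bsub>V\<^esub> \<in> carrier V"
proof -
  interpret vectorspace K V by (rule assms)
  show "\<lbrakk>x \<in> carrier V; y \<in> carrier V\<rbrakk> \<Longrightarrow> x \<oplus>\<^bsub>V\<^esub> y \<in> carrier V"
    "\<lbrakk>x \<in> carrier V; k \<in> carrier K\<rbrakk> \<Longrightarrow> k \<odot>\<^bsub>V\<^esub> x \<in> carrier V"
    "\<lbrakk>x \<in> carrier V; y \<in> carrier V\<rbrakk> \<Longrightarrow> x \<ominus>\<^bsub>V\<^esub> y \<in> carrier V"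
    "\<zero>\<^bsub>V\<^esub> \<in> carrier V"
    by simp_all
qed

lemma mackey_functorD:
  assumes "mackey_functor K T M"
  shows "X \<in> Obj T \<Longrightarrow> vectorspace K (mobj M X)"
    and "f \<in> homs T X Y \<Longrightarrow> mmap M f \<in> module_hom K (mobj M X) (mobj M Y)"
    and "\<lbrakk>X \<in> Obj T; x \<in> carrier (mobj M X)\<rbrakk> \<Longrightarrow> mmap M (Ident T X) x = x"
    and "\<lbrakk>f \<in> homs T X Y; g \<in> homs T Y Z; x \<in> carrier (mobj M X)\<rbrakk>
      \<Longrightarrow> mmap M (g \<cdot>\<^bsub>T\<^esub> f) x = mmap M g (mmap M f x)"
    and "\<lbrakk>f \<in> homs T X Y; g \<in> homs T X Y; x \<in> carrier (mobj M X)\<rbrakk>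
      \<Longrightarrow> mmap M (add_arrow T f g) x = mmap M f x \<oplus>\<^bsub>mobj M Y\<^esub> mmap M g x"
    and "\<lbrakk>X \<in> Obj T; Y \<in> Obj T; x \<in> carrier (mobj M X)\<rbrakk> \<Longrightarrow> mmap M (zero_arrow T X Y) x = \<zero>\<^bsub>mobj M Y\<^esub>"
  using assms unfolding mackey_functor_def by blast+

lemma mackey_map_closed:
  "\<lbrakk>mackey_functor K T M; f \<in> homs T X Y; x \<in> carrier (mobj M X)\<rbrakk> \<Longrightarrow> mmap M f x \<in> carrier (mobj M Y)"
  by (rule module_hom_carrier[OF mackey_functorD(2)])

text \<open>\<open>c\<close> satisfies the relations that define \<open>(M * N)(Z)\<close>.\<close>

locale day_balanced =
  fixes K :: "('k, 'm) ring_scheme" and T :: "('o, 'a, 'z) monoidal_scheme" (structure)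
    and M N :: "('o, 'a, 'k, 'v) mackey" and Z :: 'o and W :: "('k, 'w, 'y) module_scheme"
    and c :: "'o \<Rightarrow> 'o \<Rightarrow> 'a \<Rightarrow> 'v \<Rightarrow> 'v \<Rightarrow> 'w"
  assumes closed: "\<lbrakk>X \<in> Obj T; Y \<in> Obj T; h \<in> homs T (X \<boxdot> Y) Z; m \<in> carrier (mobj M X); n \<in> carrier (mobj N Y)\<rbrakk>
      \<Longrightarrow> c X Y h m n \<in> carrier W"
    and add_hom: "\<lbrakk>X \<in> Obj T; Y \<in> Obj T; h \<in> homs T (X \<boxdot> Y) Z; h' \<in> homs T (X \<boxdot> Y) Z;
        m \<in> carrier (mobj M X); n \<in> carrier (mobj N Y)\<rbrakk>
      \<Longrightarrow> c X Y (add_arrow T h h') m n = c X Y h m n \<oplus>\<^bsub>W\<^esub> c X Y h' m n"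
    and add_left: "\<lbrakk>X \<in> Obj T; Y \<in> Obj T; h \<in> homs T (X \<boxdot> Y) Z; m \<in> carrier (mobj M X); m' \<in> carrier (mobj M X);
        n \<in> carrier (mobj N Y)\<rbrakk> \<Longrightarrow> c X Y h (m \<oplus>\<^bsub>mobj M X\<^esub> m') n = c X Y h m n \<oplus>\<^bsub>W\<^esub> c X Y h m' n"
    and smult_left: "\<lbrakk>X \<in> Obj T; Y \<in> Obj T; h \<in> homs T (X \<boxdot> Y) Z; m \<in> carrier (mobj M X); n \<in> carrier (mobj N Y);
        k \<in> carrier K\<rbrakk> \<Longrightarrow> c X Y h (k \<odot>\<^bsub>mobj M X\<^esub> m) n = k \<odot>\<^bsub>W\<^esub> c X Y h m n"
    and add_right: "\<lbrakk>X \<in> Obj T; Y \<in> Obj T; h \<in> homs T (X \<boxdot> Y) Z; m \<in> carrier (mobj M X); n \<in> carrier (mobj N Y);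
        n' \<in> carrier (mobj N Y)\<rbrakk> \<Longrightarrow> c X Y h m (n \<oplus>\<^bsub>mobj N Y\<^esub> n') = c X Y h m n \<oplus>\<^bsub>W\<^esub> c X Y h m n'"
    and smult_right: "\<lbrakk>X \<in> Obj T; Y \<in> Obj T; h \<in> homs T (X \<boxdot> Y) Z; m \<in> carrier (mobj M X); n \<in> carrier (mobj N Y);
        k \<in> carrier K\<rbrakk> \<Longrightarrow> c X Y h m (k \<odot>\<^bsub>mobj N Y\<^esub> n) = k \<odot>\<^bsub>W\<^esub> c X Y h m n"
    and dinatural_left: "\<lbrakk>f \<in> homs T X X'; Y \<in> Obj T; h \<in> homs T (X' \<boxdot> Y) Z; m \<in> carrier (mobj M X);
        n \<in> carrier (mobj N Y)\<rbrakk> \<Longrightarrow> c X Y (h \<cdot> (f \<boxtimes> Ident T Y)) m n = c X' Y h (mmap M f m) n"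
    and dinatural_right: "\<lbrakk>X \<in> Obj T; g \<in> homs T Y Y'; h \<in> homs T (X \<boxdot> Y') Z; m \<in> carrier (mobj M X);
        n \<in> carrier (mobj N Y)\<rbrakk> \<Longrightarrow> c X Y (h \<cdot> (Ident T X \<boxtimes> g)) m n = c X Y' h m (mmap N g n)"

lemma (in day_balanced) hom_comp:
  assumes "t \<in> module_hom K W W'"
  shows "day_balanced K T M N Z W' (\<lambda>X Y h m n. t (c X Y h m n))"
proof unfold_locales
qed (simp_all only: closed add_hom add_left smult_left add_right smult_right dinatural_left dinatural_right
  module_hom_add[OF assms] module_hom_smult[OF assms] module_hom_carrier[OF assms])

text \<open>The last assumption is the size condition on \<open>'v\<close> under which every
  finite-dimensional space has a faithful copy there.\<close>

locale mackey_setting = K: field K + compact_closed_with_sums T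
  for K :: "('k, 'm) ring_scheme" and T :: "('o, 'a, 'z) symmetric_monoidal_scheme" (structure) +
  fixes \<C> :: "'o set" and e :: "'k list \<Rightarrow> 'v"
  assumes finite_C: "finite \<C>" and C_subset: "\<C> \<subseteq> Obj T"
    and C_generates: "X \<in> Obj T \<Longrightarrow>
      \<exists>n A S p i. (\<forall>j<n. A j \<in> \<C>) \<and> is_direct_sum T n A S p i \<and> isomorphic T X S"
    and hom_finitely_generated: "\<lbrakk>X \<in> Obj T; Y \<in> Obj T\<rbrakk> \<Longrightarrow> finitely_generated_monoid (hom_monoid T X Y)"
    and e_inj: "inj_on e (lists (carrier K))"
begin

definition fin_mackey :: "('o, 'a, 'k, 'v) mackey \<Rightarrow> bool" where
  "fin_mackey M \<longleftrightarrow> mackey_functor K T M \<and> fin_dim_mackey K T M"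

lemma fin_mackeyD:
  assumes "fin_mackey M"
  shows "mackey_functor K T M" "X \<in> Obj T \<Longrightarrow> vectorspace.fin_dim K (mobj M X)"
  using assms by (simp_all add: fin_mackey_def fin_dim_mackey_def)

text \<open>Transport x along the isomorphism k to a direct sum S and write the identity of S as the
  sum of the i j \<cdot> p j. Additivity of M then expresses x through elements that come from
  objects of \<C>.\<close>

lemma mackey_generated:
  assumes M: "mackey_functor K T M" and X: "X \<in> Obj T" and H: "linear_closed K (mobj M X) H"
    and gen: "\<And>A v x. \<lbrakk>A \<in> \<C>; v \<in> homs T A X; x \<in> carrier (mobj M A)\<rbrakk> \<Longrightarrow> mmap M v x \<in> H"
    and x: "x \<in> carrier (mobj M X)"
  shows "x \<in> H"
proof -
  note D = mackey_functorD[OF M]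
  obtain n A S p i k where A: "\<And>j. j < n \<Longrightarrow> A j \<in> \<C>" and S: "is_direct_sum T n A S p i" and k: "iso_arrow T k X S"
    using C_generates[OF X] unfolding isomorphic_def by blast
  note k = iso_arrow_inv[OF k]
  have So: "S \<in> Obj T" and pi: "\<And>j. j < n \<Longrightarrow> p j \<in> homs T S (A j) \<and> i j \<in> homs T (A j) S"
    using S unfolding is_direct_sum_def by blast+
  have pii: "\<And>j. j < n \<Longrightarrow> i j \<cdot> p j \<in> homs T S S" using pi Comp_closed by blast
  let ?y = "mmap M k x"
  have y: "?y \<in> carrier (mobj M S)" by (rule mackey_map_closed[OF M k(1) x])
  let ?H = "{s \<in> carrier (mobj M S). mmap M (inv_arrow T k) s \<in> H}"
  have H': "linear_closed K (mobj M S) ?H"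
    by (rule linear_closed_vimage[OF D(1)[OF So] D(1)[OF X] D(2)[OF k(2)] H])
  \<comment> \<open>The partial sums stay in the preimage of H under the map back to X; the case l =
    n is the identity of S.\<close>
  have "mmap M (sum_arrows S S (\<lambda>j. i j \<cdot> p j) l) ?y \<in> ?H" if "l \<le> n" for l
    using that
  proof (induction l)
    case 0
    show ?case using D(6)[OF So So y] linear_closedD(2)[OF H'] by simp
  next
    case (Suc l)
    then have l: "l < n" "l \<le> n" by simp_all
    have s: "sum_arrows S S (\<lambda>j. i j \<cdot> p j) l \<in> homs T S S"
      by (rule sum_arrows_closed[OF So So]) (use pii l in simp)
    note ip = pi[OF l(1)]
    have z: "mmap M (p l) ?y \<in> carrier (mobj M (A l))" using mackey_map_closed[OF M _ y] ip by blast
    have "mmap M (i l \<cdot> p l) ?y = mmap M (i l) (mmap M (p l) ?y)" using D(4)[OF _ _ y] ip by blast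
    moreover have "mmap M (inv_arrow T k) (mmap M (i l) (mmap M (p l) ?y)) = mmap M (inv_arrow T k \<cdot> i l) (mmap M (p l) ?y)"
      using D(4)[OF _ k(2) z] ip by simp
    moreover have "\<dots> \<in> H" using gen[OF A[OF l(1)] Comp_closed[OF _ k(2)] z] ip by blast
    moreover have "mmap M (i l) (mmap M (p l) ?y) \<in> carrier (mobj M S)" using mackey_map_closed[OF M _ z] ip by blast
    ultimately have "mmap M (i l \<cdot> p l) ?y \<in> ?H" by simp
    then show ?case
      using Suc.IH[OF l(2)] D(5)[OF s pii[OF l(1)] y] linear_closedD(3)[OF H'] by simp
  qed
  from this[of n] have "mmap M (Ident T S) ?y \<in> ?H" using direct_sum_Ident[OF S] by simp
  then have "mmap M (inv_arrow T k) ?y \<in> H" using D(3)[OF So y] by simp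
  then show ?thesis
    using D(4)[OF k(1,2) x] D(3)[OF X x] k(3) by simp
qed

text \<open>Finite generation, recast as an induction principle over arrows that is free of the
  record \<open>hom_monoid\<close>.\<close>

lemma hom_monoid_generators:
  assumes "X \<in> Obj T" "Y \<in> Obj T"
  obtains F where "finite F" "F \<subseteq> homs T X Y"
    "\<And>H. \<lbrakk>H \<subseteq> homs T X Y; F \<subseteq> H; zero_arrow T X Y \<in> H; \<And>f g. \<lbrakk>f \<in> H; g \<in> H\<rbrakk> \<Longrightarrow> add_arrow T f g \<in> H\<rbrakk> \<Longrightarrow> H = homs T X Y"
proof -
  obtain F where F: "finite F \<and> F \<subseteq> carrier (hom_monoid T X Y) \<and>
      (\<forall>H. submonoid H (hom_monoid T X Y) \<and> F \<subseteq> H \<longrightarrow> H = carrier (hom_monoid T X Y))"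
    using hom_finitely_generated[OF assms] unfolding finitely_generated_monoid_def by (rule exE)
  have F2: "F \<subseteq> homs T X Y" using conjunct1[OF conjunct2[OF F]] by (simp add: hom_monoid_def)
  have gen: "H = homs T X Y" if "H \<subseteq> homs T X Y" "F \<subseteq> H" "zero_arrow T X Y \<in> H"
    "\<And>f g. \<lbrakk>f \<in> H; g \<in> H\<rbrakk> \<Longrightarrow> add_arrow T f g \<in> H" for H
  proof -
    have "submonoid H (hom_monoid T X Y)"
      by (rule submonoid.intro) (simp_all add: hom_monoid_def that(1,3,4))
    with that(2) have "H = carrier (hom_monoid T X Y)" using conjunct2[OF conjunct2[OF F]] by blast
    then show ?thesis by (simp add: hom_monoid_def)
  qed
  show ?thesis by (rule that[OF conjunct1[OF F] F2]) (rule gen)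
qed

text \<open>An additive map sends the zero arrow to an element that equals its own double. The
  relations contain no clause for zero, so this is how the laws for zero are recovered.\<close>

lemma double_eq_zero:
  assumes "vectorspace K W" "x \<in> carrier W" "x \<oplus>\<^bsub>W\<^esub> x = x"
  shows "x = \<zero>\<^bsub>W\<^esub>"
proof -
  interpret W: vectorspace K W by (rule assms)
  have "x = (\<ominus>\<^bsub>W\<^esub> x \<oplus>\<^bsub>W\<^esub> x) \<oplus>\<^bsub>W\<^esub> x" using assms(2) by (simp add: W.M.l_neg)
  also have "\<dots> = \<ominus>\<^bsub>W\<^esub> x \<oplus>\<^bsub>W\<^esub> (x \<oplus>\<^bsub>W\<^esub> x)" using assms(2) by (simp only: W.M.a_assoc W.M.a_inv_closed)
  also have "\<dots> = \<zero>\<^bsub>W\<^esub>" unfolding assms(3) using assms(2) by (rule W.M.l_neg)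
  finally show ?thesis .
qed

subsection \<open>Day convolution of Mackey functors\<close>

lemma day_balanced_zero:
  assumes "day_balanced K T M N Z W c" "mackey_functor K T M" "mackey_functor K T N" "vectorspace K W"
    "X \<in> Obj T" "Y \<in> Obj T" "m \<in> carrier (mobj M X)" "n \<in> carrier (mobj N Y)" "h \<in> homs T (X \<boxdot> Y) Z"
  shows "c X Y (zero_arrow T (X \<boxdot> Y) Z) m n = \<zero>\<^bsub>W\<^esub>" "c X Y h \<zero>\<^bsub>mobj M X\<^esub> n = \<zero>\<^bsub>W\<^esub>" "c X Y h m \<zero>\<^bsub>mobj N Y\<^esub> = \<zero>\<^bsub>W\<^esub>"
proof -
  interpret c: day_balanced K T M N Z W c by (rule assms)
  interpret M: vectorspace K "mobj M X" by (rule mackey_functorD(1)[OF assms(2,5)])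
  interpret N: vectorspace K "mobj N Y" by (rule mackey_functorD(1)[OF assms(3,6)])
  have Z: "Z \<in> Obj T" using homs_Obj[OF assms(9)] by simp
  have 0: "zero_arrow T (X \<boxdot> Y) Z \<in> homs T (X \<boxdot> Y) Z"
    by (rule zero_arrow_closed[OF tobj_closed[OF assms(5,6)] Z])
  show "c X Y (zero_arrow T (X \<boxdot> Y) Z) m n = \<zero>\<^bsub>W\<^esub>"
    by (rule double_eq_zero[OF assms(4) c.closed[OF assms(5,6) 0 assms(7,8)]])
      (simp only: c.add_hom[OF assms(5,6) 0 0 assms(7,8), symmetric] add_arrow_zero(1)[OF 0])
  show "c X Y h \<zero>\<^bsub>mobj M X\<^esub> n = \<zero>\<^bsub>W\<^esub>"
    by (rule double_eq_zero[OF assms(4) c.closed[OF assms(5,6,9) M.M.zero_closed assms(8)]])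
      (simp only: c.add_left[OF assms(5,6,9) M.M.zero_closed M.M.zero_closed assms(8), symmetric] M.M.l_zero M.M.zero_closed)
  show "c X Y h m \<zero>\<^bsub>mobj N Y\<^esub> = \<zero>\<^bsub>W\<^esub>"
    by (rule double_eq_zero[OF assms(4) c.closed[OF assms(5,6,9,7) N.M.zero_closed]])
      (simp only: c.add_right[OF assms(5,6,9,7) N.M.zero_closed N.M.zero_closed, symmetric] N.M.l_zero N.M.zero_closed)
qed

text \<open>The arguments are freed one at a time: the arrow by generators of the hom monoid, the
  two vectors by spanning sets, and finally the objects by \<open>mackey_generated\<close>, where
  dinaturality moves an arrow that starts in an object of \<C> from the vector into h. With F, B and
  B' finite this yields finite dimension.\<close>

lemma day_generated:
  assumes c: "day_balanced K T M N Z W c" and M: "mackey_functor K T M" and N: "mackey_functor K T N"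
    and W: "vectorspace K W" and H: "linear_closed K W H" and Z: "Z \<in> Obj T"
    and F: "\<And>X Y S. \<lbrakk>X \<in> \<C>; Y \<in> \<C>; S \<subseteq> homs T (X \<boxdot> Y) Z; F X Y \<subseteq> S; zero_arrow T (X \<boxdot> Y) Z \<in> S;
      \<And>f g. \<lbrakk>f \<in> S; g \<in> S\<rbrakk> \<Longrightarrow> add_arrow T f g \<in> S\<rbrakk> \<Longrightarrow> S = homs T (X \<boxdot> Y) Z"
    and Fc: "\<And>X Y. \<lbrakk>X \<in> \<C>; Y \<in> \<C>\<rbrakk> \<Longrightarrow> F X Y \<subseteq> homs T (X \<boxdot> Y) Z"
    and B: "\<And>X. X \<in> \<C> \<Longrightarrow> spans K (mobj M X) (B X)" and B': "\<And>Y. Y \<in> \<C> \<Longrightarrow> spans K (mobj N Y) (B' Y)"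
    and base: "\<And>X Y h m n. \<lbrakk>X \<in> \<C>; Y \<in> \<C>; h \<in> F X Y; m \<in> B X; n \<in> B' Y\<rbrakk> \<Longrightarrow> c X Y h m n \<in> H"
    and X: "X \<in> Obj T" and Y: "Y \<in> Obj T" and h: "h \<in> homs T (X \<boxdot> Y) Z" and m: "m \<in> carrier (mobj M X)"
    and n: "n \<in> carrier (mobj N Y)"
  shows "c X Y h m n \<in> H"
proof -
  interpret c: day_balanced K T M N Z W c by (rule c)
  note H = linear_closedD[OF H]
  note zero = day_balanced_zero[OF c M N W]
  have left: "linear_closed K (mobj M X) {m \<in> carrier (mobj M X). c X Y h m n \<in> H}"
    if o: "X \<in> Obj T" "Y \<in> Obj T" "h \<in> homs T (X \<boxdot> Y) Z" and n: "n \<in> carrier (mobj N Y)" for X Y h n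
  proof -
    interpret M: vectorspace K "mobj M X" by (rule mackey_functorD(1)[OF M o(1)])
    show ?thesis
      unfolding linear_closed_def using zero(2)[OF o(1,2) M.M.zero_closed n o(3)] H(2)
      by (auto simp: c.add_left[OF o _ _ n] c.smult_left[OF o _ n] intro: H(3,4))
  qed
  have right: "linear_closed K (mobj N Y) {n \<in> carrier (mobj N Y). c X Y h m n \<in> H}"
    if o: "X \<in> Obj T" "Y \<in> Obj T" "h \<in> homs T (X \<boxdot> Y) Z" and m: "m \<in> carrier (mobj M X)" for X Y h m
  proof -
    interpret N: vectorspace K "mobj N Y" by (rule mackey_functorD(1)[OF N o(2)])
    show ?thesis
      unfolding linear_closed_def using zero(3)[OF o(1,2) m N.M.zero_closed o(3)] H(2)
      by (auto simp: c.add_right[OF o m] c.smult_right[OF o m] intro: H(3,4))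
  qed
  have 1: "c X Y h m n \<in> H" if o: "X \<in> \<C>" "Y \<in> \<C>" and h: "h \<in> homs T (X \<boxdot> Y) Z" and m: "m \<in> B X" and n: "n \<in> B' Y" for X Y h m n
  proof -
    have o': "X \<in> Obj T" "Y \<in> Obj T" using o C_subset by auto
    have mn: "m \<in> carrier (mobj M X)" "n \<in> carrier (mobj N Y)" using m n B[OF o(1)] B'[OF o(2)] by (auto simp: spans_def)
    have "{h \<in> homs T (X \<boxdot> Y) Z. c X Y h m n \<in> H} = homs T (X \<boxdot> Y) Z"
    proof (rule F[OF o])
      show "F X Y \<subseteq> {h \<in> homs T (X \<boxdot> Y) Z. c X Y h m n \<in> H}" using Fc[OF o] base[OF o _ m n] by blast
      show "zero_arrow T (X \<boxdot> Y) Z \<in> {h \<in> homs T (X \<boxdot> Y) Z. c X Y h m n \<in> H}"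
        using zero(1)[OF o' mn h] H(2) zero_arrow_closed[OF tobj_closed[OF o'] Z] by simp
      show "add_arrow T f g \<in> {h \<in> homs T (X \<boxdot> Y) Z. c X Y h m n \<in> H}"
        if "f \<in> {h \<in> homs T (X \<boxdot> Y) Z. c X Y h m n \<in> H}" "g \<in> {h \<in> homs T (X \<boxdot> Y) Z. c X Y h m n \<in> H}" for f g
        using that add_arrow_closed c.add_hom[OF o' _ _ mn] H(3) by simp
    qed blast
    then show ?thesis using h by blast
  qed
  have 2: "c X Y h m n \<in> H" if o: "X \<in> \<C>" "Y \<in> \<C>" and h: "h \<in> homs T (X \<boxdot> Y) Z" and m: "m \<in> carrier (mobj M X)" and n: "n \<in> B' Y" for X Y h m n
  proof -
    have o': "X \<in> Obj T" "Y \<in> Obj T" using o C_subset by auto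
    have n': "n \<in> carrier (mobj N Y)" using n B'[OF o(2)] by (auto simp: spans_def)
    have Bc: "B X \<subseteq> carrier (mobj M X)" using B[OF o(1)] by (simp add: spans_def)
    have "{m \<in> carrier (mobj M X). c X Y h m n \<in> H} = carrier (mobj M X)"
      by (rule spansD[OF B[OF o(1)] left[OF o' h n']]) (use 1[OF o h _ n] Bc in blast)
    then show ?thesis using m by blast
  qed
  have 3: "c X Y h m n \<in> H" if o: "X \<in> \<C>" "Y \<in> \<C>" and h: "h \<in> homs T (X \<boxdot> Y) Z" and m: "m \<in> carrier (mobj M X)" and n: "n \<in> carrier (mobj N Y)" for X Y h m n
  proof -
    have o': "X \<in> Obj T" "Y \<in> Obj T" using o C_subset by auto
    have Bc: "B' Y \<subseteq> carrier (mobj N Y)" using B'[OF o(2)] by (simp add: spans_def)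
    have "{n \<in> carrier (mobj N Y). c X Y h m n \<in> H} = carrier (mobj N Y)"
      by (rule spansD[OF B'[OF o(2)] right[OF o' h m]]) (use 2[OF o h m] Bc in blast)
    then show ?thesis using n by blast
  qed
  \<comment> \<open>From here X is arbitrary: the arrow h \<cdot> (v \<boxtimes> 1) has A \<in> \<C>
    as the first factor of its domain, where the previous stage applies.\<close>
  have 4: "c X Y h m n \<in> H" if o: "X \<in> Obj T" "Y \<in> \<C>" and h: "h \<in> homs T (X \<boxdot> Y) Z" and m: "m \<in> carrier (mobj M X)" and n: "n \<in> carrier (mobj N Y)" for X Y h m n
  proof -
    have Y: "Y \<in> Obj T" using o C_subset by auto
    have "m \<in> {m \<in> carrier (mobj M X). c X Y h m n \<in> H}"
    proof (rule mackey_generated[OF M o(1) left[OF o(1) Y h n] _ m])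
      fix A v x assume A: "A \<in> \<C>" and v: "v \<in> homs T A X" and x: "x \<in> carrier (mobj M A)"
      have "h \<cdot> (v \<boxtimes> Ident T Y) \<in> homs T (A \<boxdot> Y) Z"
        by (rule Comp_closed[OF tarr_closed[OF v Ident_closed[OF Y]] h])
      then show "mmap M v x \<in> {m \<in> carrier (mobj M X). c X Y h m n \<in> H}"
        using 3[OF A o(2) \<open>h \<cdot> (v \<boxtimes> Ident T Y) \<in> homs T (A \<boxdot> Y) Z\<close> x n] c.dinatural_left[OF v Y h x n]
          mackey_map_closed[OF M v x] by simp
    qed
    then show ?thesis by simp
  qed
  have "n \<in> {n \<in> carrier (mobj N Y). c X Y h m n \<in> H}"
  proof (rule mackey_generated[OF N Y right[OF X Y h m] _ n])
    fix A v x assume A: "A \<in> \<C>" and v: "v \<in> homs T A Y" and x: "x \<in> carrier (mobj N A)"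
    have "h \<cdot> (Ident T X \<boxtimes> v) \<in> homs T (X \<boxdot> A) Z"
      by (rule Comp_closed[OF tarr_closed[OF Ident_closed[OF X] v] h])
    then show "mmap N v x \<in> {n \<in> carrier (mobj N Y). c X Y h m n \<in> H}"
      using 4[OF X A \<open>h \<cdot> (Ident T X \<boxtimes> v) \<in> homs T (X \<boxdot> A) Z\<close> m x] c.dinatural_right[OF X v h m x]
        mackey_map_closed[OF N v x] by simp
  qed
  then show ?thesis by simp
qed

lemma day_generators_iff:
  "(X, Y, h, m, n) \<in> day_generators T M N Z \<longleftrightarrow> X \<in> Obj T \<and> Y \<in> Obj T \<and> h \<in> homs T (X \<boxdot> Y) Z \<and>
     m \<in> carrier (mobj M X) \<and> n \<in> carrier (mobj N Y)"
  by (simp add: day_generators_def)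

section \<open>Universal property of the space that presents the Day convolution\<close>

context
  fixes M N :: "('o, 'a, 'k, 'v) mackey" and Z :: 'o
  assumes M: "mackey_functor K T M" and N: "mackey_functor K T N" and Z: "Z \<in> Obj T"
begin

private abbreviation "G \<equiv> day_generators T M N Z"
private abbreviation "F \<equiv> free_module K G"
private abbreviation "R \<equiv> day_relations K T M N Z"
private abbreviation u where "u X Y h m n \<equiv> unit_vector K (X, Y, h, m, n)"

private lemma u_closed: "\<lbrakk>X \<in> Obj T; Y \<in> Obj T; h \<in> homs T (X \<boxdot> Y) Z; m \<in> carrier (mobj M X); n \<in> carrier (mobj N Y)\<rbrakk>
    \<Longrightarrow> u X Y h m n \<in> carrier F"
  by (rule unit_vector_closed[OF K.field_axioms]) (simp add: day_generators_iff)

text \<open>Named cases for the seven families of relations, in the order of the laws of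
  \<open>day_balanced\<close>, so that each case meets the law of the same name.\<close>

private lemma day_relations_cases:
  assumes "r \<in> R"
  obtains
    (add_hom) X Y h h' m n where "r = u X Y (add_arrow T h h') m n \<ominus>\<^bsub>F\<^esub> (u X Y h m n \<oplus>\<^bsub>F\<^esub> u X Y h' m n)"
      "X \<in> Obj T" "Y \<in> Obj T" "h \<in> homs T (X \<boxdot> Y) Z" "h' \<in> homs T (X \<boxdot> Y) Z" "m \<in> carrier (mobj M X)" "n \<in> carrier (mobj N Y)"
  | (add_left) X Y h m m' n where "r = u X Y h (m \<oplus>\<^bsub>mobj M X\<^esub> m') n \<ominus>\<^bsub>F\<^esub> (u X Y h m n \<oplus>\<^bsub>F\<^esub> u X Y h m' n)"
      "X \<in> Obj T" "Y \<in> Obj T" "h \<in> homs T (X \<boxdot> Y) Z" "m \<in> carrier (mobj M X)" "m' \<in> carrier (mobj M X)" "n \<in> carrier (mobj N Y)"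
  | (smult_left) X Y h m n k where "r = u X Y h (k \<odot>\<^bsub>mobj M X\<^esub> m) n \<ominus>\<^bsub>F\<^esub> (k \<odot>\<^bsub>F\<^esub> u X Y h m n)"
      "X \<in> Obj T" "Y \<in> Obj T" "h \<in> homs T (X \<boxdot> Y) Z" "m \<in> carrier (mobj M X)" "n \<in> carrier (mobj N Y)" "k \<in> carrier K"
  | (add_right) X Y h m n n' where "r = u X Y h m (n \<oplus>\<^bsub>mobj N Y\<^esub> n') \<ominus>\<^bsub>F\<^esub> (u X Y h m n \<oplus>\<^bsub>F\<^esub> u X Y h m n')"
      "X \<in> Obj T" "Y \<in> Obj T" "h \<in> homs T (X \<boxdot> Y) Z" "m \<in> carrier (mobj M X)" "n \<in> carrier (mobj N Y)" "n' \<in> carrier (mobj N Y)"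
  | (smult_right) X Y h m n k where "r = u X Y h m (k \<odot>\<^bsub>mobj N Y\<^esub> n) \<ominus>\<^bsub>F\<^esub> (k \<odot>\<^bsub>F\<^esub> u X Y h m n)"
      "X \<in> Obj T" "Y \<in> Obj T" "h \<in> homs T (X \<boxdot> Y) Z" "m \<in> carrier (mobj M X)" "n \<in> carrier (mobj N Y)" "k \<in> carrier K"
  | (dinatural_left) X X' Y f h m n where "r = u X Y (h \<cdot> (f \<boxtimes> Ident T Y)) m n \<ominus>\<^bsub>F\<^esub> u X' Y h (mmap M f m) n"
      "f \<in> homs T X X'" "Y \<in> Obj T" "h \<in> homs T (X' \<boxdot> Y) Z" "m \<in> carrier (mobj M X)" "n \<in> carrier (mobj N Y)"
  | (dinatural_right) X Y Y' g h m n where "r = u X Y (h \<cdot> (Ident T X \<boxtimes> g)) m n \<ominus>\<^bsub>F\<^esub> u X Y' h m (mmap N g n)"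
      "X \<in> Obj T" "g \<in> homs T Y Y'" "h \<in> homs T (X \<boxdot> Y') Z" "m \<in> carrier (mobj M X)" "n \<in> carrier (mobj N Y)"
  using assms unfolding day_relations_def Let_def day_generators_iff
  apply (elim UnE CollectE exE conjE)
  subgoal by (rule that(1))
  subgoal by (rule that(2))
  subgoal by (rule that(3))
  subgoal by (rule that(4))
  subgoal by (rule that(5))
  subgoal by (rule that(6))
  subgoal by (rule that(7))
  done

private lemma Madd: "\<lbrakk>X \<in> Obj T; m \<in> carrier (mobj M X); m' \<in> carrier (mobj M X)\<rbrakk> \<Longrightarrow> m \<oplus>\<^bsub>mobj M X\<^esub> m' \<in> carrier (mobj M X)"
  and Msm: "\<lbrakk>X \<in> Obj T; m \<in> carrier (mobj M X); k \<in> carrier K\<rbrakk> \<Longrightarrow> k \<odot>\<^bsub>mobj M X\<^esub> m \<in> carrier (mobj M X)"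
  and Nadd: "\<lbrakk>X \<in> Obj T; n \<in> carrier (mobj N X); n' \<in> carrier (mobj N X)\<rbrakk> \<Longrightarrow> n \<oplus>\<^bsub>mobj N X\<^esub> n' \<in> carrier (mobj N X)"
  and Nsm: "\<lbrakk>X \<in> Obj T; n \<in> carrier (mobj N X); k \<in> carrier K\<rbrakk> \<Longrightarrow> k \<odot>\<^bsub>mobj N X\<^esub> n \<in> carrier (mobj N X)"
  by (rule vectorspace_closed[OF mackey_functorD(1)[OF M]] vectorspace_closed[OF mackey_functorD(1)[OF N]]; assumption)+

private lemma comp_left: "\<lbrakk>f \<in> homs T X X'; Y \<in> Obj T; h \<in> homs T (X' \<boxdot> Y) Z\<rbrakk> \<Longrightarrow> h \<cdot> (f \<boxtimes> Ident T Y) \<in> homs T (X \<boxdot> Y) Z"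
  by (rule Comp_closed[OF tarr_closed[OF _ Ident_closed]])

private lemma comp_right: "\<lbrakk>X \<in> Obj T; g \<in> homs T Y Y'; h \<in> homs T (X \<boxdot> Y') Z\<rbrakk> \<Longrightarrow> h \<cdot> (Ident T X \<boxtimes> g) \<in> homs T (X \<boxdot> Y) Z"
  by (rule Comp_closed[OF tarr_closed[OF Ident_closed]])

private lemma F_vectorspace: "vectorspace K F"
  by (rule free_module_vectorspace[OF K.field_axioms])

text \<open>Membership in the free module and vanishing under a balanced map are proved together
  because both run through the same seven cases. In each of them the vanishing of the difference is
  the corresponding law of \<open>day_balanced\<close>.\<close>

private lemma day_relation_vanishes:
  assumes "r \<in> R"
  shows "r \<in> carrier F \<and> (vectorspace K W \<longrightarrow> f \<in> module_hom K F W \<longrightarrow>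
      day_balanced K T M N Z W (\<lambda>X Y h m n. f (u X Y h m n)) \<longrightarrow> f r = \<zero>\<^bsub>W\<^esub>)"
proof -
  note cl = vectorspace_closed[OF F_vectorspace] and d = module_hom_diff_eq_zero[OF F_vectorspace]
  show ?thesis
    using assms
  proof (cases rule: day_relations_cases)
    case (add_hom X Y h h' m n)
    note a = add_hom(2-)
    have v: "u X Y (add_arrow T h h') m n \<in> carrier F" "u X Y h m n \<in> carrier F" "u X Y h' m n \<in> carrier F"
      by (rule u_closed[OF a(1,2) add_arrow_closed[OF a(3,4)] a(5,6)] u_closed[OF a(1,2,3,5,6)] u_closed[OF a(1,2,4,5,6)])+
    show ?thesis
      unfolding add_hom(1)
    proof (intro conjI impI)
      assume W: "vectorspace K W" and f: "f \<in> module_hom K F W"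
        and b: "day_balanced K T M N Z W (\<lambda>X Y h m n. f (u X Y h m n))"
      show "f (u X Y (add_arrow T h h') m n \<ominus>\<^bsub>F\<^esub> (u X Y h m n \<oplus>\<^bsub>F\<^esub> u X Y h' m n)) = \<zero>\<^bsub>W\<^esub>"
        unfolding d[OF W f v(1) cl(1)[OF v(2,3)]] module_hom_add[OF f v(2,3)] by (rule day_balanced.add_hom[OF b a])
    qed (rule cl(3)[OF v(1) cl(1)[OF v(2,3)]])
  next
    case (add_left X Y h m m' n)
    note a = add_left(2-)
    have v: "u X Y h (m \<oplus>\<^bsub>mobj M X\<^esub> m') n \<in> carrier F" "u X Y h m n \<in> carrier F" "u X Y h m' n \<in> carrier F"
      by (rule u_closed[OF a(1,2,3) Madd[OF a(1,4,5)] a(6)] u_closed[OF a(1,2,3,4,6)] u_closed[OF a(1,2,3,5,6)])+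
    show ?thesis
      unfolding add_left(1)
    proof (intro conjI impI)
      assume W: "vectorspace K W" and f: "f \<in> module_hom K F W"
        and b: "day_balanced K T M N Z W (\<lambda>X Y h m n. f (u X Y h m n))"
      show "f (u X Y h (m \<oplus>\<^bsub>mobj M X\<^esub> m') n \<ominus>\<^bsub>F\<^esub> (u X Y h m n \<oplus>\<^bsub>F\<^esub> u X Y h m' n)) = \<zero>\<^bsub>W\<^esub>"
        unfolding d[OF W f v(1) cl(1)[OF v(2,3)]] module_hom_add[OF f v(2,3)] by (rule day_balanced.add_left[OF b a])
    qed (rule cl(3)[OF v(1) cl(1)[OF v(2,3)]])
  next
    case (smult_left X Y h m n k)
    note a = smult_left(2-)
    have v: "u X Y h (k \<odot>\<^bsub>mobj M X\<^esub> m) n \<in> carrier F" "u X Y h m n \<in> carrier F"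
      by (rule u_closed[OF a(1,2,3) Msm[OF a(1,4,6)] a(5)] u_closed[OF a(1,2,3,4,5)])+
    show ?thesis
      unfolding smult_left(1)
    proof (intro conjI impI)
      assume W: "vectorspace K W" and f: "f \<in> module_hom K F W"
        and b: "day_balanced K T M N Z W (\<lambda>X Y h m n. f (u X Y h m n))"
      show "f (u X Y h (k \<odot>\<^bsub>mobj M X\<^esub> m) n \<ominus>\<^bsub>F\<^esub> (k \<odot>\<^bsub>F\<^esub> u X Y h m n)) = \<zero>\<^bsub>W\<^esub>"
        unfolding d[OF W f v(1) cl(2)[OF v(2) a(6)]] module_hom_smult[OF f a(6) v(2)] by (rule day_balanced.smult_left[OF b a])
    qed (rule cl(3)[OF v(1) cl(2)[OF v(2) a(6)]])
  next
    case (add_right X Y h m n n')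
    note a = add_right(2-)
    have v: "u X Y h m (n \<oplus>\<^bsub>mobj N Y\<^esub> n') \<in> carrier F" "u X Y h m n \<in> carrier F" "u X Y h m n' \<in> carrier F"
      by (rule u_closed[OF a(1,2,3,4) Nadd[OF a(2,5,6)]] u_closed[OF a(1,2,3,4,5)] u_closed[OF a(1,2,3,4,6)])+
    show ?thesis
      unfolding add_right(1)
    proof (intro conjI impI)
      assume W: "vectorspace K W" and f: "f \<in> module_hom K F W"
        and b: "day_balanced K T M N Z W (\<lambda>X Y h m n. f (u X Y h m n))"
      show "f (u X Y h m (n \<oplus>\<^bsub>mobj N Y\<^esub> n') \<ominus>\<^bsub>F\<^esub> (u X Y h m n \<oplus>\<^bsub>F\<^esub> u X Y h m n')) = \<zero>\<^bsub>W\<^esub>"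
        unfolding d[OF W f v(1) cl(1)[OF v(2,3)]] module_hom_add[OF f v(2,3)] by (rule day_balanced.add_right[OF b a])
    qed (rule cl(3)[OF v(1) cl(1)[OF v(2,3)]])
  next
    case (smult_right X Y h m n k)
    note a = smult_right(2-)
    have v: "u X Y h m (k \<odot>\<^bsub>mobj N Y\<^esub> n) \<in> carrier F" "u X Y h m n \<in> carrier F"
      by (rule u_closed[OF a(1,2,3,4) Nsm[OF a(2,5,6)]] u_closed[OF a(1,2,3,4,5)])+
    show ?thesis
      unfolding smult_right(1)
    proof (intro conjI impI)
      assume W: "vectorspace K W" and f: "f \<in> module_hom K F W"
        and b: "day_balanced K T M N Z W (\<lambda>X Y h m n. f (u X Y h m n))"
      show "f (u X Y h m (k \<odot>\<^bsub>mobj N Y\<^esub> n) \<ominus>\<^bsub>F\<^esub> (k \<odot>\<^bsub>F\<^esub> u X Y h m n)) = \<zero>\<^bsub>W\<^esub>"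
        unfolding d[OF W f v(1) cl(2)[OF v(2) a(6)]] module_hom_smult[OF f a(6) v(2)] by (rule day_balanced.smult_right[OF b a])
    qed (rule cl(3)[OF v(1) cl(2)[OF v(2) a(6)]])
  next
    case (dinatural_left X X' Y g h m n)
    note a = dinatural_left(2-)
    have o: "X \<in> Obj T" "X' \<in> Obj T" using homs_Obj[OF a(1)] by auto
    have v: "u X Y (h \<cdot> (g \<boxtimes> Ident T Y)) m n \<in> carrier F" "u X' Y h (mmap M g m) n \<in> carrier F"
      by (rule u_closed[OF o(1) a(2) comp_left[OF a(1-3)] a(4,5)] u_closed[OF o(2) a(2,3) mackey_map_closed[OF M a(1,4)] a(5)])+
    show ?thesis
      unfolding dinatural_left(1)
    proof (intro conjI impI)
      assume W: "vectorspace K W" and f: "f \<in> module_hom K F W"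
        and b: "day_balanced K T M N Z W (\<lambda>X Y h m n. f (u X Y h m n))"
      show "f (u X Y (h \<cdot> (g \<boxtimes> Ident T Y)) m n \<ominus>\<^bsub>F\<^esub> u X' Y h (mmap M g m) n) = \<zero>\<^bsub>W\<^esub>"
        unfolding d[OF W f v] by (rule day_balanced.dinatural_left[OF b a])
    qed (rule cl(3)[OF v])
  next
    case (dinatural_right X Y Y' g h m n)
    note a = dinatural_right(2-)
    have o: "Y \<in> Obj T" "Y' \<in> Obj T" using homs_Obj[OF a(2)] by auto
    have v: "u X Y (h \<cdot> (Ident T X \<boxtimes> g)) m n \<in> carrier F" "u X Y' h m (mmap N g n) \<in> carrier F"
      by (rule u_closed[OF a(1) o(1) comp_right[OF a(1-3)] a(4,5)] u_closed[OF a(1) o(2) a(3,4) mackey_map_closed[OF N a(2,5)]])+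
    show ?thesis
      unfolding dinatural_right(1)
    proof (intro conjI impI)
      assume W: "vectorspace K W" and f: "f \<in> module_hom K F W"
        and b: "day_balanced K T M N Z W (\<lambda>X Y h m n. f (u X Y h m n))"
      show "f (u X Y (h \<cdot> (Ident T X \<boxtimes> g)) m n \<ominus>\<^bsub>F\<^esub> u X Y' h m (mmap N g n)) = \<zero>\<^bsub>W\<^esub>"
        unfolding d[OF W f v] by (rule day_balanced.dinatural_right[OF b a])
    qed (rule cl(3)[OF v])
  qed
qed

private lemma day_relationsI:
  shows "\<lbrakk>X \<in> Obj T; Y \<in> Obj T; h \<in> homs T (X \<boxdot> Y) Z; h' \<in> homs T (X \<boxdot> Y) Z; m \<in> carrier (mobj M X); n \<in> carrier (mobj N Y)\<rbrakk>
      \<Longrightarrow> u X Y (add_arrow T h h') m n \<ominus>\<^bsub>F\<^esub> (u X Y h m n \<oplus>\<^bsub>F\<^esub> u X Y h' m n) \<in> R"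
    and "\<lbrakk>X \<in> Obj T; Y \<in> Obj T; h \<in> homs T (X \<boxdot> Y) Z; m \<in> carrier (mobj M X); m' \<in> carrier (mobj M X); n \<in> carrier (mobj N Y)\<rbrakk>
      \<Longrightarrow> u X Y h (m \<oplus>\<^bsub>mobj M X\<^esub> m') n \<ominus>\<^bsub>F\<^esub> (u X Y h m n \<oplus>\<^bsub>F\<^esub> u X Y h m' n) \<in> R"
    and "\<lbrakk>X \<in> Obj T; Y \<in> Obj T; h \<in> homs T (X \<boxdot> Y) Z; m \<in> carrier (mobj M X); n \<in> carrier (mobj N Y); k \<in> carrier K\<rbrakk>
      \<Longrightarrow> u X Y h (k \<odot>\<^bsub>mobj M X\<^esub> m) n \<ominus>\<^bsub>F\<^esub> (k \<odot>\<^bsub>F\<^esub> u X Y h m n) \<in> R"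
    and "\<lbrakk>X \<in> Obj T; Y \<in> Obj T; h \<in> homs T (X \<boxdot> Y) Z; m \<in> carrier (mobj M X); n \<in> carrier (mobj N Y); n' \<in> carrier (mobj N Y)\<rbrakk>
      \<Longrightarrow> u X Y h m (n \<oplus>\<^bsub>mobj N Y\<^esub> n') \<ominus>\<^bsub>F\<^esub> (u X Y h m n \<oplus>\<^bsub>F\<^esub> u X Y h m n') \<in> R"
    and "\<lbrakk>X \<in> Obj T; Y \<in> Obj T; h \<in> homs T (X \<boxdot> Y) Z; m \<in> carrier (mobj M X); n \<in> carrier (mobj N Y); k \<in> carrier K\<rbrakk>
      \<Longrightarrow> u X Y h m (k \<odot>\<^bsub>mobj N Y\<^esub> n) \<ominus>\<^bsub>F\<^esub> (k \<odot>\<^bsub>F\<^esub> u X Y h m n) \<in> R"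
    and "\<lbrakk>g \<in> homs T X X'; Y \<in> Obj T; h \<in> homs T (X' \<boxdot> Y) Z; m \<in> carrier (mobj M X); n \<in> carrier (mobj N Y)\<rbrakk>
      \<Longrightarrow> u X Y (h \<cdot> (g \<boxtimes> Ident T Y)) m n \<ominus>\<^bsub>F\<^esub> u X' Y h (mmap M g m) n \<in> R"
    and "\<lbrakk>X \<in> Obj T; g \<in> homs T Y Y'; h \<in> homs T (X \<boxdot> Y') Z; m \<in> carrier (mobj M X); n \<in> carrier (mobj N Y)\<rbrakk>
      \<Longrightarrow> u X Y (h \<cdot> (Ident T X \<boxtimes> g)) m n \<ominus>\<^bsub>F\<^esub> u X Y' h m (mmap N g n) \<in> R"
  unfolding day_relations_def Let_def day_generators_iff
  subgoal by ((rule UnI1,rule UnI1,rule UnI1,rule UnI1,rule UnI1,rule UnI1), rule CollectI, intro exI conjI, rule refl, assumption+)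
  subgoal by ((rule UnI1,rule UnI1,rule UnI1,rule UnI1,rule UnI1,rule UnI2), rule CollectI, intro exI conjI, rule refl, assumption+)
  subgoal by ((rule UnI1,rule UnI1,rule UnI1,rule UnI1,rule UnI2), rule CollectI, intro exI conjI, rule refl, assumption+)
  subgoal by ((rule UnI1,rule UnI1,rule UnI1,rule UnI2), rule CollectI, intro exI conjI, rule refl, assumption+)
  subgoal by ((rule UnI1,rule UnI1,rule UnI2), rule CollectI, intro exI conjI, rule refl, assumption+)
  subgoal by ((rule UnI1,rule UnI2), rule CollectI, intro exI conjI, rule refl, assumption+)
  subgoal by ((rule UnI2), rule CollectI, intro exI conjI, rule refl, assumption+)
  done

text \<open>Converse of \<open>day_relation_vanishes\<close>: each relation, read as an equation, is
  one of the laws. Applied to the quotient map it shows that the classes of the generators are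
  balanced.\<close>

private lemma day_relations_balanced:
  assumes W: "vectorspace K W" and f: "f \<in> module_hom K F W" and R: "\<And>r. r \<in> R \<Longrightarrow> f r = \<zero>\<^bsub>W\<^esub>"
  shows "day_balanced K T M N Z W (\<lambda>X Y h m n. f (u X Y h m n))"
proof
  note cl = vectorspace_closed[OF F_vectorspace] and d = module_hom_diff_eq_zero[OF F_vectorspace W f]
  show "f (u X Y h m n) \<in> carrier W"
    if "X \<in> Obj T" "Y \<in> Obj T" "h \<in> homs T (X \<boxdot> Y) Z" "m \<in> carrier (mobj M X)" "n \<in> carrier (mobj N Y)" for X Y h m n
    by (rule module_hom_carrier[OF f u_closed[OF that]])
  show "f (u X Y (add_arrow T h h') m n) = f (u X Y h m n) \<oplus>\<^bsub>W\<^esub> f (u X Y h' m n)"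
    if a: "X \<in> Obj T" "Y \<in> Obj T" "h \<in> homs T (X \<boxdot> Y) Z" "h' \<in> homs T (X \<boxdot> Y) Z" "m \<in> carrier (mobj M X)"
      "n \<in> carrier (mobj N Y)" for X Y h h' m n
  proof -
    have v: "u X Y (add_arrow T h h') m n \<in> carrier F" "u X Y h m n \<in> carrier F" "u X Y h' m n \<in> carrier F"
      by (rule u_closed[OF a(1,2) add_arrow_closed[OF a(3,4)] a(5,6)] u_closed[OF a(1,2,3,5,6)] u_closed[OF a(1,2,4,5,6)])+
    have "u X Y (add_arrow T h h') m n \<ominus>\<^bsub>F\<^esub> (u X Y h m n \<oplus>\<^bsub>F\<^esub> u X Y h' m n) \<in> R"
      by (rule day_relationsI(1)[OF a])
    from R[OF this] show ?thesis
      unfolding d[OF v(1) cl(1)[OF v(2,3)]] module_hom_add[OF f v(2,3)] .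
  qed
  show "f (u X Y h (m \<oplus>\<^bsub>mobj M X\<^esub> m') n) = f (u X Y h m n) \<oplus>\<^bsub>W\<^esub> f (u X Y h m' n)"
    if a: "X \<in> Obj T" "Y \<in> Obj T" "h \<in> homs T (X \<boxdot> Y) Z" "m \<in> carrier (mobj M X)" "m' \<in> carrier (mobj M X)"
      "n \<in> carrier (mobj N Y)" for X Y h m m' n
  proof -
    have v: "u X Y h (m \<oplus>\<^bsub>mobj M X\<^esub> m') n \<in> carrier F" "u X Y h m n \<in> carrier F" "u X Y h m' n \<in> carrier F"
      by (rule u_closed[OF a(1,2,3) Madd[OF a(1,4,5)] a(6)] u_closed[OF a(1,2,3,4,6)] u_closed[OF a(1,2,3,5,6)])+
    have "u X Y h (m \<oplus>\<^bsub>mobj M X\<^esub> m') n \<ominus>\<^bsub>F\<^esub> (u X Y h m n \<oplus>\<^bsub>F\<^esub> u X Y h m' n) \<in> R"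
      by (rule day_relationsI(2)[OF a])
    from R[OF this] show ?thesis
      unfolding d[OF v(1) cl(1)[OF v(2,3)]] module_hom_add[OF f v(2,3)] .
  qed
  show "f (u X Y h (k \<odot>\<^bsub>mobj M X\<^esub> m) n) = k \<odot>\<^bsub>W\<^esub> f (u X Y h m n)"
    if a: "X \<in> Obj T" "Y \<in> Obj T" "h \<in> homs T (X \<boxdot> Y) Z" "m \<in> carrier (mobj M X)" "n \<in> carrier (mobj N Y)"
      "k \<in> carrier K" for X Y h m n k
  proof -
    have v: "u X Y h (k \<odot>\<^bsub>mobj M X\<^esub> m) n \<in> carrier F" "u X Y h m n \<in> carrier F"
      by (rule u_closed[OF a(1,2,3) Msm[OF a(1,4,6)] a(5)] u_closed[OF a(1,2,3,4,5)])+
    have "u X Y h (k \<odot>\<^bsub>mobj M X\<^esub> m) n \<ominus>\<^bsub>F\<^esub> (k \<odot>\<^bsub>F\<^esub> u X Y h m n) \<in> R"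
      by (rule day_relationsI(3)[OF a])
    from R[OF this] show ?thesis
      unfolding d[OF v(1) cl(2)[OF v(2) a(6)]] module_hom_smult[OF f a(6) v(2)] .
  qed
  show "f (u X Y h m (n \<oplus>\<^bsub>mobj N Y\<^esub> n')) = f (u X Y h m n) \<oplus>\<^bsub>W\<^esub> f (u X Y h m n')"
    if a: "X \<in> Obj T" "Y \<in> Obj T" "h \<in> homs T (X \<boxdot> Y) Z" "m \<in> carrier (mobj M X)" "n \<in> carrier (mobj N Y)"
      "n' \<in> carrier (mobj N Y)" for X Y h m n n'
  proof -
    have v: "u X Y h m (n \<oplus>\<^bsub>mobj N Y\<^esub> n') \<in> carrier F" "u X Y h m n \<in> carrier F" "u X Y h m n' \<in> carrier F"
      by (rule u_closed[OF a(1,2,3,4) Nadd[OF a(2,5,6)]] u_closed[OF a(1,2,3,4,5)] u_closed[OF a(1,2,3,4,6)])+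
    have "u X Y h m (n \<oplus>\<^bsub>mobj N Y\<^esub> n') \<ominus>\<^bsub>F\<^esub> (u X Y h m n \<oplus>\<^bsub>F\<^esub> u X Y h m n') \<in> R"
      by (rule day_relationsI(4)[OF a])
    from R[OF this] show ?thesis
      unfolding d[OF v(1) cl(1)[OF v(2,3)]] module_hom_add[OF f v(2,3)] .
  qed
  show "f (u X Y h m (k \<odot>\<^bsub>mobj N Y\<^esub> n)) = k \<odot>\<^bsub>W\<^esub> f (u X Y h m n)"
    if a: "X \<in> Obj T" "Y \<in> Obj T" "h \<in> homs T (X \<boxdot> Y) Z" "m \<in> carrier (mobj M X)" "n \<in> carrier (mobj N Y)"
      "k \<in> carrier K" for X Y h m n k
  proof -
    have v: "u X Y h m (k \<odot>\<^bsub>mobj N Y\<^esub> n) \<in> carrier F" "u X Y h m n \<in> carrier F"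
      by (rule u_closed[OF a(1,2,3,4) Nsm[OF a(2,5,6)]] u_closed[OF a(1,2,3,4,5)])+
    have "u X Y h m (k \<odot>\<^bsub>mobj N Y\<^esub> n) \<ominus>\<^bsub>F\<^esub> (k \<odot>\<^bsub>F\<^esub> u X Y h m n) \<in> R"
      by (rule day_relationsI(5)[OF a])
    from R[OF this] show ?thesis
      unfolding d[OF v(1) cl(2)[OF v(2) a(6)]] module_hom_smult[OF f a(6) v(2)] .
  qed
  show "f (u X Y (h \<cdot> (g \<boxtimes> Ident T Y)) m n) = f (u X' Y h (mmap M g m) n)"
    if a: "g \<in> homs T X X'" "Y \<in> Obj T" "h \<in> homs T (X' \<boxdot> Y) Z" "m \<in> carrier (mobj M X)" "n \<in> carrier (mobj N Y)"
    for X X' Y g h m n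
  proof -
    have o: "X \<in> Obj T" "X' \<in> Obj T" using homs_Obj[OF a(1)] by auto
    have v: "u X Y (h \<cdot> (g \<boxtimes> Ident T Y)) m n \<in> carrier F" "u X' Y h (mmap M g m) n \<in> carrier F"
      by (rule u_closed[OF o(1) a(2) comp_left[OF a(1-3)] a(4,5)] u_closed[OF o(2) a(2,3) mackey_map_closed[OF M a(1,4)] a(5)])+
    have "u X Y (h \<cdot> (g \<boxtimes> Ident T Y)) m n \<ominus>\<^bsub>F\<^esub> u X' Y h (mmap M g m) n \<in> R"
      by (rule day_relationsI(6)[OF a])
    from R[OF this] show ?thesis unfolding d[OF v] .
  qed
  show "f (u X Y (h \<cdot> (Ident T X \<boxtimes> g)) m n) = f (u X Y' h m (mmap N g n))"
    if a: "X \<in> Obj T" "g \<in> homs T Y Y'" "h \<in> homs T (X \<boxdot> Y') Z" "m \<in> carrier (mobj M X)" "n \<in> carrier (mobj N Y)"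
    for X Y Y' g h m n
  proof -
    have o: "Y \<in> Obj T" "Y' \<in> Obj T" using homs_Obj[OF a(2)] by auto
    have v: "u X Y (h \<cdot> (Ident T X \<boxtimes> g)) m n \<in> carrier F" "u X Y' h m (mmap N g n) \<in> carrier F"
      by (rule u_closed[OF a(1) o(1) comp_right[OF a(1-3)] a(4,5)] u_closed[OF a(1) o(2) a(3,4) mackey_map_closed[OF N a(2,5)]])+
    have "u X Y (h \<cdot> (Ident T X \<boxtimes> g)) m n \<ominus>\<^bsub>F\<^esub> u X Y' h m (mmap N g n) \<in> R"
      by (rule day_relationsI(7)[OF a])
    from R[OF this] show ?thesis unfolding d[OF v] .
  qed
qed

private abbreviation "P \<equiv> day_space K T M N Z"
private abbreviation p where "p X Y h m n \<equiv> presented_gen K G R (X, Y, h, m, n)"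

private lemma R_subset: "R \<subseteq> carrier F"
  by (rule subsetI) (rule conjunct1[OF day_relation_vanishes])

lemma day_space_vectorspace: "vectorspace K (day_space K T M N Z)"
  unfolding day_space_def by (rule presented_vectorspace[OF K.field_axioms R_subset])

lemma day_space_spans:
  "spans K (day_space K T M N Z) (presented_gen K (day_generators T M N Z) (day_relations K T M N Z) ` day_generators T M N Z)"
  unfolding day_space_def by (rule presented_spans[OF K.field_axioms R_subset])

lemma day_space_balanced: "day_balanced K T M N Z (day_space K T M N Z)
    (\<lambda>X Y h m n. presented_gen K (day_generators T M N Z) (day_relations K T M N Z) (X, Y, h, m, n))"
proof -
  note r = presented_relation[OF K.field_axioms R_subset refl, folded day_space_def]
  show ?thesis
    using day_relations_balanced[OF day_space_vectorspace conjunct1[OF r] bspec[OF conjunct2[OF conjunct2[OF r]]]]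
    unfolding spec[OF conjunct1[OF conjunct2[OF r]]] .
qed

text \<open>Balanced families are what the presented space represents: c extends linearly to the
  free module, and the extension kills every relation.\<close>

lemma day_space_lift:
  assumes W: "vectorspace K W" and c: "day_balanced K T M N Z W c"
  obtains t where "t \<in> module_hom K (day_space K T M N Z) W"
    "\<And>X Y h m n. (X, Y, h, m, n) \<in> day_generators T M N Z \<Longrightarrow>
      t (presented_gen K (day_generators T M N Z) (day_relations K T M N Z) (X, Y, h, m, n)) = c X Y h m n"
proof -
  interpret c: day_balanced K T M N Z W c by (rule c)
  have cl: "(case g of (X, Y, h, m, n) \<Rightarrow> c X Y h m n) \<in> carrier W" if "g \<in> G" for g
    using that by (cases g) (simp add: day_generators_iff c.closed)
  obtain L where L: "L \<in> module_hom K F W"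
    and Lu: "\<And>g. g \<in> G \<Longrightarrow> L (unit_vector K g) = (case g of (X, Y, h, m, n) \<Rightarrow> c X Y h m n)"
  proof (rule free_module_lift[where c = "\<lambda>g. case g of (X, Y, h, m, n) \<Rightarrow> c X Y h m n" and G = G, OF K.field_axioms W])
    show "(case g of (X, Y, h, m, n) \<Rightarrow> c X Y h m n) \<in> carrier W" if "g \<in> G" for g by (rule cl[OF that])
  qed (rule that)
  have Lu: "L (u X Y h m n) = c X Y h m n"
    if "X \<in> Obj T" "Y \<in> Obj T" "h \<in> homs T (X \<boxdot> Y) Z" "m \<in> carrier (mobj M X)" "n \<in> carrier (mobj N Y)" for X Y h m n
    using Lu[of "(X, Y, h, m, n)"] that by (simp add: day_generators_iff)
  \<comment> \<open>L agrees with c only on actual generators, so each law also needs the closure of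
    its arguments under the operations involved.\<close>
  have "day_balanced K T M N Z W (\<lambda>X Y h m n. L (u X Y h m n))"
  proof
    show "L (u X Y (h \<cdot> (f \<boxtimes> Ident T Y)) m n) = L (u X' Y h (mmap M f m) n)"
      if a: "f \<in> homs T X X'" "Y \<in> Obj T" "h \<in> homs T (X' \<boxdot> Y) Z" "m \<in> carrier (mobj M X)" "n \<in> carrier (mobj N Y)"
      for X X' Y f h m n
      using Lu[OF _ a(2) comp_left[OF a(1-3)] a(4,5)] Lu[OF _ a(2,3) mackey_map_closed[OF M a(1,4)] a(5)]
        homs_Obj[OF a(1)] c.dinatural_left[OF a] by simp
    show "L (u X Y (h \<cdot> (Ident T X \<boxtimes> g)) m n) = L (u X Y' h m (mmap N g n))"
      if a: "X \<in> Obj T" "g \<in> homs T Y Y'" "h \<in> homs T (X \<boxdot> Y') Z" "m \<in> carrier (mobj M X)" "n \<in> carrier (mobj N Y)"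
      for X Y Y' g h m n
      using Lu[OF a(1) _ comp_right[OF a(1-3)] a(4,5)] Lu[OF a(1) _ a(3,4) mackey_map_closed[OF N a(2,5)]]
        homs_Obj[OF a(2)] c.dinatural_right[OF a] by simp
  qed (simp_all add: Lu c.closed c.add_hom c.add_left c.smult_left c.add_right c.smult_right add_arrow_closed Madd Msm Nadd Nsm)
  then have L0: "L r = \<zero>\<^bsub>W\<^esub>" if "r \<in> R" for r
    by (rule mp[OF mp[OF mp[OF conjunct2[OF day_relation_vanishes[OF that]] W] L]])
  from presented_lift[OF K.field_axioms R_subset W L L0]
  obtain t where t: "t \<in> module_hom K (presented_space K G R) W" "\<And>g. g \<in> G \<Longrightarrow> t (presented_gen K G R g) = L (unit_vector K g)"
    by blast
  show ?thesis
    by (rule that[of t]) (use t Lu in \<open>simp_all add: day_space_def day_generators_iff\<close>)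
qed

end

end


lemma linear_mapsI: "\<lbrakk>vectorspace K V; f \<in> module_hom K V W\<rbrakk> \<Longrightarrow> restrict f (carrier V) \<in> linear_maps K V W"
  by (auto simp: linear_maps_def module_hom_def vectorspace_closed)

lemma linear_mapsD: "f \<in> linear_maps K V W \<Longrightarrow> f \<in> module_hom K V W" "f \<in> linear_maps K V W \<Longrightarrow> f \<in> extensional (carrier V)"
  by (simp_all add: linear_maps_def)

lemma linear_maps_spans_eq:
  assumes "spans K V A" "vectorspace K V" "vectorspace K W" "f \<in> linear_maps K V W" "g \<in> linear_maps K V W"
    "\<And>x. x \<in> A \<Longrightarrow> f x = g x"
  shows "f = g"
  by (rule extensionalityI[OF linear_mapsD(2)[OF assms(4)] linear_mapsD(2)[OF assms(5)]])
    (rule spans_module_hom_eq[OF assms(1-3) linear_mapsD(1)[OF assms(4)] linear_mapsD(1)[OF assms(5)] assms(6)])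

lemma module_hom_comp: "\<lbrakk>f \<in> module_hom K U V; g \<in> module_hom K V W\<rbrakk> \<Longrightarrow> (\<lambda>x. g (f x)) \<in> module_hom K U W"
  by (rule module_homI) (simp_all add: module_hom_carrier module_hom_add module_hom_smult)

lemma (in category) comp_assoc_homs:
  "\<lbrakk>f \<in> homs C A B; g \<in> homs C B D; h \<in> homs C D E\<rbrakk> \<Longrightarrow> h \<cdot> (g \<cdot> f) = (h \<cdot> g) \<cdot> f"
  by (rule Comp_assoc[symmetric])

section \<open>Finite dimension and functoriality of the Day convolution\<close>

context mackey_setting
begin

text \<open>Finite dimension supplies the injection into \<open>'v\<close> and is inherited by the
  copy, so constructions can be iterated.\<close>

lemma copy_of_fin_dim:
  fixes V :: "('k, 'w, 'y) module_scheme" and j :: "'w \<Rightarrow> 'v" and c :: "('k, 'v) module"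
  assumes V: "vectorspace K V" and fd: "vectorspace.fin_dim K V"
  defines "j \<equiv> copy_map V" and "c \<equiv> copy V"
  shows "vectorspace K c" "vectorspace.fin_dim K c" "j \<in> module_hom K V c" "carrier c = j ` carrier V"
    "inj_on j (carrier V)" "inv_into (carrier V) j \<in> module_hom K c V"
proof -
  obtain i :: "'w \<Rightarrow> 'v" where i: "inj_on i (carrier V)"
    by (rule inj_on_of_fin_dim[OF V fd e_inj])
  note c = copy_vectorspace[OF V i, folded j_def c_def]
  show "vectorspace K c" "j \<in> module_hom K V c" "carrier c = j ` carrier V"
    "inj_on j (carrier V)" "inv_into (carrier V) j \<in> module_hom K c V"
    by (fact c)+
  obtain A where "finite A" "spans K V A" using fin_dim_iff_spans[OF V] fd by blast
  then have "finite (j ` A)" "spans K c (j ` A)"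
    using spans_image[OF _ c(2,3) V c(1)] by simp_all
  then show "vectorspace.fin_dim K c" using fin_dim_iff_spans[OF c(1)] by blast
qed

lemma fin_mackey_spans:
  assumes "fin_mackey M" "X \<in> Obj T"
  shows "\<exists>B. finite B \<and> spans K (mobj M X) B"
  using fin_mackeyD[OF assms(1)] fin_dim_iff_spans[OF mackey_functorD(1)[OF _ assms(2)]] assms(2) by blast

text \<open>Over pairs of objects of the finite set \<C>, the generators with h in a finite
  generating set and m, n in finite spanning sets form a finite family; \<open>day_generated\<close>
  shows that it spans.\<close>

lemma day_space_fin_dim:
  assumes M: "fin_mackey M" and N: "fin_mackey N" and Z: "Z \<in> Obj T"
  shows "vectorspace.fin_dim K (day_space K T M N Z)"
proof -
  note M' = fin_mackeyD(1)[OF M] and N' = fin_mackeyD(1)[OF N]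
  note V = day_space_vectorspace[OF M' N' Z]
  let ?Q = "\<lambda>X Y F. finite F \<and> F \<subseteq> homs T (X \<boxdot> Y) Z \<and> (\<forall>H. H \<subseteq> homs T (X \<boxdot> Y) Z \<longrightarrow> F \<subseteq> H \<longrightarrow>
      zero_arrow T (X \<boxdot> Y) Z \<in> H \<longrightarrow> (\<forall>f\<in>H. \<forall>g\<in>H. add_arrow T f g \<in> H) \<longrightarrow> H = homs T (X \<boxdot> Y) Z)"
  \<comment> \<open>Generators are available for each hom monoid separately, whereas
    \<open>day_generated\<close> expects them as a function of the two objects.\<close>
  define F where "F X Y = (SOME F. ?Q X Y F)" for X Y
  have F: "?Q X Y (F X Y)" if "X \<in> \<C>" "Y \<in> \<C>" for X Y
    unfolding F_def
  proof (rule someI_ex)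
    have o: "X \<boxdot> Y \<in> Obj T" using that C_subset tobj_closed by blast
    show "\<exists>F. ?Q X Y F"
    proof (rule hom_monoid_generators[OF o Z])
      fix F
      assume f: "finite F" "F \<subseteq> homs T (X \<boxdot> Y) Z"
        and g: "\<And>H. \<lbrakk>H \<subseteq> homs T (X \<boxdot> Y) Z; F \<subseteq> H; zero_arrow T (X \<boxdot> Y) Z \<in> H;
          \<And>f g. \<lbrakk>f \<in> H; g \<in> H\<rbrakk> \<Longrightarrow> add_arrow T f g \<in> H\<rbrakk> \<Longrightarrow> H = homs T (X \<boxdot> Y) Z"
      have "H = homs T (X \<boxdot> Y) Z" if "H \<subseteq> homs T (X \<boxdot> Y) Z" "F \<subseteq> H" "zero_arrow T (X \<boxdot> Y) Z \<in> H"
        "\<forall>f\<in>H. \<forall>g\<in>H. add_arrow T f g \<in> H" for H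
        by (rule g[OF that(1-3)]) (use that(4) in simp)
      with f show ?thesis by (intro exI[of _ F] conjI allI impI)
    qed
  qed
  have F1: "finite (F X Y)" and F2: "F X Y \<subseteq> homs T (X \<boxdot> Y) Z" if "X \<in> \<C>" "Y \<in> \<C>" for X Y
    by (rule conjunct1[OF F[OF that]] conjunct1[OF conjunct2[OF F[OF that]]])+
  define B where "B X = (SOME B. finite B \<and> spans K (mobj M X) B)" for X
  have B: "finite (B X)" "spans K (mobj M X) (B X)" if "X \<in> \<C>" for X
    using someI_ex[OF fin_mackey_spans[OF M subsetD[OF C_subset that]]] by (simp_all add: B_def)
  define B' where "B' X = (SOME B. finite B \<and> spans K (mobj N X) B)" for X
  have B': "finite (B' X)" "spans K (mobj N X) (B' X)" if "X \<in> \<C>" for X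
    using someI_ex[OF fin_mackey_spans[OF N subsetD[OF C_subset that]]] by (simp_all add: B'_def)
  let ?p = "\<lambda>X Y h m n. presented_gen K (day_generators T M N Z) (day_relations K T M N Z) (X, Y, h, m, n)"
  let ?D = "\<Union>X\<in>\<C>. \<Union>Y\<in>\<C>. (\<lambda>(h, m, n). ?p X Y h m n) ` (F X Y \<times> B X \<times> B' Y)"
  have "finite ?D" by (intro finite_UN_I finite_imageI finite_cartesian_product finite_C F1 B(1) B'(1))
  moreover have "spans K (day_space K T M N Z) ?D"
    unfolding spans_def
  proof (intro conjI allI impI)
    interpret b: day_balanced K T M N Z "day_space K T M N Z" ?p by (rule day_space_balanced[OF M' N' Z])
    show "?D \<subseteq> carrier (day_space K T M N Z)"
    proof clarify
      fix X Y h m n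
      assume a: "X \<in> \<C>" "Y \<in> \<C>" "h \<in> F X Y" "m \<in> B X" "n \<in> B' Y"
      have "m \<in> carrier (mobj M X)" "n \<in> carrier (mobj N Y)" "h \<in> homs T (X \<boxdot> Y) Z" "X \<in> Obj T" "Y \<in> Obj T"
        using a F2[OF a(1,2)] B(2)[OF a(1)] B'(2)[OF a(2)] C_subset by (auto simp: spans_def)
      then show "?p X Y h m n \<in> carrier (day_space K T M N Z)" using b.closed by blast
    qed
    fix H assume H: "linear_closed K (day_space K T M N Z) H" and sub: "?D \<subseteq> H"
    have "?p X Y h m n \<in> H" if a: "X \<in> Obj T" "Y \<in> Obj T" "h \<in> homs T (X \<boxdot> Y) Z" "m \<in> carrier (mobj M X)"
      "n \<in> carrier (mobj N Y)" for X Y h m n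
    proof (rule day_generated[OF b.day_balanced_axioms M' N' V H Z, where F = F and B = B and B' = B', OF _ _ _ _ _ a])
      show "S = homs T (X \<boxdot> Y) Z" if "X \<in> \<C>" "Y \<in> \<C>" "S \<subseteq> homs T (X \<boxdot> Y) Z" "F X Y \<subseteq> S"
        "zero_arrow T (X \<boxdot> Y) Z \<in> S" "\<And>f g. \<lbrakk>f \<in> S; g \<in> S\<rbrakk> \<Longrightarrow> add_arrow T f g \<in> S" for X Y S
        using conjunct2[OF conjunct2[OF F[OF that(1,2)]], rule_format, OF that(3-5)] that(6) by simp
      show "F X Y \<subseteq> homs T (X \<boxdot> Y) Z" if "X \<in> \<C>" "Y \<in> \<C>" for X Y by (rule F2[OF that])
      show "?p X Y h m n \<in> H" if "X \<in> \<C>" "Y \<in> \<C>" "h \<in> F X Y" "m \<in> B X" "n \<in> B' Y" for X Y h m n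
        by (rule subsetD[OF sub]) (use that in force)
    qed (rule B(2) B'(2), assumption)+
    then show "H = carrier (day_space K T M N Z)"
      by (intro spansD[OF day_space_spans[OF M' N' Z] H]) (auto simp: day_generators_iff)
  qed
  ultimately show ?thesis using fin_dim_iff_spans[OF V] by blast
qed

text \<open>Composing the arrow argument with g preserves all relations; applied to the classes of
  generators, this yields the map that M * N assigns to g.\<close>

lemma day_balanced_postcomp:
  assumes "day_balanced K T M N Z' W c" and g: "g \<in> homs T Z Z'"
  shows "day_balanced K T M N Z W (\<lambda>X Y h m n. c X Y (g \<cdot> h) m n)"
proof -
  interpret c: day_balanced K T M N Z' W c by (rule assms)
  note gc = Comp_closed[OF _ g]
  show ?thesis
  proof
    show "c X Y (g \<cdot> (h \<cdot> (f \<boxtimes> Ident T Y))) m n = c X' Y (g \<cdot> h) (mmap M f m) n"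
      if a: "f \<in> homs T X X'" "Y \<in> Obj T" "h \<in> homs T (X' \<boxdot> Y) Z" "m \<in> carrier (mobj M X)" "n \<in> carrier (mobj N Y)"
      for X X' Y f h m n
      unfolding comp_assoc_homs[OF tarr_closed[OF a(1) Ident_closed[OF a(2)]] a(3) g]
      by (rule c.dinatural_left[OF a(1,2) gc[OF a(3)] a(4,5)])
    show "c X Y (g \<cdot> (h \<cdot> (Ident T X \<boxtimes> f))) m n = c X Y' (g \<cdot> h) m (mmap N f n)"
      if a: "X \<in> Obj T" "f \<in> homs T Y Y'" "h \<in> homs T (X \<boxdot> Y') Z" "m \<in> carrier (mobj M X)" "n \<in> carrier (mobj N Y)"
      for X Y Y' f h m n
      unfolding comp_assoc_homs[OF tarr_closed[OF Ident_closed[OF a(1)] a(2)] a(3) g]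
      by (rule c.dinatural_right[OF a(1,2) gc[OF a(3)] a(4,5)])
  qed (simp_all only: gc comp_add_arrow[OF _ _ g] c.closed c.add_hom c.add_left c.smult_left c.add_right c.smult_right)
qed

lemma natural_transformationD:
  assumes "natural_transformation K T M N \<tau>"
  shows "\<tau> \<in> extensional (Obj T)" "X \<in> Obj T \<Longrightarrow> \<tau> X \<in> linear_maps K (mobj M X) (mobj N X)"
    "X \<in> Obj T \<Longrightarrow> \<tau> X \<in> module_hom K (mobj M X) (mobj N X)"
    "\<lbrakk>f \<in> homs T X Y; x \<in> carrier (mobj M X)\<rbrakk> \<Longrightarrow> \<tau> Y (mmap M f x) = mmap N f (\<tau> X x)"
    "\<lbrakk>X \<in> Obj T; x \<in> carrier (mobj M X)\<rbrakk> \<Longrightarrow> \<tau> X x \<in> carrier (mobj N X)"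
    "\<lbrakk>X \<in> Obj T; x \<in> carrier (mobj M X); y \<in> carrier (mobj M X)\<rbrakk> \<Longrightarrow> \<tau> X (x \<oplus>\<^bsub>mobj M X\<^esub> y) = \<tau> X x \<oplus>\<^bsub>mobj N X\<^esub> \<tau> X y"
    "\<lbrakk>X \<in> Obj T; k \<in> carrier K; x \<in> carrier (mobj M X)\<rbrakk> \<Longrightarrow> \<tau> X (k \<odot>\<^bsub>mobj M X\<^esub> x) = k \<odot>\<^bsub>mobj N X\<^esub> \<tau> X x"
proof -
  note n = assms[unfolded natural_transformation_def]
  show "\<tau> \<in> extensional (Obj T)" by (rule conjunct1[OF n])
  show l: "\<tau> X \<in> linear_maps K (mobj M X) (mobj N X)" if "X \<in> Obj T" for X
    by (rule bspec[OF conjunct1[OF conjunct2[OF n]] that])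
  show "\<lbrakk>f \<in> homs T X Y; x \<in> carrier (mobj M X)\<rbrakk> \<Longrightarrow> \<tau> Y (mmap M f x) = mmap N f (\<tau> X x)"
    using conjunct2[OF conjunct2[OF n]] by blast
  show h: "\<tau> X \<in> module_hom K (mobj M X) (mobj N X)" if "X \<in> Obj T" for X
    by (rule linear_mapsD(1)[OF l[OF that]])
  show "\<lbrakk>X \<in> Obj T; x \<in> carrier (mobj M X)\<rbrakk> \<Longrightarrow> \<tau> X x \<in> carrier (mobj N X)"
    by (rule module_hom_carrier[OF h])
  show "\<lbrakk>X \<in> Obj T; x \<in> carrier (mobj M X); y \<in> carrier (mobj M X)\<rbrakk> \<Longrightarrow> \<tau> X (x \<oplus>\<^bsub>mobj M X\<^esub> y) = \<tau> X x \<oplus>\<^bsub>mobj N X\<^esub> \<tau> X y"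
    by (rule module_hom_add[OF h])
  show "\<lbrakk>X \<in> Obj T; k \<in> carrier K; x \<in> carrier (mobj M X)\<rbrakk> \<Longrightarrow> \<tau> X (k \<odot>\<^bsub>mobj M X\<^esub> x) = k \<odot>\<^bsub>mobj N X\<^esub> \<tau> X x"
    by (rule module_hom_smult[OF h])
qed

text \<open>Counterpart for morphisms in M and N: naturality of \<sigma> and \<tau> matches the two
  dinaturality relations. It yields the components of \<open>day_arrow\<close>.\<close>

lemma day_balanced_map:
  assumes c: "day_balanced K T M' N' Z W c" and s: "natural_transformation K T M M' \<sigma>"
    and t: "natural_transformation K T N N' \<tau>"
  shows "day_balanced K T M N Z W (\<lambda>X Y h m n. c X Y h (\<sigma> X m) (\<tau> Y n))"
proof -
  interpret c: day_balanced K T M' N' Z W c by (rule c)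
  note s = natural_transformationD[OF s] and t = natural_transformationD[OF t]
  show ?thesis
  proof
    show "c X Y (h \<cdot> (f \<boxtimes> Ident T Y)) (\<sigma> X m) (\<tau> Y n) = c X' Y h (\<sigma> X' (mmap M f m)) (\<tau> Y n)"
      if a: "f \<in> homs T X X'" "Y \<in> Obj T" "h \<in> homs T (X' \<boxdot> Y) Z" "m \<in> carrier (mobj M X)" "n \<in> carrier (mobj N Y)"
      for X X' Y f h m n
      using c.dinatural_left[OF a(1-3) s(5)[OF conjunct1[OF homs_Obj[OF a(1)]] a(4)] t(5)[OF a(2,5)]] s(4)[OF a(1,4)] by simp
    show "c X Y (h \<cdot> (Ident T X \<boxtimes> f)) (\<sigma> X m) (\<tau> Y n) = c X Y' h (\<sigma> X m) (\<tau> Y' (mmap N f n))"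
      if a: "X \<in> Obj T" "f \<in> homs T Y Y'" "h \<in> homs T (X \<boxdot> Y') Z" "m \<in> carrier (mobj M X)" "n \<in> carrier (mobj N Y)"
      for X Y Y' f h m n
      using c.dinatural_right[OF a(1-3) s(5)[OF a(1,4)] t(5)[OF conjunct1[OF homs_Obj[OF a(2)]] a(5)]] t(4)[OF a(2,5)] by simp
  qed (simp_all only: s(5-7) t(5-7) c.closed c.add_hom c.add_left c.smult_left c.add_right c.smult_right)
qed

context
  fixes M N :: "('o, 'a, 'k, 'v) mackey"
  assumes M: "fin_mackey M" and N: "fin_mackey N"
begin

private abbreviation D where "D \<equiv> mobj (day K T M N)"
private abbreviation cls where "cls \<equiv> day_class K T M N"

private lemma D_eq: "D Z = copy (day_space K T M N Z)"
  by (simp add: day_def)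

private lemmas day_space_facts = day_space_vectorspace[OF fin_mackeyD(1)[OF M] fin_mackeyD(1)[OF N]]
  day_space_fin_dim[OF M N]

private lemmas copy_day = copy_of_fin_dim[OF day_space_facts, folded D_eq]

lemma day_vectorspace: "Z \<in> Obj T \<Longrightarrow> vectorspace K (mobj (day K T M N) Z)"
  and day_fin_dim: "Z \<in> Obj T \<Longrightarrow> vectorspace.fin_dim K (mobj (day K T M N) Z)"
  by (rule copy_day; assumption)+

lemma day_class_balanced:
  assumes "Z \<in> Obj T"
  shows "day_balanced K T M N Z (mobj (day K T M N) Z) (day_class K T M N Z)"
  using day_balanced.hom_comp[OF day_space_balanced[OF fin_mackeyD(1)[OF M] fin_mackeyD(1)[OF N] assms]
      copy_day(3)[OF assms assms]]
  unfolding day_class_def[abs_def] .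

lemma day_spans:
  assumes "Z \<in> Obj T"
  shows "spans K (mobj (day K T M N) Z) ((\<lambda>(X, Y, h, m, n). day_class K T M N Z X Y h m n) ` day_generators T M N Z)"
  using spans_image[OF day_space_spans[OF fin_mackeyD(1)[OF M] fin_mackeyD(1)[OF N] assms] copy_day(3,4)[OF assms assms]
      day_space_facts(1)[OF assms] copy_day(1)[OF assms assms]]
  by (simp add: image_image day_class_def case_prod_unfold)

lemma day_hom_eqI:
  assumes Z: "Z \<in> Obj T" and W: "vectorspace K W" and f: "f \<in> module_hom K (mobj (day K T M N) Z) W"
    and g: "g \<in> module_hom K (mobj (day K T M N) Z) W"
    and eq: "\<And>X Y h m n. \<lbrakk>X \<in> Obj T; Y \<in> Obj T; h \<in> homs T (X \<boxdot> Y) Z; m \<in> carrier (mobj M X); n \<in> carrier (mobj N Y)\<rbrakk>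
      \<Longrightarrow> f (day_class K T M N Z X Y h m n) = g (day_class K T M N Z X Y h m n)"
    and x: "x \<in> carrier (mobj (day K T M N) Z)"
  shows "f x = g x"
  by (rule spans_module_hom_eq[OF day_spans[OF Z] day_vectorspace[OF Z] W f g _ x])
    (clarsimp simp: day_generators_iff eq)

text \<open>\<open>day\<close> and \<open>day_arrow\<close> describe linear maps by their values on
  generators. Such a description denotes: existence is the universal property read through the
  inverse of \<open>copy_map\<close>, uniqueness holds because the classes span.\<close>

lemma day_linear_map_The:
  assumes Z: "Z \<in> Obj T" and W: "vectorspace K W" and c: "day_balanced K T M N Z W c"
  defines "t \<equiv> THE t. t \<in> linear_maps K (mobj (day K T M N) Z) W \<and>
    (\<forall>X Y h m n. (X, Y, h, m, n) \<in> day_generators T M N Z \<longrightarrow> t (day_class K T M N Z X Y h m n) = c X Y h m n)"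
  shows "t \<in> linear_maps K (mobj (day K T M N) Z) W"
    "\<And>X Y h m n. \<lbrakk>X \<in> Obj T; Y \<in> Obj T; h \<in> homs T (X \<boxdot> Y) Z; m \<in> carrier (mobj M X); n \<in> carrier (mobj N Y)\<rbrakk>
      \<Longrightarrow> t (day_class K T M N Z X Y h m n) = c X Y h m n"
proof -
  let ?P = "\<lambda>t. t \<in> linear_maps K (D Z) W \<and>
    (\<forall>X Y h m n. (X, Y, h, m, n) \<in> day_generators T M N Z \<longrightarrow> t (cls Z X Y h m n) = c X Y h m n)"
  let ?S = "day_space K T M N Z"
  let ?r = "inv_into (carrier ?S) (copy_map ?S)"
  note b = day_class_balanced[OF Z] and bs = day_space_balanced[OF fin_mackeyD(1)[OF M] fin_mackeyD(1)[OF N] Z]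
  obtain s where s: "s \<in> module_hom K ?S W"
    and sp: "\<And>X Y h m n. (X, Y, h, m, n) \<in> day_generators T M N Z \<Longrightarrow>
      s (presented_gen K (day_generators T M N Z) (day_relations K T M N Z) (X, Y, h, m, n)) = c X Y h m n"
    by (rule day_space_lift[OF fin_mackeyD(1)[OF M] fin_mackeyD(1)[OF N] Z W c]) (rule that)
  let ?t = "restrict (\<lambda>x. s (?r x)) (carrier (D Z))"
  have "?P ?t"
  proof (intro conjI allI impI)
    show "?t \<in> linear_maps K (D Z) W"
      by (rule linear_mapsI[OF day_vectorspace[OF Z] module_hom_comp[OF copy_day(6)[OF Z Z] s]])
    fix X Y h m n assume g: "(X, Y, h, m, n) \<in> day_generators T M N Z"
    then have "cls Z X Y h m n \<in> carrier (D Z)"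
      using day_balanced.closed[OF b] by (simp add: day_generators_iff)
    moreover have "?r (cls Z X Y h m n) = presented_gen K (day_generators T M N Z) (day_relations K T M N Z) (X, Y, h, m, n)"
      unfolding day_class_def
      by (rule inv_into_f_f[OF copy_day(5)[OF Z Z]]) (use g day_balanced.closed[OF bs] in \<open>simp add: day_generators_iff\<close>)
    ultimately show "?t (cls Z X Y h m n) = c X Y h m n" using sp[OF g] by simp
  qed
  moreover have "t' = ?t" if "?P t'" for t'
  proof (rule linear_maps_spans_eq[OF day_spans[OF Z] day_vectorspace[OF Z] W])
    show "t' \<in> linear_maps K (D Z) W" "?t \<in> linear_maps K (D Z) W" using that \<open>?P ?t\<close> by blast+
    fix x assume "x \<in> (\<lambda>(X, Y, h, m, n). cls Z X Y h m n) ` day_generators T M N Z"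
    then obtain X Y h m n where x: "(X, Y, h, m, n) \<in> day_generators T M N Z" "x = cls Z X Y h m n" by auto
    show "t' x = ?t x" using conjunct2[OF that] conjunct2[OF \<open>?P ?t\<close>] x by presburger
  qed
  ultimately have "?P t" unfolding t_def by (rule theI)
  then show "t \<in> linear_maps K (mobj (day K T M N) Z) W"
    "\<And>X Y h m n. \<lbrakk>X \<in> Obj T; Y \<in> Obj T; h \<in> homs T (X \<boxdot> Y) Z; m \<in> carrier (mobj M X); n \<in> carrier (mobj N Y)\<rbrakk>
      \<Longrightarrow> t (day_class K T M N Z X Y h m n) = c X Y h m n"
    by (simp_all add: day_generators_iff)
qed

lemma day_map:
  assumes g: "g \<in> homs T Z Z'"
  shows "mmap (day K T M N) g \<in> linear_maps K (mobj (day K T M N) Z) (mobj (day K T M N) Z')"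
    "\<And>X Y h m n. \<lbrakk>X \<in> Obj T; Y \<in> Obj T; h \<in> homs T (X \<boxdot> Y) Z; m \<in> carrier (mobj M X); n \<in> carrier (mobj N Y)\<rbrakk>
      \<Longrightarrow> mmap (day K T M N) g (day_class K T M N Z X Y h m n) = day_class K T M N Z' X Y (g \<cdot> h) m n"
proof -
  have Z: "Z \<in> Obj T" "Z' \<in> Obj T" and gd: "Dom T g = Z" "Cod T g = Z'" using homs_Obj[OF g] homsD[OF g] by auto
  note d = day_linear_map_The[OF Z(1) day_vectorspace[OF Z(2)] day_balanced_postcomp[OF day_class_balanced[OF Z(2)] g]]
  have e: "mmap (day K T M N) g = (THE t. t \<in> linear_maps K (D Z) (D Z') \<and>
      (\<forall>X Y h m n. (X, Y, h, m, n) \<in> day_generators T M N Z \<longrightarrow> t (cls Z X Y h m n) = cls Z' X Y (g \<cdot> h) m n))"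
    unfolding D_eq by (simp add: day_def gd)
  show "mmap (day K T M N) g \<in> linear_maps K (D Z) (D Z')"
    unfolding e by (rule d(1))
  show "\<And>X Y h m n. \<lbrakk>X \<in> Obj T; Y \<in> Obj T; h \<in> homs T (X \<boxdot> Y) Z; m \<in> carrier (mobj M X); n \<in> carrier (mobj N Y)\<rbrakk>
      \<Longrightarrow> mmap (day K T M N) g (cls Z X Y h m n) = cls Z' X Y (g \<cdot> h) m n"
    unfolding e by (rule d(2))
qed

text \<open>The laws for identities, composites and sums are equalities of linear maps;
  \<open>day_hom_eqI\<close> reduces them to generators, where they become laws of composition in T.
  The law for zero arrows then follows from additivity.\<close>

lemma day_fin_mackey: "fin_mackey (day K T M N)"
proof -
  note mh = linear_mapsD(1)[OF day_map(1)]
  note cl = day_balanced.closed[OF day_class_balanced]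
  have id: "mmap (day K T M N) (Ident T X) x = x" if "X \<in> Obj T" "x \<in> carrier (D X)" for X x
  proof (rule day_hom_eqI[OF that(1) day_vectorspace[OF that(1)] mh[OF Ident_closed[OF that(1)]] _ _ that(2), of "\<lambda>x. x"])
    show "(\<lambda>x. x) \<in> module_hom K (D X) (D X)" by (rule module_homI) simp_all
    show "mmap (day K T M N) (Ident T X) (cls X A B h m n) = cls X A B h m n"
      if a: "A \<in> Obj T" "B \<in> Obj T" "h \<in> homs T (A \<boxdot> B) X" "m \<in> carrier (mobj M A)" "n \<in> carrier (mobj N B)" for A B h m n
      using day_map(2)[OF Ident_closed[OF \<open>X \<in> Obj T\<close>] a] Ident_left[OF a(3)] by simp
  qed
  have comp: "mmap (day K T M N) (g \<cdot> f) x = mmap (day K T M N) g (mmap (day K T M N) f x)"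
    if fg: "f \<in> homs T X Y" "g \<in> homs T Y Z" and x: "x \<in> carrier (D X)" for X Y Z f g x
  proof -
    have o: "X \<in> Obj T" "Z \<in> Obj T" using homs_Obj fg by blast+
    show ?thesis
    proof (rule day_hom_eqI[OF o(1) day_vectorspace[OF o(2)] mh[OF Comp_closed[OF fg]] module_hom_comp[OF mh[OF fg(1)] mh[OF fg(2)]] _ x])
      show "mmap (day K T M N) (g \<cdot> f) (cls X A B h m n) = mmap (day K T M N) g (mmap (day K T M N) f (cls X A B h m n))"
        if a: "A \<in> Obj T" "B \<in> Obj T" "h \<in> homs T (A \<boxdot> B) X" "m \<in> carrier (mobj M A)" "n \<in> carrier (mobj N B)" for A B h m n
        using day_map(2)[OF Comp_closed[OF fg] a] day_map(2)[OF fg(1) a]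
          day_map(2)[OF fg(2) a(1,2) Comp_closed[OF a(3) fg(1)] a(4,5)] Comp_assoc[OF a(3) fg] by simp
    qed
  qed
  have add: "mmap (day K T M N) (add_arrow T f g) x = mmap (day K T M N) f x \<oplus>\<^bsub>D Y\<^esub> mmap (day K T M N) g x"
    if fg: "f \<in> homs T X Y" "g \<in> homs T X Y" and x: "x \<in> carrier (D X)" for X Y f g x
  proof -
    have o: "X \<in> Obj T" "Y \<in> Obj T" using homs_Obj[OF fg(1)] by blast+
    interpret DY: vectorspace K "D Y" by (rule day_vectorspace[OF o(2)])
    note mf = mh[OF fg(1)] and mg = mh[OF fg(2)]
    have "(\<lambda>x. mmap (day K T M N) f x \<oplus>\<^bsub>D Y\<^esub> mmap (day K T M N) g x) \<in> module_hom K (D X) (D Y)"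
      by (rule module_homI)
        (simp_all add: module_hom_carrier[OF mf] module_hom_carrier[OF mg] module_hom_add[OF mf] module_hom_add[OF mg]
          module_hom_smult[OF mf] module_hom_smult[OF mg] DY.smult_r_distr DY.M.a_ac)
    from day_hom_eqI[OF o(1) day_vectorspace[OF o(2)] mh[OF add_arrow_closed[OF fg]] this _ x] show ?thesis
      using day_map(2)[OF add_arrow_closed[OF fg]] day_map(2)[OF fg(1)] day_map(2)[OF fg(2)]
        day_balanced.add_hom[OF day_class_balanced[OF o(2)] _ _ Comp_closed[OF _ fg(1)] Comp_closed[OF _ fg(2)]]
        add_arrow_comp[OF fg] by simp
  qed
  have zero: "mmap (day K T M N) (zero_arrow T X Y) x = \<zero>\<^bsub>D Y\<^esub>" if o: "X \<in> Obj T" "Y \<in> Obj T" and x: "x \<in> carrier (D X)" for X Y x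
  proof (rule double_eq_zero[OF day_vectorspace[OF o(2)]])
    note z = zero_arrow_closed[OF o]
    show "mmap (day K T M N) (zero_arrow T X Y) x \<in> carrier (D Y)" by (rule module_hom_carrier[OF mh[OF z] x])
    show "mmap (day K T M N) (zero_arrow T X Y) x \<oplus>\<^bsub>D Y\<^esub> mmap (day K T M N) (zero_arrow T X Y) x
        = mmap (day K T M N) (zero_arrow T X Y) x"
      unfolding add[OF z z x, symmetric] add_arrow_zero(1)[OF z] ..
  qed
  have "mackey_functor K T (day K T M N)"
    unfolding mackey_functor_def
    by (intro conjI ballI allI impI day_vectorspace mh id comp add zero)
  then show ?thesis
    unfolding fin_mackey_def fin_dim_mackey_def using day_fin_dim by blast
qed

end

lemma day_arrow_component:
  assumes "fin_mackey M" "fin_mackey M'" "fin_mackey N" "fin_mackey N'"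
    and s: "natural_transformation K T M M' \<sigma>" and t: "natural_transformation K T N N' \<tau>" and Z: "Z \<in> Obj T"
  defines "\<rho> \<equiv> snd (snd (day_arrow K T (M, M', \<sigma>) (N, N', \<tau>)))"
  shows "\<rho> Z \<in> linear_maps K (mobj (day K T M N) Z) (mobj (day K T M' N') Z)"
    "\<And>X Y h m n. \<lbrakk>X \<in> Obj T; Y \<in> Obj T; h \<in> homs T (X \<boxdot> Y) Z; m \<in> carrier (mobj M X); n \<in> carrier (mobj N Y)\<rbrakk>
      \<Longrightarrow> \<rho> Z (day_class K T M N Z X Y h m n) = day_class K T M' N' Z X Y h (\<sigma> X m) (\<tau> Y n)"
proof -
  note d = day_linear_map_The[OF assms(1,3) Z day_vectorspace[OF assms(2,4) Z]
      day_balanced_map[OF day_class_balanced[OF assms(2,4) Z] s t]]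
  have e: "\<rho> Z = (THE u. u \<in> linear_maps K (mobj (day K T M N) Z) (mobj (day K T M' N') Z) \<and>
     (\<forall>X Y h m n. (X, Y, h, m, n) \<in> day_generators T M N Z \<longrightarrow>
        u (day_class K T M N Z X Y h m n) = day_class K T M' N' Z X Y h (\<sigma> X m) (\<tau> Y n)))"
    using Z by (simp add: \<rho>_def day_arrow_def)
  show "\<rho> Z \<in> linear_maps K (mobj (day K T M N) Z) (mobj (day K T M' N') Z)"
    unfolding e by (rule d(1))
  show "\<And>X Y h m n. \<lbrakk>X \<in> Obj T; Y \<in> Obj T; h \<in> homs T (X \<boxdot> Y) Z; m \<in> carrier (mobj M X); n \<in> carrier (mobj N Y)\<rbrakk>
      \<Longrightarrow> \<rho> Z (day_class K T M N Z X Y h m n) = day_class K T M' N' Z X Y h (\<sigma> X m) (\<tau> Y n)"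
    unfolding e by (rule d(2))
qed

lemma day_arrow_natural:
  assumes "fin_mackey M" "fin_mackey M'" "fin_mackey N" "fin_mackey N'"
    and s: "natural_transformation K T M M' \<sigma>" and t: "natural_transformation K T N N' \<tau>"
  shows "natural_transformation K T (day K T M N) (day K T M' N') (snd (snd (day_arrow K T (M, M', \<sigma>) (N, N', \<tau>))))"
proof -
  let ?\<rho> = "snd (snd (day_arrow K T (M, M', \<sigma>) (N, N', \<tau>)))"
  note d = day_arrow_component[OF assms]
  note m = linear_mapsD(1)[OF day_map(1)[OF assms(1,3)]] linear_mapsD(1)[OF day_map(1)[OF assms(2,4)]]
  have nat: "?\<rho> Y (mmap (day K T M N) f x) = mmap (day K T M' N') f (?\<rho> X x)"
    if f: "f \<in> homs T X Y" and x: "x \<in> carrier (mobj (day K T M N) X)" for X Y f x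
  proof -
    have o: "X \<in> Obj T" "Y \<in> Obj T" using homs_Obj[OF f] by blast+
    show ?thesis
    proof (rule day_hom_eqI[OF assms(1,3) o(1) day_vectorspace[OF assms(2,4) o(2)] _ _ _ x])
      show "(\<lambda>x. ?\<rho> Y (mmap (day K T M N) f x)) \<in> module_hom K (mobj (day K T M N) X) (mobj (day K T M' N') Y)"
        by (rule module_hom_comp[OF m(1)[OF f] linear_mapsD(1)[OF d(1)[OF o(2)]]])
      show "(\<lambda>x. mmap (day K T M' N') f (?\<rho> X x)) \<in> module_hom K (mobj (day K T M N) X) (mobj (day K T M' N') Y)"
        by (rule module_hom_comp[OF linear_mapsD(1)[OF d(1)[OF o(1)]] m(2)[OF f]])
      show "?\<rho> Y (mmap (day K T M N) f (day_class K T M N X A B h m n)) = mmap (day K T M' N') f (?\<rho> X (day_class K T M N X A B h m n))"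
        if a: "A \<in> Obj T" "B \<in> Obj T" "h \<in> homs T (A \<boxdot> B) X" "m \<in> carrier (mobj M A)" "n \<in> carrier (mobj N B)" for A B h m n
        using day_map(2)[OF assms(1,3) f a] d(2)[OF o(1) a] d(2)[OF o(2) a(1,2) Comp_closed[OF a(3) f] a(4,5)]
          day_map(2)[OF assms(2,4) f a(1-3) natural_transformationD(5)[OF s a(1,4)] natural_transformationD(5)[OF t a(2,5)]] by simp
    qed
  qed
  have "?\<rho> \<in> extensional (Obj T)" by (simp add: day_arrow_def)
  then show ?thesis
    unfolding natural_transformation_def by (intro conjI ballI allI impI d(1) nat)
qed

subsection \<open>The Burnside functor\<close>

text \<open>Universal property of the free vector space on the commutative monoid T(I, U), obtained
  from the general presentation by generators and relations.\<close>

lemma burnside_space: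
  assumes U: "U \<in> Obj T"
  defines "p \<equiv> presented_gen K (homs T I U) (burnside_relations K T U)"
  shows burnside_space_vectorspace: "vectorspace K (burnside_space K T U)"
    and burnside_space_spans: "spans K (burnside_space K T U) (p ` homs T I U)"
    and burnside_space_add: "\<And>u v. \<lbrakk>u \<in> homs T I U; v \<in> homs T I U\<rbrakk> \<Longrightarrow> p (add_arrow T u v) = p u \<oplus>\<^bsub>burnside_space K T U\<^esub> p v"
    and burnside_space_lift: "\<And>W c. \<lbrakk>vectorspace K W; \<And>u. u \<in> homs T I U \<Longrightarrow> c u \<in> carrier W;
        \<And>u v. \<lbrakk>u \<in> homs T I U; v \<in> homs T I U\<rbrakk> \<Longrightarrow> c (add_arrow T u v) = c u \<oplus>\<^bsub>W\<^esub> c v\<rbrakk>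
      \<Longrightarrow> \<exists>t \<in> module_hom K (burnside_space K T U) W. \<forall>u \<in> homs T I U. t (p u) = c u"
proof -
  let ?G = "homs T I U" and ?R = "burnside_relations K T U"
  let ?F = "free_module K ?G"
  let ?u = "unit_vector K"
  note F = free_module_vectorspace[OF K.field_axioms, of ?G]
  note cl = vectorspace_closed[OF F]
  note uc = unit_vector_closed[OF K.field_axioms, of _ ?G]
  have R: "?R = {?u (add_arrow T u v) \<ominus>\<^bsub>?F\<^esub> (?u u \<oplus>\<^bsub>?F\<^esub> ?u v) | u v. u \<in> ?G \<and> v \<in> ?G}"
    by (simp add: burnside_relations_def Let_def)
  have sub: "?R \<subseteq> carrier ?F"
  proof
    fix r assume "r \<in> ?R"
    then obtain u v where r: "r = ?u (add_arrow T u v) \<ominus>\<^bsub>?F\<^esub> (?u u \<oplus>\<^bsub>?F\<^esub> ?u v)" and u: "u \<in> ?G" "v \<in> ?G"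
      unfolding R by blast
    show "r \<in> carrier ?F"
      unfolding r by (rule cl(3)[OF uc[OF add_arrow_closed[OF u]] cl(1)[OF uc[OF u(1)] uc[OF u(2)]]])
  qed
  note r = presented_relation[OF K.field_axioms sub refl, folded burnside_space_def]
  show v: "vectorspace K (burnside_space K T U)"
    unfolding burnside_space_def by (rule presented_vectorspace[OF K.field_axioms sub])
  show "spans K (burnside_space K T U) (p ` ?G)"
    unfolding burnside_space_def p_def by (rule presented_spans[OF K.field_axioms sub])
  show "p (add_arrow T u v) = p u \<oplus>\<^bsub>burnside_space K T U\<^esub> p v" if u: "u \<in> ?G" "v \<in> ?G" for u v
  proof -
    have "?u (add_arrow T u v) \<ominus>\<^bsub>?F\<^esub> (?u u \<oplus>\<^bsub>?F\<^esub> ?u v) \<in> ?R"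
      unfolding R by (intro CollectI exI conjI, rule refl, rule u(1), rule u(2))
    from bspec[OF conjunct2[OF conjunct2[OF r]] this] show ?thesis
      unfolding module_hom_diff_eq_zero[OF F v conjunct1[OF r] uc[OF add_arrow_closed[OF u]] cl(1)[OF uc[OF u(1)] uc[OF u(2)]]]
        module_hom_add[OF conjunct1[OF r] uc[OF u(1)] uc[OF u(2)]] spec[OF conjunct1[OF conjunct2[OF r]]] p_def .
  qed
  show "\<exists>t \<in> module_hom K (burnside_space K T U) W. \<forall>u \<in> ?G. t (p u) = c u"
    if W: "vectorspace K W" and c: "\<And>u. u \<in> ?G \<Longrightarrow> c u \<in> carrier W"
      and add: "\<And>u v. \<lbrakk>u \<in> ?G; v \<in> ?G\<rbrakk> \<Longrightarrow> c (add_arrow T u v) = c u \<oplus>\<^bsub>W\<^esub> c v" for W and c :: "'a \<Rightarrow> 'w"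
  proof (rule free_module_lift[where c = c and G = ?G, OF K.field_axioms W c])
    fix L assume L: "L \<in> module_hom K ?F W" and Lu: "\<And>u. u \<in> ?G \<Longrightarrow> L (?u u) = c u"
    have L0: "L r = \<zero>\<^bsub>W\<^esub>" if rR: "r \<in> ?R" for r
    proof -
      from rR obtain u v where r: "r = ?u (add_arrow T u v) \<ominus>\<^bsub>?F\<^esub> (?u u \<oplus>\<^bsub>?F\<^esub> ?u v)" and u: "u \<in> ?G" "v \<in> ?G"
        unfolding R by blast
      show ?thesis
        unfolding r module_hom_diff_eq_zero[OF F W L uc[OF add_arrow_closed[OF u]] cl(1)[OF uc[OF u(1)] uc[OF u(2)]]]
          module_hom_add[OF L uc[OF u(1)] uc[OF u(2)]] Lu[OF u(1)] Lu[OF u(2)] Lu[OF add_arrow_closed[OF u]] by (rule add[OF u])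
    qed
    from presented_lift[OF K.field_axioms sub W L L0]
    show ?thesis unfolding burnside_space_def p_def by (simp add: Lu)
  qed assumption
qed

text \<open>The classes of monoid generators of T(I, U) span, because the arrows whose class lies in
  a given linearly closed set form a submonoid.\<close>

lemma burnside_space_fin_dim:
  assumes U: "U \<in> Obj T"
  shows "vectorspace.fin_dim K (burnside_space K T U)"
proof (rule hom_monoid_generators[OF unt_closed U])
  let ?V = "burnside_space K T U" and ?p = "presented_gen K (homs T I U) (burnside_relations K T U)"
  note V = burnside_space_vectorspace[OF U] and S = burnside_space_spans[OF U] and add = burnside_space_add[OF U]
  fix F
  assume F: "finite F" "F \<subseteq> homs T I U"
    and gen: "\<And>H. \<lbrakk>H \<subseteq> homs T I U; F \<subseteq> H; zero_arrow T I U \<in> H; \<And>f g. \<lbrakk>f \<in> H; g \<in> H\<rbrakk> \<Longrightarrow> add_arrow T f g \<in> H\<rbrakk> \<Longrightarrow> H = homs T I U"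
  have pc: "?p u \<in> carrier ?V" if "u \<in> homs T I U" for u using S that by (auto simp: spans_def)
  have z: "zero_arrow T I U \<in> homs T I U" by (rule zero_arrow_closed[OF unt_closed U])
  have p0: "?p (zero_arrow T I U) = \<zero>\<^bsub>?V\<^esub>"
    by (rule double_eq_zero[OF V pc[OF z]]) (simp only: add[OF z z, symmetric] add_arrow_zero(1)[OF z])
  have "spans K ?V (?p ` F)"
    unfolding spans_def
  proof (intro conjI allI impI)
    show "?p ` F \<subseteq> carrier ?V" using F(2) pc by blast
    fix H assume H: "linear_closed K ?V H" and sub: "?p ` F \<subseteq> H"
    note Hd = linear_closedD[OF H]
    have "{u \<in> homs T I U. ?p u \<in> H} = homs T I U"
    proof (rule gen)
      show "F \<subseteq> {u \<in> homs T I U. ?p u \<in> H}" using F(2) sub by blast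
      show "zero_arrow T I U \<in> {u \<in> homs T I U. ?p u \<in> H}" using z p0 Hd(2) by simp
      show "add_arrow T f g \<in> {u \<in> homs T I U. ?p u \<in> H}"
        if "f \<in> {u \<in> homs T I U. ?p u \<in> H}" "g \<in> {u \<in> homs T I U. ?p u \<in> H}" for f g
        using that add_arrow_closed add Hd(3) by simp
    qed blast
    then have "?p ` homs T I U \<subseteq> H" by blast
    then show "H = carrier ?V" by (rule spansD[OF S H])
  qed
  then show ?thesis using F(1) fin_dim_iff_spans[OF V] by blast
qed

text \<open>Same pattern as for the Day convolution: the maps described in \<open>burnside\<close>
  exist by \<open>burnside_space_lift\<close>, and the laws are checked on the classes of arrows out
  of I.\<close>

lemma burnside_fin_mackey: "fin_mackey (burnside K T)"
proof -
  define J :: "'o \<Rightarrow> ('k, 'v) module" where "J U = copy (burnside_space K T U)" for U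
  define b :: "'o \<Rightarrow> 'a \<Rightarrow> 'v" where "b = burnside_class K T"
  let ?p = "\<lambda>U. presented_gen K (homs T I U) (burnside_relations K T U)"
  let ?r = "\<lambda>U. inv_into (carrier (burnside_space K T U)) (copy_map (burnside_space K T U) :: _ \<Rightarrow> 'v)"
  note c = copy_of_fin_dim[OF burnside_space_vectorspace burnside_space_fin_dim, folded J_def]
  have b_eq: "b U u = copy_map (burnside_space K T U) (?p U u)" for U u
    by (simp add: b_def burnside_class_def)
  have pc: "?p U u \<in> carrier (burnside_space K T U)" if "U \<in> Obj T" "u \<in> homs T I U" for U u
    using burnside_space_spans[OF that(1)] that(2) by (auto simp: spans_def)
  have bc: "b U u \<in> carrier (J U)" if "U \<in> Obj T" "u \<in> homs T I U" for U u
    unfolding b_eq by (rule module_hom_carrier[OF c(3)[OF that(1,1)] pc[OF that]])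
  have badd: "b U (add_arrow T u v) = b U u \<oplus>\<^bsub>J U\<^esub> b U v" if o: "U \<in> Obj T" and u: "u \<in> homs T I U" "v \<in> homs T I U" for U u v
    unfolding b_eq burnside_space_add[OF o u] by (rule module_hom_add[OF c(3)[OF o o] pc[OF o u(1)] pc[OF o u(2)]])
  have J_spans: "spans K (J U) (b U ` homs T I U)" if o: "U \<in> Obj T" for U
    using spans_image[OF burnside_space_spans[OF o] c(3,4)[OF o o] burnside_space_vectorspace[OF o] c(1)[OF o o]]
    by (simp add: image_image b_eq)
  have map: "mmap (burnside K T) g \<in> linear_maps K (J U) (J U') \<and>
      (\<forall>u \<in> homs T I U. mmap (burnside K T) g (b U u) = b U' (g \<cdot> u))" if g: "g \<in> homs T U U'" for g U U'
  proof -
    have o: "U \<in> Obj T" "U' \<in> Obj T" and gd: "Dom T g = U" "Cod T g = U'" using homs_Obj[OF g] homsD[OF g] by auto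
    let ?P = "\<lambda>t. t \<in> linear_maps K (J U) (J U') \<and> (\<forall>u \<in> homs T I U. t (b U u) = b U' (g \<cdot> u))"
    have "\<exists>t \<in> module_hom K (burnside_space K T U) (J U'). \<forall>u \<in> homs T I U. t (?p U u) = b U' (g \<cdot> u)"
      by (rule burnside_space_lift[OF o(1) c(1)[OF o(2,2)]])
        (simp_all only: bc[OF o(2) Comp_closed[OF _ g]] comp_add_arrow[OF _ _ g] badd[OF o(2) Comp_closed[OF _ g] Comp_closed[OF _ g]])
    then obtain t where t: "t \<in> module_hom K (burnside_space K T U) (J U')"
      and tp: "\<And>u. u \<in> homs T I U \<Longrightarrow> t (?p U u) = b U' (g \<cdot> u)" by blast
    let ?t = "restrict (\<lambda>x. t (?r U x)) (carrier (J U))"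
    have rb: "?r U (b U u) = ?p U u" if "u \<in> homs T I U" for u
      unfolding b_eq by (rule inv_into_f_f[OF c(5)[OF o(1,1)] pc[OF o(1) that]])
    have 1: "?P ?t"
    proof (intro conjI ballI)
      show "?t \<in> linear_maps K (J U) (J U')"
        by (rule linear_mapsI[OF c(1)[OF o(1,1)] module_hom_comp[OF c(6)[OF o(1,1)] t]])
      show "?t (b U u) = b U' (g \<cdot> u)" if "u \<in> homs T I U" for u
        using bc[OF o(1) that] rb[OF that] tp[OF that] by simp
    qed
    have 2: "t' = ?t" if "?P t'" for t'
      by (rule linear_maps_spans_eq[OF J_spans[OF o(1)] c(1)[OF o(1,1)] c(1)[OF o(2,2)] conjunct1[OF that] conjunct1[OF 1]])
        (use conjunct2[OF that] conjunct2[OF 1] in \<open>clarsimp simp del: restrict_apply\<close>)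
    have "mmap (burnside K T) g = (THE t. ?P t)"
      by (simp add: burnside_def gd J_def b_def)
    then show ?thesis using theI[of ?P, OF 1 2] by simp
  qed
  note mh = linear_mapsD(1)[OF conjunct1[OF map]] and mb = bspec[OF conjunct2[OF map]]
  have eqI: "f x = g x" if "U \<in> Obj T" "vectorspace K W" "f \<in> module_hom K (J U) W" "g \<in> module_hom K (J U) W"
    "\<And>u. u \<in> homs T I U \<Longrightarrow> f (b U u) = g (b U u)" "x \<in> carrier (J U)" for U and W :: "('k, 'v) module" and f g x
    by (rule spans_module_hom_eq[OF J_spans[OF that(1)] c(1)[OF that(1,1)] that(2-4) _ that(6)]) (use that(5) in blast)
  have id: "mmap (burnside K T) (Ident T X) x = x" if o: "X \<in> Obj T" and x: "x \<in> carrier (J X)" for X x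
  proof (rule eqI[OF o c(1)[OF o o] mh[OF Ident_closed[OF o]] _ _ x, of "\<lambda>x. x"])
    show "(\<lambda>x. x) \<in> module_hom K (J X) (J X)" by (rule module_homI) simp_all
    show "mmap (burnside K T) (Ident T X) (b X u) = b X u" if "u \<in> homs T I X" for u
      using mb[OF Ident_closed[OF o] that] Ident_left[OF that] by simp
  qed
  have comp: "mmap (burnside K T) (g \<cdot> f) x = mmap (burnside K T) g (mmap (burnside K T) f x)"
    if fg: "f \<in> homs T X Y" "g \<in> homs T Y Z" and x: "x \<in> carrier (J X)" for X Y Z f g x
  proof -
    have o: "X \<in> Obj T" "Z \<in> Obj T" using homs_Obj fg by blast+
    show ?thesis
    proof (rule eqI[OF o(1) c(1)[OF o(2,2)] mh[OF Comp_closed[OF fg]] module_hom_comp[OF mh[OF fg(1)] mh[OF fg(2)]] _ x])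
      show "mmap (burnside K T) (g \<cdot> f) (b X u) = mmap (burnside K T) g (mmap (burnside K T) f (b X u))" if u: "u \<in> homs T I X" for u
        using mb[OF Comp_closed[OF fg] u] mb[OF fg(1) u] mb[OF fg(2) Comp_closed[OF u fg(1)]] Comp_assoc[OF u fg] by simp
    qed
  qed
  have add: "mmap (burnside K T) (add_arrow T f g) x = mmap (burnside K T) f x \<oplus>\<^bsub>J Y\<^esub> mmap (burnside K T) g x"
    if fg: "f \<in> homs T X Y" "g \<in> homs T X Y" and x: "x \<in> carrier (J X)" for X Y f g x
  proof -
    have o: "X \<in> Obj T" "Y \<in> Obj T" using homs_Obj[OF fg(1)] by blast+
    interpret JY: vectorspace K "J Y" by (rule c(1)[OF o(2,2)])
    note mf = mh[OF fg(1)] and mg = mh[OF fg(2)]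
    have s: "(\<lambda>x. mmap (burnside K T) f x \<oplus>\<^bsub>J Y\<^esub> mmap (burnside K T) g x) \<in> module_hom K (J X) (J Y)"
      by (rule module_homI)
        (simp_all add: module_hom_carrier[OF mf] module_hom_carrier[OF mg] module_hom_add[OF mf] module_hom_add[OF mg]
          module_hom_smult[OF mf] module_hom_smult[OF mg] JY.smult_r_distr JY.M.a_ac)
    show ?thesis
    proof (rule eqI[OF o(1) c(1)[OF o(2,2)] mh[OF add_arrow_closed[OF fg]] s _ x])
      fix u assume u: "u \<in> homs T I X"
      show "mmap (burnside K T) (add_arrow T f g) (b X u) = mmap (burnside K T) f (b X u) \<oplus>\<^bsub>J Y\<^esub> mmap (burnside K T) g (b X u)"
        unfolding mb[OF add_arrow_closed[OF fg] u] mb[OF fg(1) u] mb[OF fg(2) u] add_arrow_comp[OF fg u]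
        by (rule badd[OF o(2) Comp_closed[OF u fg(1)] Comp_closed[OF u fg(2)]])
    qed
  qed
  have zero: "mmap (burnside K T) (zero_arrow T X Y) x = \<zero>\<^bsub>J Y\<^esub>" if o: "X \<in> Obj T" "Y \<in> Obj T" and x: "x \<in> carrier (J X)" for X Y x
  proof (rule double_eq_zero[OF c(1)[OF o(2,2)]])
    note z = zero_arrow_closed[OF o]
    show "mmap (burnside K T) (zero_arrow T X Y) x \<in> carrier (J Y)" by (rule module_hom_carrier[OF mh[OF z] x])
    show "mmap (burnside K T) (zero_arrow T X Y) x \<oplus>\<^bsub>J Y\<^esub> mmap (burnside K T) (zero_arrow T X Y) x
        = mmap (burnside K T) (zero_arrow T X Y) x"
      unfolding add[OF z z x, symmetric] add_arrow_zero(1)[OF z] ..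
  qed
  have J: "mobj (burnside K T) = J" by (simp add: burnside_def J_def fun_eq_iff)
  show ?thesis
    unfolding fin_mackey_def fin_dim_mackey_def mackey_functor_def J
    by (intro conjI ballI allI impI c(1,2) mh id comp add zero; assumption)
qed

end


section \<open>The dual of a Mackey functor\<close>

text \<open>An element of the dual of \<open>M\<close> at \<open>X\<close> is a family of maps \<open>T(Z \<boxdot> X, I) \<times> M(Z) \<rightarrow> k\<close>.  Since \<open>X\<close> has a dual
  object \<open>A\<close>, such a family amounts to a linear form on \<open>M(A)\<close>; no choice of \<open>A\<close> is made in the definition.\<close>

locale dual_family =
  fixes K :: "('k, 'm) ring_scheme" and T :: "('o, 'a, 'z) monoidal_scheme" (structure)
    and M :: "('o, 'a, 'k, 'v) mackey" and X :: 'o and b :: "'o \<Rightarrow> 'a \<Rightarrow> 'v \<Rightarrow> 'k"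
  assumes closed: "\<lbrakk>Z \<in> Obj T; h \<in> homs T (Z \<boxdot> X) (unt T); m \<in> carrier (mobj M Z)\<rbrakk> \<Longrightarrow> b Z h m \<in> carrier K"
    and add_hom: "\<lbrakk>Z \<in> Obj T; h \<in> homs T (Z \<boxdot> X) (unt T); h' \<in> homs T (Z \<boxdot> X) (unt T); m \<in> carrier (mobj M Z)\<rbrakk>
      \<Longrightarrow> b Z (add_arrow T h h') m = b Z h m \<oplus>\<^bsub>K\<^esub> b Z h' m"
    and add: "\<lbrakk>Z \<in> Obj T; h \<in> homs T (Z \<boxdot> X) (unt T); m \<in> carrier (mobj M Z); m' \<in> carrier (mobj M Z)\<rbrakk>
      \<Longrightarrow> b Z h (m \<oplus>\<^bsub>mobj M Z\<^esub> m') = b Z h m \<oplus>\<^bsub>K\<^esub> b Z h m'"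
    and smult: "\<lbrakk>Z \<in> Obj T; h \<in> homs T (Z \<boxdot> X) (unt T); k \<in> carrier K; m \<in> carrier (mobj M Z)\<rbrakk>
      \<Longrightarrow> b Z h (k \<odot>\<^bsub>mobj M Z\<^esub> m) = k \<otimes>\<^bsub>K\<^esub> b Z h m"
    and dinatural: "\<lbrakk>f \<in> homs T Z Z'; h \<in> homs T (Z' \<boxdot> X) (unt T); m \<in> carrier (mobj M Z)\<rbrakk>
      \<Longrightarrow> b Z (h \<cdot> (f \<boxtimes> Ident T X)) m = b Z' h (mmap M f m)"
begin

lemma linear_form: "\<lbrakk>Z \<in> Obj T; h \<in> homs T (Z \<boxdot> X) (unt T)\<rbrakk> \<Longrightarrow> linear_form K (mobj M Z) (b Z h)"
  unfolding linear_form_def by (intro conjI ballI closed add smult)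

end

context mackey_setting
begin

definition dual_domain :: "('o, 'a, 'k, 'v) mackey \<Rightarrow> 'o \<Rightarrow> ('o \<times> 'a \<times> 'v) set" where
  "dual_domain M X = {(Z, h, m). Z \<in> Obj T \<and> h \<in> homs T (Z \<boxdot> X) I \<and> m \<in> carrier (mobj M Z)}"

text \<open>Values outside \<open>dual_domain\<close> are fixed to be zero, so that two elements are
  equal as soon as they agree as families.\<close>

definition dual_carrier :: "('o, 'a, 'k, 'v) mackey \<Rightarrow> 'o \<Rightarrow> ('o \<times> 'a \<times> 'v \<Rightarrow> 'k) set" where
  "dual_carrier M X = {a. (\<forall>x. x \<notin> dual_domain M X \<longrightarrow> a x = \<zero>\<^bsub>K\<^esub>) \<and> dual_family K T M X (\<lambda>Z h m. a (Z, h, m))}"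

definition dual_module :: "('o, 'a, 'k, 'v) mackey \<Rightarrow> 'o \<Rightarrow> ('k, 'o \<times> 'a \<times> 'v \<Rightarrow> 'k) module" where
  "dual_module M X = pointwise_module K (dual_carrier M X)"

lemma dual_moduleD:
  assumes "a \<in> carrier (dual_module M X)"
  shows "x \<notin> dual_domain M X \<Longrightarrow> a x = \<zero>\<^bsub>K\<^esub>" "dual_family K T M X (\<lambda>Z h m. a (Z, h, m))" "a x \<in> carrier K"
proof -
  show z: "x \<notin> dual_domain M X \<Longrightarrow> a x = \<zero>\<^bsub>K\<^esub>" for x
    using assms by (cases x) (simp add: dual_module_def dual_carrier_def)
  show b: "dual_family K T M X (\<lambda>Z h m. a (Z, h, m))"
    using assms by (simp add: dual_module_def dual_carrier_def)
  show "a x \<in> carrier K"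
  proof (cases "x \<in> dual_domain M X")
    case True
    then show ?thesis using dual_family.closed[OF b] by (cases x) (simp add: dual_domain_def)
  qed (simp add: z)
qed

lemma dual_moduleI:
  assumes "\<And>x. x \<notin> dual_domain M X \<Longrightarrow> a x = \<zero>\<^bsub>K\<^esub>" "dual_family K T M X (\<lambda>Z h m. a (Z, h, m))"
  shows "a \<in> carrier (dual_module M X)"
  using assms by (simp add: dual_module_def dual_carrier_def)

lemma dual_module_simps [simp]:
  "\<zero>\<^bsub>dual_module M X\<^esub> = (\<lambda>x. \<zero>\<^bsub>K\<^esub>)" "a \<oplus>\<^bsub>dual_module M X\<^esub> a' = (\<lambda>x. a x \<oplus>\<^bsub>K\<^esub> a' x)"
  "k \<odot>\<^bsub>dual_module M X\<^esub> a = (\<lambda>x. k \<otimes>\<^bsub>K\<^esub> a x)"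
  by (simp_all add: dual_module_def)

lemma dual_module_vectorspace: "vectorspace K (dual_module M X)"
proof -
  have "vectorspace K (pointwise_module K (carrier (dual_module M X)))"
  proof (rule pointwise_vectorspace[OF K.field_axioms])
    show "(\<lambda>x. \<zero>\<^bsub>K\<^esub>) \<in> carrier (dual_module M X)"
      by (rule dual_moduleI[OF refl]) (unfold_locales; simp)
    fix a assume a: "a \<in> carrier (dual_module M X)"
    interpret a: dual_family K T M X "\<lambda>Z h m. a (Z, h, m)" by (rule dual_moduleD(2)[OF a])
    note ac = dual_moduleD(3)[OF a]
    show "a x \<in> carrier K" for x by (rule ac)
    show "(\<lambda>x. k \<otimes>\<^bsub>K\<^esub> a x) \<in> carrier (dual_module M X)" if k: "k \<in> carrier K" for k
    proof (rule dual_moduleI)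
      show "k \<otimes>\<^bsub>K\<^esub> a x = \<zero>\<^bsub>K\<^esub>" if "x \<notin> dual_domain M X" for x using dual_moduleD(1)[OF a that] k by simp
      show "dual_family K T M X (\<lambda>Z h m. k \<otimes>\<^bsub>K\<^esub> a (Z, h, m))"
        by unfold_locales
          (simp_all only: K.m_closed k ac a.add_hom a.add a.smult a.dinatural K.r_distr K.m_lcomm)
    qed
    fix a' assume a': "a' \<in> carrier (dual_module M X)"
    interpret a': dual_family K T M X "\<lambda>Z h m. a' (Z, h, m)" by (rule dual_moduleD(2)[OF a'])
    note ac' = dual_moduleD(3)[OF a']
    show "(\<lambda>x. a x \<oplus>\<^bsub>K\<^esub> a' x) \<in> carrier (dual_module M X)"
    proof (rule dual_moduleI)
      show "a x \<oplus>\<^bsub>K\<^esub> a' x = \<zero>\<^bsub>K\<^esub>" if "x \<notin> dual_domain M X" for x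
        using dual_moduleD(1)[OF a that] dual_moduleD(1)[OF a' that] by simp
      show "dual_family K T M X (\<lambda>Z h m. a (Z, h, m) \<oplus>\<^bsub>K\<^esub> a' (Z, h, m))"
        by unfold_locales
          (simp_all only: K.a_closed K.m_closed ac ac' a.add_hom a.add a.smult a.dinatural a'.add_hom a'.add a'.smult a'.dinatural
            K.r_distr K.a_ac)
    qed
  qed
  then show ?thesis by (simp add: dual_module_def)
qed

text \<open>The Yoneda lemma: a family is determined by its value at the representing arrow \<open>\<epsilon>\<close>.\<close>

lemma dual_module_yoneda:
  assumes M: "fin_mackey M" and p: "perfect A A' \<epsilon>"
  shows "vectorspace.fin_dim K (dual_module M A')"
    and "\<And>\<Phi>. linear_form K (dual_module M A') \<Phi> \<Longrightarrow>
      \<exists>v \<in> carrier (mobj M A). \<forall>d \<in> carrier (dual_module M A'). \<Phi> d = d (A, \<epsilon>, v)"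
    and "\<And>\<xi>. linear_form K (mobj M A) \<xi> \<Longrightarrow>
      \<exists>d \<in> carrier (dual_module M A'). \<forall>v \<in> carrier (mobj M A). d (A, \<epsilon>, v) = \<xi> v"
proof -
  have o: "A \<in> Obj T" "A' \<in> Obj T" and \<epsilon>: "\<epsilon> \<in> homs T (A \<boxdot> A') I" using p by (simp_all add: perfect_def)
  note M' = fin_mackeyD(1)[OF M]
  note D = mackey_functorD[OF M']
  let ?F = "\<lambda>g. \<epsilon> \<cdot> (g \<boxtimes> Ident T A')"
  have bij: "bij_betw ?F (homs T Z A) (homs T (Z \<boxdot> A') I)" if "Z \<in> Obj T" for Z
    using p that by (simp add: perfect_def)
  \<comment> \<open>The arrow Z -> A whose transpose is h.\<close>
  define hat where "hat Z h = inv_into (homs T Z A) ?F h" for Z h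
  have hat: "hat Z h \<in> homs T Z A" "?F (hat Z h) = h" if "Z \<in> Obj T" "h \<in> homs T (Z \<boxdot> A') I" for Z h
  proof -
    have "h \<in> ?F ` homs T Z A" using bij[OF that(1)] that(2) by (simp add: bij_betw_def)
    then show "hat Z h \<in> homs T Z A" "?F (hat Z h) = h"
      unfolding hat_def by (rule inv_into_into, rule f_inv_into_f)
  qed
  have hat_eq: "hat Z (?F g) = g" if "g \<in> homs T Z A" for Z g
  proof -
    have "inj_on ?F (homs T Z A)" using bij[of Z] homs_Obj[OF that] by (simp add: bij_betw_def)
    then show ?thesis unfolding hat_def using that by (rule inv_into_f_f)
  qed
  have t: "f \<boxtimes> Ident T A' \<in> homs T (Z \<boxdot> A') (Z' \<boxdot> A')" if "f \<in> homs T Z Z'" for f Z Z'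
    by (rule tarr_closed[OF that Ident_closed[OF o(2)]])
  have Fcomp: "?F (g \<cdot> f) = ?F g \<cdot> (f \<boxtimes> Ident T A')" if "f \<in> homs T Z Z'" "g \<in> homs T Z' A" for f g Z Z'
    using tarr_Comp[OF that Ident_closed[OF o(2)] Ident_closed[OF o(2)]] Ident_left[OF Ident_closed[OF o(2)]]
      Comp_assoc[OF t[OF that(1)] t[OF that(2)] \<epsilon>] by simp
  have surj: "\<exists>d \<in> carrier (dual_module M A'). \<forall>v \<in> carrier (mobj M A). d (A, \<epsilon>, v) = \<xi> v"
    if \<xi>: "linear_form K (mobj M A) \<xi>" for \<xi>
  proof -
    note x = linear_formD[OF \<xi>]
    \<comment> \<open>The Yoneda formula: starting from \<xi> at \<epsilon>, dinaturality along
      \<open>hat Z h\<close> forces this value at h.\<close>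
    let ?d = "\<lambda>(Z, h, m). if (Z, h, m) \<in> dual_domain M A' then \<xi> (mmap M (hat Z h) m) else \<zero>\<^bsub>K\<^esub>"
    have d: "?d (Z, h, m) = \<xi> (mmap M (hat Z h) m)"
      if "Z \<in> Obj T" "h \<in> homs T (Z \<boxdot> A') I" "m \<in> carrier (mobj M Z)" for Z h m
      using that by (simp add: dual_domain_def)
    have "dual_family K T M A' (\<lambda>Z h m. ?d (Z, h, m))"
    proof
      fix Z h m assume a: "Z \<in> Obj T" "h \<in> homs T (Z \<boxdot> A') I" "m \<in> carrier (mobj M Z)"
      note mh = D(2)[OF hat(1)[OF a(1,2)]]
      show "?d (Z, h, m) \<in> carrier K" unfolding d[OF a] by (rule x(1)[OF module_hom_carrier[OF mh a(3)]])
      show "?d (Z, h, k \<odot>\<^bsub>mobj M Z\<^esub> m) = k \<otimes>\<^bsub>K\<^esub> ?d (Z, h, m)" if k: "k \<in> carrier K" for k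
        unfolding d[OF a] d[OF a(1,2) vectorspace_closed(2)[OF D(1)[OF a(1)] a(3) k]] module_hom_smult[OF mh k a(3)]
        by (rule x(3)[OF k module_hom_carrier[OF mh a(3)]])
      show "?d (Z, h, m \<oplus>\<^bsub>mobj M Z\<^esub> m') = ?d (Z, h, m) \<oplus>\<^bsub>K\<^esub> ?d (Z, h, m')" if m': "m' \<in> carrier (mobj M Z)" for m'
        unfolding d[OF a] d[OF a(1,2) m'] d[OF a(1,2) vectorspace_closed(1)[OF D(1)[OF a(1)] a(3) m']] module_hom_add[OF mh a(3) m']
        by (rule x(2)[OF module_hom_carrier[OF mh a(3)] module_hom_carrier[OF mh m']])
      show "?d (Z, add_arrow T h h', m) = ?d (Z, h, m) \<oplus>\<^bsub>K\<^esub> ?d (Z, h', m)" if h': "h' \<in> homs T (Z \<boxdot> A') I" for h'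
      proof -
        note mh' = D(2)[OF hat(1)[OF a(1) h']]
        \<comment> \<open>Additivity in h requires transposition to be additive and not merely
          bijective; this is the content of \<open>perfect_add\<close>.\<close>
        have "hat Z (add_arrow T h h') = add_arrow T (hat Z h) (hat Z h')"
          using perfect_add[OF p hat(1)[OF a(1,2)] hat(1)[OF a(1) h']] hat(2)[OF a(1,2)] hat(2)[OF a(1) h']
            hat_eq[OF add_arrow_closed[OF hat(1)[OF a(1,2)] hat(1)[OF a(1) h']]] by simp
        then show ?thesis
          unfolding d[OF a] d[OF a(1) h' a(3)] d[OF a(1) add_arrow_closed[OF a(2) h'] a(3)]
          using D(5)[OF hat(1)[OF a(1,2)] hat(1)[OF a(1) h'] a(3)]
            x(2)[OF module_hom_carrier[OF mh a(3)] module_hom_carrier[OF mh' a(3)]] by simp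
      qed
    next
      fix f Z Z' h m assume a: "f \<in> homs T Z Z'" "h \<in> homs T (Z' \<boxdot> A') I" "m \<in> carrier (mobj M Z)"
      have o': "Z \<in> Obj T" "Z' \<in> Obj T" using homs_Obj[OF a(1)] by auto
      have "hat Z (h \<cdot> (f \<boxtimes> Ident T A')) = hat Z' h \<cdot> f"
        using Fcomp[OF a(1) hat(1)[OF o'(2) a(2)]] hat(2)[OF o'(2) a(2)] hat_eq[OF Comp_closed[OF a(1) hat(1)[OF o'(2) a(2)]]] by simp
      then show "?d (Z, h \<cdot> (f \<boxtimes> Ident T A'), m) = ?d (Z', h, mmap M f m)"
        unfolding d[OF o'(1) Comp_closed[OF t[OF a(1)] a(2)] a(3)] d[OF o'(2) a(2) mackey_map_closed[OF M' a(1,3)]]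
        using D(4)[OF a(1) hat(1)[OF o'(2) a(2)] a(3)] by simp
    qed
    then have dd: "?d \<in> carrier (dual_module M A')" by (intro dual_moduleI) (auto simp: case_prod_unfold)
    have "hat A \<epsilon> = Ident T A"
      using hat_eq[OF Ident_closed[OF o(1)]] tarr_Ident[OF o] Ident_right[OF \<epsilon>] by simp
    then have "?d (A, \<epsilon>, v) = \<xi> v" if "v \<in> carrier (mobj M A)" for v
      unfolding d[OF o(1) \<epsilon> that] using D(3)[OF o(1) that] by simp
    with dd show ?thesis by blast
  qed
  have inj: "d = d'" if d: "d \<in> carrier (dual_module M A')" and d': "d' \<in> carrier (dual_module M A')"
    and eq: "\<And>v. v \<in> carrier (mobj M A) \<Longrightarrow> d (A, \<epsilon>, v) = d' (A, \<epsilon>, v)" for d d'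
  proof (rule ext)
    fix x :: "'o \<times> 'a \<times> 'v"
    obtain Z h m where x: "x = (Z, h, m)" by (cases x)
    show "d x = d' x"
    proof (cases "x \<in> dual_domain M A'")
      case False
      then show ?thesis using dual_moduleD(1)[OF d] dual_moduleD(1)[OF d'] by simp
    next
      case True
      then have a: "Z \<in> Obj T" "h \<in> homs T (Z \<boxdot> A') I" "m \<in> carrier (mobj M Z)" by (simp_all add: x dual_domain_def)
      note g = hat[OF a(1,2)]
      show ?thesis
        using dual_family.dinatural[OF dual_moduleD(2)[OF d] g(1) \<epsilon> a(3)]
          dual_family.dinatural[OF dual_moduleD(2)[OF d'] g(1) \<epsilon> a(3)] eq[OF mackey_map_closed[OF M' g(1) a(3)]] g(2) x by simp
    qed
  qed
  have p1: "linear_form K (dual_module M A') (\<lambda>d. d (A, \<epsilon>, v))" if "v \<in> carrier (mobj M A)" for v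
    unfolding linear_form_def by (simp add: dual_moduleD(3))
  have p2: "linear_form K (mobj M A) (\<lambda>v. d (A, \<epsilon>, v))" if "d \<in> carrier (dual_module M A')" for d
    by (rule dual_family.linear_form[OF dual_moduleD(2)[OF that] o(1) \<epsilon>])
  \<comment> \<open>Evaluation at \<epsilon> is the pairing that exhibits the space of families as
    the linear dual of M(A).\<close>
  note ds = dual_space[where p = "\<lambda>d v. d (A, \<epsilon>, v)", OF D(1)[OF o(1)] fin_mackeyD(2)[OF M o(1)] dual_module_vectorspace]
  show "vectorspace.fin_dim K (dual_module M A')" by (rule ds(1)) (fact p1 p2 inj surj)+
  show "\<exists>v \<in> carrier (mobj M A). \<forall>d \<in> carrier (dual_module M A'). \<Phi> d = d (A, \<epsilon>, v)"
    if "linear_form K (dual_module M A') \<Phi>" for \<Phi> by (rule ds(2)) (fact p1 p2 inj surj that)+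
  show "\<exists>d \<in> carrier (dual_module M A'). \<forall>v \<in> carrier (mobj M A). d (A, \<epsilon>, v) = \<xi> v"
    if "linear_form K (mobj M A) \<xi>" for \<xi> by (rule surj[OF that])
qed

text \<open>The space at X is the linear dual of M(A) for a dual object A of X, so X takes the
  second place in \<open>perfect\<close>.\<close>

lemma dual_module_fin_dim:
  assumes "fin_mackey M" "X \<in> Obj T"
  shows "vectorspace.fin_dim K (dual_module M X)"
proof (rule perfect_exists[OF assms(2)])
  fix A \<epsilon> assume "perfect A X (\<epsilon> \<cdot> brd T A X)"
  then show ?thesis by (rule dual_module_yoneda(1)[OF assms(1)])
qed

text \<open>Decodes an element of the copy inside \<open>'v\<close> into a family;
  \<open>of_family\<close> encodes. The section on star-autonomy works through these two
  alone.\<close>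

definition pairing :: "('o, 'a, 'k, 'v) mackey \<Rightarrow> 'o \<Rightarrow> 'v \<Rightarrow> 'o \<Rightarrow> 'a \<Rightarrow> 'v \<Rightarrow> 'k" where
  "pairing M X w = (\<lambda>Z h m. inv_into (carrier (dual_module M X)) (copy_map (dual_module M X)) w (Z, h, m))"

text \<open>The family is cut off outside its domain to meet the normal form of
  \<open>dual_carrier\<close>.\<close>

definition of_family :: "('o, 'a, 'k, 'v) mackey \<Rightarrow> 'o \<Rightarrow> ('o \<Rightarrow> 'a \<Rightarrow> 'v \<Rightarrow> 'k) \<Rightarrow> 'v" where
  "of_family M X b = copy_map (dual_module M X)
     (\<lambda>(Z, h, m). if (Z, h, m) \<in> dual_domain M X then b Z h m else \<zero>\<^bsub>K\<^esub>)"

text \<open>Precomposition with 1 \<boxtimes> f turns arrows out of Z \<boxdot> Y into arrows out of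
  Z \<boxdot> X. Evaluating a family on the results reverses the direction once more, so S M is
  covariant.\<close>

definition dual :: "('o, 'a, 'k, 'v) mackey \<Rightarrow> ('o, 'a, 'k, 'v) mackey" where
  "dual M = \<lparr>mobj = (\<lambda>X. copy (dual_module M X)),
     mmap = (\<lambda>f w. of_family M (Cod T f) (\<lambda>Z h m. pairing M (Dom T f) w Z (h \<cdot> (Ident T Z \<boxtimes> f)) m))\<rparr>"

section \<open>The dual as a finite-dimensional Mackey functor\<close>

context
  fixes M :: "('o, 'a, 'k, 'v) mackey"
  assumes M: "fin_mackey M"
begin

private lemma mobj_dual: "mobj (dual M) X = copy (dual_module M X)"
  by (simp add: dual_def)

private lemmas copy_dual = copy_of_fin_dim[OF dual_module_vectorspace dual_module_fin_dim[OF M], folded mobj_dual]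

lemma dual_vectorspace: "X \<in> Obj T \<Longrightarrow> vectorspace K (mobj (dual M) X)"
  and dual_fin_dim: "X \<in> Obj T \<Longrightarrow> vectorspace.fin_dim K (mobj (dual M) X)"
  by (rule copy_dual; assumption)+

private lemma inv_closed:
  "\<lbrakk>X \<in> Obj T; w \<in> carrier (mobj (dual M) X)\<rbrakk> \<Longrightarrow> inv_into (carrier (dual_module M X)) (copy_map (dual_module M X)) w \<in> carrier (dual_module M X)"
  by (rule module_hom_carrier[OF copy_dual(6)])

lemma pairing_family: "\<lbrakk>X \<in> Obj T; w \<in> carrier (mobj (dual M) X)\<rbrakk> \<Longrightarrow> dual_family K T M X (pairing M X w)"
  unfolding pairing_def by (rule dual_moduleD(2)[OF inv_closed])

lemma pairing_add:
  assumes "X \<in> Obj T" "w \<in> carrier (mobj (dual M) X)" "w' \<in> carrier (mobj (dual M) X)"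
  shows "pairing M X (w \<oplus>\<^bsub>mobj (dual M) X\<^esub> w') Z h m = pairing M X w Z h m \<oplus>\<^bsub>K\<^esub> pairing M X w' Z h m"
  unfolding pairing_def using module_hom_add[OF copy_dual(6)[OF assms(1)] assms(2,3)] by simp

lemma pairing_smult:
  assumes "X \<in> Obj T" "k \<in> carrier K" "w \<in> carrier (mobj (dual M) X)"
  shows "pairing M X (k \<odot>\<^bsub>mobj (dual M) X\<^esub> w) Z h m = k \<otimes>\<^bsub>K\<^esub> pairing M X w Z h m"
  unfolding pairing_def using module_hom_smult[OF copy_dual(6)[OF assms(1)] assms(2,3)] by simp

lemma pairing_closed:
  "\<lbrakk>X \<in> Obj T; w \<in> carrier (mobj (dual M) X)\<rbrakk> \<Longrightarrow> pairing M X w Z h m \<in> carrier K"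
  unfolding pairing_def by (rule dual_moduleD(3)[OF inv_closed])

text \<open>Extensionality principle for S M: equations are proved by comparing families on their
  domain, without reference to the copy.\<close>

lemma pairing_eqI:
  assumes X: "X \<in> Obj T" and w: "w \<in> carrier (mobj (dual M) X)" "w' \<in> carrier (mobj (dual M) X)"
    and eq: "\<And>Z h m. \<lbrakk>Z \<in> Obj T; h \<in> homs T (Z \<boxdot> X) I; m \<in> carrier (mobj M Z)\<rbrakk> \<Longrightarrow> pairing M X w Z h m = pairing M X w' Z h m"
  shows "w = w'"
proof -
  let ?r = "inv_into (carrier (dual_module M X)) (copy_map (dual_module M X) :: _ \<Rightarrow> 'v)"
  have "?r w = ?r w'"
  proof (rule ext)
    fix x :: "'o \<times> 'a \<times> 'v"
    obtain Z h m where x: "x = (Z, h, m)" by (cases x)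
    show "?r w x = ?r w' x"
    proof (cases "x \<in> dual_domain M X")
      case True
      then show ?thesis using eq[of Z h m] by (simp add: x dual_domain_def pairing_def)
    next
      case False
      then show ?thesis using dual_moduleD(1)[OF inv_closed[OF X w(1)]] dual_moduleD(1)[OF inv_closed[OF X w(2)]] by simp
    qed
  qed
  then show ?thesis
    using w f_inv_into_f[of _ "copy_map (dual_module M X)" "carrier (dual_module M X)"] unfolding copy_dual(4)[OF X] by metis
qed

lemma of_family:
  assumes X: "X \<in> Obj T" and b: "dual_family K T M X b"
  shows "of_family M X b \<in> carrier (mobj (dual M) X)"
    and "\<And>Z h m. \<lbrakk>Z \<in> Obj T; h \<in> homs T (Z \<boxdot> X) I; m \<in> carrier (mobj M Z)\<rbrakk> \<Longrightarrow> pairing M X (of_family M X b) Z h m = b Z h m"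
proof -
  interpret b: dual_family K T M X b by (rule b)
  let ?a = "\<lambda>(Z, h, m). if (Z, h, m) \<in> dual_domain M X then b Z h m else \<zero>\<^bsub>K\<^esub>"
  have d: "?a (Z, h, m) = b Z h m" if "Z \<in> Obj T" "h \<in> homs T (Z \<boxdot> X) I" "m \<in> carrier (mobj M Z)" for Z h m
    using that by (simp add: dual_domain_def)
  note D = mackey_functorD[OF fin_mackeyD(1)[OF M]]
  have "dual_family K T M X (\<lambda>Z h m. ?a (Z, h, m))"
  proof
    fix f Z Z' h m assume a: "f \<in> homs T Z Z'" "h \<in> homs T (Z' \<boxdot> X) I" "m \<in> carrier (mobj M Z)"
    have o': "Z \<in> Obj T" "Z' \<in> Obj T" using homs_Obj[OF a(1)] by auto
    show "?a (Z, h \<cdot> (f \<boxtimes> Ident T X), m) = ?a (Z', h, mmap M f m)"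
      unfolding d[OF o'(1) Comp_closed[OF tarr_closed[OF a(1) Ident_closed[OF X]] a(2)] a(3)]
        d[OF o'(2) a(2) mackey_map_closed[OF fin_mackeyD(1)[OF M] a(1,3)]] by (rule b.dinatural[OF a])
  qed (simp_all only: d b.closed b.add_hom b.add b.smult add_arrow_closed vectorspace_closed[OF D(1)])
  then have a: "?a \<in> carrier (dual_module M X)" by (intro dual_moduleI) (auto simp: case_prod_unfold)
  show "of_family M X b \<in> carrier (mobj (dual M) X)"
    unfolding of_family_def by (rule module_hom_carrier[OF copy_dual(3)[OF X] a])
  show "pairing M X (of_family M X b) Z h m = b Z h m"
    if "Z \<in> Obj T" "h \<in> homs T (Z \<boxdot> X) I" "m \<in> carrier (mobj M Z)" for Z h m
    unfolding pairing_def of_family_def inv_into_f_f[OF copy_dual(5)[OF X] a] by (rule d[OF that])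
qed

text \<open>Carries \<open>dual_module_yoneda\<close> over to the copy, for use in
  \<open>double_dual_bij\<close>.\<close>

lemma dual_yoneda:
  assumes p: "perfect A A' \<epsilon>"
  shows "linear_form K (mobj (dual M) A') \<Phi> \<Longrightarrow>
      \<exists>v \<in> carrier (mobj M A). \<forall>w \<in> carrier (mobj (dual M) A'). \<Phi> w = pairing M A' w A \<epsilon> v"
    and "linear_form K (mobj M A) \<xi> \<Longrightarrow>
      \<exists>w \<in> carrier (mobj (dual M) A'). \<forall>v \<in> carrier (mobj M A). pairing M A' w A \<epsilon> v = \<xi> v"
proof -
  have o: "A' \<in> Obj T" using p by (simp add: perfect_def)
  let ?j = "copy_map (dual_module M A') :: _ \<Rightarrow> 'v"
  have p: "pairing M A' (?j d) A \<epsilon> v = d (A, \<epsilon>, v)" if "d \<in> carrier (dual_module M A')" for d v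
    unfolding pairing_def inv_into_f_f[OF copy_dual(5)[OF o] that] ..
  note y = dual_module_yoneda[OF M assms]
  show "\<exists>v \<in> carrier (mobj M A). \<forall>w \<in> carrier (mobj (dual M) A'). \<Phi> w = pairing M A' w A \<epsilon> v"
    if \<Phi>: "linear_form K (mobj (dual M) A') \<Phi>"
    using y(2)[OF linear_form_comp[OF \<Phi> copy_dual(3)[OF o]]] unfolding copy_dual(4)[OF o] by (simp add: p)
  show "\<exists>w \<in> carrier (mobj (dual M) A'). \<forall>v \<in> carrier (mobj M A). pairing M A' w A \<epsilon> v = \<xi> v"
    if \<xi>: "linear_form K (mobj M A) \<xi>"
    using y(3)[OF \<xi>] unfolding copy_dual(4)[OF o] by (simp add: p)
qed

text \<open>Dinaturality survives because f acts on the second factor and g on the first, and such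
  arrows interchange.\<close>

lemma dual_family_act:
  assumes f: "f \<in> homs T X Y" and b: "dual_family K T M X b"
  shows "dual_family K T M Y (\<lambda>Z h m. b Z (h \<cdot> (Ident T Z \<boxtimes> f)) m)"
proof -
  interpret b: dual_family K T M X b by (rule b)
  have o: "X \<in> Obj T" "Y \<in> Obj T" using homs_Obj[OF f] by auto
  have t: "Ident T Z \<boxtimes> f \<in> homs T (Z \<boxdot> X) (Z \<boxdot> Y)" if "Z \<in> Obj T" for Z
    by (rule tarr_closed[OF Ident_closed[OF that] f])
  note c = Comp_closed[OF t]
  show ?thesis
  proof
    fix g Z Z' h m assume a: "g \<in> homs T Z Z'" "h \<in> homs T (Z' \<boxdot> Y) I" "m \<in> carrier (mobj M Z)"
    have o': "Z \<in> Obj T" "Z' \<in> Obj T" using homs_Obj[OF a(1)] by auto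
    have gy: "g \<boxtimes> Ident T Y \<in> homs T (Z \<boxdot> Y) (Z' \<boxdot> Y)" and gx: "g \<boxtimes> Ident T X \<in> homs T (Z \<boxdot> X) (Z' \<boxdot> X)"
      by (rule tarr_closed[OF a(1) Ident_closed[OF o(2)]] tarr_closed[OF a(1) Ident_closed[OF o(1)]])+
    have "(g \<boxtimes> Ident T Y) \<cdot> (Ident T Z \<boxtimes> f) = (Ident T Z' \<boxtimes> f) \<cdot> (g \<boxtimes> Ident T X)"
      using tarr_Comp[OF Ident_closed[OF o'(1)] a(1) f Ident_closed[OF o(2)]]
        tarr_Comp[OF a(1) Ident_closed[OF o'(2)] Ident_closed[OF o(1)] f]
      unfolding Ident_left[OF a(1)] Ident_right[OF a(1)] Ident_left[OF f] Ident_right[OF f] by simp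
    then have "(h \<cdot> (g \<boxtimes> Ident T Y)) \<cdot> (Ident T Z \<boxtimes> f) = (h \<cdot> (Ident T Z' \<boxtimes> f)) \<cdot> (g \<boxtimes> Ident T X)"
      unfolding Comp_assoc[OF t[OF o'(1)] gy a(2)] Comp_assoc[OF gx t[OF o'(2)] a(2)] by simp
    then show "b Z ((h \<cdot> (g \<boxtimes> Ident T Y)) \<cdot> (Ident T Z \<boxtimes> f)) m = b Z' (h \<cdot> (Ident T Z' \<boxtimes> f)) (mmap M g m)"
      using b.dinatural[OF a(1) c[OF o'(2) a(2)] a(3)] by simp
  qed (simp_all only: c b.closed b.add_hom b.add b.smult add_arrow_comp[OF _ _ t])
qed

lemma dual_map:
  assumes f: "f \<in> homs T X Y" and w: "w \<in> carrier (mobj (dual M) X)"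
  shows "mmap (dual M) f w \<in> carrier (mobj (dual M) Y)"
    "\<And>Z h m. \<lbrakk>Z \<in> Obj T; h \<in> homs T (Z \<boxdot> Y) I; m \<in> carrier (mobj M Z)\<rbrakk>
      \<Longrightarrow> pairing M Y (mmap (dual M) f w) Z h m = pairing M X w Z (h \<cdot> (Ident T Z \<boxtimes> f)) m"
proof -
  have o: "X \<in> Obj T" "Y \<in> Obj T" and d: "Dom T f = X" "Cod T f = Y" using homs_Obj[OF f] homsD[OF f] by auto
  have e: "mmap (dual M) f w = of_family M Y (\<lambda>Z h m. pairing M X w Z (h \<cdot> (Ident T Z \<boxtimes> f)) m)"
    by (simp add: dual_def d)
  note b = of_family[OF o(2) dual_family_act[OF f pairing_family[OF o(1) w]]]
  show "mmap (dual M) f w \<in> carrier (mobj (dual M) Y)" unfolding e by (rule b(1))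
  show "\<And>Z h m. \<lbrakk>Z \<in> Obj T; h \<in> homs T (Z \<boxdot> Y) I; m \<in> carrier (mobj M Z)\<rbrakk>
      \<Longrightarrow> pairing M Y (mmap (dual M) f w) Z h m = pairing M X w Z (h \<cdot> (Ident T Z \<boxtimes> f)) m"
    unfolding e by (rule b(2))
qed

lemma dual_fin_mackey: "fin_mackey (dual M)"
proof -
  note v = vectorspace_closed[OF dual_vectorspace]
  have t: "Ident T Z \<boxtimes> f \<in> homs T (Z \<boxdot> X) (Z \<boxdot> Y)" if "f \<in> homs T X Y" "Z \<in> Obj T" for Z X Y f
    by (rule tarr_closed[OF Ident_closed[OF that(2)] that(1)])
  have hom: "mmap (dual M) f \<in> module_hom K (mobj (dual M) X) (mobj (dual M) Y)" if f: "f \<in> homs T X Y" for f X Y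
  proof (rule module_homI)
    have o: "X \<in> Obj T" "Y \<in> Obj T" using homs_Obj[OF f] by auto
    note c = dual_map(1)[OF f]
    show "mmap (dual M) f x \<in> carrier (mobj (dual M) Y)" if "x \<in> carrier (mobj (dual M) X)" for x
      by (rule c[OF that])
    show "mmap (dual M) f (x \<oplus>\<^bsub>mobj (dual M) X\<^esub> y) = mmap (dual M) f x \<oplus>\<^bsub>mobj (dual M) Y\<^esub> mmap (dual M) f y"
      if x: "x \<in> carrier (mobj (dual M) X)" "y \<in> carrier (mobj (dual M) X)" for x y
      by (rule pairing_eqI[OF o(2) c[OF v(1)[OF o(1) x]] v(1)[OF o(2) c[OF x(1)] c[OF x(2)]]])
        (simp only: dual_map(2)[OF f v(1)[OF o(1) x]] dual_map(2)[OF f x(1)] dual_map(2)[OF f x(2)] pairing_add[OF o(1) x]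
          pairing_add[OF o(2) c[OF x(1)] c[OF x(2)]])
    show "mmap (dual M) f (k \<odot>\<^bsub>mobj (dual M) X\<^esub> x) = k \<odot>\<^bsub>mobj (dual M) Y\<^esub> mmap (dual M) f x"
      if k: "k \<in> carrier K" and x: "x \<in> carrier (mobj (dual M) X)" for k x
      by (rule pairing_eqI[OF o(2) c[OF v(2)[OF o(1) x k]] v(2)[OF o(2) c[OF x] k]])
        (simp only: dual_map(2)[OF f v(2)[OF o(1) x k]] dual_map(2)[OF f x] pairing_smult[OF o(1) k x] pairing_smult[OF o(2) k c[OF x]])
  qed
  have id: "mmap (dual M) (Ident T X) x = x" if o: "X \<in> Obj T" and x: "x \<in> carrier (mobj (dual M) X)" for X x
    by (rule pairing_eqI[OF o dual_map(1)[OF Ident_closed[OF o] x] x])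
      (simp only: dual_map(2)[OF Ident_closed[OF o] x] tarr_Ident[OF _ o] Ident_right)
  have comp: "mmap (dual M) (g \<cdot> f) x = mmap (dual M) g (mmap (dual M) f x)"
    if fg: "f \<in> homs T X Y" "g \<in> homs T Y Z" and x: "x \<in> carrier (mobj (dual M) X)" for X Y Z f g x
  proof (rule pairing_eqI[OF _ dual_map(1)[OF Comp_closed[OF fg] x] dual_map(1)[OF fg(2) dual_map(1)[OF fg(1) x]]])
    show "Z \<in> Obj T" using homs_Obj[OF fg(2)] by simp
    fix U h m assume a: "U \<in> Obj T" "h \<in> homs T (U \<boxdot> Z) I" "m \<in> carrier (mobj M U)"
    have "Ident T U \<boxtimes> (g \<cdot> f) = (Ident T U \<boxtimes> g) \<cdot> (Ident T U \<boxtimes> f)"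
      using tarr_Comp[OF Ident_closed[OF a(1)] Ident_closed[OF a(1)] fg] Ident_left[OF Ident_closed[OF a(1)]] by simp
    then show "pairing M Z (mmap (dual M) (g \<cdot> f) x) U h m = pairing M Z (mmap (dual M) g (mmap (dual M) f x)) U h m"
      unfolding dual_map(2)[OF Comp_closed[OF fg] x a] dual_map(2)[OF fg(2) dual_map(1)[OF fg(1) x] a]
        dual_map(2)[OF fg(1) x a(1) Comp_closed[OF t[OF fg(2) a(1)] a(2)] a(3)]
        Comp_assoc[OF t[OF fg(1) a(1)] t[OF fg(2) a(1)] a(2)] by simp
  qed
  \<comment> \<open>Here S M meets the addition of arrows: \<open>comp_add_tarr'\<close> distributes
    1 \<boxtimes> (f + g) under h.\<close>
  have add: "mmap (dual M) (add_arrow T f g) x = mmap (dual M) f x \<oplus>\<^bsub>mobj (dual M) Y\<^esub> mmap (dual M) g x"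
    if fg: "f \<in> homs T X Y" "g \<in> homs T X Y" and x: "x \<in> carrier (mobj (dual M) X)" for X Y f g x
  proof -
    have o: "X \<in> Obj T" "Y \<in> Obj T" using homs_Obj[OF fg(1)] by auto
    note fx = dual_map(1)[OF fg(1) x] and gx = dual_map(1)[OF fg(2) x]
    show ?thesis
    proof (rule pairing_eqI[OF o(2) dual_map(1)[OF add_arrow_closed[OF fg] x] v(1)[OF o(2) fx gx]])
      fix U h m assume a: "U \<in> Obj T" "h \<in> homs T (U \<boxdot> Y) I" "m \<in> carrier (mobj M U)"
      show "pairing M Y (mmap (dual M) (add_arrow T f g) x) U h m
        = pairing M Y (mmap (dual M) f x \<oplus>\<^bsub>mobj (dual M) Y\<^esub> mmap (dual M) g x) U h m"
        unfolding dual_map(2)[OF add_arrow_closed[OF fg] x a] pairing_add[OF o(2) fx gx] dual_map(2)[OF fg(1) x a]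
          dual_map(2)[OF fg(2) x a] comp_add_tarr'[OF a(2) fg a(1)]
        by (rule dual_family.add_hom[OF pairing_family[OF o(1) x] a(1) Comp_closed[OF t[OF fg(1) a(1)] a(2)]
            Comp_closed[OF t[OF fg(2) a(1)] a(2)] a(3)])
    qed
  qed
  have zero: "mmap (dual M) (zero_arrow T X Y) x = \<zero>\<^bsub>mobj (dual M) Y\<^esub>"
    if o: "X \<in> Obj T" "Y \<in> Obj T" and x: "x \<in> carrier (mobj (dual M) X)" for X Y x
  proof (rule double_eq_zero[OF dual_vectorspace[OF o(2)]])
    note z = zero_arrow_closed[OF o]
    show "mmap (dual M) (zero_arrow T X Y) x \<in> carrier (mobj (dual M) Y)" by (rule dual_map(1)[OF z x])
    show "mmap (dual M) (zero_arrow T X Y) x \<oplus>\<^bsub>mobj (dual M) Y\<^esub> mmap (dual M) (zero_arrow T X Y) x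
        = mmap (dual M) (zero_arrow T X Y) x"
      unfolding add[OF z z x, symmetric] add_arrow_zero(1)[OF z] ..
  qed
  have "mackey_functor K T (dual M)"
    unfolding mackey_functor_def
    by (intro conjI ballI allI impI dual_vectorspace hom id comp add zero; assumption)
  then show ?thesis
    unfolding fin_mackey_def fin_dim_mackey_def using dual_fin_dim by blast
qed

end

end


section \<open>Star-autonomy\<close>

context mackey_setting
begin

section \<open>The category of finite-dimensional Mackey functors\<close>

abbreviation \<M> :: "(('o, 'a, 'k, 'v) mackey, ('o, 'a, 'k, 'v) mackey_arrow) monoidal" where
  "\<M> \<equiv> Mky_fin K T"

definition component :: "('o, 'a, 'k, 'v) mackey_arrow \<Rightarrow> 'o \<Rightarrow> 'v \<Rightarrow> 'v" where
  "component f = snd (snd f)"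

text \<open>Components are restricted to the carriers because arrows of the category are required to
  be extensional; equality of arrows then reduces to equality of values.\<close>

definition arrow_of :: "('o, 'a, 'k, 'v) mackey \<Rightarrow> ('o, 'a, 'k, 'v) mackey \<Rightarrow> ('o \<Rightarrow> 'v \<Rightarrow> 'v) \<Rightarrow>
    ('o, 'a, 'k, 'v) mackey_arrow" where
  "arrow_of A B t = (A, B, \<lambda>X \<in> Obj T. restrict (t X) (carrier (mobj A X)))"

lemma Obj_M: "A \<in> Obj \<M> \<longleftrightarrow> fin_mackey A"
  by (simp add: Mky_fin_def Mky_def fin_mackey_def)

lemma homs_M: "f \<in> homs \<M> A B \<longleftrightarrow>
    f = (A, B, component f) \<and> fin_mackey A \<and> fin_mackey B \<and> natural_transformation K T A B (component f)"
  by (cases f) (auto simp: homs_def Mky_fin_def Mky_def fin_mackey_def component_def)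

lemma arrowD:
  assumes "f \<in> homs \<M> A B"
  shows "fin_mackey A" "fin_mackey B" "natural_transformation K T A B (component f)" "f = (A, B, component f)"
  using assms homs_M by blast+

lemmas component_natural = natural_transformationD(4)[OF arrowD(3)]
lemmas component_closed = natural_transformationD(5)[OF arrowD(3)]
lemmas component_hom = natural_transformationD(3)[OF arrowD(3)]

lemma arrow_eqI:
  assumes f: "f \<in> homs \<M> A B" and g: "g \<in> homs \<M> A B"
    and eq: "\<And>X x. \<lbrakk>X \<in> Obj T; x \<in> carrier (mobj A X)\<rbrakk> \<Longrightarrow> component f X x = component g X x"
  shows "f = g"
proof -
  note nf = natural_transformationD[OF arrowD(3)[OF f]] and ng = natural_transformationD[OF arrowD(3)[OF g]]
  have "component f = component g"
  proof (rule extensionalityI[OF nf(1) ng(1)])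
    fix X assume X: "X \<in> Obj T"
    show "component f X = component g X"
      by (rule extensionalityI[OF linear_mapsD(2)[OF nf(2)[OF X]] linear_mapsD(2)[OF ng(2)[OF X]]]) (rule eq[OF X])
  qed
  then show ?thesis using arrowD(4)[OF f] arrowD(4)[OF g] by simp
qed

lemma arrow_of:
  assumes A: "fin_mackey A" and B: "fin_mackey B"
    and t: "\<And>X. X \<in> Obj T \<Longrightarrow> t X \<in> module_hom K (mobj A X) (mobj B X)"
    and nat: "\<And>X Y f x. \<lbrakk>f \<in> homs T X Y; x \<in> carrier (mobj A X)\<rbrakk> \<Longrightarrow> t Y (mmap A f x) = mmap B f (t X x)"
  shows "arrow_of A B t \<in> homs \<M> A B"
    "\<And>X x. \<lbrakk>X \<in> Obj T; x \<in> carrier (mobj A X)\<rbrakk> \<Longrightarrow> component (arrow_of A B t) X x = t X x"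
proof -
  show c: "component (arrow_of A B t) X x = t X x" if "X \<in> Obj T" "x \<in> carrier (mobj A X)" for X x
    using that by (simp add: arrow_of_def component_def)
  have "natural_transformation K T A B (component (arrow_of A B t))"
    unfolding natural_transformation_def
  proof (intro conjI ballI allI impI)
    show "component (arrow_of A B t) \<in> extensional (Obj T)" by (simp add: arrow_of_def component_def)
    show "component (arrow_of A B t) X \<in> linear_maps K (mobj A X) (mobj B X)" if X: "X \<in> Obj T" for X
      using linear_mapsI[OF mackey_functorD(1)[OF fin_mackeyD(1)[OF A] X] t[OF X]] X
      by (simp add: arrow_of_def component_def)
    show "component (arrow_of A B t) Y (mmap A f x) = mmap B f (component (arrow_of A B t) X x)"
      if f: "f \<in> homs T X Y" and x: "x \<in> carrier (mobj A X)" for X Y f x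
      using c[OF _ mackey_map_closed[OF fin_mackeyD(1)[OF A] f x]] c[OF _ x] homs_Obj[OF f] nat[OF f x] by simp
  qed
  then show "arrow_of A B t \<in> homs \<M> A B"
    unfolding homs_M using A B by (simp add: arrow_of_def component_def)
qed

lemma Ident_M: "Ident \<M> A = arrow_of A A (\<lambda>X x. x)"
  by (simp add: Mky_fin_def Mky_def arrow_of_def)

lemma Comp_M:
  assumes f: "f \<in> homs \<M> A B" and g: "g \<in> homs \<M> B D"
  shows "g \<cdot>\<^bsub>\<M>\<^esub> f \<in> homs \<M> A D"
    "\<And>X x. \<lbrakk>X \<in> Obj T; x \<in> carrier (mobj A X)\<rbrakk> \<Longrightarrow> component (g \<cdot>\<^bsub>\<M>\<^esub> f) X x = component g X (component f X x)"
proof -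
  have "g \<cdot>\<^bsub>\<M>\<^esub> f = (B, D, component g) \<cdot>\<^bsub>\<M>\<^esub> (A, B, component f)"
    using arrowD(4)[OF f] arrowD(4)[OF g] by simp
  also have "\<dots> = arrow_of A D (\<lambda>X x. component g X (component f X x))"
    by (simp add: Mky_fin_def Mky_def arrow_of_def compose_def)
  finally have e: "g \<cdot>\<^bsub>\<M>\<^esub> f = arrow_of A D (\<lambda>X x. component g X (component f X x))" .
  note a = arrow_of[where t = "\<lambda>X x. component g X (component f X x)", OF arrowD(1)[OF f] arrowD(2)[OF g]]
  have h: "(\<lambda>x. component g X (component f X x)) \<in> module_hom K (mobj A X) (mobj D X)" if "X \<in> Obj T" for X
    by (rule module_hom_comp[OF component_hom[OF f that] component_hom[OF g that]])
  have n: "component g Y (component f Y (mmap A k x)) = mmap D k (component g X (component f X x))"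
    if k: "k \<in> homs T X Y" and x: "x \<in> carrier (mobj A X)" for X Y k x
    using component_natural[OF f k x] component_natural[OF g k component_closed[OF f _ x]] homs_Obj[OF k] by simp
  show "g \<cdot>\<^bsub>\<M>\<^esub> f \<in> homs \<M> A D" unfolding e by (rule a(1)) (fact h n)+
  show "component (g \<cdot>\<^bsub>\<M>\<^esub> f) X x = component g X (component f X x)" if "X \<in> Obj T" "x \<in> carrier (mobj A X)" for X x
    unfolding e by (rule a(2)) (fact h n that)+
qed

lemma Ident_M_arrow:
  assumes "fin_mackey A"
  shows "Ident \<M> A \<in> homs \<M> A A" "\<And>X x. \<lbrakk>X \<in> Obj T; x \<in> carrier (mobj A X)\<rbrakk> \<Longrightarrow> component (Ident \<M> A) X x = x"
proof -
  have h: "(\<lambda>x. x) \<in> module_hom K (mobj A X) (mobj A X)" if "X \<in> Obj T" for X by (rule module_homI) simp_all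
  have refl: "mmap A f x = mmap A f x" if "f \<in> homs T X Y" "x \<in> carrier (mobj A X)" for f X Y x ..
  show "Ident \<M> A \<in> homs \<M> A A"
    unfolding Ident_M by (rule arrow_of(1)[OF assms assms h refl])
  show "component (Ident \<M> A) X x = x" if "X \<in> Obj T" "x \<in> carrier (mobj A X)" for X x
    unfolding Ident_M by (rule arrow_of(2)[where t = "\<lambda>X x. x", OF assms assms]) (fact h refl that)+
qed

lemma tobj_M: "A \<boxdot>\<^bsub>\<M>\<^esub> B = day K T A B"
  by (simp add: Mky_fin_def Mky_def)

lemma tarr_M:
  assumes f: "f \<in> homs \<M> A A'" and g: "g \<in> homs \<M> B B'"
  shows "f \<boxtimes>\<^bsub>\<M>\<^esub> g \<in> homs \<M> (day K T A B) (day K T A' B')"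
    "\<And>Z X Y h m n. \<lbrakk>Z \<in> Obj T; X \<in> Obj T; Y \<in> Obj T; h \<in> homs T (X \<boxdot> Y) Z; m \<in> carrier (mobj A X); n \<in> carrier (mobj B Y)\<rbrakk>
      \<Longrightarrow> component (f \<boxtimes>\<^bsub>\<M>\<^esub> g) Z (day_class K T A B Z X Y h m n)
        = day_class K T A' B' Z X Y h (component f X m) (component g Y n)"
proof -
  note F = arrowD[OF f] and G = arrowD[OF g]
  have e: "f \<boxtimes>\<^bsub>\<M>\<^esub> g = day_arrow K T (A, A', component f) (B, B', component g)"
    using F(4) G(4) by (simp add: Mky_fin_def Mky_def)
  have c: "component (f \<boxtimes>\<^bsub>\<M>\<^esub> g) = snd (snd (day_arrow K T (A, A', component f) (B, B', component g)))"
    unfolding e component_def[of "day_arrow K T (A, A', component f) (B, B', component g)"] ..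
  have d: "day_arrow K T (A, A', component f) (B, B', component g) = (day K T A B, day K T A' B', component (f \<boxtimes>\<^bsub>\<M>\<^esub> g))"
    unfolding c day_arrow_def by simp
  have "natural_transformation K T (day K T A B) (day K T A' B') (component (f \<boxtimes>\<^bsub>\<M>\<^esub> g))"
    unfolding c by (rule day_arrow_natural[OF F(1,2) G(1,2) F(3) G(3)])
  then show "f \<boxtimes>\<^bsub>\<M>\<^esub> g \<in> homs \<M> (day K T A B) (day K T A' B')"
    unfolding homs_M using e[unfolded d] day_fin_mackey[OF F(1) G(1)] day_fin_mackey[OF F(2) G(2)] by blast
  show "\<And>Z X Y h m n. \<lbrakk>Z \<in> Obj T; X \<in> Obj T; Y \<in> Obj T; h \<in> homs T (X \<boxdot> Y) Z; m \<in> carrier (mobj A X); n \<in> carrier (mobj B Y)\<rbrakk>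
      \<Longrightarrow> component (f \<boxtimes>\<^bsub>\<M>\<^esub> g) Z (day_class K T A B Z X Y h m n)
        = day_class K T A' B' Z X Y h (component f X m) (component g Y n)"
    unfolding c by (rule day_arrow_component(2)[OF F(1,2) G(1,2) F(3) G(3)])
qed

subsection \<open>The duality functor\<close>

definition dual_arrow :: "('o, 'a, 'k, 'v) mackey_arrow \<Rightarrow> ('o, 'a, 'k, 'v) mackey_arrow" where
  "dual_arrow f = (let A = fst f; B = fst (snd f) in
     arrow_of (dual B) (dual A) (\<lambda>X w. of_family A X (\<lambda>Z h m. pairing B X w Z h (component f Z m))))"

lemma dual_family_pullback:
  assumes f: "f \<in> homs \<M> A B" and X: "X \<in> Obj T" and b: "dual_family K T B X b"
  shows "dual_family K T A X (\<lambda>Z h m. b Z h (component f Z m))"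
proof -
  interpret b: dual_family K T B X b by (rule b)
  note n = natural_transformationD[OF arrowD(3)[OF f]]
  show ?thesis
  proof
    fix g Z Z' h m assume a: "g \<in> homs T Z Z'" "h \<in> homs T (Z' \<boxdot> X) I" "m \<in> carrier (mobj A Z)"
    show "b Z (h \<cdot> (g \<boxtimes> Ident T X)) (component f Z m) = b Z' h (component f Z' (mmap A g m))"
      unfolding n(4)[OF a(1,3)] by (rule b.dinatural[OF a(1,2) n(5)[OF conjunct1[OF homs_Obj[OF a(1)]] a(3)]])
  qed (simp_all only: n(5-7) b.closed b.add_hom b.add b.smult)
qed

text \<open>Currying: a morphism N -> S L is given by families that depend linearly and naturally on
  a further argument n. Both \<open>dual_arrow\<close> and \<open>double_dual\<close> are
  instances.\<close>

lemma arrow_into_dual: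
  assumes N: "fin_mackey N" and L: "fin_mackey L"
    and fam: "\<And>X n. \<lbrakk>X \<in> Obj T; n \<in> carrier (mobj N X)\<rbrakk> \<Longrightarrow> dual_family K T L X (b X n)"
    and add: "\<And>X n n' Z h m. \<lbrakk>X \<in> Obj T; n \<in> carrier (mobj N X); n' \<in> carrier (mobj N X); Z \<in> Obj T; h \<in> homs T (Z \<boxdot> X) I;
        m \<in> carrier (mobj L Z)\<rbrakk> \<Longrightarrow> b X (n \<oplus>\<^bsub>mobj N X\<^esub> n') Z h m = b X n Z h m \<oplus>\<^bsub>K\<^esub> b X n' Z h m"
    and smult: "\<And>X k n Z h m. \<lbrakk>X \<in> Obj T; k \<in> carrier K; n \<in> carrier (mobj N X); Z \<in> Obj T; h \<in> homs T (Z \<boxdot> X) I;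
        m \<in> carrier (mobj L Z)\<rbrakk> \<Longrightarrow> b X (k \<odot>\<^bsub>mobj N X\<^esub> n) Z h m = k \<otimes>\<^bsub>K\<^esub> b X n Z h m"
    and nat: "\<And>X Y f n Z h m. \<lbrakk>f \<in> homs T X Y; n \<in> carrier (mobj N X); Z \<in> Obj T; h \<in> homs T (Z \<boxdot> Y) I;
        m \<in> carrier (mobj L Z)\<rbrakk> \<Longrightarrow> b Y (mmap N f n) Z h m = b X n Z (h \<cdot> (Ident T Z \<boxtimes> f)) m"
  defines "F \<equiv> arrow_of N (dual L) (\<lambda>X n. of_family L X (b X n))"
  shows "F \<in> homs \<M> N (dual L)"
    and "\<And>X n. \<lbrakk>X \<in> Obj T; n \<in> carrier (mobj N X)\<rbrakk> \<Longrightarrow> component F X n \<in> carrier (mobj (dual L) X)"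
    and "\<And>X n Z h m. \<lbrakk>X \<in> Obj T; n \<in> carrier (mobj N X); Z \<in> Obj T; h \<in> homs T (Z \<boxdot> X) I; m \<in> carrier (mobj L Z)\<rbrakk>
      \<Longrightarrow> pairing L X (component F X n) Z h m = b X n Z h m"
proof -
  note o = of_family[OF L _ fam]
  note vN = vectorspace_closed[OF mackey_functorD(1)[OF fin_mackeyD(1)[OF N]]]
  note vD = vectorspace_closed[OF dual_vectorspace[OF L]]
  have hom: "(\<lambda>n. of_family L X (b X n)) \<in> module_hom K (mobj N X) (mobj (dual L) X)" if X: "X \<in> Obj T" for X
  proof (rule module_homI)
    note c = o(1)[OF X X]
    show "of_family L X (b X n) \<in> carrier (mobj (dual L) X)" if "n \<in> carrier (mobj N X)" for n by (rule c[OF that])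
    show "of_family L X (b X (n \<oplus>\<^bsub>mobj N X\<^esub> n')) = of_family L X (b X n) \<oplus>\<^bsub>mobj (dual L) X\<^esub> of_family L X (b X n')"
      if n: "n \<in> carrier (mobj N X)" "n' \<in> carrier (mobj N X)" for n n'
      by (rule pairing_eqI[OF L X c[OF vN(1)[OF X n]] vD(1)[OF X c[OF n(1)] c[OF n(2)]]])
        (simp only: pairing_add[OF L X c[OF n(1)] c[OF n(2)]] o(2)[OF X X vN(1)[OF X n]] o(2)[OF X X n(1)] o(2)[OF X X n(2)]
          add[OF X n])
    show "of_family L X (b X (k \<odot>\<^bsub>mobj N X\<^esub> n)) = k \<odot>\<^bsub>mobj (dual L) X\<^esub> of_family L X (b X n)"
      if k: "k \<in> carrier K" and n: "n \<in> carrier (mobj N X)" for k n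
      by (rule pairing_eqI[OF L X c[OF vN(2)[OF X n k]] vD(2)[OF X c[OF n] k]])
        (simp only: pairing_smult[OF L X k c[OF n]] o(2)[OF X X vN(2)[OF X n k]] o(2)[OF X X n] smult[OF X k n])
  qed
  have natural: "of_family L Y (b Y (mmap N f n)) = mmap (dual L) f (of_family L X (b X n))"
    if f: "f \<in> homs T X Y" and n: "n \<in> carrier (mobj N X)" for X Y f n
  proof -
    have ob: "X \<in> Obj T" "Y \<in> Obj T" using homs_Obj[OF f] by auto
    have fn: "mmap N f n \<in> carrier (mobj N Y)" by (rule mackey_map_closed[OF fin_mackeyD(1)[OF N] f n])
    note c = o(1)[OF ob(1,1) n]
    show ?thesis
    proof (rule pairing_eqI[OF L ob(2) o(1)[OF ob(2,2) fn] dual_map(1)[OF L f c]])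
      fix Z h m assume a: "Z \<in> Obj T" "h \<in> homs T (Z \<boxdot> Y) I" "m \<in> carrier (mobj L Z)"
      have hf: "h \<cdot> (Ident T Z \<boxtimes> f) \<in> homs T (Z \<boxdot> X) I"
        by (rule Comp_closed[OF tarr_closed[OF Ident_closed[OF a(1)] f] a(2)])
      show "pairing L Y (of_family L Y (b Y (mmap N f n))) Z h m = pairing L Y (mmap (dual L) f (of_family L X (b X n))) Z h m"
        unfolding dual_map(2)[OF L f c a] o(2)[OF ob(2,2) fn a] o(2)[OF ob(1,1) n a(1) hf a(3)] by (rule nat[OF f n a])
    qed
  qed
  note F = arrow_of[where t = "\<lambda>X n. of_family L X (b X n)", OF N dual_fin_mackey[OF L], folded F_def]
  show "F \<in> homs \<M> N (dual L)" by (rule F(1)) (fact hom natural)+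
  have F: "component F X n = of_family L X (b X n)" if "X \<in> Obj T" "n \<in> carrier (mobj N X)" for X n
    by (rule F(2)) (fact hom natural that)+
  show "component F X n \<in> carrier (mobj (dual L) X)" if "X \<in> Obj T" "n \<in> carrier (mobj N X)" for X n
    unfolding F[OF that] by (rule o(1)[OF that(1) that])
  show "pairing L X (component F X n) Z h m = b X n Z h m"
    if "X \<in> Obj T" "n \<in> carrier (mobj N X)" "Z \<in> Obj T" "h \<in> homs T (Z \<boxdot> X) I" "m \<in> carrier (mobj L Z)" for X n Z h m
    unfolding F[OF that(1,2)] by (rule o(2)[OF that(1) that])
qed

lemma dual_arrow:
  assumes f: "f \<in> homs \<M> A B"
  shows "dual_arrow f \<in> homs \<M> (dual B) (dual A)"
    and "\<And>X w Z h m. \<lbrakk>X \<in> Obj T; w \<in> carrier (mobj (dual B) X); Z \<in> Obj T; h \<in> homs T (Z \<boxdot> X) I; m \<in> carrier (mobj A Z)\<rbrakk>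
      \<Longrightarrow> pairing A X (component (dual_arrow f) X w) Z h m = pairing B X w Z h (component f Z m)"
proof -
  note F = arrowD[OF f]
  have e: "dual_arrow f = arrow_of (dual B) (dual A) (\<lambda>X w. of_family A X (\<lambda>Z h m. pairing B X w Z h (component f Z m)))"
    using arg_cong[OF F(4), of fst] arg_cong[OF F(4), of "\<lambda>f. fst (snd f)"] by (simp add: dual_arrow_def)
  have nat: "pairing B Y (mmap (dual B) g w) Z h (component f Z m) = pairing B X w Z (h \<cdot> (Ident T Z \<boxtimes> g)) (component f Z m)"
    if "g \<in> homs T X Y" "w \<in> carrier (mobj (dual B) X)" "Z \<in> Obj T" "h \<in> homs T (Z \<boxdot> Y) I" "m \<in> carrier (mobj A Z)" for X Y g w Z h m
    by (rule dual_map(2)[OF F(2) that(1-4) component_closed[OF f that(3,5)]])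
  note r = arrow_into_dual[where b = "\<lambda>X w Z h m. pairing B X w Z h (component f Z m)", OF dual_fin_mackey[OF F(2)] F(1)
      dual_family_pullback[OF f _ pairing_family[OF F(2)]] pairing_add[OF F(2)] pairing_smult[OF F(2)] nat, folded e]
  show "dual_arrow f \<in> homs \<M> (dual B) (dual A)" by (rule r(1))
  show "\<And>X w Z h m. \<lbrakk>X \<in> Obj T; w \<in> carrier (mobj (dual B) X); Z \<in> Obj T; h \<in> homs T (Z \<boxdot> X) I; m \<in> carrier (mobj A Z)\<rbrakk>
      \<Longrightarrow> pairing A X (component (dual_arrow f) X w) Z h m = pairing B X w Z h (component f Z m)"
    by (rule r(3))
qed

lemma arrow_into_dual_eqI:
  assumes f: "f \<in> homs \<M> A (dual L)" and g: "g \<in> homs \<M> A (dual L)" and L: "fin_mackey L"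
    and eq: "\<And>X x Z h m. \<lbrakk>X \<in> Obj T; x \<in> carrier (mobj A X); Z \<in> Obj T; h \<in> homs T (Z \<boxdot> X) I; m \<in> carrier (mobj L Z)\<rbrakk>
      \<Longrightarrow> pairing L X (component f X x) Z h m = pairing L X (component g X x) Z h m"
  shows "f = g"
proof (rule arrow_eqI[OF f g])
  fix X x assume X: "X \<in> Obj T" and x: "x \<in> carrier (mobj A X)"
  show "component f X x = component g X x"
    by (rule pairing_eqI[OF L X component_closed[OF f X x] component_closed[OF g X x]]) (rule eq[OF X x])
qed

lemma dual_arrow_Ident:
  assumes A: "fin_mackey A"
  shows "dual_arrow (Ident \<M> A) = Ident \<M> (dual A)"
proof (rule arrow_into_dual_eqI[OF dual_arrow(1)[OF Ident_M_arrow(1)[OF A]] Ident_M_arrow(1)[OF dual_fin_mackey[OF A]] A])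
  fix X x Z h m
  assume a: "X \<in> Obj T" "x \<in> carrier (mobj (dual A) X)" "Z \<in> Obj T" "h \<in> homs T (Z \<boxdot> X) I" "m \<in> carrier (mobj A Z)"
  show "pairing A X (component (dual_arrow (Ident \<M> A)) X x) Z h m = pairing A X (component (Ident \<M> (dual A)) X x) Z h m"
    unfolding dual_arrow(2)[OF Ident_M_arrow(1)[OF A] a] Ident_M_arrow(2)[OF A a(3,5)]
      Ident_M_arrow(2)[OF dual_fin_mackey[OF A] a(1,2)] ..
qed

lemma dual_arrow_Comp:
  assumes f: "f \<in> homs \<M> A B" and g: "g \<in> homs \<M> B D"
  shows "dual_arrow (g \<cdot>\<^bsub>\<M>\<^esub> f) = dual_arrow f \<cdot>\<^bsub>\<M>\<^esub> dual_arrow g"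
proof (rule arrow_into_dual_eqI[OF dual_arrow(1)[OF Comp_M(1)[OF f g]] Comp_M(1)[OF dual_arrow(1)[OF g] dual_arrow(1)[OF f]] arrowD(1)[OF f]])
  fix X x Z h m
  assume a: "X \<in> Obj T" "x \<in> carrier (mobj (dual D) X)" "Z \<in> Obj T" "h \<in> homs T (Z \<boxdot> X) I" "m \<in> carrier (mobj A Z)"
  show "pairing A X (component (dual_arrow (g \<cdot>\<^bsub>\<M>\<^esub> f)) X x) Z h m
    = pairing A X (component (dual_arrow f \<cdot>\<^bsub>\<M>\<^esub> dual_arrow g) X x) Z h m"
    unfolding dual_arrow(2)[OF Comp_M(1)[OF f g] a] Comp_M(2)[OF f g a(3,5)]
      Comp_M(2)[OF dual_arrow(1)[OF g] dual_arrow(1)[OF f] a(1,2)]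
      dual_arrow(2)[OF f a(1) component_closed[OF dual_arrow(1)[OF g] a(1,2)] a(3-5)]
      dual_arrow(2)[OF g a(1-4) component_closed[OF f a(3,5)]] ..
qed

text \<open>Evaluation at x. The braiding occurs because a family w at Z expects arrows out of X
  \<boxdot> Z, whereas an element of S (S M) at X is tested on arrows out of Z \<boxdot> X.\<close>

definition double_dual :: "('o, 'a, 'k, 'v) mackey \<Rightarrow> ('o, 'a, 'k, 'v) mackey_arrow" where
  "double_dual M = arrow_of M (dual (dual M))
     (\<lambda>X x. of_family (dual M) X (\<lambda>Z h w. pairing M Z w X (h \<cdot> brd T X Z) x))"

lemma double_dual:
  assumes M: "fin_mackey M"
  shows "double_dual M \<in> homs \<M> M (dual (dual M))"
    and "\<And>X x Z h w. \<lbrakk>X \<in> Obj T; x \<in> carrier (mobj M X); Z \<in> Obj T; h \<in> homs T (Z \<boxdot> X) I; w \<in> carrier (mobj (dual M) Z)\<rbrakk>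
      \<Longrightarrow> pairing (dual M) X (component (double_dual M) X x) Z h w = pairing M Z w X (h \<cdot> brd T X Z) x"
proof -
  have hb: "h \<cdot> brd T X Z \<in> homs T (X \<boxdot> Z) I" if "X \<in> Obj T" "Z \<in> Obj T" "h \<in> homs T (Z \<boxdot> X) I" for X Z h
    by (rule Comp_closed[OF brd_closed[OF that(1,2)] that(3)])
  have fam: "dual_family K T (dual M) X (\<lambda>Z h w. pairing M Z w X (h \<cdot> brd T X Z) x)"
    if X: "X \<in> Obj T" and x: "x \<in> carrier (mobj M X)" for X x
  proof
    fix Z h w assume Z: "Z \<in> Obj T" and h: "h \<in> homs T (Z \<boxdot> X) I" and w: "w \<in> carrier (mobj (dual M) Z)"
    show "pairing M Z w X (h \<cdot> brd T X Z) x \<in> carrier K" by (rule pairing_closed[OF M Z w])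
    show "pairing M Z (w \<oplus>\<^bsub>mobj (dual M) Z\<^esub> w') X (h \<cdot> brd T X Z) x
        = pairing M Z w X (h \<cdot> brd T X Z) x \<oplus>\<^bsub>K\<^esub> pairing M Z w' X (h \<cdot> brd T X Z) x"
      if "w' \<in> carrier (mobj (dual M) Z)" for w' by (rule pairing_add[OF M Z w that])
    show "pairing M Z (k \<odot>\<^bsub>mobj (dual M) Z\<^esub> w) X (h \<cdot> brd T X Z) x = k \<otimes>\<^bsub>K\<^esub> pairing M Z w X (h \<cdot> brd T X Z) x"
      if "k \<in> carrier K" for k by (rule pairing_smult[OF M Z that w])
    show "pairing M Z w X (add_arrow T h h' \<cdot> brd T X Z) x
        = pairing M Z w X (h \<cdot> brd T X Z) x \<oplus>\<^bsub>K\<^esub> pairing M Z w X (h' \<cdot> brd T X Z) x"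
      if h': "h' \<in> homs T (Z \<boxdot> X) I" for h'
      unfolding add_arrow_comp[OF h h' brd_closed[OF X Z]]
      by (rule dual_family.add_hom[OF pairing_family[OF M Z w] X hb[OF X Z h] hb[OF X Z h'] x])
  next
    fix f Z Z' h w assume f: "f \<in> homs T Z Z'" and h: "h \<in> homs T (Z' \<boxdot> X) I" and w: "w \<in> carrier (mobj (dual M) Z)"
    have o: "Z \<in> Obj T" "Z' \<in> Obj T" using homs_Obj[OF f] by auto
    note c = brd_closed[OF X o(1)] tarr_closed[OF f Ident_closed[OF X]] tarr_closed[OF Ident_closed[OF X] f] brd_closed[OF X o(2)]
    have "(h \<cdot> (f \<boxtimes> Ident T X)) \<cdot> brd T X Z = (h \<cdot> brd T X Z') \<cdot> (Ident T X \<boxtimes> f)"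
      unfolding Comp_assoc[OF c(1,2) h] Comp_assoc[OF c(3,4) h] brd_natural[OF Ident_closed[OF X] f] ..
    then show "pairing M Z w X ((h \<cdot> (f \<boxtimes> Ident T X)) \<cdot> brd T X Z) x = pairing M Z' (mmap (dual M) f w) X (h \<cdot> brd T X Z') x"
      unfolding dual_map(2)[OF M f w X hb[OF X o(2) h] x] by simp
  qed
  have add: "pairing M Z w X (h \<cdot> brd T X Z) (x \<oplus>\<^bsub>mobj M X\<^esub> x') = pairing M Z w X (h \<cdot> brd T X Z) x \<oplus>\<^bsub>K\<^esub> pairing M Z w X (h \<cdot> brd T X Z) x'"
    if "X \<in> Obj T" "x \<in> carrier (mobj M X)" "x' \<in> carrier (mobj M X)" "Z \<in> Obj T" "h \<in> homs T (Z \<boxdot> X) I" "w \<in> carrier (mobj (dual M) Z)" for X x x' Z h w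
    by (rule dual_family.add[OF pairing_family[OF M that(4,6)] that(1) hb[OF that(1,4,5)] that(2,3)])
  have smult: "pairing M Z w X (h \<cdot> brd T X Z) (k \<odot>\<^bsub>mobj M X\<^esub> x) = k \<otimes>\<^bsub>K\<^esub> pairing M Z w X (h \<cdot> brd T X Z) x"
    if "X \<in> Obj T" "k \<in> carrier K" "x \<in> carrier (mobj M X)" "Z \<in> Obj T" "h \<in> homs T (Z \<boxdot> X) I" "w \<in> carrier (mobj (dual M) Z)" for X x k Z h w
    by (rule dual_family.smult[OF pairing_family[OF M that(4,6)] that(1) hb[OF that(1,4,5)] that(2,3)])
  have nat: "pairing M Z w Y (h \<cdot> brd T Y Z) (mmap M f x) = pairing M Z w X ((h \<cdot> (Ident T Z \<boxtimes> f)) \<cdot> brd T X Z) x"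
    if f: "f \<in> homs T X Y" and x: "x \<in> carrier (mobj M X)" and Z: "Z \<in> Obj T" and h: "h \<in> homs T (Z \<boxdot> Y) I"
      and w: "w \<in> carrier (mobj (dual M) Z)" for X Y f x Z h w
  proof -
    have o: "X \<in> Obj T" "Y \<in> Obj T" using homs_Obj[OF f] by auto
    note c = brd_closed[OF o(1) Z] tarr_closed[OF Ident_closed[OF Z] f] tarr_closed[OF f Ident_closed[OF Z]] brd_closed[OF o(2) Z]
    have "(h \<cdot> (Ident T Z \<boxtimes> f)) \<cdot> brd T X Z = (h \<cdot> brd T Y Z) \<cdot> (f \<boxtimes> Ident T Z)"
      unfolding Comp_assoc[OF c(1,2) h] Comp_assoc[OF c(3,4) h] brd_natural[OF f Ident_closed[OF Z]] ..
    then show ?thesis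
      using dual_family.dinatural[OF pairing_family[OF M Z w] f hb[OF o(2) Z h] x] by simp
  qed
  note r = arrow_into_dual[where b = "\<lambda>X x Z h w. pairing M Z w X (h \<cdot> brd T X Z) x", OF M dual_fin_mackey[OF M] fam add smult nat,
      folded double_dual_def]
  show "double_dual M \<in> homs \<M> M (dual (dual M))" by (rule r(1))
  show "\<And>X x Z h w. \<lbrakk>X \<in> Obj T; x \<in> carrier (mobj M X); Z \<in> Obj T; h \<in> homs T (Z \<boxdot> X) I; w \<in> carrier (mobj (dual M) Z)\<rbrakk>
      \<Longrightarrow> pairing (dual M) X (component (double_dual M) X x) Z h w = pairing M Z w X (h \<cdot> brd T X Z) x"
    by (rule r(3))
qed

lemma double_dual_natural:
  assumes f: "f \<in> homs \<M> A B"
  shows "dual_arrow (dual_arrow f) \<cdot>\<^bsub>\<M>\<^esub> double_dual A = double_dual B \<cdot>\<^bsub>\<M>\<^esub> f"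
proof -
  note A = arrowD(1)[OF f] and B = arrowD(2)[OF f] and f' = dual_arrow(1)[OF f]
  note f'' = dual_arrow(1)[OF f']
  show ?thesis
  proof (rule arrow_into_dual_eqI[OF Comp_M(1)[OF double_dual(1)[OF A] f''] Comp_M(1)[OF f double_dual(1)[OF B]] dual_fin_mackey[OF B]])
    fix X x Z h m
    assume a: "X \<in> Obj T" "x \<in> carrier (mobj A X)" "Z \<in> Obj T" "h \<in> homs T (Z \<boxdot> X) I" "m \<in> carrier (mobj (dual B) Z)"
    have hb: "h \<cdot> brd T X Z \<in> homs T (X \<boxdot> Z) I"
      by (rule Comp_closed[OF brd_closed[OF a(1,3)] a(4)])
    show "pairing (dual B) X (component (dual_arrow (dual_arrow f) \<cdot>\<^bsub>\<M>\<^esub> double_dual A) X x) Z h m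
      = pairing (dual B) X (component (double_dual B \<cdot>\<^bsub>\<M>\<^esub> f) X x) Z h m"
      unfolding Comp_M(2)[OF double_dual(1)[OF A] f'' a(1,2)] Comp_M(2)[OF f double_dual(1)[OF B] a(1,2)]
        dual_arrow(2)[OF f' a(1) component_closed[OF double_dual(1)[OF A] a(1,2)] a(3-5)]
        double_dual(2)[OF A a(1-4) component_closed[OF f' a(3,5)]]
        double_dual(2)[OF B a(1) component_closed[OF f a(1,2)] a(3-5)]
        dual_arrow(2)[OF f a(3,5,1) hb a(2)] ..
  qed
qed

text \<open>Injectivity: forms on M(X) separate points, and each of them is the pairing with some w
  at \<epsilon>. Surjectivity: an element y is determined by its values at \<epsilon>', since every
  arrow Z \<boxdot> X -> I comes from \<epsilon>' by dinaturality. These values constitute a linear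
  form on S M at A', which by reflexivity is evaluation at some x.\<close>

lemma double_dual_bij:
  assumes M: "fin_mackey M" and X: "X \<in> Obj T"
  shows "bij_betw (component (double_dual M) X) (carrier (mobj M X)) (carrier (mobj (dual (dual M)) X))"
proof (rule perfect_exists[OF X])
  fix A' \<epsilon>
  let ?\<epsilon>' = "\<epsilon> \<cdot> brd T A' X"
  assume p: "perfect X A' \<epsilon>" and p': "perfect A' X ?\<epsilon>'"
  note d = double_dual[OF M] and M' = dual_fin_mackey[OF M]
  have A': "A' \<in> Obj T" and \<epsilon>: "\<epsilon> \<in> homs T (X \<boxdot> A') I" and \<epsilon>': "?\<epsilon>' \<in> homs T (A' \<boxdot> X) I"
    using p p' by (simp_all add: perfect_def)
  \<comment> \<open>The braiding in \<open>double_dual\<close> undoes the one in \<epsilon>', so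
    that everything can be expressed through the same \<epsilon>.\<close>
  have \<epsilon>b: "?\<epsilon>' \<cdot> brd T X A' = \<epsilon>"
    using Comp_assoc[OF brd_closed[OF X A'] brd_closed[OF A' X] \<epsilon>] brd_symmetric[OF X A'] Ident_right[OF \<epsilon>] by simp
  have "inj_on (component (double_dual M) X) (carrier (mobj M X))"
  proof (rule inj_onI)
    fix x y assume x: "x \<in> carrier (mobj M X)" and y: "y \<in> carrier (mobj M X)"
      and eq: "component (double_dual M) X x = component (double_dual M) X y"
    have e: "pairing M A' w X \<epsilon> x = pairing M A' w X \<epsilon> y" if w: "w \<in> carrier (mobj (dual M) A')" for w
      using d(2)[OF X x A' \<epsilon>' w] d(2)[OF X y A' \<epsilon>' w] eq \<epsilon>b by simp
    show "x = y"
    proof (rule linear_forms_separate[OF mackey_functorD(1)[OF fin_mackeyD(1)[OF M] X] fin_mackeyD(2)[OF M X] x y])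
      fix \<xi> assume "linear_form K (mobj M X) \<xi>"
      from dual_yoneda(2)[OF M p this] obtain w where "w \<in> carrier (mobj (dual M) A')"
        "\<forall>v \<in> carrier (mobj M X). pairing M A' w X \<epsilon> v = \<xi> v" by blast
      then show "\<xi> x = \<xi> y" using e[of w] x y by simp
    qed
  qed
  moreover have "y \<in> component (double_dual M) X ` carrier (mobj M X)" if y: "y \<in> carrier (mobj (dual (dual M)) X)" for y
  proof -
    note fy = pairing_family[OF M' X y]
    have "linear_form K (mobj (dual M) A') (pairing (dual M) X y A' ?\<epsilon>')"
      by (rule dual_family.linear_form[OF fy A' \<epsilon>'])
    from dual_yoneda(1)[OF M p this] obtain x where x: "x \<in> carrier (mobj M X)"
      and xy: "\<And>w. w \<in> carrier (mobj (dual M) A') \<Longrightarrow> pairing (dual M) X y A' ?\<epsilon>' w = pairing M A' w X \<epsilon> x" by blast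
    have "component (double_dual M) X x = y"
    proof (rule pairing_eqI[OF M' X component_closed[OF d(1) X x] y])
      fix Z h w assume a: "Z \<in> Obj T" "h \<in> homs T (Z \<boxdot> X) I" "w \<in> carrier (mobj (dual M) Z)"
      have "h \<in> (\<lambda>g. ?\<epsilon>' \<cdot> (g \<boxtimes> Ident T X)) ` homs T Z A'"
        using p' a(1,2) by (simp add: perfect_def bij_betw_def)
      then obtain g where g: "g \<in> homs T Z A'" "h = ?\<epsilon>' \<cdot> (g \<boxtimes> Ident T X)" by blast
      note t = tarr_closed[OF g(1) Ident_closed[OF X]] and t' = tarr_closed[OF Ident_closed[OF X] g(1)]
      have "h \<cdot> brd T X Z = ?\<epsilon>' \<cdot> ((g \<boxtimes> Ident T X) \<cdot> brd T X Z)"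
        unfolding g(2) by (rule Comp_assoc[OF brd_closed[OF X a(1)] t \<epsilon>'])
      also have "\<dots> = ?\<epsilon>' \<cdot> (brd T X A' \<cdot> (Ident T X \<boxtimes> g))"
        unfolding brd_natural[OF Ident_closed[OF X] g(1)] ..
      also have "\<dots> = \<epsilon> \<cdot> (Ident T X \<boxtimes> g)"
        unfolding Comp_assoc[OF t' brd_closed[OF X A'] \<epsilon>', symmetric] \<epsilon>b ..
      finally have hb: "h \<cdot> brd T X Z = \<epsilon> \<cdot> (Ident T X \<boxtimes> g)" .
      have "pairing (dual M) X y Z h w = pairing (dual M) X y A' ?\<epsilon>' (mmap (dual M) g w)"
        unfolding g(2) by (rule dual_family.dinatural[OF fy g(1) \<epsilon>' a(3)])
      also have "\<dots> = pairing M A' (mmap (dual M) g w) X \<epsilon> x"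
        by (rule xy[OF dual_map(1)[OF M g(1) a(3)]])
      also have "\<dots> = pairing M Z w X (h \<cdot> brd T X Z) x"
        unfolding hb by (rule dual_map(2)[OF M g(1) a(3) X \<epsilon> x])
      finally show "pairing (dual M) X (component (double_dual M) X x) Z h w = pairing (dual M) X y Z h w"
        unfolding d(2)[OF X x a] by simp
    qed
    then show ?thesis using x by blast
  qed
  moreover have "component (double_dual M) X ` carrier (mobj M X) \<subseteq> carrier (mobj (dual (dual M)) X)"
    by (rule image_subsetI) (rule component_closed[OF d(1) X])
  ultimately show ?thesis unfolding bij_betw_def by blast
qed

text \<open>Linearity and naturality of the inverse are checked after applying f, which is injective
  in each component.\<close>

lemma bij_arrow_inverse:
  assumes f: "f \<in> homs \<M> A B"
    and bij: "\<And>X. X \<in> Obj T \<Longrightarrow> bij_betw (component f X) (carrier (mobj A X)) (carrier (mobj B X))"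
  obtains g where "g \<in> homs \<M> B A" "g \<cdot>\<^bsub>\<M>\<^esub> f = Ident \<M> A" "f \<cdot>\<^bsub>\<M>\<^esub> g = Ident \<M> B"
proof -
  note A = arrowD(1)[OF f] and B = arrowD(2)[OF f]
  define t where "t X = inv_into (carrier (mobj A X)) (component f X)" for X
  have t1: "t X (component f X x) = x" if "X \<in> Obj T" "x \<in> carrier (mobj A X)" for X x
    unfolding t_def by (rule bij_betw_inv_into_left[OF bij[OF that(1)] that(2)])
  have t2: "component f X (t X y) = y" "t X y \<in> carrier (mobj A X)" if "X \<in> Obj T" "y \<in> carrier (mobj B X)" for X y
    unfolding t_def by (rule bij_betw_inv_into_right[OF bij[OF that(1)] that(2)])
      (rule bij_betw_apply[OF bij_betw_inv_into[OF bij[OF that(1)]] that(2)])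
  have eqI: "x = y" if "X \<in> Obj T" "x \<in> carrier (mobj A X)" "y \<in> carrier (mobj A X)" "component f X x = component f X y" for X x y
    by (rule trans[OF t1[OF that(1,2), symmetric] t1[OF that(1,3), folded that(4)]])
  note vA = vectorspace_closed[OF mackey_functorD(1)[OF fin_mackeyD(1)[OF A]]]
  note vB = vectorspace_closed[OF mackey_functorD(1)[OF fin_mackeyD(1)[OF B]]]
  have hom: "t X \<in> module_hom K (mobj B X) (mobj A X)" if X: "X \<in> Obj T" for X
  proof (rule module_homI)
    note fh = component_hom[OF f X]
    show "t X x \<in> carrier (mobj A X)" if "x \<in> carrier (mobj B X)" for x by (rule t2(2)[OF X that])
    show "t X (x \<oplus>\<^bsub>mobj B X\<^esub> y) = t X x \<oplus>\<^bsub>mobj A X\<^esub> t X y" if x: "x \<in> carrier (mobj B X)" "y \<in> carrier (mobj B X)" for x y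
      by (rule eqI[OF X t2(2)[OF X vB(1)[OF X x]] vA(1)[OF X t2(2)[OF X x(1)] t2(2)[OF X x(2)]]])
        (simp only: t2(1)[OF X vB(1)[OF X x]] module_hom_add[OF fh t2(2)[OF X x(1)] t2(2)[OF X x(2)]] t2(1)[OF X x(1)] t2(1)[OF X x(2)])
    show "t X (k \<odot>\<^bsub>mobj B X\<^esub> x) = k \<odot>\<^bsub>mobj A X\<^esub> t X x" if k: "k \<in> carrier K" and x: "x \<in> carrier (mobj B X)" for k x
      by (rule eqI[OF X t2(2)[OF X vB(2)[OF X x k]] vA(2)[OF X t2(2)[OF X x] k]])
        (simp only: t2(1)[OF X vB(2)[OF X x k]] module_hom_smult[OF fh k t2(2)[OF X x]] t2(1)[OF X x])
  qed
  have nat: "t Y (mmap B g x) = mmap A g (t X x)" if g: "g \<in> homs T X Y" and x: "x \<in> carrier (mobj B X)" for X Y g x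
  proof -
    have o: "X \<in> Obj T" "Y \<in> Obj T" using homs_Obj[OF g] by auto
    have gx: "mmap B g x \<in> carrier (mobj B Y)" by (rule mackey_map_closed[OF fin_mackeyD(1)[OF B] g x])
    note tx = t2(2)[OF o(1) x]
    show ?thesis
      by (rule eqI[OF o(2) t2(2)[OF o(2) gx] mackey_map_closed[OF fin_mackeyD(1)[OF A] g tx]])
        (simp only: t2(1)[OF o(2) gx] component_natural[OF f g tx] t2(1)[OF o(1) x])
  qed
  let ?g = "arrow_of B A t"
  have g1: "?g \<in> homs \<M> B A" by (rule arrow_of(1)[OF B A]) (fact hom nat)+
  have g2: "component ?g X x = t X x" if "X \<in> Obj T" "x \<in> carrier (mobj B X)" for X x
    by (rule arrow_of(2)[OF B A]) (fact hom nat that)+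
  show ?thesis
  proof (rule that[OF g1])
    show "?g \<cdot>\<^bsub>\<M>\<^esub> f = Ident \<M> A"
      by (rule arrow_eqI[OF Comp_M(1)[OF f g1] Ident_M_arrow(1)[OF A]])
        (simp only: Comp_M(2)[OF f g1] g2 component_closed[OF f] t1 Ident_M_arrow(2)[OF A])
    show "f \<cdot>\<^bsub>\<M>\<^esub> ?g = Ident \<M> B"
      by (rule arrow_eqI[OF Comp_M(1)[OF g1 f] Ident_M_arrow(1)[OF B]])
        (simp only: Comp_M(2)[OF g1 f] g2 t2 Ident_M_arrow(2)[OF B])
  qed
qed

lemma category_M: "category \<M>"
proof
  fix f assume "f \<in> Arr \<M>"
  then show "Dom \<M> f \<in> Obj \<M>" "Cod \<M> f \<in> Obj \<M>"
    by (auto simp: Mky_fin_def Mky_def)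
next
  show "Ident \<M> A \<in> homs \<M> A A" if "A \<in> Obj \<M>" for A
    using Ident_M_arrow(1) that by (simp only: Obj_M)
  show "g \<cdot>\<^bsub>\<M>\<^esub> f \<in> homs \<M> A D" if "f \<in> homs \<M> A B" "g \<in> homs \<M> B D" for f g A B D
    by (rule Comp_M(1)[OF that])
  show "Ident \<M> B \<cdot>\<^bsub>\<M>\<^esub> f = f" if f: "f \<in> homs \<M> A B" for f A B
    by (rule arrow_eqI[OF Comp_M(1)[OF f Ident_M_arrow(1)[OF arrowD(2)[OF f]]] f])
      (simp only: Comp_M(2)[OF f Ident_M_arrow(1)[OF arrowD(2)[OF f]]] component_closed[OF f] Ident_M_arrow(2)[OF arrowD(2)[OF f]])
  show "f \<cdot>\<^bsub>\<M>\<^esub> Ident \<M> A = f" if f: "f \<in> homs \<M> A B" for f A B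
    by (rule arrow_eqI[OF Comp_M(1)[OF Ident_M_arrow(1)[OF arrowD(1)[OF f]] f] f])
      (simp only: Comp_M(2)[OF Ident_M_arrow(1)[OF arrowD(1)[OF f]] f] Ident_M_arrow(2)[OF arrowD(1)[OF f]])
  show "(h \<cdot>\<^bsub>\<M>\<^esub> g) \<cdot>\<^bsub>\<M>\<^esub> f = h \<cdot>\<^bsub>\<M>\<^esub> (g \<cdot>\<^bsub>\<M>\<^esub> f)"
    if f: "f \<in> homs \<M> A B" and g: "g \<in> homs \<M> B D" and h: "h \<in> homs \<M> D E" for f g h A B D E
    by (rule arrow_eqI[OF Comp_M(1)[OF f Comp_M(1)[OF g h]] Comp_M(1)[OF Comp_M(1)[OF f g] h]])
      (simp only: Comp_M(2)[OF f Comp_M(1)[OF g h]] Comp_M(2)[OF g h] Comp_M(2)[OF Comp_M(1)[OF f g] h] Comp_M(2)[OF f g] component_closed[OF f])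
qed

end

lemma op_cat_simps [simp]:
  "Obj (op_cat C) = Obj C" "Arr (op_cat C) = Arr C" "Dom (op_cat C) = Cod C" "Cod (op_cat C) = Dom C"
  "Ident (op_cat C) = Ident C" "g \<cdot>\<^bsub>op_cat C\<^esub> f = f \<cdot>\<^bsub>C\<^esub> g"
  by (simp_all add: op_cat_def)

lemma homs_op_cat [simp]: "homs (op_cat C) A B = homs C B A"
  by (auto simp: homs_def)

context mackey_setting
begin

text \<open>S is its own quasi-inverse. Both natural isomorphisms come from
  \<open>double_dual\<close>: in the opposite category it already points from S (S A) to A, and in
  the category itself its inverse does.\<close>

lemma dual_equivalence:
  "equivalence_of_categories (op_cat \<M>) \<M> dual dual_arrow dual dual_arrow"
proof -
  interpret M: category \<M> by (rule category_M)
  have f1: "is_functor (op_cat \<M>) \<M> dual dual_arrow"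
    unfolding is_functor_def
    by (simp add: Obj_M dual_fin_mackey dual_arrow_Ident dual_arrow(1) dual_arrow_Comp)
  have f2: "is_functor \<M> (op_cat \<M>) dual dual_arrow"
    unfolding is_functor_def
    by (simp add: Obj_M dual_fin_mackey dual_arrow_Ident dual_arrow(1) dual_arrow_Comp)
  have ex: "\<exists>g. g \<in> homs \<M> (dual (dual A)) A \<and> g \<cdot>\<^bsub>\<M>\<^esub> double_dual A = Ident \<M> A \<and>
      double_dual A \<cdot>\<^bsub>\<M>\<^esub> g = Ident \<M> (dual (dual A))" if "fin_mackey A" for A
  proof (rule bij_arrow_inverse[OF double_dual(1)[OF that]])
    show "bij_betw (component (double_dual A) X) (carrier (mobj A X)) (carrier (mobj (dual (dual A)) X))"
      if "X \<in> Obj T" for X by (rule double_dual_bij[OF \<open>fin_mackey A\<close> that])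
  qed (intro exI conjI)
  \<comment> \<open>Inverses are chosen for all objects at once, as a natural isomorphism is a
    function of the object.\<close>
  define undouble where "undouble A = (SOME g. g \<in> homs \<M> (dual (dual A)) A \<and> g \<cdot>\<^bsub>\<M>\<^esub> double_dual A = Ident \<M> A \<and>
      double_dual A \<cdot>\<^bsub>\<M>\<^esub> g = Ident \<M> (dual (dual A)))" for A
  have i: "undouble A \<in> homs \<M> (dual (dual A)) A" "undouble A \<cdot>\<^bsub>\<M>\<^esub> double_dual A = Ident \<M> A"
      "double_dual A \<cdot>\<^bsub>\<M>\<^esub> undouble A = Ident \<M> (dual (dual A))" if "fin_mackey A" for A
  proof -
    note s = someI_ex[OF ex[OF that], folded undouble_def]
    show "undouble A \<in> homs \<M> (dual (dual A)) A" by (rule conjunct1[OF s])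
    show "undouble A \<cdot>\<^bsub>\<M>\<^esub> double_dual A = Ident \<M> A" by (rule conjunct1[OF conjunct2[OF s]])
    show "double_dual A \<cdot>\<^bsub>\<M>\<^esub> undouble A = Ident \<M> (dual (dual A))" by (rule conjunct2[OF conjunct2[OF s]])
  qed
  have n1: "natural_iso (op_cat \<M>) (op_cat \<M>) (dual \<circ> dual) (dual_arrow \<circ> dual_arrow) id id double_dual"
    unfolding natural_iso_def
  proof (intro conjI ballI allI impI)
    fix A assume "A \<in> Obj (op_cat \<M>)"
    then have A: "fin_mackey A" by (simp add: Obj_M)
    note dA = double_dual(1)[OF A] and dA' = conjunct1[OF conjunct2[OF homsD[OF dA]]] conjunct2[OF conjunct2[OF homsD[OF dA]]]
    have "inverse_arrows (op_cat \<M>) (double_dual A) (undouble A)"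
      unfolding inverse_arrows_def op_cat_simps homs_op_cat dA' i(2,3)[OF A]
      using i(1)[OF A] conjunct1[OF homsD[OF dA]] by (intro conjI) (assumption | rule refl)+
    then show "iso_arrow (op_cat \<M>) (double_dual A) ((dual \<circ> dual) A) (id A)"
      unfolding iso_arrow_def homs_op_cat comp_apply id_apply using dA by blast
  next
    fix A B f assume "f \<in> homs (op_cat \<M>) A B"
    then have f: "f \<in> homs \<M> B A" by simp
    show "double_dual B \<cdot>\<^bsub>op_cat \<M>\<^esub> (dual_arrow \<circ> dual_arrow) f = id f \<cdot>\<^bsub>op_cat \<M>\<^esub> double_dual A"
      unfolding op_cat_simps comp_apply id_apply by (rule double_dual_natural[OF f])
  qed
  have n2: "natural_iso \<M> \<M> (dual \<circ> dual) (dual_arrow \<circ> dual_arrow) id id undouble"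
    unfolding natural_iso_def
  proof (intro conjI ballI allI impI)
    fix A assume "A \<in> Obj \<M>"
    then have A: "fin_mackey A" by (simp add: Obj_M)
    show "iso_arrow \<M> (undouble A) ((dual \<circ> dual) A) (id A)"
      unfolding comp_apply id_apply by (rule M.iso_arrowI[OF i(1)[OF A] double_dual(1)[OF A] i(3)[OF A] i(2)[OF A]])
  next
    fix A B f assume f: "f \<in> homs \<M> A B"
    note A = arrowD(1)[OF f] and B = arrowD(2)[OF f]
    note dA = double_dual(1)[OF A] and dB = double_dual(1)[OF B] and f'' = dual_arrow(1)[OF dual_arrow(1)[OF f]]
    have "undouble B \<cdot>\<^bsub>\<M>\<^esub> dual_arrow (dual_arrow f) = undouble B \<cdot>\<^bsub>\<M>\<^esub> (dual_arrow (dual_arrow f) \<cdot>\<^bsub>\<M>\<^esub> (double_dual A \<cdot>\<^bsub>\<M>\<^esub> undouble A))"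
      unfolding i(3)[OF A] M.Ident_right[OF f''] ..
    also have "\<dots> = undouble B \<cdot>\<^bsub>\<M>\<^esub> ((double_dual B \<cdot>\<^bsub>\<M>\<^esub> f) \<cdot>\<^bsub>\<M>\<^esub> undouble A)"
      unfolding M.Comp_assoc[OF i(1)[OF A] dA f'', symmetric] double_dual_natural[OF f] ..
    also have "\<dots> = (undouble B \<cdot>\<^bsub>\<M>\<^esub> double_dual B) \<cdot>\<^bsub>\<M>\<^esub> (f \<cdot>\<^bsub>\<M>\<^esub> undouble A)"
      unfolding M.Comp_assoc[OF i(1)[OF A] f dB] M.Comp_assoc[OF M.Comp_closed[OF i(1)[OF A] f] dB i(1)[OF B]] ..
    also have "\<dots> = f \<cdot>\<^bsub>\<M>\<^esub> undouble A"
      unfolding i(2)[OF B] by (rule M.Ident_left[OF M.Comp_closed[OF i(1)[OF A] f]])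
    finally show "undouble B \<cdot>\<^bsub>\<M>\<^esub> (dual_arrow \<circ> dual_arrow) f = id f \<cdot>\<^bsub>\<M>\<^esub> undouble A" unfolding comp_apply id_apply .
  qed
  show ?thesis
    unfolding equivalence_of_categories_def by (intro conjI exI) (rule f1 f2 n1 n2)+
qed

end


section \<open>Cyclic rotation of trilinear families\<close>

text \<open>Dinaturality is required jointly for three arrows, which makes the notion visibly
  invariant under rotation. For Mackey functors, identities in two of the places give back the
  separate conditions.\<close>

locale trilinear =
  fixes K :: "('k, 'm) ring_scheme" and T :: "('o, 'a, 'z) monoidal_scheme" (structure)
    and L M N :: "('o, 'a, 'k, 'v) mackey" and t :: "'o \<Rightarrow> 'o \<Rightarrow> 'o \<Rightarrow> 'a \<Rightarrow> 'v \<Rightarrow> 'v \<Rightarrow> 'v \<Rightarrow> 'k"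
  assumes closed: "\<lbrakk>Z \<in> Obj T; X \<in> Obj T; Y \<in> Obj T; \<omega> \<in> homs T (Z \<boxdot> X \<boxdot> Y) (unt T); l \<in> carrier (mobj L Z);
        m \<in> carrier (mobj M X); n \<in> carrier (mobj N Y)\<rbrakk> \<Longrightarrow> t Z X Y \<omega> l m n \<in> carrier K"
    and add_hom: "\<lbrakk>Z \<in> Obj T; X \<in> Obj T; Y \<in> Obj T; \<omega> \<in> homs T (Z \<boxdot> X \<boxdot> Y) (unt T);
        \<omega>' \<in> homs T (Z \<boxdot> X \<boxdot> Y) (unt T); l \<in> carrier (mobj L Z); m \<in> carrier (mobj M X); n \<in> carrier (mobj N Y)\<rbrakk>
      \<Longrightarrow> t Z X Y (add_arrow T \<omega> \<omega>') l m n = t Z X Y \<omega> l m n \<oplus>\<^bsub>K\<^esub> t Z X Y \<omega>' l m n"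
    and add1: "\<lbrakk>Z \<in> Obj T; X \<in> Obj T; Y \<in> Obj T; \<omega> \<in> homs T (Z \<boxdot> X \<boxdot> Y) (unt T); l \<in> carrier (mobj L Z);
        l' \<in> carrier (mobj L Z); m \<in> carrier (mobj M X); n \<in> carrier (mobj N Y)\<rbrakk>
      \<Longrightarrow> t Z X Y \<omega> (l \<oplus>\<^bsub>mobj L Z\<^esub> l') m n = t Z X Y \<omega> l m n \<oplus>\<^bsub>K\<^esub> t Z X Y \<omega> l' m n"
    and add2: "\<lbrakk>Z \<in> Obj T; X \<in> Obj T; Y \<in> Obj T; \<omega> \<in> homs T (Z \<boxdot> X \<boxdot> Y) (unt T); l \<in> carrier (mobj L Z);
        m \<in> carrier (mobj M X); m' \<in> carrier (mobj M X); n \<in> carrier (mobj N Y)\<rbrakk>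
      \<Longrightarrow> t Z X Y \<omega> l (m \<oplus>\<^bsub>mobj M X\<^esub> m') n = t Z X Y \<omega> l m n \<oplus>\<^bsub>K\<^esub> t Z X Y \<omega> l m' n"
    and add3: "\<lbrakk>Z \<in> Obj T; X \<in> Obj T; Y \<in> Obj T; \<omega> \<in> homs T (Z \<boxdot> X \<boxdot> Y) (unt T); l \<in> carrier (mobj L Z);
        m \<in> carrier (mobj M X); n \<in> carrier (mobj N Y); n' \<in> carrier (mobj N Y)\<rbrakk>
      \<Longrightarrow> t Z X Y \<omega> l m (n \<oplus>\<^bsub>mobj N Y\<^esub> n') = t Z X Y \<omega> l m n \<oplus>\<^bsub>K\<^esub> t Z X Y \<omega> l m n'"
    and smult1: "\<lbrakk>Z \<in> Obj T; X \<in> Obj T; Y \<in> Obj T; \<omega> \<in> homs T (Z \<boxdot> X \<boxdot> Y) (unt T); k \<in> carrier K;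
        l \<in> carrier (mobj L Z); m \<in> carrier (mobj M X); n \<in> carrier (mobj N Y)\<rbrakk>
      \<Longrightarrow> t Z X Y \<omega> (k \<odot>\<^bsub>mobj L Z\<^esub> l) m n = k \<otimes>\<^bsub>K\<^esub> t Z X Y \<omega> l m n"
    and smult2: "\<lbrakk>Z \<in> Obj T; X \<in> Obj T; Y \<in> Obj T; \<omega> \<in> homs T (Z \<boxdot> X \<boxdot> Y) (unt T); k \<in> carrier K;
        l \<in> carrier (mobj L Z); m \<in> carrier (mobj M X); n \<in> carrier (mobj N Y)\<rbrakk>
      \<Longrightarrow> t Z X Y \<omega> l (k \<odot>\<^bsub>mobj M X\<^esub> m) n = k \<otimes>\<^bsub>K\<^esub> t Z X Y \<omega> l m n"
    and smult3: "\<lbrakk>Z \<in> Obj T; X \<in> Obj T; Y \<in> Obj T; \<omega> \<in> homs T (Z \<boxdot> X \<boxdot> Y) (unt T); k \<in> carrier K;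
        l \<in> carrier (mobj L Z); m \<in> carrier (mobj M X); n \<in> carrier (mobj N Y)\<rbrakk>
      \<Longrightarrow> t Z X Y \<omega> l m (k \<odot>\<^bsub>mobj N Y\<^esub> n) = k \<otimes>\<^bsub>K\<^esub> t Z X Y \<omega> l m n"
    and dinatural: "\<lbrakk>f \<in> homs T Z Z'; g \<in> homs T X X'; h \<in> homs T Y Y'; \<omega> \<in> homs T (Z' \<boxdot> X' \<boxdot> Y') (unt T);
        l \<in> carrier (mobj L Z); m \<in> carrier (mobj M X); n \<in> carrier (mobj N Y)\<rbrakk>
      \<Longrightarrow> t Z X Y (\<omega> \<cdot> (f \<boxtimes> (g \<boxtimes> h))) l m n = t Z' X' Y' \<omega> (mmap L f l) (mmap M g m) (mmap N h n)"

context mackey_setting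
begin

lemma day_arrow_eqI:
  assumes M: "fin_mackey M" and N: "fin_mackey N"
    and x: "x \<in> homs \<M> (day K T M N) B" and y: "y \<in> homs \<M> (day K T M N) B"
    and eq: "\<And>W X Y g m n. \<lbrakk>W \<in> Obj T; X \<in> Obj T; Y \<in> Obj T; g \<in> homs T (X \<boxdot> Y) W; m \<in> carrier (mobj M X);
        n \<in> carrier (mobj N Y)\<rbrakk>
      \<Longrightarrow> component x W (day_class K T M N W X Y g m n) = component y W (day_class K T M N W X Y g m n)"
  shows "x = y"
proof (rule arrow_eqI[OF x y])
  fix W u assume W: "W \<in> Obj T" and u: "u \<in> carrier (mobj (day K T M N) W)"
  show "component x W u = component y W u"
    by (rule day_hom_eqI[OF M N W mackey_functorD(1)[OF fin_mackeyD(1)[OF arrowD(2)[OF x]] W] component_hom[OF x W]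
          component_hom[OF y W] eq[OF W] u])
qed

text \<open>Universal property of M * N on the level of functors: the pointwise linear maps fit
  together because naturality in W can be checked on generators.\<close>

lemma day_arrow_exists:
  assumes M: "fin_mackey M" and N: "fin_mackey N" and B: "fin_mackey B"
    and bal: "\<And>W. W \<in> Obj T \<Longrightarrow> day_balanced K T M N W (mobj B W) (c W)"
    and nat: "\<And>k W W' X Y g m n. \<lbrakk>k \<in> homs T W W'; X \<in> Obj T; Y \<in> Obj T; g \<in> homs T (X \<boxdot> Y) W; m \<in> carrier (mobj M X);
        n \<in> carrier (mobj N Y)\<rbrakk> \<Longrightarrow> c W' X Y (k \<cdot> g) m n = mmap B k (c W X Y g m n)"
  obtains x where "x \<in> homs \<M> (day K T M N) B"
    "\<And>W X Y g m n. \<lbrakk>W \<in> Obj T; X \<in> Obj T; Y \<in> Obj T; g \<in> homs T (X \<boxdot> Y) W; m \<in> carrier (mobj M X); n \<in> carrier (mobj N Y)\<rbrakk>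
      \<Longrightarrow> component x W (day_class K T M N W X Y g m n) = c W X Y g m n"
proof -
  define s where "s W = (THE t. t \<in> linear_maps K (mobj (day K T M N) W) (mobj B W) \<and>
    (\<forall>X Y h m n. (X, Y, h, m, n) \<in> day_generators T M N W \<longrightarrow> t (day_class K T M N W X Y h m n) = c W X Y h m n))" for W
  note vB = mackey_functorD(1)[OF fin_mackeyD(1)[OF B]]
  have s1: "s W \<in> module_hom K (mobj (day K T M N) W) (mobj B W)" if "W \<in> Obj T" for W
    unfolding s_def by (rule linear_mapsD(1)[OF day_linear_map_The(1)[OF M N that vB[OF that] bal[OF that]]])
  have s2: "s W (day_class K T M N W X Y g m n) = c W X Y g m n"
    if "W \<in> Obj T" "X \<in> Obj T" "Y \<in> Obj T" "g \<in> homs T (X \<boxdot> Y) W" "m \<in> carrier (mobj M X)" "n \<in> carrier (mobj N Y)" for W X Y g m n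
    unfolding s_def by (rule day_linear_map_The(2)[OF M N that(1) vB[OF that(1)] bal[OF that(1)] that(2-6)])
  note D = day_fin_mackey[OF M N]
  have natural: "s W' (mmap (day K T M N) k u) = mmap B k (s W u)"
    if k: "k \<in> homs T W W'" and u: "u \<in> carrier (mobj (day K T M N) W)" for W W' k u
  proof -
    have W: "W \<in> Obj T" "W' \<in> Obj T" using homs_Obj[OF k] by simp_all
    note hk = mackey_functorD(2)[OF fin_mackeyD(1)[OF D] k] and hB = mackey_functorD(2)[OF fin_mackeyD(1)[OF B] k]
    show ?thesis
    proof (rule day_hom_eqI[OF M N W(1) vB[OF W(2)] module_hom_comp[OF hk s1[OF W(2)]] module_hom_comp[OF s1[OF W(1)] hB] _ u])
      fix X Y g m n
      assume a: "X \<in> Obj T" "Y \<in> Obj T" "g \<in> homs T (X \<boxdot> Y) W" "m \<in> carrier (mobj M X)" "n \<in> carrier (mobj N Y)"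
      show "s W' (mmap (day K T M N) k (day_class K T M N W X Y g m n)) = mmap B k (s W (day_class K T M N W X Y g m n))"
        unfolding day_map(2)[OF M N k a] s2[OF W(1) a] s2[OF W(2) a(1,2) Comp_closed[OF a(3) k] a(4,5)]
        by (rule nat[OF k a])
    qed
  qed
  have x: "arrow_of (day K T M N) B s \<in> homs \<M> (day K T M N) B"
    by (rule arrow_of(1)[OF D B]) (fact s1 natural)+
  show ?thesis
  proof (rule that[OF x])
    fix W X Y g m n
    assume a: "W \<in> Obj T" "X \<in> Obj T" "Y \<in> Obj T" "g \<in> homs T (X \<boxdot> Y) W" "m \<in> carrier (mobj M X)" "n \<in> carrier (mobj N Y)"
    have u: "day_class K T M N W X Y g m n \<in> carrier (mobj (day K T M N) W)"
      by (rule day_balanced.closed[OF day_class_balanced[OF M N a(1)] a(2-6)])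
    have "component (arrow_of (day K T M N) B s) W (day_class K T M N W X Y g m n) = s W (day_class K T M N W X Y g m n)"
      by (rule arrow_of(2)[OF D B]) (fact s1 natural a(1) u)+
    then show "component (arrow_of (day K T M N) B s) W (day_class K T M N W X Y g m n) = c W X Y g m n"
      unfolding s2[OF a] .
  qed
qed

text \<open>The object W is eliminated as in the Yoneda lemma: only the generator whose arrow is the
  identity of X \<boxdot> Y is evaluated. What remains depends on an arrow out of Z \<boxdot> X
  \<boxdot> Y, where the three objects have equal standing.\<close>

definition tri :: "('o, 'a, 'k, 'v) mackey \<Rightarrow> ('o, 'a, 'k, 'v) mackey \<Rightarrow> ('o, 'a, 'k, 'v) mackey \<Rightarrow>
    ('o, 'a, 'k, 'v) mackey_arrow \<Rightarrow> 'o \<Rightarrow> 'o \<Rightarrow> 'o \<Rightarrow> 'a \<Rightarrow> 'v \<Rightarrow> 'v \<Rightarrow> 'v \<Rightarrow> 'k" where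
  "tri L M N x Z X Y \<omega> l m n =
     pairing L (X \<boxdot> Y) (component x (X \<boxdot> Y) (day_class K T M N (X \<boxdot> Y) X Y (Ident T (X \<boxdot> Y)) m n)) Z \<omega> l"

section \<open>Morphisms M * N -> S L as trilinear families\<close>

context
  fixes L M N :: "('o, 'a, 'k, 'v) mackey"
  assumes L: "fin_mackey L" and M: "fin_mackey M" and N: "fin_mackey N"
begin

private abbreviation "gen \<equiv> day_class K T M N"

text \<open>A generator with arrow g is the image under (M * N)(g) of the one with the identity
  arrow, and naturality of x turns this into composition with 1 \<boxtimes> g. Hence
  \<open>tri\<close> determines x.\<close>

lemma pairing_eq_tri:
  assumes x: "x \<in> homs \<M> (day K T M N) (dual L)"
    and a: "W \<in> Obj T" "X \<in> Obj T" "Y \<in> Obj T" "g \<in> homs T (X \<boxdot> Y) W" "m \<in> carrier (mobj M X)" "n \<in> carrier (mobj N Y)"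
    and b: "Z \<in> Obj T" "h \<in> homs T (Z \<boxdot> W) I" "l \<in> carrier (mobj L Z)"
  shows "pairing L W (component x W (gen W X Y g m n)) Z h l = tri L M N x Z X Y (h \<cdot> (Ident T Z \<boxtimes> g)) l m n"
proof -
  note XY = tobj_closed[OF a(2,3)] and id = Ident_closed[OF tobj_closed[OF a(2,3)]]
  have u: "gen (X \<boxdot> Y) X Y (Ident T (X \<boxdot> Y)) m n \<in> carrier (mobj (day K T M N) (X \<boxdot> Y))"
    by (rule day_balanced.closed[OF day_class_balanced[OF M N XY] a(2,3) id a(5,6)])
  have e: "gen W X Y g m n = mmap (day K T M N) g (gen (X \<boxdot> Y) X Y (Ident T (X \<boxdot> Y)) m n)"
    unfolding day_map(2)[OF M N a(4) a(2,3) id a(5,6)] Ident_right[OF a(4)] ..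
  show ?thesis
    unfolding tri_def e component_natural[OF x a(4) u]
    by (rule dual_map(2)[OF L a(4) component_closed[OF x XY u] b])
qed

lemma tri_eqI:
  assumes x: "x \<in> homs \<M> (day K T M N) (dual L)" and y: "y \<in> homs \<M> (day K T M N) (dual L)"
    and eq: "\<And>Z X Y \<omega> l m n. \<lbrakk>Z \<in> Obj T; X \<in> Obj T; Y \<in> Obj T; \<omega> \<in> homs T (Z \<boxdot> X \<boxdot> Y) I; l \<in> carrier (mobj L Z);
        m \<in> carrier (mobj M X); n \<in> carrier (mobj N Y)\<rbrakk> \<Longrightarrow> tri L M N x Z X Y \<omega> l m n = tri L M N y Z X Y \<omega> l m n"
  shows "x = y"
proof (rule day_arrow_eqI[OF M N x y])
  fix W X Y g m n
  assume a: "W \<in> Obj T" "X \<in> Obj T" "Y \<in> Obj T" "g \<in> homs T (X \<boxdot> Y) W" "m \<in> carrier (mobj M X)" "n \<in> carrier (mobj N Y)"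
  have u: "gen W X Y g m n \<in> carrier (mobj (day K T M N) W)"
    by (rule day_balanced.closed[OF day_class_balanced[OF M N a(1)] a(2-6)])
  show "component x W (gen W X Y g m n) = component y W (gen W X Y g m n)"
  proof (rule pairing_eqI[OF L a(1) component_closed[OF x a(1) u] component_closed[OF y a(1) u]])
    fix Z h l assume b: "Z \<in> Obj T" "h \<in> homs T (Z \<boxdot> W) I" "l \<in> carrier (mobj L Z)"
    show "pairing L W (component x W (gen W X Y g m n)) Z h l = pairing L W (component y W (gen W X Y g m n)) Z h l"
      unfolding pairing_eq_tri[OF x a b] pairing_eq_tri[OF y a b]
      by (rule eq[OF b(1) a(2,3) Comp_closed[OF tarr_closed[OF Ident_closed[OF b(1)] a(4)] b(2)] b(3) a(5,6)])
  qed
qed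

lemma tri_trilinear:
  assumes x: "x \<in> homs \<M> (day K T M N) (dual L)"
  shows "trilinear K T L M N (tri L M N x)"
proof -
  note XY = tobj_closed and id = Ident_closed[OF tobj_closed]
  note bal = day_class_balanced[OF M N XY]
  have u: "gen (X \<boxdot> Y) X Y (Ident T (X \<boxdot> Y)) m n \<in> carrier (mobj (day K T M N) (X \<boxdot> Y))"
    if "X \<in> Obj T" "Y \<in> Obj T" "m \<in> carrier (mobj M X)" "n \<in> carrier (mobj N Y)" for X Y m n
    by (rule day_balanced.closed[OF bal[OF that(1,2)] that(1,2) id[OF that(1,2)] that(3,4)])
  have cu: "component x (X \<boxdot> Y) (gen (X \<boxdot> Y) X Y (Ident T (X \<boxdot> Y)) m n) \<in> carrier (mobj (dual L) (X \<boxdot> Y))"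
    if "X \<in> Obj T" "Y \<in> Obj T" "m \<in> carrier (mobj M X)" "n \<in> carrier (mobj N Y)" for X Y m n
    by (rule component_closed[OF x XY[OF that(1,2)] u[OF that]])
  show ?thesis
  proof
    fix Z X Y \<omega> l m n
    assume o: "Z \<in> Obj T" "X \<in> Obj T" "Y \<in> Obj T" and \<omega>: "\<omega> \<in> homs T (Z \<boxdot> X \<boxdot> Y) I"
      and l: "l \<in> carrier (mobj L Z)" and m: "m \<in> carrier (mobj M X)" and n: "n \<in> carrier (mobj N Y)"
    note c = cu[OF o(2,3) m n] and b = bal[OF o(2,3)] and i = id[OF o(2,3)] and hx = component_hom[OF x XY[OF o(2,3)]]
    note fam = pairing_family[OF L XY[OF o(2,3)] c]
    show "tri L M N x Z X Y \<omega> l m n \<in> carrier K" unfolding tri_def by (rule pairing_closed[OF L XY[OF o(2,3)] c])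
    show "tri L M N x Z X Y (add_arrow T \<omega> \<omega>') l m n = tri L M N x Z X Y \<omega> l m n \<oplus>\<^bsub>K\<^esub> tri L M N x Z X Y \<omega>' l m n"
      if "\<omega>' \<in> homs T (Z \<boxdot> X \<boxdot> Y) I" for \<omega>'
      unfolding tri_def by (rule dual_family.add_hom[OF fam o(1) \<omega> that l])
    show "tri L M N x Z X Y \<omega> (l \<oplus>\<^bsub>mobj L Z\<^esub> l') m n = tri L M N x Z X Y \<omega> l m n \<oplus>\<^bsub>K\<^esub> tri L M N x Z X Y \<omega> l' m n"
      if "l' \<in> carrier (mobj L Z)" for l'
      unfolding tri_def by (rule dual_family.add[OF fam o(1) \<omega> l that])
    show "tri L M N x Z X Y \<omega> l (m \<oplus>\<^bsub>mobj M X\<^esub> m') n = tri L M N x Z X Y \<omega> l m n \<oplus>\<^bsub>K\<^esub> tri L M N x Z X Y \<omega> l m' n"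
      if "m' \<in> carrier (mobj M X)" for m'
      unfolding tri_def day_balanced.add_left[OF b o(2,3) i m that n] module_hom_add[OF hx u[OF o(2,3) m n] u[OF o(2,3) that n]]
      by (rule pairing_add[OF L XY[OF o(2,3)] c cu[OF o(2,3) that n]])
    show "tri L M N x Z X Y \<omega> l m (n \<oplus>\<^bsub>mobj N Y\<^esub> n') = tri L M N x Z X Y \<omega> l m n \<oplus>\<^bsub>K\<^esub> tri L M N x Z X Y \<omega> l m n'"
      if "n' \<in> carrier (mobj N Y)" for n'
      unfolding tri_def day_balanced.add_right[OF b o(2,3) i m n that] module_hom_add[OF hx u[OF o(2,3) m n] u[OF o(2,3) m that]]
      by (rule pairing_add[OF L XY[OF o(2,3)] c cu[OF o(2,3) m that]])
    fix k assume k: "k \<in> carrier K"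
    show "tri L M N x Z X Y \<omega> (k \<odot>\<^bsub>mobj L Z\<^esub> l) m n = k \<otimes>\<^bsub>K\<^esub> tri L M N x Z X Y \<omega> l m n"
      unfolding tri_def by (rule dual_family.smult[OF fam o(1) \<omega> k l])
    show "tri L M N x Z X Y \<omega> l (k \<odot>\<^bsub>mobj M X\<^esub> m) n = k \<otimes>\<^bsub>K\<^esub> tri L M N x Z X Y \<omega> l m n"
      unfolding tri_def day_balanced.smult_left[OF b o(2,3) i m n k] module_hom_smult[OF hx k u[OF o(2,3) m n]]
      by (rule pairing_smult[OF L XY[OF o(2,3)] k c])
    show "tri L M N x Z X Y \<omega> l m (k \<odot>\<^bsub>mobj N Y\<^esub> n) = k \<otimes>\<^bsub>K\<^esub> tri L M N x Z X Y \<omega> l m n"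
      unfolding tri_def day_balanced.smult_right[OF b o(2,3) i m n k] module_hom_smult[OF hx k u[OF o(2,3) m n]]
      by (rule pairing_smult[OF L XY[OF o(2,3)] k c])
  next
    fix f Z Z' g X X' h Y Y' \<omega> l m n
    assume f: "f \<in> homs T Z Z'" and g: "g \<in> homs T X X'" and h: "h \<in> homs T Y Y'"
      and \<omega>: "\<omega> \<in> homs T (Z' \<boxdot> X' \<boxdot> Y') I"
      and l: "l \<in> carrier (mobj L Z)" and m: "m \<in> carrier (mobj M X)" and n: "n \<in> carrier (mobj N Y)"
    have o: "Z \<in> Obj T" "Z' \<in> Obj T" "X \<in> Obj T" "X' \<in> Obj T" "Y \<in> Obj T" "Y' \<in> Obj T"
      using homs_Obj[OF f] homs_Obj[OF g] homs_Obj[OF h] by simp_all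
    note gh = tarr_closed[OF g h] and iZ = Ident_closed[OF o(2)] and i = id[OF o(4,6)] and iXY = id[OF o(3,5)]
    note b = bal[OF o(4,6)]
    \<comment> \<open>The three arrows are split apart: f is absorbed by dinaturality of the dual
      family, g and h by the relations of the Day convolution.\<close>
    have fgh: "f \<boxtimes> (g \<boxtimes> h) = (Ident T Z' \<boxtimes> (g \<boxtimes> h)) \<cdot> (f \<boxtimes> Ident T (X \<boxdot> Y))"
      using tarr_Comp[OF f iZ iXY gh] Ident_left[OF f] Ident_right[OF gh] by simp
    have gh': "g \<boxtimes> h = (g \<boxtimes> Ident T Y') \<cdot> (Ident T X \<boxtimes> h)"
      using tarr_Comp[OF Ident_closed[OF o(3)] g h Ident_closed[OF o(6)]] Ident_right[OF g] Ident_left[OF h] by simp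
    note g1 = tarr_closed[OF g Ident_closed[OF o(6)]] and h1 = tarr_closed[OF Ident_closed[OF o(3)] h]
    have fl: "mmap L f l \<in> carrier (mobj L Z')" and hn: "mmap N h n \<in> carrier (mobj N Y')"
      by (rule mackey_map_closed[OF fin_mackeyD(1)[OF L] f l], rule mackey_map_closed[OF fin_mackeyD(1)[OF N] h n])
    have cl: "gen (X' \<boxdot> Y') X Y (g \<boxtimes> h) m n = gen (X' \<boxdot> Y') X' Y' (Ident T (X' \<boxdot> Y')) (mmap M g m) (mmap N h n)"
      using day_balanced.dinatural_left[OF b g o(6) i m hn] day_balanced.dinatural_right[OF b o(3) h g1 m n]
      unfolding gh' Ident_left[OF g1] by simp
    have "tri L M N x Z X Y (\<omega> \<cdot> (f \<boxtimes> (g \<boxtimes> h))) l m n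
        = tri L M N x Z X Y ((\<omega> \<cdot> (Ident T Z' \<boxtimes> (g \<boxtimes> h))) \<cdot> (f \<boxtimes> Ident T (X \<boxdot> Y))) l m n"
      unfolding fgh Comp_assoc[OF tarr_closed[OF f iXY] tarr_closed[OF iZ gh] \<omega>] ..
    also have "\<dots> = tri L M N x Z' X Y (\<omega> \<cdot> (Ident T Z' \<boxtimes> (g \<boxtimes> h))) (mmap L f l) m n"
      unfolding tri_def
      by (rule dual_family.dinatural[OF pairing_family[OF L XY[OF o(3,5)] cu[OF o(3,5) m n]] f
          Comp_closed[OF tarr_closed[OF iZ gh] \<omega>] l])
    also have "\<dots> = pairing L (X' \<boxdot> Y') (component x (X' \<boxdot> Y') (gen (X' \<boxdot> Y') X Y (g \<boxtimes> h) m n)) Z' \<omega> (mmap L f l)"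
      by (rule pairing_eq_tri[OF x XY[OF o(4,6)] o(3,5) gh m n o(2) \<omega> fl, symmetric])
    also have "\<dots> = tri L M N x Z' X' Y' \<omega> (mmap L f l) (mmap M g m) (mmap N h n)"
      unfolding cl tri_def ..
    finally show "tri L M N x Z X Y (\<omega> \<cdot> (f \<boxtimes> (g \<boxtimes> h))) l m n
        = tri L M N x Z' X' Y' \<omega> (mmap L f l) (mmap M g m) (mmap N h n)" .
  qed
qed

text \<open>The morphism is rebuilt by the formula of \<open>pairing_eq_tri\<close>: the generator
  with arrow g goes to the family that evaluates t at h \<cdot> (1 \<boxtimes> g). Dinaturality of t
  in Z makes this a dual family, dinaturality in X and Y makes it balanced.\<close>

lemma tri_surj:
  assumes t: "trilinear K T L M N t"
  obtains x where "x \<in> homs \<M> (day K T M N) (dual L)"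
    "\<And>Z X Y \<omega> l m n. \<lbrakk>Z \<in> Obj T; X \<in> Obj T; Y \<in> Obj T; \<omega> \<in> homs T (Z \<boxdot> X \<boxdot> Y) I; l \<in> carrier (mobj L Z);
        m \<in> carrier (mobj M X); n \<in> carrier (mobj N Y)\<rbrakk> \<Longrightarrow> tri L M N x Z X Y \<omega> l m n = t Z X Y \<omega> l m n"
proof -
  interpret t: trilinear K T L M N t by (rule t)
  note mid = mackey_functorD(3)[OF fin_mackeyD(1)]
  have din1: "t Z X Y (\<omega> \<cdot> (f \<boxtimes> Ident T (X \<boxdot> Y))) l m n = t Z' X Y \<omega> (mmap L f l) m n"
    if "f \<in> homs T Z Z'" "X \<in> Obj T" "Y \<in> Obj T" "\<omega> \<in> homs T (Z' \<boxdot> X \<boxdot> Y) I" "l \<in> carrier (mobj L Z)" "m \<in> carrier (mobj M X)"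
      "n \<in> carrier (mobj N Y)" for Z Z' X Y \<omega> f l m n
    using t.dinatural[OF that(1) Ident_closed[OF that(2)] Ident_closed[OF that(3)] that(4-7)]
    unfolding tarr_Ident[OF that(2,3)] mid[OF M that(2,6)] mid[OF N that(3,7)] .
  have din2: "t Z X Y (\<omega> \<cdot> (Ident T Z \<boxtimes> (g \<boxtimes> Ident T Y))) l m n = t Z X' Y \<omega> l (mmap M g m) n"
    if "Z \<in> Obj T" "g \<in> homs T X X'" "Y \<in> Obj T" "\<omega> \<in> homs T (Z \<boxdot> X' \<boxdot> Y) I" "l \<in> carrier (mobj L Z)" "m \<in> carrier (mobj M X)"
      "n \<in> carrier (mobj N Y)" for Z X X' Y \<omega> g l m n
    using t.dinatural[OF Ident_closed[OF that(1)] that(2) Ident_closed[OF that(3)] that(4-7)]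
    unfolding mid[OF L that(1,5)] mid[OF N that(3,7)] .
  have din3: "t Z X Y (\<omega> \<cdot> (Ident T Z \<boxtimes> (Ident T X \<boxtimes> h))) l m n = t Z X Y' \<omega> l m (mmap N h n)"
    if "Z \<in> Obj T" "X \<in> Obj T" "h \<in> homs T Y Y'" "\<omega> \<in> homs T (Z \<boxdot> X \<boxdot> Y') I" "l \<in> carrier (mobj L Z)" "m \<in> carrier (mobj M X)"
      "n \<in> carrier (mobj N Y)" for Z X Y Y' \<omega> h l m n
    using t.dinatural[OF Ident_closed[OF that(1)] Ident_closed[OF that(2)] that(3) that(4-7)]
    unfolding mid[OF L that(1,5)] mid[OF M that(2,6)] .
  have hg: "h \<cdot> (Ident T Z \<boxtimes> g) \<in> homs T (Z \<boxdot> X) I" if "Z \<in> Obj T" "g \<in> homs T X W" "h \<in> homs T (Z \<boxdot> W) I" for Z X W g h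
    by (rule Comp_closed[OF tarr_closed[OF Ident_closed[OF that(1)] that(2)] that(3)])
  have hgk: "h \<cdot> (Ident T Z \<boxtimes> (g \<cdot> k)) = (h \<cdot> (Ident T Z \<boxtimes> g)) \<cdot> (Ident T Z \<boxtimes> k)"
    if "Z \<in> Obj T" "k \<in> homs T Y X" "g \<in> homs T X W" "h \<in> homs T (Z \<boxdot> W) I" for Z Y X W g h k
    using tarr_Comp[OF Ident_closed[OF that(1)] Ident_closed[OF that(1)] that(2,3)] Ident_left[OF Ident_closed[OF that(1)]]
      Comp_assoc[OF tarr_closed[OF Ident_closed[OF that(1)] that(2)] tarr_closed[OF Ident_closed[OF that(1)] that(3)] that(4)]
    by simp
  define b where "b X Y g m n = (\<lambda>Z h l. t Z X Y (h \<cdot> (Ident T Z \<boxtimes> g)) l m n)" for X Y g m n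
  have fam: "dual_family K T L W (b X Y g m n)"
    if W: "W \<in> Obj T" and o: "X \<in> Obj T" "Y \<in> Obj T" and g: "g \<in> homs T (X \<boxdot> Y) W" and m: "m \<in> carrier (mobj M X)"
      and n: "n \<in> carrier (mobj N Y)" for W X Y g m n
  proof
    fix Z h l assume Z: "Z \<in> Obj T" and h: "h \<in> homs T (Z \<boxdot> W) I" and l: "l \<in> carrier (mobj L Z)"
    note c = hg[OF Z g h]
    show "b X Y g m n Z h l \<in> carrier K" unfolding b_def by (rule t.closed[OF Z o c l m n])
    show "b X Y g m n Z (add_arrow T h h') l = b X Y g m n Z h l \<oplus>\<^bsub>K\<^esub> b X Y g m n Z h' l" if "h' \<in> homs T (Z \<boxdot> W) I" for h'
      unfolding b_def add_arrow_comp[OF h that tarr_closed[OF Ident_closed[OF Z] g]] by (rule t.add_hom[OF Z o c hg[OF Z g that] l m n])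
    show "b X Y g m n Z h (l \<oplus>\<^bsub>mobj L Z\<^esub> l') = b X Y g m n Z h l \<oplus>\<^bsub>K\<^esub> b X Y g m n Z h l'" if "l' \<in> carrier (mobj L Z)" for l'
      unfolding b_def by (rule t.add1[OF Z o c l that m n])
    show "b X Y g m n Z h (k \<odot>\<^bsub>mobj L Z\<^esub> l) = k \<otimes>\<^bsub>K\<^esub> b X Y g m n Z h l" if "k \<in> carrier K" for k
      unfolding b_def by (rule t.smult1[OF Z o c that l m n])
  next
    fix f Z Z' h l assume f: "f \<in> homs T Z Z'" and h: "h \<in> homs T (Z' \<boxdot> W) I" and l: "l \<in> carrier (mobj L Z)"
    have Z: "Z \<in> Obj T" "Z' \<in> Obj T" using homs_Obj[OF f] by simp_all
    note iW = Ident_closed[OF W] and iXY = Ident_closed[OF tobj_closed[OF o]]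
    \<comment> \<open>f acts on Z and g on the remaining factors, so the two interchange.\<close>
    have "(h \<cdot> (f \<boxtimes> Ident T W)) \<cdot> (Ident T Z \<boxtimes> g) = h \<cdot> (f \<boxtimes> g)"
      using Comp_assoc[OF tarr_closed[OF Ident_closed[OF Z(1)] g] tarr_closed[OF f iW] h]
        tarr_Comp[OF Ident_closed[OF Z(1)] f g iW] Ident_right[OF f] Ident_left[OF g] by simp
    also have "\<dots> = (h \<cdot> (Ident T Z' \<boxtimes> g)) \<cdot> (f \<boxtimes> Ident T (X \<boxdot> Y))"
      using Comp_assoc[OF tarr_closed[OF f iXY] tarr_closed[OF Ident_closed[OF Z(2)] g] h]
        tarr_Comp[OF f Ident_closed[OF Z(2)] iXY g] Ident_left[OF f] Ident_right[OF g] by simp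
    finally have e: "(h \<cdot> (f \<boxtimes> Ident T W)) \<cdot> (Ident T Z \<boxtimes> g) = (h \<cdot> (Ident T Z' \<boxtimes> g)) \<cdot> (f \<boxtimes> Ident T (X \<boxdot> Y))" .
    show "b X Y g m n Z (h \<cdot> (f \<boxtimes> Ident T W)) l = b X Y g m n Z' h (mmap L f l)"
      unfolding b_def e by (rule din1[OF f o hg[OF Z(2) g h] l m n])
  qed
  define c where "c W X Y g m n = of_family L W (b X Y g m n)" for W X Y g m n
  have c1: "c W X Y g m n \<in> carrier (mobj (dual L) W)"
    if "W \<in> Obj T" "X \<in> Obj T" "Y \<in> Obj T" "g \<in> homs T (X \<boxdot> Y) W" "m \<in> carrier (mobj M X)" "n \<in> carrier (mobj N Y)" for W X Y g m n
    unfolding c_def by (rule of_family(1)[OF L that(1) fam[OF that]])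
  have c2: "pairing L W (c W X Y g m n) Z h l = t Z X Y (h \<cdot> (Ident T Z \<boxtimes> g)) l m n"
    if "W \<in> Obj T" "X \<in> Obj T" "Y \<in> Obj T" "g \<in> homs T (X \<boxdot> Y) W" "m \<in> carrier (mobj M X)" "n \<in> carrier (mobj N Y)"
      "Z \<in> Obj T" "h \<in> homs T (Z \<boxdot> W) I" "l \<in> carrier (mobj L Z)" for W X Y g m n Z h l
    using of_family(2)[OF L that(1) fam[OF that(1-6)] that(7-9)] unfolding c_def b_def .
  note vD = vectorspace_closed[OF dual_vectorspace[OF L]]
  note vM = vectorspace_closed[OF mackey_functorD(1)[OF fin_mackeyD(1)[OF M]]]
  note vN = vectorspace_closed[OF mackey_functorD(1)[OF fin_mackeyD(1)[OF N]]]
  have bal: "day_balanced K T M N W (mobj (dual L) W) (c W)" if W: "W \<in> Obj T" for W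
  proof
    fix X Y g m n
    assume o: "X \<in> Obj T" "Y \<in> Obj T" and g: "g \<in> homs T (X \<boxdot> Y) W" and m: "m \<in> carrier (mobj M X)" and n: "n \<in> carrier (mobj N Y)"
    note C = c1[OF W o] and P = c2[OF W o]
    show "c W X Y g m n \<in> carrier (mobj (dual L) W)" by (rule C[OF g m n])
    \<comment> \<open>t is additive in its arrow, and \<open>comp_add_tarr'\<close> makes that arrow
      additive in g.\<close>
    show "c W X Y (add_arrow T g g') m n = c W X Y g m n \<oplus>\<^bsub>mobj (dual L) W\<^esub> c W X Y g' m n" if g': "g' \<in> homs T (X \<boxdot> Y) W" for g'
      by (rule pairing_eqI[OF L W C[OF add_arrow_closed[OF g g'] m n] vD(1)[OF W C[OF g m n] C[OF g' m n]]])
        (simp only: pairing_add[OF L W C[OF g m n] C[OF g' m n]] P[OF add_arrow_closed[OF g g'] m n] P[OF g m n] P[OF g' m n]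
          comp_add_tarr'[OF _ g g'] t.add_hom[OF _ o hg[OF _ g] hg[OF _ g'] _ m n])
    show "c W X Y g (m \<oplus>\<^bsub>mobj M X\<^esub> m') n = c W X Y g m n \<oplus>\<^bsub>mobj (dual L) W\<^esub> c W X Y g m' n" if m': "m' \<in> carrier (mobj M X)" for m'
      by (rule pairing_eqI[OF L W C[OF g vM(1)[OF o(1) m m'] n] vD(1)[OF W C[OF g m n] C[OF g m' n]]])
        (simp only: pairing_add[OF L W C[OF g m n] C[OF g m' n]] P[OF g vM(1)[OF o(1) m m'] n] P[OF g m n] P[OF g m' n]
          t.add2[OF _ o hg[OF _ g] _ m m' n])
    show "c W X Y g m (n \<oplus>\<^bsub>mobj N Y\<^esub> n') = c W X Y g m n \<oplus>\<^bsub>mobj (dual L) W\<^esub> c W X Y g m n'" if n': "n' \<in> carrier (mobj N Y)" for n'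
      by (rule pairing_eqI[OF L W C[OF g m vN(1)[OF o(2) n n']] vD(1)[OF W C[OF g m n] C[OF g m n']]])
        (simp only: pairing_add[OF L W C[OF g m n] C[OF g m n']] P[OF g m vN(1)[OF o(2) n n']] P[OF g m n] P[OF g m n']
          t.add3[OF _ o hg[OF _ g] _ m n n'])
    fix k assume k: "k \<in> carrier K"
    show "c W X Y g (k \<odot>\<^bsub>mobj M X\<^esub> m) n = k \<odot>\<^bsub>mobj (dual L) W\<^esub> c W X Y g m n"
      by (rule pairing_eqI[OF L W C[OF g vM(2)[OF o(1) m k] n] vD(2)[OF W C[OF g m n] k]])
        (simp only: pairing_smult[OF L W k C[OF g m n]] P[OF g vM(2)[OF o(1) m k] n] P[OF g m n] t.smult2[OF _ o hg[OF _ g] k _ m n])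
    show "c W X Y g m (k \<odot>\<^bsub>mobj N Y\<^esub> n) = k \<odot>\<^bsub>mobj (dual L) W\<^esub> c W X Y g m n"
      by (rule pairing_eqI[OF L W C[OF g m vN(2)[OF o(2) n k]] vD(2)[OF W C[OF g m n] k]])
        (simp only: pairing_smult[OF L W k C[OF g m n]] P[OF g m vN(2)[OF o(2) n k]] P[OF g m n] t.smult3[OF _ o hg[OF _ g] k _ m n])
  next
    fix f X X' Y h m n
    assume f: "f \<in> homs T X X'" and Y: "Y \<in> Obj T" and h: "h \<in> homs T (X' \<boxdot> Y) W" and m: "m \<in> carrier (mobj M X)" and n: "n \<in> carrier (mobj N Y)"
    have o: "X \<in> Obj T" "X' \<in> Obj T" using homs_Obj[OF f] by simp_all
    note fY = tarr_closed[OF f Ident_closed[OF Y]] and fm = mackey_map_closed[OF fin_mackeyD(1)[OF M] f m]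
    note hf = Comp_closed[OF fY h]
    show "c W X Y (h \<cdot> (f \<boxtimes> Ident T Y)) m n = c W X' Y h (mmap M f m) n"
      by (rule pairing_eqI[OF L W c1[OF W o(1) Y hf m n] c1[OF W o(2) Y h fm n]])
        (simp only: c2[OF W o(1) Y hf m n] c2[OF W o(2) Y h fm n] hgk[OF _ fY h] din2[OF _ f Y hg[OF _ h] _ m n])
  next
    fix X g Y Y' h m n
    assume X: "X \<in> Obj T" and g: "g \<in> homs T Y Y'" and h: "h \<in> homs T (X \<boxdot> Y') W" and m: "m \<in> carrier (mobj M X)" and n: "n \<in> carrier (mobj N Y)"
    have o: "Y \<in> Obj T" "Y' \<in> Obj T" using homs_Obj[OF g] by simp_all
    note Xg = tarr_closed[OF Ident_closed[OF X] g] and gn = mackey_map_closed[OF fin_mackeyD(1)[OF N] g n]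
    note hf = Comp_closed[OF Xg h]
    show "c W X Y (h \<cdot> (Ident T X \<boxtimes> g)) m n = c W X Y' h m (mmap N g n)"
      by (rule pairing_eqI[OF L W c1[OF W X o(1) hf m n] c1[OF W X o(2) h m gn]])
        (simp only: c2[OF W X o(1) hf m n] c2[OF W X o(2) h m gn] hgk[OF _ Xg h] din3[OF _ X g hg[OF _ h] _ m n])
  qed
  have nat: "c W' X Y (k \<cdot> g) m n = mmap (dual L) k (c W X Y g m n)"
    if k: "k \<in> homs T W W'" and o: "X \<in> Obj T" "Y \<in> Obj T" and g: "g \<in> homs T (X \<boxdot> Y) W" and m: "m \<in> carrier (mobj M X)"
      and n: "n \<in> carrier (mobj N Y)" for k W W' X Y g m n
  proof -
    have W: "W \<in> Obj T" "W' \<in> Obj T" using homs_Obj[OF k] by simp_all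
    note kg = Comp_closed[OF g k]
    show ?thesis
      by (rule pairing_eqI[OF L W(2) c1[OF W(2) o kg m n] dual_map(1)[OF L k c1[OF W(1) o g m n]]])
        (simp only: dual_map(2)[OF L k c1[OF W(1) o g m n]] c2[OF W(2) o kg m n] c2[OF W(1) o g m n _ hg[OF _ k]] hgk[OF _ g k])
  qed
  show ?thesis
  proof (rule day_arrow_exists[OF M N dual_fin_mackey[OF L] bal nat])
    fix x assume x: "x \<in> homs \<M> (day K T M N) (dual L)"
      and xc: "\<And>W X Y g m n. \<lbrakk>W \<in> Obj T; X \<in> Obj T; Y \<in> Obj T; g \<in> homs T (X \<boxdot> Y) W; m \<in> carrier (mobj M X);
        n \<in> carrier (mobj N Y)\<rbrakk> \<Longrightarrow> component x W (gen W X Y g m n) = c W X Y g m n"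
    show thesis
    proof (rule that[OF x])
      fix Z X Y \<omega> l m n
      assume a: "Z \<in> Obj T" "X \<in> Obj T" "Y \<in> Obj T" "\<omega> \<in> homs T (Z \<boxdot> X \<boxdot> Y) I" "l \<in> carrier (mobj L Z)"
        "m \<in> carrier (mobj M X)" "n \<in> carrier (mobj N Y)"
      note XY = tobj_closed[OF a(2,3)]
      note i = Ident_closed[OF XY]
      show "tri L M N x Z X Y \<omega> l m n = t Z X Y \<omega> l m n"
        unfolding tri_def xc[OF XY a(2,3) i a(6,7)] c2[OF XY a(2,3) i a(6,7) a(1,4,5)] tarr_Ident[OF a(1) XY] Ident_right[OF a(4)] ..
    qed
  qed
qed

text \<open>Precomposition with \<open>rot\<close> is additive, and \<open>rot_natural\<close>
  permutes the three arrows of the dinaturality condition in the same way as the arguments.\<close>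

lemma trilinear_rotate:
  assumes t: "trilinear K T L M N t"
  shows "trilinear K T M N L (\<lambda>X Y Z \<omega> m n l. t Z X Y (\<omega> \<cdot> rot Z X Y) l m n)"
proof -
  interpret t: trilinear K T L M N t by (rule t)
  have r: "\<omega> \<cdot> rot Z X Y \<in> homs T (Z \<boxdot> X \<boxdot> Y) I"
    if "Z \<in> Obj T" "X \<in> Obj T" "Y \<in> Obj T" "\<omega> \<in> homs T (X \<boxdot> Y \<boxdot> Z) I" for Z X Y \<omega>
    by (rule Comp_closed[OF rot_closed[OF that(1-3)] that(4)])
  show ?thesis
  proof
    fix X Y Z \<omega> m n l
    assume o: "X \<in> Obj T" "Y \<in> Obj T" "Z \<in> Obj T" and \<omega>: "\<omega> \<in> homs T (X \<boxdot> Y \<boxdot> Z) I"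
      and m: "m \<in> carrier (mobj M X)" and n: "n \<in> carrier (mobj N Y)" and l: "l \<in> carrier (mobj L Z)"
    note w = r[OF o(3,1,2) \<omega>]
    show "t Z X Y (\<omega> \<cdot> rot Z X Y) l m n \<in> carrier K" by (rule t.closed[OF o(3,1,2) w l m n])
    show "t Z X Y (add_arrow T \<omega> \<omega>' \<cdot> rot Z X Y) l m n = t Z X Y (\<omega> \<cdot> rot Z X Y) l m n \<oplus>\<^bsub>K\<^esub> t Z X Y (\<omega>' \<cdot> rot Z X Y) l m n"
      if "\<omega>' \<in> homs T (X \<boxdot> Y \<boxdot> Z) I" for \<omega>'
      unfolding add_arrow_comp[OF \<omega> that rot_closed[OF o(3,1,2)]] by (rule t.add_hom[OF o(3,1,2) w r[OF o(3,1,2) that] l m n])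
    show "t Z X Y (\<omega> \<cdot> rot Z X Y) l (m \<oplus>\<^bsub>mobj M X\<^esub> m') n = t Z X Y (\<omega> \<cdot> rot Z X Y) l m n \<oplus>\<^bsub>K\<^esub> t Z X Y (\<omega> \<cdot> rot Z X Y) l m' n"
      if "m' \<in> carrier (mobj M X)" for m' by (rule t.add2[OF o(3,1,2) w l m that n])
    show "t Z X Y (\<omega> \<cdot> rot Z X Y) l m (n \<oplus>\<^bsub>mobj N Y\<^esub> n') = t Z X Y (\<omega> \<cdot> rot Z X Y) l m n \<oplus>\<^bsub>K\<^esub> t Z X Y (\<omega> \<cdot> rot Z X Y) l m n'"
      if "n' \<in> carrier (mobj N Y)" for n' by (rule t.add3[OF o(3,1,2) w l m n that])
    show "t Z X Y (\<omega> \<cdot> rot Z X Y) (l \<oplus>\<^bsub>mobj L Z\<^esub> l') m n = t Z X Y (\<omega> \<cdot> rot Z X Y) l m n \<oplus>\<^bsub>K\<^esub> t Z X Y (\<omega> \<cdot> rot Z X Y) l' m n"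
      if "l' \<in> carrier (mobj L Z)" for l' by (rule t.add1[OF o(3,1,2) w l that m n])
    fix k assume k: "k \<in> carrier K"
    show "t Z X Y (\<omega> \<cdot> rot Z X Y) l (k \<odot>\<^bsub>mobj M X\<^esub> m) n = k \<otimes>\<^bsub>K\<^esub> t Z X Y (\<omega> \<cdot> rot Z X Y) l m n"
      by (rule t.smult2[OF o(3,1,2) w k l m n])
    show "t Z X Y (\<omega> \<cdot> rot Z X Y) l m (k \<odot>\<^bsub>mobj N Y\<^esub> n) = k \<otimes>\<^bsub>K\<^esub> t Z X Y (\<omega> \<cdot> rot Z X Y) l m n"
      by (rule t.smult3[OF o(3,1,2) w k l m n])
    show "t Z X Y (\<omega> \<cdot> rot Z X Y) (k \<odot>\<^bsub>mobj L Z\<^esub> l) m n = k \<otimes>\<^bsub>K\<^esub> t Z X Y (\<omega> \<cdot> rot Z X Y) l m n"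
      by (rule t.smult1[OF o(3,1,2) w k l m n])
  next
    fix g X X' h Y Y' f Z Z' \<omega> m n l
    assume g: "g \<in> homs T X X'" and h: "h \<in> homs T Y Y'" and f: "f \<in> homs T Z Z'" and \<omega>: "\<omega> \<in> homs T (X' \<boxdot> Y' \<boxdot> Z') I"
      and m: "m \<in> carrier (mobj M X)" and n: "n \<in> carrier (mobj N Y)" and l: "l \<in> carrier (mobj L Z)"
    have o: "Z \<in> Obj T" "Z' \<in> Obj T" "X \<in> Obj T" "X' \<in> Obj T" "Y \<in> Obj T" "Y' \<in> Obj T"
      using homs_Obj[OF f] homs_Obj[OF g] homs_Obj[OF h] by simp_all
    have e: "(\<omega> \<cdot> (g \<boxtimes> (h \<boxtimes> f))) \<cdot> rot Z X Y = (\<omega> \<cdot> rot Z' X' Y') \<cdot> (f \<boxtimes> (g \<boxtimes> h))"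
      unfolding Comp_assoc[OF rot_closed[OF o(1,3,5)] tarr_closed[OF g tarr_closed[OF h f]] \<omega>]
        Comp_assoc[OF tarr_closed[OF f tarr_closed[OF g h]] rot_closed[OF o(2,4,6)] \<omega>] rot_natural[OF f g h] ..
    show "t Z X Y ((\<omega> \<cdot> (g \<boxtimes> (h \<boxtimes> f))) \<cdot> rot Z X Y) l m n
        = t Z' X' Y' (\<omega> \<cdot> rot Z' X' Y') (mmap L f l) (mmap M g m) (mmap N h n)"
      unfolding e by (rule t.dinatural[OF f g h r[OF o(2,4,6) \<omega>] l m n])
  qed
qed

end

text \<open>Existence comes from \<open>trilinear_rotate\<close> and \<open>tri_surj\<close>;
  \<open>tri_eqI\<close> gives uniqueness, so the choice is harmless.\<close>

definition rotate_arrow :: "('o, 'a, 'k, 'v) mackey \<Rightarrow> ('o, 'a, 'k, 'v) mackey \<Rightarrow> ('o, 'a, 'k, 'v) mackey \<Rightarrow>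
    ('o, 'a, 'k, 'v) mackey_arrow \<Rightarrow> ('o, 'a, 'k, 'v) mackey_arrow" where
  "rotate_arrow A B D x = (SOME y. y \<in> homs \<M> (day K T B D) (dual A) \<and>
     (\<forall>X Y Z \<omega> a b d. X \<in> Obj T \<longrightarrow> Y \<in> Obj T \<longrightarrow> Z \<in> Obj T \<longrightarrow> \<omega> \<in> homs T (X \<boxdot> Y \<boxdot> Z) I \<longrightarrow> a \<in> carrier (mobj A X) \<longrightarrow>
        b \<in> carrier (mobj B Y) \<longrightarrow> d \<in> carrier (mobj D Z) \<longrightarrow>
        tri A B D y X Y Z \<omega> a b d = tri D A B x Z X Y (\<omega> \<cdot> rot Z X Y) d a b))"

lemma rotate_arrow:
  assumes A: "fin_mackey A" and B: "fin_mackey B" and D: "fin_mackey D" and x: "x \<in> homs \<M> (day K T A B) (dual D)"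
  shows "rotate_arrow A B D x \<in> homs \<M> (day K T B D) (dual A)"
    "\<And>X Y Z \<omega> a b d. \<lbrakk>X \<in> Obj T; Y \<in> Obj T; Z \<in> Obj T; \<omega> \<in> homs T (X \<boxdot> Y \<boxdot> Z) I; a \<in> carrier (mobj A X);
        b \<in> carrier (mobj B Y); d \<in> carrier (mobj D Z)\<rbrakk>
      \<Longrightarrow> tri A B D (rotate_arrow A B D x) X Y Z \<omega> a b d = tri D A B x Z X Y (\<omega> \<cdot> rot Z X Y) d a b"
proof -
  let ?P = "\<lambda>y. y \<in> homs \<M> (day K T B D) (dual A) \<and>
     (\<forall>X Y Z \<omega> a b d. X \<in> Obj T \<longrightarrow> Y \<in> Obj T \<longrightarrow> Z \<in> Obj T \<longrightarrow> \<omega> \<in> homs T (X \<boxdot> Y \<boxdot> Z) I \<longrightarrow> a \<in> carrier (mobj A X) \<longrightarrow>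
        b \<in> carrier (mobj B Y) \<longrightarrow> d \<in> carrier (mobj D Z) \<longrightarrow>
        tri A B D y X Y Z \<omega> a b d = tri D A B x Z X Y (\<omega> \<cdot> rot Z X Y) d a b)"
  have "\<exists>y. ?P y"
  proof (rule tri_surj[OF A B D trilinear_rotate[OF D A B tri_trilinear[OF D A B x]]])
    fix y assume y: "y \<in> homs \<M> (day K T B D) (dual A)"
      and e: "\<And>X Y Z \<omega> a b d. \<lbrakk>X \<in> Obj T; Y \<in> Obj T; Z \<in> Obj T; \<omega> \<in> homs T (X \<boxdot> Y \<boxdot> Z) I; a \<in> carrier (mobj A X);
        b \<in> carrier (mobj B Y); d \<in> carrier (mobj D Z)\<rbrakk> \<Longrightarrow> tri A B D y X Y Z \<omega> a b d = tri D A B x Z X Y (\<omega> \<cdot> rot Z X Y) d a b"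
    show "\<exists>y. ?P y" by (rule exI[of _ y], rule conjI[OF y], intro allI impI, rule e)
  qed
  then have P: "?P (rotate_arrow A B D x)" unfolding rotate_arrow_def by (rule someI_ex)
  show "rotate_arrow A B D x \<in> homs \<M> (day K T B D) (dual A)" by (rule conjunct1[OF P])
  show "tri A B D (rotate_arrow A B D x) X Y Z \<omega> a b d = tri D A B x Z X Y (\<omega> \<cdot> rot Z X Y) d a b"
    if "X \<in> Obj T" "Y \<in> Obj T" "Z \<in> Obj T" "\<omega> \<in> homs T (X \<boxdot> Y \<boxdot> Z) I" "a \<in> carrier (mobj A X)"
      "b \<in> carrier (mobj B Y)" "d \<in> carrier (mobj D Z)" for X Y Z \<omega> a b d
    by (rule conjunct2[OF P, rule_format, OF that])
qed

text \<open>On trilinear families the three rotations amount to precomposition with three successive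
  instances of \<open>rot\<close>, which is the identity by \<open>rot_rot_rot\<close>.\<close>

lemma rotate_arrow_cubed:
  assumes A: "fin_mackey A" and B: "fin_mackey B" and D: "fin_mackey D" and x: "x \<in> homs \<M> (day K T A B) (dual D)"
  shows "rotate_arrow D A B (rotate_arrow B D A (rotate_arrow A B D x)) = x"
proof -
  note r1 = rotate_arrow[OF A B D x]
  note r2 = rotate_arrow[OF B D A r1(1)]
  note r3 = rotate_arrow[OF D A B r2(1)]
  show ?thesis
  proof (rule tri_eqI[OF D A B r3(1) x])
    fix Z X Y \<omega> d a b
    assume o: "Z \<in> Obj T" "X \<in> Obj T" "Y \<in> Obj T" and \<omega>: "\<omega> \<in> homs T (Z \<boxdot> X \<boxdot> Y) I"
      and d: "d \<in> carrier (mobj D Z)" and a: "a \<in> carrier (mobj A X)" and b: "b \<in> carrier (mobj B Y)"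
    note c1 = rot_closed[OF o] and c2 = rot_closed[OF o(2,3,1)] and c3 = rot_closed[OF o(3,1,2)]
    note w3 = Comp_closed[OF c3 \<omega>]
    note w2 = Comp_closed[OF c2 w3]
    have e: "((\<omega> \<cdot> rot Y Z X) \<cdot> rot X Y Z) \<cdot> rot Z X Y = \<omega>"
      unfolding Comp_assoc[OF c1 c2 w3] Comp_assoc[OF Comp_closed[OF c1 c2] c3 \<omega>] rot_rot_rot[OF o] by (rule Ident_right[OF \<omega>])
    show "tri D A B (rotate_arrow D A B (rotate_arrow B D A (rotate_arrow A B D x))) Z X Y \<omega> d a b = tri D A B x Z X Y \<omega> d a b"
      unfolding r3(2)[OF o \<omega> d a b] r2(2)[OF o(3,1,2) w3 b d a] r1(2)[OF o(2,3,1) w2 a b d] e ..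
  qed
qed

text \<open>The inverse consists of the two remaining rotations; both composites are instances of
  \<open>rotate_arrow_cubed\<close>, up to renaming the three functors.\<close>

lemma rotate_arrow_bij:
  assumes A: "fin_mackey A" and B: "fin_mackey B" and D: "fin_mackey D"
  shows "bij_betw (rotate_arrow A B D) (homs \<M> (day K T A B) (dual D)) (homs \<M> (day K T B D) (dual A))"
  by (rule bij_betw_byWitness[where f' = "\<lambda>y. rotate_arrow D A B (rotate_arrow B D A y)"])
    (intro ballI image_subsetI rotate_arrow_cubed rotate_arrow(1) A B D | assumption)+

text \<open>In terms of \<open>tri\<close>, composing with d, f and g only substitutes into the
  three vector arguments and leaves the arrow \<omega> alone. Naturality of the rotation then
  becomes immediate.\<close>

lemma tri_comp:
  assumes f: "f \<in> homs \<M> A' A" and g: "g \<in> homs \<M> B' B" and d: "d \<in> homs \<M> D' D"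
    and x: "x \<in> homs \<M> (day K T A B) (dual D)"
  shows "dual_arrow d \<cdot>\<^bsub>\<M>\<^esub> x \<cdot>\<^bsub>\<M>\<^esub> (f \<boxtimes>\<^bsub>\<M>\<^esub> g) \<in> homs \<M> (day K T A' B') (dual D')"
    and "\<And>Z X Y \<omega> l m n. \<lbrakk>Z \<in> Obj T; X \<in> Obj T; Y \<in> Obj T; \<omega> \<in> homs T (Z \<boxdot> X \<boxdot> Y) I; l \<in> carrier (mobj D' Z);
        m \<in> carrier (mobj A' X); n \<in> carrier (mobj B' Y)\<rbrakk>
      \<Longrightarrow> tri D' A' B' (dual_arrow d \<cdot>\<^bsub>\<M>\<^esub> x \<cdot>\<^bsub>\<M>\<^esub> (f \<boxtimes>\<^bsub>\<M>\<^esub> g)) Z X Y \<omega> l m n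
        = tri D A B x Z X Y \<omega> (component d Z l) (component f X m) (component g Y n)"
proof -
  note fg = tarr_M(1)[OF f g] and dd = dual_arrow(1)[OF d]
  note xfg = Comp_M(1)[OF fg x]
  show "dual_arrow d \<cdot>\<^bsub>\<M>\<^esub> x \<cdot>\<^bsub>\<M>\<^esub> (f \<boxtimes>\<^bsub>\<M>\<^esub> g) \<in> homs \<M> (day K T A' B') (dual D')" by (rule Comp_M(1)[OF xfg dd])
  fix Z X Y \<omega> l m n
  assume o: "Z \<in> Obj T" "X \<in> Obj T" "Y \<in> Obj T" and \<omega>: "\<omega> \<in> homs T (Z \<boxdot> X \<boxdot> Y) I"
    and l: "l \<in> carrier (mobj D' Z)" and m: "m \<in> carrier (mobj A' X)" and n: "n \<in> carrier (mobj B' Y)"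
  note XY = tobj_closed[OF o(2,3)]
  note i = Ident_closed[OF XY]
  have u: "day_class K T A' B' (X \<boxdot> Y) X Y (Ident T (X \<boxdot> Y)) m n \<in> carrier (mobj (day K T A' B') (X \<boxdot> Y))"
    by (rule day_balanced.closed[OF day_class_balanced[OF arrowD(1)[OF f] arrowD(1)[OF g] XY] o(2,3) i m n])
  show "tri D' A' B' (dual_arrow d \<cdot>\<^bsub>\<M>\<^esub> x \<cdot>\<^bsub>\<M>\<^esub> (f \<boxtimes>\<^bsub>\<M>\<^esub> g)) Z X Y \<omega> l m n
        = tri D A B x Z X Y \<omega> (component d Z l) (component f X m) (component g Y n)"
    unfolding tri_def Comp_M(2)[OF xfg dd XY u]
    unfolding dual_arrow(2)[OF d XY component_closed[OF xfg XY u] o(1) \<omega> l]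
    unfolding Comp_M(2)[OF fg x XY u] tarr_M(2)[OF f g XY o(2,3) i m n] ..
qed

lemma rotate_arrow_natural:
  assumes f: "f \<in> homs \<M> A' A" and g: "g \<in> homs \<M> B' B" and d: "d \<in> homs \<M> D' D"
    and x: "x \<in> homs \<M> (day K T A B) (dual D)"
  shows "rotate_arrow A' B' D' (dual_arrow d \<cdot>\<^bsub>\<M>\<^esub> x \<cdot>\<^bsub>\<M>\<^esub> (f \<boxtimes>\<^bsub>\<M>\<^esub> g))
    = dual_arrow f \<cdot>\<^bsub>\<M>\<^esub> rotate_arrow A B D x \<cdot>\<^bsub>\<M>\<^esub> (g \<boxtimes>\<^bsub>\<M>\<^esub> d)"
proof -
  note A = arrowD(2)[OF f] and B = arrowD(2)[OF g] and D = arrowD(2)[OF d]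
  note A' = arrowD(1)[OF f] and B' = arrowD(1)[OF g] and D' = arrowD(1)[OF d]
  note r = rotate_arrow[OF A B D x]
  note t = tri_comp[OF f g d x] and t' = tri_comp[OF g d f r(1)]
  note r' = rotate_arrow[OF A' B' D' t(1)]
  show ?thesis
  proof (rule tri_eqI[OF A' B' D' r'(1) t'(1)])
    fix X Y Z \<omega> a b l
    assume o: "X \<in> Obj T" "Y \<in> Obj T" "Z \<in> Obj T" and \<omega>: "\<omega> \<in> homs T (X \<boxdot> Y \<boxdot> Z) I"
      and a: "a \<in> carrier (mobj A' X)" and b: "b \<in> carrier (mobj B' Y)" and l: "l \<in> carrier (mobj D' Z)"
    show "tri A' B' D' (rotate_arrow A' B' D' (dual_arrow d \<cdot>\<^bsub>\<M>\<^esub> x \<cdot>\<^bsub>\<M>\<^esub> (f \<boxtimes>\<^bsub>\<M>\<^esub> g))) X Y Z \<omega> a b l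
        = tri A' B' D' (dual_arrow f \<cdot>\<^bsub>\<M>\<^esub> rotate_arrow A B D x \<cdot>\<^bsub>\<M>\<^esub> (g \<boxtimes>\<^bsub>\<M>\<^esub> d)) X Y Z \<omega> a b l"
      unfolding r'(2)[OF o \<omega> a b l] t(2)[OF o(3,1,2) Comp_closed[OF rot_closed[OF o(3,1,2)] \<omega>] l a b] t'(2)[OF o \<omega> a b l]
        r(2)[OF o \<omega> component_closed[OF f o(1) a] component_closed[OF g o(2) b] component_closed[OF d o(3) l]] ..
  qed
qed

lemma star_autonomous_M: "star_autonomous \<M>"
  unfolding star_autonomous_def star_autonomous_promonoidal_def tobj_M
proof (intro exI conjI ballI allI impI)
  show "equivalence_of_categories (op_cat \<M>) \<M> dual dual_arrow dual dual_arrow" by (rule dual_equivalence)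
  show "bij_betw (rotate_arrow A B D) (homs \<M> (day K T A B) (dual D)) (homs \<M> (day K T B D) (dual A))"
    if "A \<in> Obj \<M>" "B \<in> Obj \<M>" "D \<in> Obj \<M>" for A B D
    using that unfolding Obj_M by (rule rotate_arrow_bij)
  show "rotate_arrow A' B' D' (dual_arrow d \<cdot>\<^bsub>\<M>\<^esub> x \<cdot>\<^bsub>\<M>\<^esub> (f \<boxtimes>\<^bsub>\<M>\<^esub> g))
      = dual_arrow f \<cdot>\<^bsub>\<M>\<^esub> rotate_arrow A B D x \<cdot>\<^bsub>\<M>\<^esub> (g \<boxtimes>\<^bsub>\<M>\<^esub> d)"
    if "f \<in> homs \<M> A' A" "g \<in> homs \<M> B' B" "d \<in> homs \<M> D' D" "x \<in> homs \<M> (day K T A B) (dual D)" for A A' B B' D D' f g d x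
    by (rule rotate_arrow_natural[OF that])
qed

end

text \<open>The map e expresses that \<open>'v\<close> is large enough to hold copies of the values
  of all tensor products and duals. It is a condition on the universe of vectors and not on
  T.\<close>

theorem theorem9p2:
  fixes K :: "('k, 'm) ring_scheme"
    and T :: "('o, 'a, 'z) symmetric_monoidal_scheme"
    and \<C> :: "'o set"
    and e :: "'k list \<Rightarrow> 'v"
  assumes "field K"
    and "symmetric_compact_closed_category T"
    and "has_finite_direct_sums T"
    and "finite \<C>" and "\<C> \<subseteq> Obj T"
    and "\<And>X. X \<in> Obj T \<Longrightarrow>
      \<exists>n A S p i. (\<forall>j<n. A j \<in> \<C>) \<and> is_direct_sum T n A S p i \<and> isomorphic T X S"
    and "\<And>X Y. \<lbrakk>X \<in> Obj T; Y \<in> Obj T\<rbrakk> \<Longrightarrow> finitely_generated_monoid (hom_monoid T X Y)"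
    and "inj_on e (lists (carrier K))"
  defines "\<M> \<equiv> Mky_fin K T :: (('o, 'a, 'k, 'v) mackey, ('o, 'a, 'k, 'v) mackey_arrow) monoidal"
  shows "(\<forall>M \<in> Obj \<M>. \<forall>N \<in> Obj \<M>. M \<boxdot>\<^bsub>\<M>\<^esub> N \<in> Obj \<M>) \<and> unt \<M> \<in> Obj \<M> \<and> star_autonomous \<M>"
proof -
  interpret symmetric_compact_closed_category T by (rule assms(2))
  interpret field K by (rule assms(1))
  interpret mackey_setting K T \<C> e
    by unfold_locales (fact assms)+
  have "unt (Mky_fin K T) = (burnside K T :: ('o, 'a, 'k, 'v) mackey)" by (simp add: Mky_fin_def Mky_def)
  then show ?thesis
    unfolding \<M>_def using day_fin_mackey burnside_fin_mackey star_autonomous_M by (simp add: Obj_M tobj_M)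
qed

end
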